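(* Let $(M,\omega)$ be an almost symplectic manifold (i.e. $\omega$ is a nondegenerate, not necessarily closed, $2$-form). Then the tuple $$(\mathcal{A},\wedge,d,\ \Delta_1=d^\omega+[\Lambda,[d,L]]^\omega,\ \Delta_2=-[d,L]^\omega)$$ is a commutative $\mathrm{BV}_\infty$-algebra (with $\Delta_k=0$ for $k\ge3$). The total differential $$\mathbb{D}=d+\big(d^\omega+[\Lambda,[d,L]]^\omega\big)\xi-[d,L]^\omega\,\xi^2\in\mathrm{End}(\mathcal{A})[[\xi]]$$ satisfies $\mathbb{D}=e^{\Lambda\xi}\,d\,e^{-\Lambda\xi}$.
   Context: **Algebra.** Brackets are graded commutators: $[f_1,f_2]=f_1f_2-(-1)^{|f_1||f_2|}f_2f_1$. Let $(A,\wedge)$ be a graded commutative unital algebra. A homogeneous linear operator $f$ on $A$ has order $\le 0$ if it is left multiplication $L_a$ by a homogeneous element $a\in A$; inductively it has order $\le r$ if $[L_a,f]$ has order $\le r-1$ for every homogeneous $a\in A$. A commutative $\mathrm{BV}_\infty$-algebra is a tuple $(A,\wedge,\Delta_0=d,\Delta_1,\Delta_2,\ldots)$ such that $(A,\wedge,d)$ is a commutative dg-algebra (cohomological grading, $|d|=1$), $\Delta_n$ is a linear operator of degree $1-2n$ and of order $\le n+1$, and $\sum_{i=0}^n\Delta_i\Delta_{n-i}=0$ for all $n\ge 0$. In a finite tuple the remaining operators are zero. **Geometry.** $\dim M=2n$; $\mathcal{A}$ is the real de Rham algebra. $\langle-,-\rangle_\omega$ is the pairing on $\mathcal{A}^k$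 given by $\langle a_1\wedge\cdots\wedge a_k,b_1\wedge\cdots\wedge b_k\rangle_\omega=\det(\omega^{-1}(a_i,b_j))$ for $1$-forms $a_i,b_j$, where $\omega^{-1}$ is the bilinear form on $1$-forms whose matrix in a coframe $\{e^i\}$ is the inverse of the matrix $(\omega(e_i,e_j))$ in the dual frame. The symplectic star $\star_\omega:\mathcal{A}^k\to\mathcal{A}^{2n-k}$ is defined by $\alpha\wedge\star_\omega\beta=\langle\alpha,\beta\rangle_\omega\,\omega^n/n!$; $\star_\omega^2=1$. For a $C^\infty(M)$-linear operator $\phi$ on forms, its symplectic adjoint $\phi^\omega$ is defined by $\langle\phi\alpha,\beta\rangle_\omega=\langle\alpha,\phi^\omega\beta\rangle_\omega$. $L\eta=\omega\wedge\eta$, $\Lambda=L^\omega=\star_\omega L\star_\omega$. The operator $[d,L]$ is wedging with $d\omega$, and $[d,L]^\omega=(-1)^{k+1}\star_\omega[d,L]\star_\omega$ on $\mathcal{A}^k$. The symplectic adjoint of $d$ is $d^\omega=(-1)^k\star_\omega d\star_\omega$ on $\mathcal{A}^k$. $\xi$ is a formal parameter. *)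

theory Defs
  imports
    "HOL-Analysis.Analysis"
    "HOL-Library.Function_Algebras"
    "HOL-Library.More_List"
begin

section \<open>Pointwise real vector space structure on functions\<close>

instantiation "fun" :: (type, scaleR) scaleR
begin
definition scaleR_fun :: "real \<Rightarrow> ('a \<Rightarrow> 'b) \<Rightarrow> 'a \<Rightarrow> 'b"
  where "scaleR_fun r f = (\<lambda>x. r *\<^sub>R f x)"
instance ..
end

lemma scaleR_fun_apply [simp]: "(r *\<^sub>R f) x = r *\<^sub>R f x"
  by (simp add: scaleR_fun_def)

instance "fun" :: (type, real_vector) real_vector
  by standard (simp_all add: fun_eq_iff scaleR_add_right scaleR_add_left)

section \<open>Commutative BV-infinity algebras\<close>

text \<open>
  A graded vector space is a family \<open>A\<close> of subspaces of an ambient real vector space, indexed by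
  the integers, whose sum is direct; its underlying ungraded space is \<open>total_space A\<close>. Operators are
  functions on the ambient type of which only the values on \<open>total_space A\<close> matter.
\<close>

definition ksign :: "int \<Rightarrow> real"
  where "ksign k = (if even k then 1 else - 1)"

definition total_space :: "(int \<Rightarrow> 'a::real_vector set) \<Rightarrow> 'a set"
  where "total_space A = span (\<Union>k. A k)"

definition endo :: "(int \<Rightarrow> 'a::real_vector set) \<Rightarrow> ('a \<Rightarrow> 'a) \<Rightarrow> bool"
  where "endo A f \<longleftrightarrow>
    (\<forall>x\<in>total_space A. f x \<in> total_space A) \<and>
    (\<forall>x\<in>total_space A. \<forall>y\<in>total_space A. f (x + y) = f x + f y) \<and>
    (\<forall>r. \<forall>x\<in>total_space A. f (r *\<^sub>R x) = r *\<^sub>R f x)"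

definition has_degree :: "(int \<Rightarrow> 'a::real_vector set) \<Rightarrow> int \<Rightarrow> ('a \<Rightarrow> 'a) \<Rightarrow> bool"
  where "has_degree A k f \<longleftrightarrow> endo A f \<and> (\<forall>j. \<forall>x\<in>A j. f x \<in> A (j + k))"

definition graded_comm_algebra ::
    "(int \<Rightarrow> 'a::real_vector set) \<Rightarrow> ('a \<Rightarrow> 'a \<Rightarrow> 'a) \<Rightarrow> 'a \<Rightarrow> bool"
  where "graded_comm_algebra A m e \<longleftrightarrow>
    (\<forall>k. subspace (A k)) \<and>
    (\<forall>K x. finite K \<longrightarrow> (\<forall>k\<in>K. x k \<in> A k) \<longrightarrow> (\<Sum>k\<in>K. x k) = 0 \<longrightarrow> (\<forall>k\<in>K. x k = 0)) \<and>
    (\<forall>a\<in>total_space A. endo A (\<lambda>b. m a b) \<and> endo A (\<lambda>b. m b a)) \<and>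
    (\<forall>a\<in>total_space A. \<forall>b\<in>total_space A. \<forall>c\<in>total_space A. m (m a b) c = m a (m b c)) \<and>
    e \<in> A 0 \<and> (\<forall>a\<in>total_space A. m e a = a \<and> m a e = a) \<and>
    (\<forall>i j. \<forall>a\<in>A i. \<forall>b\<in>A j. m a b \<in> A (i + j) \<and> m a b = ksign (i * j) *\<^sub>R m b a)"

text \<open>Graded commutator of operators \<open>f\<close>, \<open>g\<close> of degrees \<open>i\<close>, \<open>j\<close>.\<close>

definition gcomm :: "int \<Rightarrow> int \<Rightarrow> ('a::real_vector \<Rightarrow> 'a) \<Rightarrow> ('a \<Rightarrow> 'a) \<Rightarrow> 'a \<Rightarrow> 'a"
  where "gcomm i j f g = (\<lambda>x. f (g x) - ksign (i * j) *\<^sub>R g (f x))"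

text \<open>\<open>order_le A m r k f\<close>: the operator \<open>f\<close> of degree \<open>k\<close> has order at most \<open>r\<close>.\<close>

fun order_le ::
    "(int \<Rightarrow> 'a::real_vector set) \<Rightarrow> ('a \<Rightarrow> 'a \<Rightarrow> 'a) \<Rightarrow> nat \<Rightarrow> int \<Rightarrow> ('a \<Rightarrow> 'a) \<Rightarrow> bool"
  where
    "order_le A m 0 k f \<longleftrightarrow> has_degree A k f \<and> (\<exists>a\<in>A k. \<forall>x\<in>total_space A. f x = m a x)"
  | "order_le A m (Suc r) k f \<longleftrightarrow> has_degree A k f \<and>
       (\<forall>j. \<forall>a\<in>A j. order_le A m r (j + k) (gcomm j k (m a) f))"

definition commutative_dg_algebra ::
    "(int \<Rightarrow> 'a::real_vector set) \<Rightarrow> ('a \<Rightarrow> 'a \<Rightarrow> 'a) \<Rightarrow> 'a \<Rightarrow> ('a \<Rightarrow> 'a) \<Rightarrow> bool"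
  where "commutative_dg_algebra A m e d \<longleftrightarrow>
    graded_comm_algebra A m e \<and> has_degree A 1 d \<and>
    (\<forall>x\<in>total_space A. d (d x) = 0) \<and>
    (\<forall>i. \<forall>a\<in>A i. \<forall>b\<in>total_space A. d (m a b) = m (d a) b + ksign i *\<^sub>R m a (d b))"

definition commutative_BV_infinity_algebra ::
    "(int \<Rightarrow> 'a::real_vector set) \<Rightarrow> ('a \<Rightarrow> 'a \<Rightarrow> 'a) \<Rightarrow> 'a \<Rightarrow> (nat \<Rightarrow> 'a \<Rightarrow> 'a) \<Rightarrow> bool"
  where "commutative_BV_infinity_algebra A m e \<Delta> \<longleftrightarrow>
    commutative_dg_algebra A m e (\<Delta> 0) \<and>
    (\<forall>n. has_degree A (1 - 2 * int n) (\<Delta> n) \<and>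
         order_le A m (n + 1) (1 - 2 * int n) (\<Delta> n)) \<and>
    (\<forall>n. \<forall>x\<in>total_space A. (\<Sum>i\<le>n. \<Delta> i (\<Delta> (n - i) x)) = 0)"

section \<open>Formal power series of endomorphisms\<close>

text \<open>
  An element \<open>\<Sum>k. S k \<xi>^k\<close> of \<open>End(A)[[\<xi>]]\<close> is given by its sequence of coefficients; since operators
  matter only on \<open>total_space A\<close>, equality of series is \<open>series_eq\<close>.
\<close>

definition End_series :: "(int \<Rightarrow> 'a::real_vector set) \<Rightarrow> (nat \<Rightarrow> 'a \<Rightarrow> 'a) set"
  where "End_series A = {S. \<forall>k. endo A (S k)}"

definition series_eq ::
    "(int \<Rightarrow> 'a::real_vector set) \<Rightarrow> (nat \<Rightarrow> 'a \<Rightarrow> 'a) \<Rightarrow> (nat \<Rightarrow> 'a \<Rightarrow> 'a) \<Rightarrow> bool"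
  where "series_eq A S T \<longleftrightarrow> (\<forall>k. \<forall>x\<in>total_space A. S k x = T k x)"

definition series_mult ::
    "(nat \<Rightarrow> 'a::real_vector \<Rightarrow> 'a) \<Rightarrow> (nat \<Rightarrow> 'a \<Rightarrow> 'a) \<Rightarrow> nat \<Rightarrow> 'a \<Rightarrow> 'a"
  where "series_mult S T = (\<lambda>k x. \<Sum>i\<le>k. S i (T (k - i) x))"

definition series_const :: "('a::real_vector \<Rightarrow> 'a) \<Rightarrow> nat \<Rightarrow> 'a \<Rightarrow> 'a"
  where "series_const f = (\<lambda>k. if k = 0 then f else 0)"

text \<open>The series \<open>e^(f \<xi>)\<close>.\<close>

definition series_exp :: "('a::real_vector \<Rightarrow> 'a) \<Rightarrow> nat \<Rightarrow> 'a \<Rightarrow> 'a"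
  where "series_exp f = (\<lambda>k. (1 / fact k) *\<^sub>R (f ^^ k))"

section \<open>Exterior forms on \<open>\<real>\<^sup>n\<close>\<close>

text \<open>
  A possibly inhomogeneous exterior form is a function on lists of vectors; its part of degree \<open>k\<close>
  is its restriction to lists of length \<open>k\<close>.
\<close>

type_synonym 'n ext = "(real ^ 'n) list \<Rightarrow> real"

definition ext :: "nat \<Rightarrow> ('n::finite) ext set"
  where "ext k = {a.
    (\<forall>us vs. linear (\<lambda>v. a (us @ v # vs))) \<and>
    (\<forall>vs. \<not> distinct vs \<longrightarrow> a vs = 0) \<and>
    (\<forall>vs. length vs \<noteq> k \<longrightarrow> a vs = 0)}"

definition part :: "nat \<Rightarrow> ('n::finite) ext \<Rightarrow> 'n ext"
  where "part k a = (\<lambda>vs. if length vs = k then a vs else 0)"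

definition unit_ext :: "('n::finite) ext"
  where "unit_ext = (\<lambda>vs. if vs = [] then 1 else 0)"

text \<open>
  The shuffle formula, without factorials: \<open>S\<close> is the set of positions of the arguments fed to
  the first factor and the sign is that of the corresponding shuffle, so that a product of
  1-forms evaluates to a determinant.
\<close>

definition shuffle_sign :: "nat set \<Rightarrow> nat \<Rightarrow> real"
  where "shuffle_sign S m = (- 1) ^ card {(i, j). i \<in> S \<and> j \<in> {..<m} - S \<and> j < i}"

definition wedge :: "('n::finite) ext \<Rightarrow> 'n ext \<Rightarrow> 'n ext"
  where "wedge a b = (\<lambda>vs. \<Sum>S\<in>Pow {..<length vs}.
    shuffle_sign S (length vs) * a (nths vs S) * b (nths vs ({..<length vs} - S)))"

definition wedge_list :: "('n::finite) ext list \<Rightarrow> 'n ext"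
  where "wedge_list as = foldr wedge as unit_ext"

section \<open>Linear algebra of a nondegenerate 2-form\<close>

definition nondegenerate :: "('n::finite) ext \<Rightarrow> bool"
  where "nondegenerate w \<longleftrightarrow> (\<forall>u. (\<forall>v. w [u, v] = 0) \<longrightarrow> u = 0)"

definition gram :: "('n::finite) ext \<Rightarrow> real ^ 'n ^ 'n"
  where "gram w = (\<chi> i j. w [axis i 1, axis j 1])"

text \<open>The bilinear form \<open>\<omega>\<^sup>-\<^sup>1\<close> on 1-forms; its matrix in the standard coframe is the inverse of
  \<open>gram w\<close>.\<close>

definition inv_form :: "('n::finite) ext \<Rightarrow> 'n ext \<Rightarrow> 'n ext \<Rightarrow> real"
  where "inv_form w a b =
    (\<Sum>i\<in>UNIV. \<Sum>j\<in>UNIV. a [axis i 1] * matrix_inv (gram w) $ i $ j * b [axis j 1])"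

text \<open>Determinant of the matrix with entries \<open>B i j\<close>, where \<open>i\<close> and \<open>j\<close> are less than \<open>k\<close>.\<close>

definition det_nat :: "nat \<Rightarrow> (nat \<Rightarrow> nat \<Rightarrow> real) \<Rightarrow> real"
  where "det_nat k B = (\<Sum>p | p permutes {..<k}. of_int (sign p) * (\<Prod>i<k. B i (p i)))"

definition is_pairing :: "('n::finite) ext \<Rightarrow> nat \<Rightarrow> ('n ext \<Rightarrow> 'n ext \<Rightarrow> real) \<Rightarrow> bool"
  where "is_pairing w k P \<longleftrightarrow>
    (\<forall>a\<in>ext k. \<forall>b\<in>ext k. \<forall>c\<in>ext k.
       P (a + b) c = P a c + P b c \<and> P c (a + b) = P c a + P c b) \<and>
    (\<forall>r. \<forall>a\<in>ext k. \<forall>b\<in>ext k. P (r *\<^sub>R a) b = r * P a b \<and> P a (r *\<^sub>R b) = r * P a b) \<and>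
    (\<forall>as bs. length as = k \<longrightarrow> length bs = k \<longrightarrow> set as \<subseteq> ext 1 \<longrightarrow> set bs \<subseteq> ext 1 \<longrightarrow>
       P (wedge_list as) (wedge_list bs) = det_nat k (\<lambda>i j. inv_form w (as ! i) (bs ! j)))"

text \<open>
  The decomposable forms span \<open>ext k\<close>, so \<open>is_pairing w k\<close> determines the pairing on \<open>ext k\<close>;
  the values chosen elsewhere are not used.
\<close>

definition pairing :: "('n::finite) ext \<Rightarrow> nat \<Rightarrow> 'n ext \<Rightarrow> 'n ext \<Rightarrow> real"
  where "pairing w k = (SOME P. is_pairing w k P)"

text \<open>Extension to inhomogeneous forms, parts of different degrees being orthogonal.\<close>

definition total_pairing :: "('n::finite) ext \<Rightarrow> 'n ext \<Rightarrow> 'n ext \<Rightarrow> real"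
  where "total_pairing w a b = (\<Sum>k\<le>CARD('n). pairing w k (part k a) (part k b))"

text \<open>\<open>\<omega>^n / n!\<close> in dimension \<open>2 n\<close>.\<close>

definition volume :: "('n::finite) ext \<Rightarrow> 'n ext"
  where "volume w = (1 / fact (CARD('n) div 2)) *\<^sub>R ((wedge w ^^ (CARD('n) div 2)) unit_ext)"

definition star_hom :: "('n::finite) ext \<Rightarrow> nat \<Rightarrow> 'n ext \<Rightarrow> 'n ext"
  where "star_hom w k b = (THE c. c \<in> ext (CARD('n) - k) \<and>
    (\<forall>a\<in>ext k. wedge a c = pairing w k a b *\<^sub>R volume w))"

definition star_ext :: "('n::finite) ext \<Rightarrow> 'n ext \<Rightarrow> 'n ext"
  where "star_ext w b = (\<Sum>k\<le>CARD('n). star_hom w k (part k b))"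

section \<open>Smooth manifolds\<close>

text \<open>Iterated directional derivatives; only used for open \<open>S\<close>.\<close>

fun Ck_on :: "nat \<Rightarrow> 'a::real_normed_vector set \<Rightarrow> ('a \<Rightarrow> 'b::real_normed_vector) \<Rightarrow> bool"
  where
    "Ck_on 0 S f \<longleftrightarrow> continuous_on S f"
  | "Ck_on (Suc k) S f \<longleftrightarrow> (\<forall>x\<in>S. f differentiable (at x)) \<and>
       (\<forall>v. Ck_on k S (\<lambda>x. frechet_derivative f (at x) v))"

definition smooth_on :: "'a::real_normed_vector set \<Rightarrow> ('a \<Rightarrow> 'b::real_normed_vector) \<Rightarrow> bool"
  where "smooth_on S f \<longleftrightarrow> (\<forall>k. Ck_on k S f)"

text \<open>A chart is a pair of its domain and its coordinate map; outside the domain the values of the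
  coordinate map are irrelevant.\<close>

type_synonym ('m, 'n) chart = "'m set \<times> ('m \<Rightarrow> real ^ 'n)"

definition chart_dom :: "('m, 'n::finite) chart \<Rightarrow> 'm set"
  where "chart_dom c = fst c"

definition chart_rng :: "('m, 'n::finite) chart \<Rightarrow> (real ^ 'n) set"
  where "chart_rng c = snd c ` fst c"

definition transition :: "('m, 'n::finite) chart \<Rightarrow> ('m, 'n) chart \<Rightarrow> real ^ 'n \<Rightarrow> real ^ 'n"
  where "transition c c' = snd c' \<circ> inv_into (chart_dom c) (snd c)"

text \<open>
  A smooth atlas \<open>M\<close> modelled on \<open>\<real>\<^sup>n\<close>; the manifold itself is the union of the chart domains, an
  open subset of the Hausdorff and second countable space \<open>'m\<close>.
\<close>

definition smooth_manifold ::
    "('m::{t2_space,second_countable_topology}, 'n::finite) chart set \<Rightarrow> bool"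
  where "smooth_manifold M \<longleftrightarrow>
    (\<forall>c\<in>M. open (chart_dom c) \<and> open (chart_rng c) \<and> (\<exists>g. homeomorphism (chart_dom c) (chart_rng c) (snd c) g)) \<and>
    (\<forall>c\<in>M. \<forall>c'\<in>M. smooth_on (snd c ` (chart_dom c \<inter> chart_dom c')) (transition c c'))"

section \<open>The de Rham algebra\<close>

text \<open>
  A differential form is a family of forms on the coordinate ranges of the charts in the atlas,
  compatible under pullback along the transition maps. As functions are total, it is required to be
  0 off the coordinate ranges and off the atlas.
\<close>

type_synonym ('m, 'n) dform = "('m, 'n) chart \<Rightarrow> real ^ 'n \<Rightarrow> 'n ext"

definition forms :: "('m, 'n::finite) chart set \<Rightarrow> nat \<Rightarrow> ('m, 'n) dform set"
  where "forms M k = {\<alpha>.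
    (\<forall>c x. c \<notin> M \<or> x \<notin> chart_rng c \<longrightarrow> \<alpha> c x = 0) \<and>
    (\<forall>c\<in>M. \<forall>x\<in>chart_rng c. \<alpha> c x \<in> ext k) \<and>
    (\<forall>c\<in>M. \<forall>vs. smooth_on (chart_rng c) (\<lambda>x. \<alpha> c x vs)) \<and>
    (\<forall>c\<in>M. \<forall>c'\<in>M. \<forall>p\<in>chart_dom c \<inter> chart_dom c'. \<forall>vs.
       \<alpha> c (snd c p) vs =
       \<alpha> c' (snd c' p) (map (frechet_derivative (transition c c') (at (snd c p))) vs))}"

definition deRham :: "('m, 'n::finite) chart set \<Rightarrow> int \<Rightarrow> ('m, 'n) dform set"
  where "deRham M k = (if k < 0 then {0} else forms M (nat k))"

definition on_charts ::
    "('m, 'n::finite) chart set \<Rightarrow> (('m, 'n) chart \<Rightarrow> real ^ 'n \<Rightarrow> 'n ext) \<Rightarrow> ('m, 'n) dform"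
  where "on_charts M F = (\<lambda>c x. if c \<in> M \<and> x \<in> chart_rng c then F c x else 0)"

definition one_form :: "('m, 'n::finite) chart set \<Rightarrow> ('m, 'n) dform"
  where "one_form M = on_charts M (\<lambda>c x. unit_ext)"

definition wedge_form :: "('m, 'n::finite) dform \<Rightarrow> ('m, 'n) dform \<Rightarrow> ('m, 'n) dform"
  where "wedge_form \<alpha> \<beta> = (\<lambda>c x. wedge (\<alpha> c x) (\<beta> c x))"

definition dR :: "('m, 'n::finite) chart set \<Rightarrow> ('m, 'n) dform \<Rightarrow> ('m, 'n) dform"
  where "dR M \<alpha> = on_charts M (\<lambda>c x vs. \<Sum>i<length vs. (- 1) ^ i *
    frechet_derivative (\<lambda>y. \<alpha> c y (take i vs @ drop (Suc i) vs)) (at x) (vs ! i))"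

section \<open>Operators of an almost symplectic manifold\<close>

definition almost_symplectic ::
    "('m::{t2_space,second_countable_topology}, 'n::finite) chart set \<Rightarrow> ('m, 'n) dform \<Rightarrow> bool"
  where "almost_symplectic M \<omega> \<longleftrightarrow>
    smooth_manifold M \<and> \<omega> \<in> forms M 2 \<and> (\<forall>c\<in>M. \<forall>x\<in>chart_rng c. nondegenerate (\<omega> c x))"

definition star :: "('m, 'n::finite) chart set \<Rightarrow> ('m, 'n) dform \<Rightarrow> ('m, 'n) dform \<Rightarrow> ('m, 'n) dform"
  where "star M \<omega> \<beta> = on_charts M (\<lambda>c x. star_ext (\<omega> c x) (\<beta> c x))"

definition lefschetz :: "('m, 'n::finite) dform \<Rightarrow> ('m, 'n) dform \<Rightarrow> ('m, 'n) dform"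
  where "lefschetz \<omega> = wedge_form \<omega>"

text \<open>The symplectic adjoint of a \<open>C\<^sup>\<infinity>(M)\<close>-linear operator \<open>\<phi>\<close> on forms; the two sides are compared
  as functions on the manifold, that is, at all points in all charts.\<close>

definition adjoint_op ::
    "('m, 'n::finite) chart set \<Rightarrow> ('m, 'n) dform \<Rightarrow> (('m, 'n) dform \<Rightarrow> ('m, 'n) dform) \<Rightarrow>
     ('m, 'n) dform \<Rightarrow> ('m, 'n) dform"
  where "adjoint_op M \<omega> \<phi> \<beta> = (THE \<gamma>. \<gamma> \<in> total_space (deRham M) \<and>
    (\<forall>\<alpha>\<in>total_space (deRham M). \<forall>c\<in>M. \<forall>x\<in>chart_rng c.
       total_pairing (\<omega> c x) (\<phi> \<alpha> c x) (\<beta> c x) = total_pairing (\<omega> c x) (\<alpha> c x) (\<gamma> c x)))"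

definition dual_lefschetz ::
    "('m, 'n::finite) chart set \<Rightarrow> ('m, 'n) dform \<Rightarrow> ('m, 'n) dform \<Rightarrow> ('m, 'n) dform"
  where "dual_lefschetz M \<omega> = adjoint_op M \<omega> (lefschetz \<omega>)"

definition degree_sign :: "('m, 'n::finite) dform \<Rightarrow> ('m, 'n) dform"
  where "degree_sign \<alpha> = (\<lambda>c x vs. (- 1) ^ length vs * \<alpha> c x vs)"

text \<open>\<open>(- 1)^k \<star> d \<star>\<close> on forms of degree \<open>k\<close>.\<close>

definition d_adjoint ::
    "('m, 'n::finite) chart set \<Rightarrow> ('m, 'n) dform \<Rightarrow> ('m, 'n) dform \<Rightarrow> ('m, 'n) dform"
  where "d_adjoint M \<omega> \<alpha> = star M \<omega> (dR M (star M \<omega> (degree_sign \<alpha>)))"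

definition comm_d_L ::
    "('m, 'n::finite) chart set \<Rightarrow> ('m, 'n) dform \<Rightarrow> ('m, 'n) dform \<Rightarrow> ('m, 'n) dform"
  where "comm_d_L M \<omega> = gcomm 1 2 (dR M) (lefschetz \<omega>)"

definition comm_Lambda_d_L ::
    "('m, 'n::finite) chart set \<Rightarrow> ('m, 'n) dform \<Rightarrow> ('m, 'n) dform \<Rightarrow> ('m, 'n) dform"
  where "comm_Lambda_d_L M \<omega> = gcomm (- 2) 3 (dual_lefschetz M \<omega>) (comm_d_L M \<omega>)"

end

theory Submission
  imports Defs "Jordan_Normal_Form.Determinant"
begin

text \<open>
  On the fibres, \<open>L\<close> and \<open>\<Lambda>\<close> generate \<open>sl\<^sub>2\<close>. For the adjoint action, \<open>W = [d, L]\<close> is a lowest weight vector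
  of weight \<open>-3\<close> and \<open>d + [\<Lambda>, W] / 3\<close> one of weight \<open>-1\<close>. As \<open>L\<close> and \<open>\<Lambda>\<close> are nilpotent, these vectors
  generate representations of dimension 4 and 2, so \<open>ad \<Lambda>\<close> kills \<open>d\<close> after three steps and
  \<open>e\<^bsup>\<Lambda>\<xi>\<^esup> d e\<^bsup>-\<Lambda>\<xi>\<^esup>\<close> is quadratic in \<open>\<xi>\<close>. Up to a sign depending on the degree, the symplectic star is the
  Weyl element \<open>e\<^bsup>L\<^esup> e\<^bsup>-\<Lambda>\<^esup> e\<^bsup>L\<^esup>\<close>: both intertwine exterior multiplication by a covector with contraction
  by the corresponding vector, and they agree on \<open>1\<close>. Conjugation by it exchanges lowest and highest weight
  vectors, which identifies the adjoints of \<open>W\<close>, \<open>[\<Lambda>, W]\<close> and \<open>d\<close> and shows that the coefficients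
  \<open>[\<Lambda>, d]\<close> and \<open>[\<Lambda>, [\<Lambda>, d]] / 2\<close> are the given \<open>\<Delta>\<^sub>1\<close> and \<open>\<Delta>\<^sub>2\<close>. The equation \<open>\<D>\<^sup>2 = 0\<close> is that of \<open>d\<close>
  conjugated. Finally \<open>\<Lambda>\<close> has order 2, \<open>d\<close> has order 1, and the order of a graded commutator of operators of
  orders \<open>r\<close> and \<open>s\<close> is at most \<open>r + s - 1\<close>. The adjoint of an operator, a priori only a choice, is unique
  because forms with small support take all values at a given point.
\<close>

text \<open>The weights come from H = [\<Lambda>, L], which multiplies k-forms by n - k: an operator
  raising the degree by r has weight -r, so d has weight -1 and W, multiplication by the 3-form
  d\<omega>, has weight -3. The factor 1/3 is forced by [L, d] = -W and [L, [\<Lambda>, W]] = 3 W.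
  Because d itself is not annihilated by \<open>ad L\<close>, the symplectic adjoint of d is
  [\<Lambda>, d] plus a multiple of [\<Lambda>, [\<Lambda>, W]]; the correction in
  \<open>\<Delta>\<^sub>1\<close> is exactly what removes this multiple. Star, pairing and adjoints
  are defined by choice or description. Explicit operators (\<open>pstar\<close>, \<open>pr\<close>,
  \<open>lam\<close>) are therefore built first and identified by uniqueness afterwards. Identities
  on a fibre avoid shuffles: evaluating on a list with head v is contracting by v, so the product is
  recursive along lists, and forms are generated from 1 by covectors, so an operator is known from
  its commutation with one covector. Smoothness and chart independence of the star are inherited
  from L and \<Lambda>, for which they follow from Cramer's rule and naturality.\<close>

no_notation vec_index (infixl "$" 100)
no_notation scalar_prod (infix "\<bullet>" 70)

lemma sum_fun_apply: "(sum f A) x = (\<Sum>i\<in>A. f i x)"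
  by (induction A rule: infinite_finite_induct) auto

section \<open>Interior products and the exterior algebra\<close>

text \<open>The interior product. The vector enters at the head of the list, so contracting a form
  and peeling off its first argument coincide; together with the value at the empty list this turns
  identities of forms into inductions on lists.\<close>

definition ctr :: "real ^ 'n \<Rightarrow> ('n::finite) ext \<Rightarrow> 'n ext"
  where "ctr v a = (\<lambda>vs. a (v # vs))"

text \<open>The grading involution; as an operator on inhomogeneous forms it carries the Koszul
  signs without a case split on degrees.\<close>

definition parity :: "('n::finite) ext \<Rightarrow> 'n ext"
  where "parity a = (\<lambda>vs. (- 1) ^ length vs * a vs)"

definition form1 :: "real ^ 'n \<Rightarrow> ('n::finite) ext"
  where "form1 u = (\<lambda>vs. if length vs = 1 then hd vs \<bullet> u else 0)"

definition deg_op :: "('n::finite) ext \<Rightarrow> 'n ext"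
  where "deg_op a = (\<lambda>vs. real (length vs) * a vs)"

definition pull :: "(real ^ 'n \<Rightarrow> real ^ 'n) \<Rightarrow> ('n::finite) ext \<Rightarrow> 'n ext"
  where "pull T a = (\<lambda>vs. a (map T vs))"

definition multilin :: "('n::finite) ext \<Rightarrow> bool"
  where "multilin a \<longleftrightarrow> (\<forall>us vs. linear (\<lambda>v. a (us @ v # vs)))"

text \<open>Alternating forms of mixed degree, the fibre of the total space; \<open>ext\<close> is
  cut out of it by a support condition (\<open>ext_iff\<close>).\<close>

definition altf :: "('n::finite) ext set"
  where "altf = {a. multilin a \<and> (\<forall>vs. \<not> distinct vs \<longrightarrow> a vs = 0)}"

lemma ext_iff: "a \<in> ext k \<longleftrightarrow> a \<in> altf \<and> (\<forall>vs. length vs \<noteq> k \<longrightarrow> a vs = 0)"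
  by (auto simp: ext_def altf_def multilin_def)

lemma ctr_apply: "ctr v a vs = a (v # vs)"
  by (simp add: ctr_def)

lemma parity_apply: "parity a vs = (- 1) ^ length vs * a vs"
  by (simp add: parity_def)

lemma ctr_linear [simp]:
  "ctr v (a + b) = ctr v a + ctr v b" "ctr v (a - b) = ctr v a - ctr v b"
  "ctr v (r *\<^sub>R a) = r *\<^sub>R ctr v a" "ctr v 0 = 0" "ctr v (- a) = - ctr v a"
  by (auto simp: ctr_def fun_eq_iff)

lemma ctr_sum: "ctr v (sum f A) = (\<Sum>i\<in>A. ctr v (f i))"
  by (simp add: ctr_def fun_eq_iff sum_fun_apply)

lemma parity_linear [simp]:
  "parity (a + b) = parity a + parity b" "parity (a - b) = parity a - parity b"
  "parity (r *\<^sub>R a) = r *\<^sub>R parity a" "parity 0 = 0" "parity (- a) = - parity a"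
  by (auto simp: parity_def fun_eq_iff algebra_simps)

lemma parity_parity [simp]: "parity (parity a) = a"
  by (auto simp: parity_def fun_eq_iff mult.assoc[symmetric] simp flip: power_mult_distrib)

lemma ctr_parity: "ctr v (parity a) = - parity (ctr v a)"
  by (auto simp: parity_def ctr_def fun_eq_iff)

lemma ctr_unit [simp]: "ctr v unit_ext = 0"
  by (auto simp: ctr_def unit_ext_def fun_eq_iff)

lemma parity_unit [simp]: "parity unit_ext = unit_ext"
  by (auto simp: parity_def unit_ext_def fun_eq_iff)

lemma ctr_form1: "ctr v (form1 u) = (v \<bullet> u) *\<^sub>R unit_ext"
  by (auto simp: ctr_def unit_ext_def form1_def fun_eq_iff)

lemma parity_form1: "parity (form1 u) = - form1 u"
  by (auto simp: parity_def form1_def fun_eq_iff)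

lemma wedge_add_left: "wedge (a + b) c = wedge a c + wedge b c"
  by (auto simp: wedge_def fun_eq_iff algebra_simps sum.distrib)

lemma wedge_add_right: "wedge c (a + b) = wedge c a + wedge c b"
  by (auto simp: wedge_def fun_eq_iff algebra_simps sum.distrib)

lemma wedge_scaleR_left: "wedge (r *\<^sub>R a) c = r *\<^sub>R wedge a c"
  by (auto simp: wedge_def fun_eq_iff algebra_simps sum_distrib_left)

lemma wedge_scaleR_right: "wedge c (r *\<^sub>R a) = r *\<^sub>R wedge c a"
  by (auto simp: wedge_def fun_eq_iff algebra_simps sum_distrib_left)

lemma wedge_zero [simp]: "wedge 0 c = 0" "wedge c 0 = 0"
  by (auto simp: wedge_def fun_eq_iff)

lemma wedge_minus_left: "wedge (- a) c = - wedge a c"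
  using wedge_scaleR_left[of "-1"] by simp

lemma wedge_minus_right: "wedge c (- a) = - wedge c a"
  using wedge_scaleR_right[of _ "-1"] by simp

lemma wedge_diff_left: "wedge (a - b) c = wedge a c - wedge b c"
  using wedge_add_left[of a "-b"] wedge_minus_left by simp

lemma wedge_diff_right: "wedge c (a - b) = wedge c a - wedge c b"
  using wedge_add_right[of c a "-b"] wedge_minus_right by simp

lemmas wedge_linear = wedge_add_left wedge_add_right wedge_scaleR_left wedge_scaleR_right
  wedge_minus_left wedge_minus_right wedge_diff_left wedge_diff_right

lemma wedge_sum_left: "wedge (sum f A) c = (\<Sum>i\<in>A. wedge (f i) c)"
  by (simp add: sum_comp_morphism[of "\<lambda>a. wedge a c", unfolded o_def] wedge_add_left)

lemma wedge_sum_right: "wedge c (sum f A) = (\<Sum>i\<in>A. wedge c (f i))"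
  by (simp add: sum_comp_morphism[of "\<lambda>a. wedge c a", unfolded o_def] wedge_add_right)

lemma wedge_Nil: "wedge a b [] = a [] * b []"
  by (simp add: wedge_def shuffle_sign_def)

lemma Pow_lessThan_Suc_shift:
  "Pow {..<Suc m} = (\<lambda>S. Suc ` S) ` Pow {..<m} \<union> (\<lambda>S. insert 0 (Suc ` S)) ` Pow {..<m}"
proof -
  have "{..<Suc m} = insert 0 (Suc ` {..<m})"
    by (auto simp: lessThan_Suc_eq_insert_0)
  then have "Pow {..<Suc m} = Pow (Suc ` {..<m}) \<union> insert 0 ` Pow (Suc ` {..<m})"
    by (simp add: Pow_insert)
  also have "Pow (Suc ` {..<m}) = (`) Suc ` Pow {..<m}"
    by (simp add: image_Pow_surj)
  finally show ?thesis
    by (simp add: image_image)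
qed

text \<open>A position 0 in the first block has nothing before it, so it contributes no
  inversion.\<close>

lemma shuffle_sign_insert_0:
  assumes "S \<subseteq> {..<m}"
  shows "shuffle_sign (insert 0 (Suc ` S)) (Suc m) = shuffle_sign S m"
proof -
  have "{(i, j). i \<in> insert 0 (Suc ` S) \<and> j \<in> {..<Suc m} - insert 0 (Suc ` S) \<and> j < i}
    = map_prod Suc Suc ` {(i, j). i \<in> S \<and> j \<in> {..<m} - S \<and> j < i}" (is "?A = map_prod Suc Suc ` ?B")
  proof (intro equalityI subsetI)
    fix x assume "x \<in> ?A"
    then obtain i j where x: "x = (i, j)" "i \<in> insert 0 (Suc ` S)" "j < Suc m" "j \<notin> insert 0 (Suc ` S)" "j < i"
      by auto
    then obtain i' where "i = Suc i'" "i' \<in> S" by auto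
    moreover obtain j' where "j = Suc j'" using x by (cases j) auto
    ultimately show "x \<in> map_prod Suc Suc ` ?B" using x by auto
  qed auto
  then show ?thesis
    unfolding shuffle_sign_def by (simp add: card_image inj_on_def)
qed

text \<open>A position 0 in the second block is preceded by none but forms an inversion with every
  element of the first block; these \<open>card S\<close> extra inversions are the sign that
  \<open>parity\<close> records in the product recursion.\<close>

lemma shuffle_sign_Suc_image:
  assumes "S \<subseteq> {..<m}"
  shows "shuffle_sign (Suc ` S) (Suc m) = (- 1) ^ card S * shuffle_sign S m"
proof -
  have fin: "finite S" using assms finite_subset by blast
  have "{(i, j). i \<in> Suc ` S \<and> j \<in> {..<Suc m} - Suc ` S \<and> j < i}
    = (\<lambda>i. (Suc i, 0)) ` S \<union> map_prod Suc Suc ` {(i, j). i \<in> S \<and> j \<in> {..<m} - S \<and> j < i}"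
    (is "?A = ?C \<union> map_prod Suc Suc ` ?B")
  proof (intro equalityI subsetI)
    fix x assume "x \<in> ?A"
    then obtain i j where x: "x = (i, j)" "i \<in> Suc ` S" "j < Suc m" "j \<notin> Suc ` S" "j < i"
      by auto
    then obtain i' where "i = Suc i'" "i' \<in> S" by auto
    then show "x \<in> ?C \<union> map_prod Suc Suc ` ?B" using x by (cases j) auto
  qed auto
  moreover have "finite ?B"
    by (rule finite_subset[of _ "S \<times> {..<m}"]) (use fin in auto)
  moreover have "card (?C \<union> map_prod Suc Suc ` ?B) = card ?C + card (map_prod Suc Suc ` ?B)"
    by (rule card_Un_disjoint) (use fin \<open>finite ?B\<close> in auto)
  moreover have "card ?C = card S" by (rule card_image) (auto simp: inj_on_def)
  moreover have "card (map_prod Suc Suc ` ?B) = card ?B" by (rule card_image) (auto simp: inj_on_def)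
  ultimately show ?thesis
    unfolding shuffle_sign_def by (simp add: power_add)
qed

text \<open>
  Splitting the shuffles according to the factor that receives the first argument gives a recursion
  along lists.
\<close>

lemma wedge_Cons:
  "wedge a b (v # vs) = wedge (ctr v a) b vs + wedge (parity a) (ctr v b) vs"
proof -
  define m where "m = length vs"
  define F where "F S = shuffle_sign S (Suc m) * a (nths (v # vs) S) * b (nths (v # vs) ({..<Suc m} - S))" for S
  have inj1: "inj_on (\<lambda>S. Suc ` S) (Pow {..<m})"
    by (auto simp: inj_on_def inj_image_eq_iff)
  have inj2: "inj_on (\<lambda>S. insert 0 (Suc ` S)) (Pow {..<m})"
  proof (rule inj_onI)
    fix S T :: "nat set" assume "insert 0 (Suc ` S) = insert 0 (Suc ` T)"
    then have "Suc ` S = Suc ` T" by (metis Diff_insert_absorb imageE nat.distinct(1))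
    then show "S = T" by (simp add: inj_image_eq_iff)
  qed
  have "wedge a b (v # vs) = (\<Sum>S\<in>Pow {..<Suc m}. F S)"
    by (simp add: wedge_def F_def m_def)
  also have "\<dots> = (\<Sum>S\<in>(\<lambda>S. Suc ` S) ` Pow {..<m}. F S) + (\<Sum>S\<in>(\<lambda>S. insert 0 (Suc ` S)) ` Pow {..<m}. F S)"
    unfolding Pow_lessThan_Suc_shift by (rule sum.union_disjoint) auto
  also have "\<dots> = (\<Sum>S\<in>Pow {..<m}. F (Suc ` S)) + (\<Sum>S\<in>Pow {..<m}. F (insert 0 (Suc ` S)))"
    using inj1 inj2 by (simp add: sum.reindex)
  also have "(\<Sum>S\<in>Pow {..<m}. F (Suc ` S)) = wedge (parity a) (ctr v b) vs"
    unfolding wedge_def m_def[symmetric]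
  proof (rule sum.cong[OF refl])
    fix S assume "S \<in> Pow {..<m}"
    then have S: "S \<subseteq> {..<m}" by auto
    then have "{i. i < m \<and> i \<in> S} = S" by auto
    then have "card S = length (nths vs S)" by (simp add: length_nths m_def)
    moreover have "{j. Suc j \<in> Suc ` S} = S" "{j. j < m \<and> Suc j \<notin> Suc ` S} = {..<m} - S"
      "{j. Suc j \<in> {..<Suc m} - Suc ` S} = {..<m} - S" by auto
    ultimately show "F (Suc ` S) = shuffle_sign S m * parity a (nths vs S) * ctr v b (nths vs ({..<m} - S))"
      by (simp add: F_def shuffle_sign_Suc_image[OF S] nths_Cons parity_def ctr_def)
  qed
  also have "(\<Sum>S\<in>Pow {..<m}. F (insert 0 (Suc ` S))) = wedge (ctr v a) b vs"
    unfolding wedge_def m_def[symmetric]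
  proof (rule sum.cong[OF refl])
    fix S assume "S \<in> Pow {..<m}"
    then have S: "S \<subseteq> {..<m}" by auto
    have "{j. Suc j \<in> insert 0 (Suc ` S)} = S" 
      "{j. Suc j \<in> {..<Suc m} - insert 0 (Suc ` S)} = {..<m} - S" by auto
    then show "F (insert 0 (Suc ` S)) = shuffle_sign S m * ctr v a (nths vs S) * b (nths vs ({..<m} - S))"
      by (simp add: F_def shuffle_sign_insert_0[OF S] nths_Cons ctr_def)
  qed
  finally show ?thesis by simp
qed

lemma ctr_wedge: "ctr v (wedge a b) = wedge (ctr v a) b + wedge (parity a) (ctr v b)"
  by (simp add: ctr_def fun_eq_iff wedge_Cons[unfolded ctr_def])

lemma parity_wedge: "parity (wedge a b) = wedge (parity a) (parity b)"
proof
  fix vs show "parity (wedge a b) vs = wedge (parity a) (parity b) vs"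
  proof (induction vs arbitrary: a b)
    case Nil then show ?case by (simp add: parity_def wedge_Nil)
  next
    case (Cons v vs)
    have "parity (wedge a b) (v # vs) = - parity (wedge (ctr v a) b) vs - parity (wedge (parity a) (ctr v b)) vs"
      by (simp add: parity_apply wedge_Cons algebra_simps)
    then show ?case
      unfolding Cons by (simp add: wedge_Cons ctr_parity wedge_linear)
  qed
qed

lemma unit_Nil [simp]: "unit_ext [] = 1"
  by (simp add: unit_ext_def)

lemma wedge_unit_left [simp]: "wedge unit_ext a = a"
proof
  fix vs show "wedge unit_ext a vs = a vs"
    by (induction vs arbitrary: a) (auto simp: wedge_Nil wedge_Cons ctr_apply)
qed

lemma wedge_unit_right [simp]: "wedge a unit_ext = a"
proof
  fix vs show "wedge a unit_ext vs = a vs"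
    by (induction vs arbitrary: a) (auto simp: wedge_Nil wedge_Cons ctr_apply)
qed

text \<open>Contraction is a graded derivation of either bracketing, so both sides satisfy one
  recursion along the arguments and agree at the empty list; no shuffles into three blocks are
  compared.\<close>

lemma wedge_assoc: "wedge (wedge a b) c = wedge a (wedge b c)"
proof
  fix vs show "wedge (wedge a b) c vs = wedge a (wedge b c) vs"
    by (induction vs arbitrary: a b c)
      (auto simp: wedge_Nil wedge_Cons ctr_wedge parity_wedge wedge_linear)
qed

lemma wedge_support:
  assumes "\<And>vs. length vs \<noteq> j \<Longrightarrow> a vs = 0" "\<And>vs. length vs \<noteq> k \<Longrightarrow> b vs = 0" "length vs \<noteq> j + k"
  shows "wedge a b vs = 0"
proof -
  have "a (nths vs S) = 0 \<or> b (nths vs ({..<length vs} - S)) = 0" if "S \<subseteq> {..<length vs}" for S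
  proof (rule ccontr)
    assume "\<not> ?thesis"
    then have "length (nths vs S) = j" "length (nths vs ({..<length vs} - S)) = k"
      using assms by blast+
    moreover have "length (nths vs S) = card S" "length (nths vs ({..<length vs} - S)) = card ({..<length vs} - S)"
      using that by (auto simp: length_nths intro!: arg_cong[where f=card])
    moreover have "card ({..<length vs} - S) + card S = length vs"
      using that by (metis card_Diff_subset card_lessThan card_mono finite_lessThan finite_subset le_add_diff_inverse2)
    ultimately show False using assms(3) by simp
  qed
  then show ?thesis
    unfolding wedge_def by (intro sum.neutral) auto
qed

lemma parity_homogeneous:
  assumes "\<And>vs. length vs \<noteq> j \<Longrightarrow> a vs = 0"
  shows "parity a = (- 1) ^ j *\<^sub>R a"
  using assms by (force simp: parity_def fun_eq_iff)

text \<open>Peeling off an argument contracts one factor and lowers its degree by one, so the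
  induction keeps both degrees arbitrary; a contracted 0-form vanishes, which gives the separate
  cases.\<close>

lemma wedge_commute:
  assumes "\<And>vs. length vs \<noteq> j \<Longrightarrow> a vs = 0" "\<And>vs. length vs \<noteq> k \<Longrightarrow> b vs = 0"
  shows "wedge a b = (- 1) ^ (j * k) *\<^sub>R wedge b a"
proof
  fix vs show "wedge a b vs = ((- 1) ^ (j * k) *\<^sub>R wedge b a) vs"
    using assms
  proof (induction vs arbitrary: a b j k)
    case Nil
    show ?case
    proof (cases "j = 0 \<or> k = 0")
      case True then show ?thesis by (auto simp: wedge_Nil)
    next
      case False then show ?thesis using Nil(1)[of "[]"] Nil(2)[of "[]"] by (simp add: wedge_Nil)
    qed
  next
    case (Cons v vs)
    \<comment> \<open>The sign for degrees j - 1 and k; jk + k stands for jk - k, which has the same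
      parity.\<close>
    have 1: "wedge (ctr v a) b vs = (- 1) ^ (j * k + k) * wedge b (ctr v a) vs"
    proof (cases j)
      case 0
      then have "ctr v a = 0" using Cons.prems(1) by (auto simp: ctr_def fun_eq_iff)
      then show ?thesis by simp
    next
      case (Suc j')
      have "wedge (ctr v a) b vs = ((- 1) ^ (j' * k) *\<^sub>R wedge b (ctr v a)) vs"
        by (rule Cons.IH) (use Suc Cons.prems in \<open>auto simp: ctr_def\<close>)
      moreover have "j * k + k = j' * k + 2 * k" using Suc by simp
      ultimately show ?thesis by (simp add: power_add)
    qed
    have 2: "wedge a (ctr v b) vs = (- 1) ^ (j * k + j) * wedge (ctr v b) a vs"
    proof (cases k)
      case 0
      then have "ctr v b = 0" using Cons.prems(2) by (auto simp: ctr_def fun_eq_iff)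
      then show ?thesis by simp
    next
      case (Suc k')
      have "wedge a (ctr v b) vs = ((- 1) ^ (j * k') *\<^sub>R wedge (ctr v b) a) vs"
        by (rule Cons.IH) (use Suc Cons.prems in \<open>auto simp: ctr_def\<close>)
      moreover have "j * k + j = j * k' + 2 * j" using Suc by simp
      ultimately show ?thesis by (simp add: power_add)
    qed
    have p: "parity a = (- 1) ^ j *\<^sub>R a" "parity b = (- 1) ^ k *\<^sub>R b"
      by (rule parity_homogeneous, use Cons.prems in blast)+
    have s: "(- 1) ^ j * ((- 1) ^ j * x) = x" for j and x :: real
      by (simp add: mult.assoc[symmetric] flip: power_mult_distrib)
    show ?case
      unfolding wedge_Cons p wedge_scaleR_left scaleR_fun_apply 1 2 real_scaleR_def
      by (simp add: power_add algebra_simps s)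
  qed
qed

section \<open>Pullback, multilinear and alternating forms\<close>

lemma wedge_pull: "wedge (pull T a) (pull T b) = pull T (wedge a b)"
  by (auto simp: wedge_def pull_def nths_map fun_eq_iff)

lemma ctr_pull: "ctr v (pull T a) = pull T (ctr (T v) a)"
  by (auto simp: ctr_def pull_def)

lemma pull_linear [simp]: "pull T (a + b) = pull T a + pull T b" "pull T (r *\<^sub>R a) = r *\<^sub>R pull T a"
  "pull T 0 = 0" "pull T (a - b) = pull T a - pull T b" "pull T (- a) = - pull T a"
  by (auto simp: pull_def fun_eq_iff)

lemma pull_sum: "pull T (sum f A) = (\<Sum>i\<in>A. pull T (f i))"
  by (simp add: pull_def fun_eq_iff sum_fun_apply)

lemma pull_unit [simp]: "pull T unit_ext = unit_ext"
  by (auto simp: pull_def unit_ext_def)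

lemma pull_pull: "pull T (pull S a) = pull (S \<circ> T) a"
  by (auto simp: pull_def)

lemma multilinD: "multilin a \<Longrightarrow> linear (\<lambda>v. a (us @ v # vs))"
  by (auto simp: multilin_def)

lemma multilin_ctr: "multilin a \<Longrightarrow> multilin (ctr v a)"
  unfolding multilin_def ctr_def append_Cons[symmetric] by blast

lemma multilin_parity: "multilin a \<Longrightarrow> multilin (parity a)"
  by (simp add: multilin_def parity_def linear_iff algebra_simps)

lemma ctr_add_vec: "multilin a \<Longrightarrow> ctr (u + v) a = ctr u a + ctr v a"
  using linear_add[OF multilinD[where us="[]"]] by (fastforce simp: ctr_def fun_eq_iff)

lemma ctr_scaleR_vec: "multilin a \<Longrightarrow> ctr (r *\<^sub>R v) a = r *\<^sub>R ctr v a"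
  using linear_scale[OF multilinD[where us="[]"]] by (fastforce simp: ctr_def fun_eq_iff)

lemma ctr_zero_vec: "multilin a \<Longrightarrow> ctr 0 a = 0"
  using ctr_scaleR_vec[of a 0 0] by simp

lemma ctr_sum_vec: "multilin a \<Longrightarrow> ctr (sum f A) a = (\<Sum>i\<in>A. ctr (f i) a)"
  by (simp add: sum_comp_morphism[of "\<lambda>v. ctr v a", unfolded o_def] ctr_add_vec ctr_zero_vec)

lemma vec_expand: "(v :: real ^ 'n) = (\<Sum>i\<in>UNIV. (v $ i) *\<^sub>R axis i 1)"
  using basis_expansion[of v] by (simp add: scalar_mult_eq_scaleR)

lemma ctr_expand: "multilin a \<Longrightarrow> ctr v a = (\<Sum>i\<in>UNIV. (v $ i) *\<^sub>R ctr (axis i 1) a)"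
  using ctr_sum_vec[of a "\<lambda>i. v $ i *\<^sub>R axis i 1" UNIV]
  by (simp add: ctr_scaleR_vec flip: vec_expand)

lemma multilin_wedge:
  assumes "multilin a" "multilin b" shows "multilin (wedge a b)"
proof -
  have "linear (\<lambda>v. wedge a b (us @ v # vs))" for us vs
    using assms
  proof (induction us arbitrary: a b)
    case Nil
    show ?case
      by (rule linearI) (simp_all add: wedge_Cons ctr_add_vec ctr_scaleR_vec Nil wedge_linear algebra_simps)
  next
    case (Cons u us)
    show ?case
      unfolding append_Cons wedge_Cons
      by (intro linear_compose_add Cons.IH multilin_ctr multilin_parity Cons.prems)
  qed
  then show ?thesis by (simp add: multilin_def)
qed

text \<open>Equal adjacent arguments suffice: polarising them makes adjacent transpositions change
  the sign, and such transpositions bring two equal arguments together.\<close>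

lemma altfI:
  assumes "multilin a" and z: "\<And>us v vs. a (us @ v # v # vs) = 0"
  shows "a \<in> altf"
proof -
  have swap: "a (us @ v # w # vs) = - a (us @ w # v # vs)" for us v w vs
  proof -
    have l1: "linear (\<lambda>v. a (us @ v # x # vs))" for x using multilinD[OF assms(1)] by blast
    have l2: "linear (\<lambda>v. a (us @ x # v # vs))" for x using multilinD[OF assms(1), of "us @ [x]"] by simp
    have "a (us @ (v + w) # (v + w) # vs) = a (us @ v # w # vs) + a (us @ w # v # vs)"
      by (simp only: linear_add[OF l1] linear_add[OF l2]) (simp add: z)
    then show ?thesis by (simp add: z)
  qed
  have "a (us @ y # ys @ y # vs) = 0" for us y ys vs
  proof (induction ys arbitrary: us)
    case Nil show ?case using z by simp
  next
    case (Cons x ys)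
    have "a (us @ x # y # ys @ y # vs) = 0" using Cons[of "us @ [x]"] by simp
    then show ?case using swap[of us y x "ys @ y # vs"] by simp
  qed
  then have "a vs = 0" if "\<not> distinct vs" for vs
    using not_distinct_decomp[OF that] by auto
  then show ?thesis using assms(1) by (auto simp: altf_def)
qed

lemma altf_multilin: "a \<in> altf \<Longrightarrow> multilin a"
  by (simp add: altf_def)

lemma altf_repeat: "a \<in> altf \<Longrightarrow> a (us @ v # v # vs) = 0"
  by (simp add: altf_def)

lemma altf_ctr: "a \<in> altf \<Longrightarrow> ctr v a \<in> altf"
  by (auto simp: altf_def multilin_ctr) (simp add: ctr_def)

lemma altf_parity: "a \<in> altf \<Longrightarrow> parity a \<in> altf"
  by (auto simp: altf_def multilin_parity) (simp add: parity_def)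

lemma ctr_ctr: "a \<in> altf \<Longrightarrow> ctr u (ctr v a) = - ctr v (ctr u a)"
proof -
  assume a: "a \<in> altf"
  have z: "ctr x (ctr x a) = 0" for x
    using altf_repeat[OF a, of "[]"] by (simp add: ctr_def fun_eq_iff)
  have "ctr (u + v) (ctr (u + v) a) = ctr u (ctr v a) + ctr v (ctr u a)"
    by (simp add: ctr_add_vec altf_multilin[OF a] multilin_ctr z)
  then show ?thesis by (simp add: z add_eq_0_iff2)
qed

lemma ctr_ctr_same: "a \<in> altf \<Longrightarrow> ctr u (ctr u a) = 0"
  using altf_repeat[of a "[]"] by (simp add: ctr_def fun_eq_iff)

lemma altf_wedge:
  assumes "a \<in> altf" "b \<in> altf" shows "wedge a b \<in> altf"
proof (rule altfI)
  show "multilin (wedge a b)" using assms by (simp add: altf_multilin multilin_wedge)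
  show "wedge a b (us @ v # v # vs) = 0" for us v vs
    using assms
  proof (induction us arbitrary: a b)
    case Nil
    then show ?case
      by (simp add: wedge_Cons ctr_wedge ctr_parity wedge_linear ctr_ctr_same)
  next
    case (Cons u us)
    then show ?case by (simp add: wedge_Cons altf_ctr altf_parity)
  qed
qed

lemma multilin_lin:
  "multilin a \<Longrightarrow> multilin b \<Longrightarrow> multilin (a + b)" "multilin a \<Longrightarrow> multilin (r *\<^sub>R a)" "multilin 0"
  by (auto simp: multilin_def linear_iff algebra_simps)

lemma altf_lin:
  "a \<in> altf \<Longrightarrow> b \<in> altf \<Longrightarrow> a + b \<in> altf" "a \<in> altf \<Longrightarrow> r *\<^sub>R a \<in> altf" "0 \<in> altf"
  by (auto simp: altf_def multilin_lin)

lemma altf_minus: "a \<in> altf \<Longrightarrow> - a \<in> altf"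
  using altf_lin(2)[of a "-1"] by simp

lemma altf_diff: "a \<in> altf \<Longrightarrow> b \<in> altf \<Longrightarrow> a - b \<in> altf"
  using altf_lin(1)[of a "-b"] altf_minus[of b] by simp

lemma altf_sum: "(\<And>i. i \<in> I \<Longrightarrow> f i \<in> altf) \<Longrightarrow> sum f I \<in> altf"
  by (induction I rule: infinite_finite_induct) (auto simp: altf_lin)

lemma altf_scale_length:
  assumes "a \<in> altf" shows "(\<lambda>vs. f (length vs) * a vs) \<in> altf"
  using assms by (auto simp: altf_def multilin_def linear_iff algebra_simps)

lemma altf_unit: "unit_ext \<in> altf"
  by (rule altfI) (auto simp: multilin_def unit_ext_def linear_zero)

lemma altf_form1: "form1 u \<in> altf"
proof (rule altfI)
  show "multilin (form1 u)"
    unfolding multilin_def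
  proof (intro allI)
    fix us vs :: "(real ^ 'a) list"
    show "linear (\<lambda>v. form1 u (us @ v # vs))"
    proof (cases us)
      case Nil then show ?thesis
        by (cases vs) (auto simp: form1_def linear_zero linear_iff inner_add_left)
    qed (auto simp: form1_def linear_zero)
  qed
qed (auto simp: form1_def)

lemma altf_pull:
  assumes "linear T" "a \<in> altf" shows "pull T a \<in> altf"
proof (rule altfI)
  show "multilin (pull T a)"
    using linear_compose[OF assms(1) multilinD[OF altf_multilin[OF assms(2)]]]
    by (auto simp: multilin_def pull_def o_def)
qed (use altf_repeat[OF assms(2)] in \<open>auto simp: pull_def\<close>)

lemma altf_part: "a \<in> altf \<Longrightarrow> part k a \<in> altf"
  using altf_scale_length[of a "\<lambda>n. if n = k then 1 else 0"] by (simp add: part_def if_distrib[of "\<lambda>x. x * _"] cong: if_cong)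

lemma part_in_ext: "a \<in> altf \<Longrightarrow> part k a \<in> ext k"
  by (simp add: ext_iff altf_part) (simp add: part_def)

lemma ctr_e: "ctr v (wedge (form1 u) a) = (v \<bullet> u) *\<^sub>R a - wedge (form1 u) (ctr v a)"
  by (simp add: ctr_wedge ctr_form1 parity_form1 wedge_linear)

lemma e_e: "wedge (form1 u) (wedge (form1 v) a) = - wedge (form1 v) (wedge (form1 u) a)"
proof -
  have "wedge (form1 u) (form1 v) = - wedge (form1 v) (form1 u)"
    by (subst wedge_commute[of 1 _ 1]) (auto simp: form1_def)
  then show ?thesis
    by (metis wedge_assoc wedge_minus_left)
qed

text \<open>Euler's identity. Contracting the left side by v gives \<open>ctr v a\<close> from the
  covectors and, since contractions anticommute, the left side for \<open>ctr v a\<close>, whose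
  degree is one less.\<close>

lemma euler:
  assumes "a \<in> altf"
  shows "(\<Sum>i\<in>UNIV. wedge (form1 (axis i 1)) (ctr (axis i 1) a)) = deg_op a"
proof
  fix vs show "(\<Sum>i\<in>UNIV. wedge (form1 (axis i 1)) (ctr (axis i 1) a)) vs = deg_op a vs"
    using assms
  proof (induction vs arbitrary: a)
    case Nil then show ?case by (simp add: sum_fun_apply wedge_Nil form1_def deg_op_def)
  next
    case (Cons v vs)
    have "(\<Sum>i\<in>UNIV. wedge (form1 (axis i 1)) (ctr (axis i 1) a)) (v # vs)
      = (\<Sum>i\<in>UNIV. ctr v (wedge (form1 (axis i 1)) (ctr (axis i 1) a))) vs"
      by (simp add: sum_fun_apply ctr_apply)
    also have "\<dots> = (\<Sum>i\<in>UNIV. (v $ i) *\<^sub>R ctr (axis i 1) a + wedge (form1 (axis i 1)) (ctr (axis i 1) (ctr v a))) vs"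
      by (simp add: ctr_e inner_axis ctr_ctr[OF Cons.prems, of v] wedge_linear)
    also have "\<dots> = ctr v a vs + deg_op (ctr v a) vs"
      using Cons.IH[OF altf_ctr[OF Cons.prems]]
      by (simp add: sum.distrib flip: ctr_expand[OF altf_multilin[OF Cons.prems], of v])
    finally show ?case by (simp add: deg_op_def ctr_def algebra_simps)
  qed
qed

lemma altf_eq_0_basis:
  assumes "multilin a" "\<And>is. length is = m \<Longrightarrow> a (us @ map (\<lambda>i. axis i 1) is) = 0" "length vs = m"
  shows "a (us @ vs) = 0"
  using assms
proof (induction vs arbitrary: us m)
  case Nil then show ?case by (metis list.map_disc_iff list.size(3))
next
  case (Cons v vs)
  have "a (us @ axis i 1 # vs) = 0" for i
  proof -
    have "a ((us @ [axis i 1]) @ vs) = 0"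
    proof (rule Cons.IH[where m = "length vs"])
      fix js :: "'a list" assume "length js = length vs"
      then show "a ((us @ [axis i 1]) @ map (\<lambda>i. axis i 1) js) = 0"
        using Cons.prems(2)[of "i # js"] Cons.prems(3) by simp
    qed (use Cons.prems in auto)
    then show ?thesis by simp
  qed
  moreover have "a (us @ v # vs) = (\<Sum>i\<in>UNIV. v $ i * a (us @ axis i 1 # vs))"
    using linear_sum[OF multilinD[OF Cons.prems(1), of us vs], of "\<lambda>i. v $ i *\<^sub>R axis i 1" UNIV]
    by (simp add: linear_scale[OF multilinD[OF Cons.prems(1), of us vs]] flip: vec_expand)
  ultimately show ?case by simp
qed

lemma altf_long_zero:
  fixes a :: "('n::finite) ext"
  assumes "a \<in> altf" "length vs > CARD('n)" shows "a vs = 0"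
proof -
  have "a ([] @ vs) = 0"
  proof (rule altf_eq_0_basis[where m = "length vs"])
    fix js :: "'n list" assume "length js = length vs"
    then have "\<not> distinct js"
      using assms(2) distinct_card[of js] card_mono[of UNIV "set js"] by fastforce
    then have "\<not> distinct (map (\<lambda>i. axis i (1::real)) js)"
      by (metis distinct_map)
    then show "a ([] @ map (\<lambda>i. axis i 1) js) = 0" using assms(1) by (simp add: altf_def)
  qed (use assms in \<open>auto simp: altf_multilin\<close>)
  then show ?thesis by simp
qed

lemma altf_part_sum:
  fixes a :: "('n::finite) ext"
  assumes "a \<in> altf" shows "a = (\<Sum>k\<le>CARD('n). part k a)"
proof
  fix vs show "a vs = (\<Sum>k\<le>CARD('n). part k a) vs"
    using altf_long_zero[OF assms, of vs]
    by (cases "length vs \<le> CARD('n)") (auto simp: sum_fun_apply part_def)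
qed

section \<open>Scaling by functions of the degree\<close>

text \<open>One family for all operators that are scalar in each degree: signs, the degree operator,
  \<open>eps\<close>, projections to a degree, and the weight operator n - k.\<close>

definition lenscale :: "(nat \<Rightarrow> real) \<Rightarrow> ('n::finite) ext \<Rightarrow> 'n ext"
  where "lenscale g a = (\<lambda>vs. g (length vs) * a vs)"

lemma lenscale_linear [simp]:
  "lenscale g (a + b) = lenscale g a + lenscale g b" "lenscale g (a - b) = lenscale g a - lenscale g b"
  "lenscale g (r *\<^sub>R a) = r *\<^sub>R lenscale g a" "lenscale g 0 = 0" "lenscale g (- a) = - lenscale g a"
  by (auto simp: lenscale_def fun_eq_iff algebra_simps)

lemma lenscale_sum: "lenscale g (sum f A) = (\<Sum>i\<in>A. lenscale g (f i))"
  by (simp add: lenscale_def fun_eq_iff sum_fun_apply sum_distrib_left)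

lemma lenscale_lenscale: "lenscale g (lenscale h a) = lenscale (\<lambda>k. g k * h k) a"
  by (auto simp: lenscale_def fun_eq_iff)

lemma parity_lenscale: "parity = lenscale (\<lambda>k. (- 1) ^ k)"
  by (auto simp: lenscale_def fun_eq_iff parity_def)

lemma deg_op_lenscale: "deg_op = lenscale real"
  by (auto simp: lenscale_def fun_eq_iff deg_op_def)

lemma altf_lenscale: "a \<in> altf \<Longrightarrow> lenscale g a \<in> altf"
  unfolding lenscale_def by (rule altf_scale_length)

lemma ctr_lenscale: "ctr v (lenscale g a) = lenscale (\<lambda>k. g (Suc k)) (ctr v a)"
  by (auto simp: lenscale_def ctr_def fun_eq_iff)

lemma lenscale_wedge:
  assumes "\<And>vs. length vs \<noteq> j \<Longrightarrow> a vs = 0"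
  shows "lenscale g (wedge a b) = wedge a (lenscale (\<lambda>k. g (j + k)) b)"
proof
  fix vs show "lenscale g (wedge a b) vs = wedge a (lenscale (\<lambda>k. g (j + k)) b) vs"
    using assms
  proof (induction vs arbitrary: a b j g)
    case Nil
    then show ?case by (cases "j = 0") (auto simp: lenscale_def wedge_Nil)
  next
    case (Cons v vs)
    have 1: "wedge (ctr v a) (lenscale (\<lambda>k. g (j + k)) b) vs = lenscale (\<lambda>k. g (Suc k)) (wedge (ctr v a) b) vs"
    proof (cases j)
      case 0
      then have "ctr v a = 0" using Cons.prems by (auto simp: ctr_def fun_eq_iff)
      then show ?thesis by simp
    next
      case (Suc j')
      show ?thesis
        using Cons.IH[of j' "ctr v a" "\<lambda>k. g (Suc k)" b] Cons.prems Suc by (simp add: ctr_def)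
    qed
    have 2: "wedge (parity a) (ctr v (lenscale (\<lambda>k. g (j + k)) b)) vs
      = lenscale (\<lambda>k. g (Suc k)) (wedge (parity a) (ctr v b)) vs"
      using Cons.IH[of j "parity a" "\<lambda>k. g (Suc k)" "ctr v b"] Cons.prems
      by (simp add: parity_def ctr_lenscale)
    show ?case
      unfolding wedge_Cons 1 2 by (simp add: lenscale_def wedge_Cons algebra_simps)
  qed
qed

lemma lenscale_e: "lenscale g (wedge (form1 u) a) = wedge (form1 u) (lenscale (\<lambda>k. g (Suc k)) a)"
  using lenscale_wedge[of 1 "form1 u" g a] by (simp add: form1_def)

lemma lenscale_ext: "a \<in> ext k \<Longrightarrow> lenscale g a = g k *\<^sub>R a"
  by (force simp: ext_iff lenscale_def fun_eq_iff)

lemma parity_e: "parity (wedge (form1 u) a) = - wedge (form1 u) (parity a)"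
  by (simp add: parity_wedge parity_form1 wedge_linear)

lemma parity_ext: "a \<in> ext k \<Longrightarrow> parity a = (- 1) ^ k *\<^sub>R a"
  by (simp add: parity_lenscale lenscale_ext)

lemma ext_lin: "a \<in> ext k \<Longrightarrow> b \<in> ext k \<Longrightarrow> a + b \<in> ext k" "a \<in> ext k \<Longrightarrow> r *\<^sub>R a \<in> ext k" "0 \<in> ext k"
  "a \<in> ext k \<Longrightarrow> - a \<in> ext k" "a \<in> ext k \<Longrightarrow> b \<in> ext k \<Longrightarrow> a - b \<in> ext k"
  by (auto simp: ext_iff altf_lin altf_minus altf_diff)

lemma ext_sum: "(\<And>i. i \<in> I \<Longrightarrow> f i \<in> ext k) \<Longrightarrow> sum f I \<in> ext k"
  by (simp add: ext_iff altf_sum sum_fun_apply)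

lemma ext_altf: "a \<in> ext k \<Longrightarrow> a \<in> altf"
  by (simp add: ext_iff)

lemma unit_in_ext: "unit_ext \<in> ext 0"
  by (auto simp: ext_iff altf_unit) (simp add: unit_ext_def)

lemma form1_in_ext: "form1 u \<in> ext 1"
  by (auto simp: ext_iff altf_form1) (simp add: form1_def)

lemma ctr_in_ext: "a \<in> ext (Suc k) \<Longrightarrow> ctr v a \<in> ext k"
  by (simp add: ext_iff altf_ctr) (simp add: ctr_def)

lemma wedge_in_ext: "a \<in> ext j \<Longrightarrow> b \<in> ext k \<Longrightarrow> wedge a b \<in> ext (j + k)"
  unfolding ext_iff by (auto intro: altf_wedge wedge_support)

lemma e_in_ext: "a \<in> ext k \<Longrightarrow> wedge (form1 u) a \<in> ext (Suc k)"
  using wedge_in_ext[OF form1_in_ext] by fastforce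

lemma ext_0_eq: "a \<in> ext 0 \<Longrightarrow> a = a [] *\<^sub>R unit_ext"
  by (auto simp: ext_iff unit_ext_def fun_eq_iff)

lemma ext_1_eq: 
  assumes "a \<in> ext 1" shows "a = form1 (\<chi> i. a [axis i 1])"
proof
  fix vs :: "(real ^ 'a) list"
  show "a vs = form1 (\<chi> i. a [axis i 1]) vs"
  proof (cases "length vs = 1")
    case True
    then obtain v where vs: "vs = [v]" by (auto simp: length_Suc_conv)
    have "a [v] = (\<Sum>i\<in>UNIV. v $ i * a [axis i 1])"
      using ctr_expand[of a v] assms
      by (simp add: ext_iff altf_multilin ctr_def fun_eq_iff sum_fun_apply)
    then show ?thesis by (simp add: vs form1_def inner_vec_def)
  next
    case False then show ?thesis using assms by (auto simp: ext_iff form1_def)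
  qed
qed

lemma ext_long_zero: "a \<in> ext k \<Longrightarrow> k > CARD('n) \<Longrightarrow> a = (0 :: ('n::finite) ext)"
  using altf_long_zero[of a] unfolding ext_iff fun_eq_iff zero_fun_apply by metis

text \<open>Covectors generate: by \<open>euler\<close> a form of degree k + 1 is 1/(k + 1) times a
  sum of covectors times its contractions. This induction reduces operator identities on a fibre to
  commutation with one covector.\<close>

lemma ext_induct [consumes 1, case_names add scale unit wedge]:
  assumes "a \<in> ext k"
    and add: "\<And>k a b. a \<in> ext k \<Longrightarrow> b \<in> ext k \<Longrightarrow> P k a \<Longrightarrow> P k b \<Longrightarrow> P k (a + b)"
    and scale: "\<And>k r a. a \<in> ext k \<Longrightarrow> P k a \<Longrightarrow> P k (r *\<^sub>R a)"
    and unit: "P 0 unit_ext"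
    and wedge: "\<And>k u a. a \<in> ext k \<Longrightarrow> P k a \<Longrightarrow> P (Suc k) (wedge (form1 u) a)"
  shows "P k a"
  using assms(1)
proof (induction k arbitrary: a)
  case 0
  show ?case by (subst ext_0_eq[OF 0]) (rule scale[OF unit_in_ext unit])
next
  case (Suc k)
  have S: "(\<Sum>i\<in>I. wedge (form1 (axis i 1)) (ctr (axis i 1) a)) \<in> ext (Suc k)
     \<and> P (Suc k) (\<Sum>i\<in>I. wedge (form1 (axis i 1)) (ctr (axis i 1) a))" if "finite I" for I
    using that
  proof induction
    case empty
    \<comment> \<open>There is no rule for the zero form, so the empty sum is produced as a zero
      multiple of some product.\<close>
    have "P (Suc k) (0 *\<^sub>R wedge (form1 undefined) (0 *\<^sub>R ctr undefined a))"
      by (intro scale wedge e_in_ext ext_lin ctr_in_ext Suc)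
    then show ?case by (simp add: ext_lin flip: zero_fun_def)
  next
    case (insert i I)
    have "ctr (axis i 1) a \<in> ext k" "P k (ctr (axis i 1) a)" using Suc by (simp_all add: ctr_in_ext)
    then show ?case
      unfolding sum.insert[OF insert.hyps] using insert.IH by (blast intro: add wedge ext_lin e_in_ext)
  qed
  have "deg_op a = real (Suc k) *\<^sub>R a"
    using Suc.prems by (simp add: deg_op_lenscale lenscale_ext del: of_nat_Suc)
  then have "a = (1 / real (Suc k)) *\<^sub>R (\<Sum>i\<in>UNIV. wedge (form1 (axis i 1)) (ctr (axis i 1) a))"
    using euler[OF ext_altf[OF Suc.prems]] by simp
  moreover have "P (Suc k) ((1 / real (Suc k)) *\<^sub>R (\<Sum>i\<in>UNIV. wedge (form1 (axis i 1)) (ctr (axis i 1) a)))"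
    using S[OF finite_class.finite_UNIV] by (intro scale) auto
  ultimately show ?case by (simp only:)
qed

lemma altf_induct [consumes 1, case_names add scale unit wedge]:
  assumes "a \<in> altf"
    and add: "\<And>a b. a \<in> altf \<Longrightarrow> b \<in> altf \<Longrightarrow> P a \<Longrightarrow> P b \<Longrightarrow> P (a + b)"
    and scale: "\<And>r a. a \<in> altf \<Longrightarrow> P a \<Longrightarrow> P (r *\<^sub>R a)"
    and unit: "P unit_ext"
    and wedge: "\<And>u a. a \<in> altf \<Longrightarrow> P a \<Longrightarrow> P (wedge (form1 u) a)"
  shows "P a"
proof -
  have part: "P (part k a)" for k
    using part_in_ext[OF assms(1), of k]
    by (rule ext_induct[where P = "\<lambda>_. P"]) (auto intro: assms ext_altf)
  have "(\<Sum>k\<in>K. part k a) \<in> altf \<and> P (\<Sum>k\<in>K. part k a)" if "finite K" for K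
    using that
  proof induction
    case empty
    show ?case using scale[OF altf_unit unit, of 0] by (simp add: altf_lin flip: zero_fun_def)
  next
    case (insert k K)
    then show ?case unfolding sum.insert[OF insert.hyps]
      using part assms(1) by (blast intro: add altf_lin altf_part)
  qed
  then have "P (\<Sum>k\<le>CARD('a). part k a)" by blast
  then show ?thesis using altf_part_sum[OF assms(1)] by (simp only:)
qed

lemma ctr_e_sum:
  assumes "a \<in> (altf :: ('n::finite) ext set)"
  shows "(\<Sum>i\<in>UNIV. ctr (axis i 1) (wedge (form1 (axis i 1)) a)) = real CARD('n) *\<^sub>R a - deg_op a"
  unfolding euler[OF assms, symmetric] ctr_e sum_subtractf
  by (simp add: fun_eq_iff sum_fun_apply inner_axis)

text \<open>Contracting the products with the basis covectors and summing gives N - deg on a, with N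
  the dimension; if all these products vanish, only the top degree survives.\<close>

lemma e_kernel:
  fixes a :: "('n::finite) ext"
  assumes "a \<in> altf" "\<And>i. wedge (form1 (axis i 1)) a = 0" "length vs \<noteq> CARD('n)"
  shows "a vs = 0"
proof -
  have "(real CARD('n) *\<^sub>R a - deg_op a) vs = 0"
    unfolding ctr_e_sum[OF assms(1), symmetric] by (simp add: assms(2))
  then have "(real CARD('n) - real (length vs)) * a vs = 0"
    by (simp add: deg_op_def algebra_simps)
  then show ?thesis using assms(3) by simp
qed

text \<open>For every covector u, the product of u and c is annihilated by all forms of degree one
  less, so it vanishes by induction; then \<open>e_kernel\<close> applies because the degree of c is
  below the top.\<close>

lemma wedge_nondegenerate:
  fixes c :: "('n::finite) ext"
  assumes "c \<in> ext m" "k + m = CARD('n)" "\<And>a. a \<in> ext k \<Longrightarrow> wedge a c = 0"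
  shows "c = 0"
  using assms
proof (induction k arbitrary: m c)
  case 0 then show ?case using unit_in_ext by force
next
  case (Suc k)
  have "wedge (form1 u) c = 0" for u
  proof (rule Suc.IH[of _ "Suc m"])
    fix a :: "'n ext" assume "a \<in> ext k"
    then have "wedge a (form1 u) \<in> ext (Suc k)"
      using wedge_in_ext[OF _ form1_in_ext] by fastforce
    then show "wedge a (wedge (form1 u) c) = 0"
      using Suc.prems by (simp flip: wedge_assoc zero_fun_def)
  qed (use Suc in \<open>auto intro: e_in_ext\<close>)
  then have "c vs = 0" if "length vs = m" for vs
    using e_kernel[of c vs] Suc.prems that by (simp add: ext_altf)
  then show ?case using Suc.prems(1) by (auto simp: ext_iff fun_eq_iff)
qed

section \<open>Truncated exponentials of operators\<close>

text \<open>Truncated, so that no convergence is involved; for K past the nilpotency index it is the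
  exponential.\<close>

definition opexp :: "nat \<Rightarrow> ('a::real_vector \<Rightarrow> 'a) \<Rightarrow> 'a \<Rightarrow> 'a"
  where "opexp K f a = (\<Sum>j<K. (1 / fact j) *\<^sub>R (f ^^ j) a)"

text \<open>If h = [f, g] commutes with f, then f^j g = g f^j + j h f^(j-1), and summation gives e^f
  g = (g + h) e^f. The commutation relations are asked for on V only, because for forms they hold
  only on alternating ones.\<close>

lemma opexp_commute:
  fixes f g h :: "'a::real_vector \<Rightarrow> 'a"
  assumes V: "\<And>a. a \<in> V \<Longrightarrow> f a \<in> V" "a \<in> V" "K > 0"
    and lin: "linear f" "linear g" "linear h"
    and fg: "\<And>a. a \<in> V \<Longrightarrow> f (g a) = g (f a) + h a"
    and fh: "\<And>a. a \<in> V \<Longrightarrow> f (h a) = h (f a)"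
    and nil: "(f ^^ (K - 1)) a = 0"
  shows "opexp K f (g a) = g (opexp K f a) + h (opexp K f a)"
proof -
  have fV: "(f ^^ j) a \<in> V" for j by (induction j) (auto simp: V)
  have pow: "(f ^^ j) (g a) = g ((f ^^ j) a) + real j *\<^sub>R h ((f ^^ (j - 1)) a)" for j
  proof (induction j)
    case (Suc j)
    have "f (h ((f ^^ (j - 1)) a)) = h ((f ^^ j) a)" if "j > 0"
      using fh[OF fV, of "j - 1"] that by (cases j) auto
    then show ?case
      using Suc fg[OF fV, of j]
      by (cases "j = 0") (auto simp: linear_add[OF lin(1)] linear_scale[OF lin(1)] algebra_simps)
  qed (simp add: linear_0[OF lin(3)])
  have "(\<Sum>j<K. (1 / fact j) *\<^sub>R (real j *\<^sub>R h ((f ^^ (j - 1)) a))) = (\<Sum>j<K - 1. (1 / fact j) *\<^sub>R h ((f ^^ j) a))"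
  proof -
    have "(\<Sum>j<Suc (K - 1). (1 / fact j) *\<^sub>R (real j *\<^sub>R h ((f ^^ (j - 1)) a)))
      = (\<Sum>j<K - 1. (1 / fact (Suc j)) *\<^sub>R (real (Suc j) *\<^sub>R h ((f ^^ j) a)))"
      unfolding sum.lessThan_Suc_shift by simp
    also have "\<dots> = (\<Sum>j<K - 1. (1 / fact j) *\<^sub>R h ((f ^^ j) a))"
      by (intro sum.cong refl) (simp add: field_simps del: of_nat_Suc)
    finally show ?thesis using V(3) by simp
  qed
  \<comment> \<open>The index shift left out the term j = K - 1; it vanishes by
    \<open>nil\<close>.\<close>
  also have "\<dots> = (\<Sum>j<K. (1 / fact j) *\<^sub>R h ((f ^^ j) a))"
    using nil V(3) by (cases K) (auto simp: linear_0[OF lin(3)])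
  finally show ?thesis
    unfolding opexp_def pow
    by (simp add: linear_sum[OF lin(2)] linear_sum[OF lin(3)] linear_scale[OF lin(2)] linear_scale[OF lin(3)]
      scaleR_add_right sum.distrib)
qed

section \<open>The contraction with the inverse bivector\<close>

definition pinv :: "('n::finite) ext \<Rightarrow> 'n \<Rightarrow> 'n \<Rightarrow> real"
  where "pinv w i j = matrix_inv (gram w) $ i $ j"

text \<open>The vector dual to a covector: for nondegenerate w, contracting w by it returns the
  covector (\<open>ctr_sharp_w\<close>).\<close>

definition sharp :: "('n::finite) ext \<Rightarrow> real ^ 'n \<Rightarrow> real ^ 'n"
  where "sharp w u = (\<Sum>i\<in>UNIV. \<Sum>j\<in>UNIV. (u $ i * pinv w i j) *\<^sub>R axis j 1)"

text \<open>Explicit candidate for \<Lambda> on a fibre. The factor 1/2 counts each unordered index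
  pair once, and the order of the two inserted basis vectors makes \<open>lam w w\<close> equal to
  +n.\<close>

definition lam :: "('n::finite) ext \<Rightarrow> 'n ext \<Rightarrow> 'n ext"
  where "lam w a = (\<lambda>vs. \<Sum>i\<in>UNIV. \<Sum>m\<in>UNIV. pinv w i m / 2 * a (axis m 1 # axis i 1 # vs))"

text \<open>Explicit candidate for the pairing: 1/k! times the full contraction of a and b with k
  copies of the inverse matrix; the denominators of the recursion multiply to k!.\<close>

primrec pr :: "('n::finite) ext \<Rightarrow> nat \<Rightarrow> 'n ext \<Rightarrow> 'n ext \<Rightarrow> real"
  where
    "pr w 0 a b = a [] * b []"
  | "pr w (Suc k) a b = (\<Sum>i\<in>UNIV. \<Sum>j\<in>UNIV. pinv w i j * pr w k (ctr (axis i 1) a) (ctr (axis j 1) b)) / (real k + 1)"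

lemma axis_nth: "axis i x $ j = (if j = i then x else 0)"
  by (simp add: axis_def)

lemma lam_ctr_eq: "lam w a = (\<Sum>i\<in>UNIV. \<Sum>m\<in>UNIV. (pinv w i m / 2) *\<^sub>R ctr (axis i 1) (ctr (axis m 1) a))"
  by (simp add: lam_def fun_eq_iff sum_fun_apply ctr_def)

lemma lam_linear: "linear (lam w)"
  by (rule linearI) (simp_all add: lam_def fun_eq_iff algebra_simps sum.distrib sum_distrib_left)

lemmas lam_lin [simp] = linear_add[OF lam_linear] linear_diff[OF lam_linear] linear_scale[OF lam_linear]
  linear_0[OF lam_linear] linear_neg[OF lam_linear]

lemma altf_lam: "a \<in> altf \<Longrightarrow> lam w a \<in> altf"
  unfolding lam_ctr_eq by (intro altf_sum altf_lin altf_ctr)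

lemma lam_in_ext: "a \<in> ext (Suc (Suc k)) \<Longrightarrow> lam w a \<in> ext k"
  unfolding lam_ctr_eq by (intro ext_sum ext_lin ctr_in_ext)

lemma lam_low: "a \<in> ext k \<Longrightarrow> k < 2 \<Longrightarrow> lam w a = 0"
  by (auto simp: ext_iff lam_def fun_eq_iff)

lemma ctr_sharp: "multilin a \<Longrightarrow> ctr (sharp w u) a = (\<Sum>i\<in>UNIV. \<Sum>j\<in>UNIV. (u $ i * pinv w i j) *\<^sub>R ctr (axis j 1) a)"
  by (simp add: sharp_def ctr_sum_vec ctr_scaleR_vec)

lemma lam_ctr: "a \<in> altf \<Longrightarrow> lam w (ctr v a) = ctr v (lam w a)"
  unfolding lam_ctr_eq
  by (simp add: ctr_sum ctr_ctr[of "ctr _ a" _ v] altf_ctr ctr_ctr[of a _ v])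

lemma ctr_wedge_even:
  assumes "parity a = a" shows "ctr v (wedge a b) = wedge (ctr v a) b + wedge a (ctr v b)"
  by (simp add: ctr_wedge assms)

locale symplectic_form =
  fixes w :: "('n::finite) ext" and n :: nat
  assumes w_ext: "w \<in> ext 2" and nondeg: "nondegenerate w" and dim: "CARD('n) = 2 * n"
begin

lemma w_altf: "w \<in> altf" using w_ext by (rule ext_altf)

lemma w_skew: "w [u, v] = - w [v, u]"
proof -
  have "ctr v (ctr u w) [] = - ctr u (ctr v w) []" using ctr_ctr[OF w_altf, of v u] by simp
  then show ?thesis by (simp add: ctr_def)
qed

lemma w_expand: "w [u, v] = (\<Sum>i\<in>UNIV. u $ i * w [axis i 1, v])"
  using ctr_expand[OF altf_multilin[OF w_altf], of u] by (simp add: ctr_def fun_eq_iff sum_fun_apply)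

lemma parity_w: "parity w = w"
  using parity_ext[OF w_ext] by simp

text \<open>A vector in the kernel of the Gram matrix pairs to zero with all basis vectors, hence
  with everything.\<close>

lemma invertible_gram: "invertible (gram w)"
proof -
  have "x = 0" if "gram w *v x = 0" for x
  proof -
    have "w [x, axis i 1] = 0" for i
    proof -
      have "(gram w *v x) $ i = (\<Sum>j\<in>UNIV. w [axis i 1, axis j 1] * x $ j)"
        by (simp add: matrix_vector_mult_def gram_def)
      also have "\<dots> = - w [x, axis i 1]"
        unfolding w_expand[of x] sum_negf[symmetric]
        by (intro sum.cong refl) (subst w_skew, simp)
      finally show ?thesis using that by simp
    qed
    then have "w [axis i 1, x] = 0" for i
      by (subst w_skew) simp
    then have "w [v, x] = 0" for v
      by (simp add: w_expand[of v])
    then have "w [x, v] = 0" for v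
      by (subst w_skew) simp
    then show ?thesis using nondeg by (simp add: nondegenerate_def)
  qed
  then show ?thesis
    unfolding invertible_left_inverse matrix_left_invertible_ker by blast
qed

lemma gram_inverse: "gram w ** matrix_inv (gram w) = Finite_Cartesian_Product.mat 1" "matrix_inv (gram w) ** gram w = Finite_Cartesian_Product.mat 1"
  using someI_ex[OF invertible_gram[unfolded invertible_def]] by (auto simp: matrix_inv_def)

lemma pinv_gram: "(\<Sum>j\<in>UNIV. pinv w i j * w [axis j 1, axis k 1]) = (if i = k then 1 else 0)"
  using arg_cong[OF gram_inverse(2), of "\<lambda>A. A $ i $ k"]
  by (simp add: matrix_matrix_mult_def gram_def Finite_Cartesian_Product.mat_def pinv_def)

text \<open>With G skew and A its inverse, transposing G A = 1 gives A^T G^T = 1, hence A = A^T G^T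
  A = - A^T G A = - A^T.\<close>

lemma pinv_skew: "pinv w i j = - pinv w j i"
proof -
  define A where "A = matrix_inv (gram w)"
  have G: "transpose (gram w) = - gram w"
    by (simp add: transpose_def gram_def Finite_Cartesian_Product.vec_eq_iff) (blast intro: w_skew)
  have "transpose A ** transpose (gram w) = Finite_Cartesian_Product.mat 1"
    using arg_cong[OF gram_inverse(1), of transpose] by (simp add: matrix_transpose_mul A_def transpose_mat)
  then have "(transpose A ** transpose (gram w)) ** A = A" by (simp add: A_def)
  then have "transpose A ** ((- gram w) ** A) = A" by (simp add: G matrix_mul_assoc)
  moreover have "(- gram w) ** A = - Finite_Cartesian_Product.mat 1"
    using gram_inverse(1) by (simp add: A_def matrix_matrix_mult_def Finite_Cartesian_Product.vec_eq_iff sum_negf)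
  ultimately have "transpose A ** (- Finite_Cartesian_Product.mat 1) = A" by simp
  then have "(transpose A ** (- Finite_Cartesian_Product.mat 1)) $ i $ j = A $ i $ j" by simp
  moreover have "(transpose A ** (- Finite_Cartesian_Product.mat 1)) $ i $ j = - A $ j $ i"
    by (simp add: matrix_matrix_mult_def transpose_def Finite_Cartesian_Product.mat_def if_distrib[of "\<lambda>x. _ * x"] sum_negf cong: if_cong)
  ultimately show ?thesis by (simp add: pinv_def A_def)
qed

lemma sharp_nth: "sharp w u $ j = (\<Sum>i\<in>UNIV. u $ i * pinv w i j)"
  unfolding sharp_def sum_component
  by (simp add: axis_def if_distrib[of "\<lambda>x. _ * x"] cong: if_cong)

lemma ctr_sharp_w: "ctr (sharp w u) w = form1 u"
proof -
  have "ctr (sharp w u) w [axis k 1] = u $ k" for k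
  proof -
    have "ctr (sharp w u) w [axis k 1] = (\<Sum>j\<in>UNIV. \<Sum>i\<in>UNIV. u $ i * pinv w i j * w [axis j 1, axis k 1])"
      by (simp add: ctr_def w_expand[of "sharp w u"] sharp_nth sum_distrib_right)
    also have "\<dots> = (\<Sum>i\<in>UNIV. u $ i * (\<Sum>j\<in>UNIV. pinv w i j * w [axis j 1, axis k 1]))"
      by (subst sum.swap) (simp add: sum_distrib_left mult.assoc)
    also have "\<dots> = u $ k"
      by (simp add: pinv_gram if_distrib[of "\<lambda>x. _ * x"] cong: if_cong)
    finally show ?thesis .
  qed
  moreover have "ctr (sharp w u) w \<in> ext 1" using ctr_in_ext[of w 1] w_ext by (simp add: numeral_2_eq_2)
  ultimately show ?thesis using ext_1_eq[of "ctr (sharp w u) w"] by (simp add: vec_nth_inverse)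
qed

lemma sharp_flat:
  assumes "ctr v w = form1 u" shows "sharp w u = v"
proof -
  have "w [sharp w u - v, x] = 0" for x
    using ctr_sharp_w[of u] assms linear_diff[OF multilinD[OF altf_multilin[OF w_altf], of "[]" "[x]"]]
    by (simp add: ctr_def fun_eq_iff)
  then have "sharp w u - v = 0" using nondeg unfolding nondegenerate_def by blast
  then show ?thesis by simp
qed

lemma sharp_surj: "\<exists>u. sharp w u = v"
proof -
  have "ctr v w \<in> ext 1" using ctr_in_ext[of w 1] w_ext by (simp add: numeral_2_eq_2)
  then show ?thesis using ext_1_eq sharp_flat by blast
qed

text \<open>Either of the two contractions may hit u; the two resulting sums agree by skewness of
  \<open>pinv w\<close>, which uses up the factor 1/2 in \<open>lam\<close>.\<close>

lemma lam_e: "multilin a \<Longrightarrow> lam w (wedge (form1 u) a) = wedge (form1 u) (lam w a) - ctr (sharp w u) a"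
proof -
  assume a: "multilin a"
  have c: "ctr (axis i 1) (ctr (axis m 1) (wedge (form1 u) a))
    = (u $ m) *\<^sub>R ctr (axis i 1) a - (u $ i) *\<^sub>R ctr (axis m 1) a
      + wedge (form1 u) (ctr (axis i 1) (ctr (axis m 1) a))" for i m
    by (simp add: ctr_e inner_axis')
  have "(\<Sum>i\<in>UNIV. \<Sum>m\<in>UNIV. (pinv w i m / 2) *\<^sub>R ((u $ m) *\<^sub>R ctr (axis i 1) a))
    = - (\<Sum>i\<in>UNIV. \<Sum>m\<in>UNIV. (pinv w i m / 2) *\<^sub>R ((u $ i) *\<^sub>R ctr (axis m 1) a))"
    unfolding sum_negf[symmetric] by (subst sum.swap, intro sum.cong refl, subst pinv_skew, simp)
  moreover have "ctr (sharp w u) a = (\<Sum>i\<in>UNIV. \<Sum>m\<in>UNIV. (pinv w i m / 2) *\<^sub>R ((u $ i) *\<^sub>R ctr (axis m 1) a))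
     + (\<Sum>i\<in>UNIV. \<Sum>m\<in>UNIV. (pinv w i m / 2) *\<^sub>R ((u $ i) *\<^sub>R ctr (axis m 1) a))"
    unfolding ctr_sharp[OF a] sum.distrib[symmetric] scaleR_add_left[symmetric] scaleR_scaleR
    by (simp add: mult.commute)
  ultimately show ?thesis
    unfolding lam_ctr_eq c
    by (simp add: scaleR_add_right scaleR_diff_right sum.distrib sum_subtractf wedge_sum_right wedge_linear)
qed

lemma w_commute_e: "wedge w (wedge (form1 u) a) = wedge (form1 u) (wedge w a)"
proof -
  have "wedge w (form1 u) = wedge (form1 u) w"
    using wedge_commute[of 2 w 1 "form1 u"] w_ext by (simp add: ext_iff form1_def)
  then show ?thesis by (metis wedge_assoc)
qed

lemma ctr_sharp_wedge_w: "ctr (sharp w u) (wedge w a) = wedge (form1 u) a + wedge w (ctr (sharp w u) a)"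
  by (simp add: ctr_wedge_even[OF parity_w] ctr_sharp_w)

lemma lam_unit: "lam w unit_ext = 0"
  by (rule lam_low[OF unit_in_ext]) simp

lemma lam_w: "lam w w = real n *\<^sub>R unit_ext"
proof -
  have "(\<Sum>i\<in>UNIV. \<Sum>m\<in>UNIV. pinv w i m / 2 * w [axis m 1, axis i 1])
     = (\<Sum>i\<in>UNIV. (\<Sum>m\<in>UNIV. pinv w i m * w [axis m 1, axis i 1]) / 2)"
    by (simp add: sum_divide_distrib)
  also have "\<dots> = real n" by (simp add: pinv_gram dim)
  finally have "lam w w [] = real n" by (simp add: lam_def)
  then show ?thesis using ext_0_eq[OF lam_in_ext[of w 0 w]] w_ext by (simp add: numeral_2_eq_2)
qed

text \<open>Induction over generators: moving \<Lambda> and L past a covector u leaves a single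
  extra term, minus the product with u, so each covector lowers the eigenvalue by one, starting from
  n on 1.\<close>

lemma lam_wedge_w:
  assumes "a \<in> altf"
  shows "lam w (wedge w a) = wedge w (lam w a) + lenscale (\<lambda>k. real n - real k) a"
  using assms
proof (induction rule: altf_induct[where P = "\<lambda>a. lam w (wedge w a) = wedge w (lam w a) + lenscale (\<lambda>k. real n - real k) a"])
  case (add a b) then show ?case by (simp add: wedge_linear)
next
  case (scale r a) then show ?case by (simp add: wedge_linear algebra_simps)
next
  case unit then show ?case by (simp add: lam_unit lam_w lenscale_ext[OF unit_in_ext])
next
  case (wedge u a)
  have m: "multilin a" "multilin (wedge w a)" using wedge(1) w_altf by (simp_all add: altf_multilin multilin_wedge)
  have "lenscale (\<lambda>k. real n - real (Suc k)) a = lenscale (\<lambda>k. real n - real k) a - a"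
    by (simp add: lenscale_def fun_eq_iff algebra_simps)
  then show ?case
    by (simp only: w_commute_e lam_e[OF m(1)] lam_e[OF m(2)] ctr_sharp_wedge_w wedge(2) wedge_linear lenscale_e)
       simp
qed

section \<open>The pairing\<close>

lemma pr_add: "pr w k (a + b) c = pr w k a c + pr w k b c" "pr w k c (a + b) = pr w k c a + pr w k c b"
  by (induction k arbitrary: a b c) (auto simp: algebra_simps sum.distrib add_divide_distrib)

lemma pr_scale: "pr w k (r *\<^sub>R a) b = r * pr w k a b" "pr w k a (r *\<^sub>R b) = r * pr w k a b"
  by (induction k arbitrary: a b) (auto simp: algebra_simps sum_distrib_left)

lemma pr_zero: "pr w k 0 b = 0" "pr w k a 0 = 0"
  using pr_scale(1)[of k 0 0 b] pr_scale(2)[of k a 0 0] by simp_all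

lemma pr_minus: "pr w k (- a) b = - pr w k a b" "pr w k a (- b) = - pr w k a b"
  using pr_scale(1)[of k "-1" a b] pr_scale(2)[of k a "-1" b] by simp_all

lemma pr_diff: "pr w k (a - b) c = pr w k a c - pr w k b c" "pr w k c (a - b) = pr w k c a - pr w k c b"
  using pr_add(1)[of k a "-b" c] pr_add(2)[of k c a "-b"] by (simp_all add: pr_minus)

lemma pr_sum: "pr w k (sum f A) b = (\<Sum>i\<in>A. pr w k (f i) b)" "pr w k a (sum f A) = (\<Sum>i\<in>A. pr w k a (f i))"
  by (simp_all add: sum_comp_morphism[of "\<lambda>a. pr w k a b", unfolded o_def]
    sum_comp_morphism[of "\<lambda>b. pr w k a b", unfolded o_def] pr_add pr_zero)

lemma pr_skew: "pr w k a b = (- 1) ^ k * pr w k b a"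
proof (induction k arbitrary: a b)
  case (Suc k)
  have "(\<Sum>i\<in>UNIV. \<Sum>j\<in>UNIV. pinv w i j * pr w k (ctr (axis i 1) a) (ctr (axis j 1) b))
    = (\<Sum>i\<in>UNIV. \<Sum>j\<in>UNIV. - (pinv w i j * ((- 1) ^ k * pr w k (ctr (axis i 1) b) (ctr (axis j 1) a))))"
    by (subst sum.swap, intro sum.cong refl, subst pinv_skew, subst Suc, simp)
  then show ?case by (simp add: sum_negf sum_distrib_left mult.left_commute)
qed simp

text \<open>In degree k + 2 the first contraction either hits u, giving the right side once, or
  passes to a, giving it k + 1 times by induction; the total k + 2 cancels the denominator. This is
  the basic adjunction for the pairing.\<close>

lemma pr_e: "b \<in> altf \<Longrightarrow> pr w (Suc k) (wedge (form1 u) a) b = pr w k a (ctr (sharp w u) b)"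
proof (induction k arbitrary: a b)
  case 0
  have "wedge (form1 u) x [] = 0" for x by (simp add: wedge_Nil form1_def)
  with 0 show ?case
    by (simp add: ctr_sharp altf_multilin sum_fun_apply ctr_e inner_axis' sum_distrib_left algebra_simps)
next
  case (Suc k)
  have s: "(\<Sum>i\<in>UNIV. \<Sum>j\<in>UNIV. pinv w i j * (u $ i * pr w (Suc k) a (ctr (axis j 1) b))) = pr w (Suc k) a (ctr (sharp w u) b)"
    by (simp only: ctr_sharp[OF altf_multilin[OF Suc.prems]] pr_sum pr_scale) (simp add: algebra_simps del: pr.simps)
  have "pr w (Suc k) (wedge (form1 u) (ctr (axis i 1) a)) (ctr (axis j 1) b)
      = - pr w k (ctr (axis i 1) a) (ctr (axis j 1) (ctr (sharp w u) b))" for i j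
    by (simp only: Suc.IH[OF altf_ctr[OF Suc.prems]] ctr_ctr[OF Suc.prems, of "sharp w u"] pr_minus)
  then have "pr w (Suc (Suc k)) (wedge (form1 u) a) b =
    ((\<Sum>i\<in>UNIV. \<Sum>j\<in>UNIV. pinv w i j * (u $ i * pr w (Suc k) a (ctr (axis j 1) b)))
     + (\<Sum>i\<in>UNIV. \<Sum>j\<in>UNIV. pinv w i j * pr w k (ctr (axis i 1) a) (ctr (axis j 1) (ctr (sharp w u) b)))) / (real (Suc k) + 1)"
    by (simp only: pr.simps(2)[of w "Suc k"] ctr_e pr_diff pr_scale inner_axis' distrib_left right_diff_distrib)
       (simp add: sum.distrib del: pr.simps)
  also have "(\<Sum>i\<in>UNIV. \<Sum>j\<in>UNIV. pinv w i j * pr w k (ctr (axis i 1) a) (ctr (axis j 1) (ctr (sharp w u) b)))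
    = (real k + 1) * pr w (Suc k) a (ctr (sharp w u) b)"
    by (simp add: add_pos_nonneg)
  finally have "pr w (Suc (Suc k)) (wedge (form1 u) a) b
      = ((real (Suc k) + 1) * pr w (Suc k) a (ctr (sharp w u) b)) / (real (Suc k) + 1)"
    unfolding s by (simp add: algebra_simps del: pr.simps)
  then show ?case by (simp only:) (simp del: pr.simps)
qed

text \<open>By Euler's identity w is half the sum of the basis covectors times the contractions of w
  by the basis vectors, and the sharp of such a contraction is the basis vector itself. Two uses of
  \<open>pr_e\<close> then turn multiplication by w into contraction with the inverse
  bivector.\<close>

lemma pr_wedge_w:
  assumes "b \<in> altf"
  shows "pr w (Suc (Suc k)) (wedge w a) b = pr w k a (lam w b)"
proof -
  define g where "g i = (\<chi> j. ctr (axis i 1) w [axis j 1])" for i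
  have g: "ctr (axis i 1) w = form1 (g i)" for i
    unfolding g_def by (rule ext_1_eq) (use ctr_in_ext[of w 1] w_ext in \<open>simp add: numeral_2_eq_2\<close>)
  then have sg: "sharp w (g i) = axis i 1" for i by (rule sharp_flat)
  have "deg_op w = 2 *\<^sub>R w" using lenscale_ext[OF w_ext] by (simp add: deg_op_lenscale)
  then have "w = (\<Sum>i\<in>UNIV. (1 / 2) *\<^sub>R wedge (form1 (axis i 1)) (form1 (g i)))"
    using euler[OF w_altf] by (simp add: g flip: scaleR_sum_right)
  then have "wedge w a = (\<Sum>i\<in>UNIV. (1 / 2) *\<^sub>R wedge (form1 (axis i 1)) (wedge (form1 (g i)) a))"
    by (metis (no_types, lifting) sum.cong wedge_assoc wedge_scaleR_left wedge_sum_left)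
  then have "pr w (Suc (Suc k)) (wedge w a) b
     = (\<Sum>i\<in>UNIV. (1 / 2) * pr w k a (ctr (axis i 1) (ctr (sharp w (axis i 1)) b)))"
    by (simp only: pr_sum pr_scale pr_e[OF assms] pr_e[OF altf_ctr[OF assms]] sg)
  also have "\<dots> = pr w k a (lam w b)"
  proof -
    have "ctr (sharp w (axis i 1)) b = (\<Sum>j\<in>UNIV. pinv w i j *\<^sub>R ctr (axis j 1) b)" for i
      by (subst ctr_expand[OF altf_multilin[OF assms]])
        (simp add: sharp_nth axis_nth if_distrib[of "\<lambda>x. x * _"] cong: if_cong)
    then show ?thesis
      by (simp add: lam_ctr_eq pr_sum pr_scale ctr_sum sum_distrib_left)
  qed
  finally show ?thesis .
qed

text \<open>Every vector is dual to a covector, so pairing with products with covectors tests the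
  contraction of b by an arbitrary vector, in one degree less.\<close>

lemma pr_nondegenerate:
  assumes "b \<in> altf" "\<And>a. a \<in> ext k \<Longrightarrow> pr w k a b = 0" "length vs = k"
  shows "b vs = 0"
  using assms
proof (induction k arbitrary: b vs)
  case 0 then show ?case using unit_in_ext by fastforce
next
  case (Suc k)
  obtain v vs' where vs: "vs = v # vs'" "length vs' = k" using Suc.prems(3) by (cases vs) auto
  obtain u where u: "sharp w u = v" using sharp_surj by blast
  have "ctr v b vs' = 0"
  proof (rule Suc.IH[OF altf_ctr[OF Suc.prems(1)] _ vs(2)])
    fix a :: "'n ext" assume "a \<in> ext k"
    then show "pr w k a (ctr v b) = 0"
      using Suc.prems(2)[OF e_in_ext, of a u] pr_e[OF Suc.prems(1), of k u a] u by simp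
  qed
  then show ?case by (simp add: vs ctr_def)
qed

end

section \<open>The determinant formula\<close>

declare pr.simps(2) [simp del]

lemma det_nat_eq_det: "det_nat k B = Determinant.det (Matrix.mat k k (\<lambda>(i, j). B i j))"
proof -
  have "(\<Prod>i<k. B i (p i)) = (\<Prod>i = 0..<k. Matrix.mat k k (\<lambda>(i, j). B i j) $$ (i, p i))" if "p permutes {..<k}" for p
    by (intro prod.cong) (use permutes_in_image[OF that] in \<open>auto simp: atLeast0LessThan\<close>)
  then show ?thesis
    unfolding det_nat_def Determinant.det_def
    by (auto simp: atLeast0LessThan intro!: sum.cong)
qed

text \<open>Laplace expansion along the first row, borrowed from matrices indexed by naturals; the
  conditional skips column j.\<close>

lemma det_nat_Suc:
  "det_nat (Suc k) B = (\<Sum>j<Suc k. (- 1) ^ j * B 0 j * det_nat k (\<lambda>i l. B (Suc i) (if l < j then l else Suc l)))"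
proof -
  let ?A = "Matrix.mat (Suc k) (Suc k) (\<lambda>(i, j). B i j)"
  have "det_nat (Suc k) B = (\<Sum>j<Suc k. ?A $$ (0, j) * cofactor ?A 0 j)"
    unfolding det_nat_eq_det by (rule laplace_expansion_row) auto
  also have "\<dots> = (\<Sum>j<Suc k. (- 1) ^ j * B 0 j * det_nat k (\<lambda>i l. B (Suc i) (if l < j then l else Suc l)))"
  proof (intro sum.cong refl)
    fix j assume j: "j \<in> {..<Suc k}"
    have "mat_delete ?A 0 j = Matrix.mat k k (\<lambda>(i, l). B (Suc i) (if l < j then l else Suc l))"
      by (rule eq_matI) (use j in \<open>auto simp: mat_delete_def\<close>)
    then show "?A $$ (0, j) * cofactor ?A 0 j = (- 1) ^ j * B 0 j * det_nat k (\<lambda>i l. B (Suc i) (if l < j then l else Suc l))"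
      using j by (simp add: cofactor_def det_nat_eq_det)
  qed
  finally show ?thesis .
qed

lemma wedge_list_simps [simp]: "wedge_list [] = unit_ext" "wedge_list (a # as) = wedge a (wedge_list as)"
  by (simp_all add: wedge_list_def)

lemma wedge_list_in_ext: "set as \<subseteq> ext 1 \<Longrightarrow> wedge_list as \<in> ext (length as)"
  using wedge_in_ext[of _ 1] by (induction as) (auto simp: unit_in_ext)

lemma ext_span_wedge_list:
  assumes "a \<in> ext k"
  shows "a \<in> span {wedge_list as |as. length as = k \<and> set as \<subseteq> ext 1}" (is "a \<in> span (?W k)")
  using assms
proof (induction rule: ext_induct[where P = "\<lambda>k a. a \<in> span {wedge_list as |as. length as = k \<and> set as \<subseteq> ext 1}"])
  case (add k a b) then show ?case by (intro span_add)
next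
  case (scale k r a) then show ?case by (intro span_scale)
next
  case unit then show ?case by (intro span_base) auto
next
  case (wedge k u a)
  have lin: "linear (wedge (form1 u))" by (rule linearI) (simp_all add: wedge_linear)
  have "wedge (form1 u) ` ?W k \<subseteq> ?W (Suc k)"
  proof
    fix x assume "x \<in> wedge (form1 u) ` ?W k"
    then obtain as where "x = wedge_list (form1 u # as)" "length as = k" "set as \<subseteq> ext 1" by auto
    then show "x \<in> ?W (Suc k)" using form1_in_ext[of u] by (intro CollectI exI[of _ "form1 u # as"]) auto
  qed
  then have "wedge (form1 u) ` span (?W k) \<subseteq> span (?W (Suc k))"
    unfolding linear_span_image[OF lin, symmetric] by (rule span_mono)
  then show ?case using wedge by blast
qed

text \<open>A contracted product expands like a determinant along a row, which is why
  \<open>pr\<close> of decomposable forms is a determinant.\<close>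

lemma ctr_wedge_list_form1:
  "ctr v (wedge_list (map form1 us)) =
    (\<Sum>j<length us. ((- 1) ^ j * (v \<bullet> us ! j)) *\<^sub>R wedge_list (map form1 (take j us @ drop (Suc j) us)))"
proof (induction us)
  case Nil then show ?case by (simp flip: zero_fun_def)
next
  case (Cons u us)
  have "ctr v (wedge_list (map form1 (u # us)))
    = (v \<bullet> u) *\<^sub>R wedge_list (map form1 us)
      - (\<Sum>j<length us. ((- 1) ^ j * (v \<bullet> us ! j)) *\<^sub>R wedge (form1 u) (wedge_list (map form1 (take j us @ drop (Suc j) us))))"
    by (simp only: list.map wedge_list_simps ctr_e Cons wedge_sum_right wedge_linear)
  then show ?case
    by (simp only: list.size add_0_right add_Suc_right sum.lessThan_Suc_shift) (simp add: sum_negf)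
qed

context symplectic_form
begin

lemma inner_sharp: "sharp w u \<bullet> v = inv_form w (form1 u) (form1 v)"
proof -
  have "form1 u [axis i 1] = u $ i" for u :: "real ^ 'n" and i
    by (simp add: form1_def inner_axis')
  then show ?thesis
    by (simp add: inner_vec_def sharp_nth inv_form_def pinv_def sum_distrib_right) (rule sum.swap)
qed

lemma pr_wedge_list:
  assumes "length us = k" "length vs = k"
  shows "pr w k (wedge_list (map form1 us)) (wedge_list (map form1 vs)) =
    det_nat k (\<lambda>i j. inv_form w (form1 (us ! i)) (form1 (vs ! j)))"
  using assms
proof (induction k arbitrary: us vs)
  case 0 then show ?case by (simp add: det_nat_def)
next
  case (Suc k)
  then obtain u us' where us: "us = u # us'" "length us' = k" by (cases us) auto
  have altf: "wedge_list (map form1 vs) \<in> altf"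
    using wedge_list_in_ext[of "map form1 vs"] form1_in_ext by (auto intro: ext_altf)
  have "pr w (Suc k) (wedge_list (map form1 us)) (wedge_list (map form1 vs))
    = (\<Sum>j<Suc k. ((- 1) ^ j * inv_form w (form1 u) (form1 (vs ! j))) *
        pr w k (wedge_list (map form1 us')) (wedge_list (map form1 (take j vs @ drop (Suc j) vs))))"
    by (simp only: us list.map wedge_list_simps pr_e[OF altf] ctr_wedge_list_form1 pr_sum pr_scale inner_sharp Suc.prems(2))
  also have "\<dots> = det_nat (Suc k) (\<lambda>i j. inv_form w (form1 (us ! i)) (form1 (vs ! j)))"
    unfolding det_nat_Suc
  proof (intro sum.cong refl)
    fix j assume j: "j \<in> {..<Suc k}"
    define ws where "ws = take j vs @ drop (Suc j) vs"
    have len: "length ws = k" using j Suc.prems by (simp add: ws_def)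
    \<comment> \<open>Deleting entry j reindexes the list exactly as the minor skips column
      j.\<close>
    have nth: "ws ! l = vs ! (if l < j then l else Suc l)" if "l < k" for l
      using that j Suc.prems by (auto simp: ws_def nth_append min_def)
    have "det_nat k (\<lambda>i l. inv_form w (form1 (us' ! i)) (form1 (ws ! l)))
      = det_nat k (\<lambda>i l. inv_form w (form1 (us' ! i)) (form1 (vs ! (if l < j then l else Suc l))))"
      unfolding det_nat_def
    proof (intro sum.cong refl arg_cong2[of _ _ _ _ "(*)"] prod.cong)
      fix p i assume "p \<in> {p. p permutes {..<k}}" "i \<in> {..<k}"
      then have "p i < k" using permutes_in_image[of p "{..<k}" i] by auto
      then show "inv_form w (form1 (us' ! i)) (form1 (ws ! p i))
        = inv_form w (form1 (us' ! i)) (form1 (vs ! (if p i < j then p i else Suc (p i))))"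
        by (simp add: nth)
    qed
    then show "(- 1) ^ j * inv_form w (form1 u) (form1 (vs ! j)) * pr w k (wedge_list (map form1 us'))
          (wedge_list (map form1 (take j vs @ drop (Suc j) vs)))
        = (- 1) ^ j * inv_form w (form1 (us ! 0)) (form1 (vs ! j)) *
          det_nat k (\<lambda>i l. inv_form w (form1 (us ! Suc i)) (form1 (vs ! (if l < j then l else Suc l))))"
      unfolding ws_def[symmetric] Suc.IH[OF us(2) len] by (simp add: us)
  qed
  finally show ?case .
qed

lemma is_pairing_pr: "is_pairing w k (pr w k)"
  unfolding is_pairing_def
proof (intro conjI ballI allI impI)
  fix as bs :: "'n ext list"
  assume as: "length as = k" "set as \<subseteq> ext 1" and bs: "length bs = k" "set bs \<subseteq> ext 1"
  define us where "us = map (\<lambda>a. \<chi> i. a [axis i 1]) as"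
  define vs where "vs = map (\<lambda>a. \<chi> i. a [axis i 1]) bs"
  have u: "as = map form1 us" unfolding us_def map_map o_def
    by (intro map_idI[symmetric] ext_1_eq[symmetric]) (use as in auto)
  have v: "bs = map form1 vs" unfolding vs_def map_map o_def
    by (intro map_idI[symmetric] ext_1_eq[symmetric]) (use bs in auto)
  have "length us = k" "length vs = k" using as bs by (simp_all add: us_def vs_def)
  note this[simp]
  have "pr w k (wedge_list as) (wedge_list bs) = det_nat k (\<lambda>i j. inv_form w (form1 (us ! i)) (form1 (vs ! j)))"
    unfolding u v by (rule pr_wedge_list) simp_all
  also have "\<dots> = det_nat k (\<lambda>i j. inv_form w (as ! i) (bs ! j))"
    unfolding det_nat_def
  proof (intro sum.cong refl arg_cong2[of _ _ _ _ "(*)"] prod.cong)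
    fix p i assume "p \<in> {p. p permutes {..<k}}" "i \<in> {..<k}"
    then have "p i < k" "i < k" using permutes_in_image[of p "{..<k}" i] by auto
    then show "inv_form w (form1 (us ! i)) (form1 (vs ! p i)) = inv_form w (as ! i) (bs ! p i)"
      by (simp add: u v)
  qed
  finally show "pr w k (wedge_list as) (wedge_list bs) = det_nat k (\<lambda>i j. inv_form w (as ! i) (bs ! j))" .
qed (simp_all add: pr_add pr_scale)

text \<open>Bilinear maps that agree on decomposable forms agree on their span; the span is taken in
  one argument at a time. This determines \<open>pairing\<close> although it is a choice.\<close>

lemma is_pairing_unique:
  assumes P: "is_pairing w k P" and a: "a \<in> ext k" and b: "b \<in> ext k"
  shows "P a b = pr w k a b"
proof -
  define W :: "'n ext set" where "W = {wedge_list as |as. length as = k \<and> set as \<subseteq> ext 1}"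
  have W: "W \<subseteq> ext k" using wedge_list_in_ext by (auto simp: W_def)
  have add: "P (x + y) z = P x z + P y z" "P z (x + y) = P z x + P z y" if "x \<in> ext k" "y \<in> ext k" "z \<in> ext k" for x y z
    using P that by (auto simp: is_pairing_def)
  have scale: "P (r *\<^sub>R x) y = r * P x y" "P x (r *\<^sub>R y) = r * P x y" if "x \<in> ext k" "y \<in> ext k" for r x y
    using P that by (auto simp: is_pairing_def)
  have z: "P 0 x = 0" "P x 0 = 0" if "x \<in> ext k" for x
    using scale[OF that that, of 0] by simp_all
  have "P x y = pr w k x y" if "x \<in> W" "y \<in> W" for x y
    using that P is_pairing_pr[of k] by (auto simp: W_def is_pairing_def)
  moreover have "subspace {x \<in> ext k. P x y = pr w k x y}" if "y \<in> ext k" for y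
    using that by (auto simp: subspace_def ext_lin z add scale pr_add pr_scale pr_zero)
  ultimately have "span W \<subseteq> {x \<in> ext k. P x y = pr w k x y}" if "y \<in> W" for y
    using that W by (intro span_minimal) auto
  then have "P x y = pr w k x y" if "x \<in> ext k" "y \<in> W" for x y
    using ext_span_wedge_list[OF that(1)] that(2) unfolding W_def by blast
  moreover have "subspace {y \<in> ext k. P x y = pr w k x y}" if "x \<in> ext k" for x
    using that by (auto simp: subspace_def ext_lin z add scale pr_add pr_scale pr_zero)
  ultimately have "span W \<subseteq> {y \<in> ext k. P x y = pr w k x y}" if "x \<in> ext k" for x
    using that W by (intro span_minimal) auto
  then show ?thesis using ext_span_wedge_list[OF b] a unfolding W_def by blast
qed

lemma pairing_eq_pr: "a \<in> ext k \<Longrightarrow> b \<in> ext k \<Longrightarrow> pairing w k a b = pr w k a b"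
  unfolding pairing_def using is_pairing_unique someI[of "is_pairing w k", OF is_pairing_pr] by blast

lemma pr_part: "pr w k (part k a) b = pr w k a b" "pr w k b (part k a) = pr w k b a"
proof -
  have c: "ctr v (part (Suc k) a) = part k (ctr v a)" for v k and a :: "'n ext"
    by (auto simp: ctr_def part_def fun_eq_iff)
  show "pr w k (part k a) b = pr w k a b" "pr w k b (part k a) = pr w k b a"
    by (induction k arbitrary: a b) (simp_all add: c pr.simps(2), simp_all add: part_def)
qed

lemma total_pairing_eq:
  "a \<in> altf \<Longrightarrow> b \<in> altf \<Longrightarrow> total_pairing w a b = (\<Sum>k\<le>CARD('n). pr w k a b)"
  by (simp add: total_pairing_def pairing_eq_pr part_in_ext pr_part)

lemma pr_long: "a \<in> altf \<Longrightarrow> k > CARD('n) \<Longrightarrow> pr w k a b = 0"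
  using ext_long_zero[OF part_in_ext[of a k]] pr_part(1)[of k a b] by (simp add: pr_zero)

lemma pr_low_wedge: "k < j \<Longrightarrow> c \<in> ext j \<Longrightarrow> a \<in> altf \<Longrightarrow> pr w k (wedge c a) b = 0"
proof -
  assume a: "k < j" "c \<in> ext j" "a \<in> altf"
  have "wedge c a vs = 0" if "length vs = k" for vs
  proof -
    have "c (nths vs S) = 0" for S
    proof -
      have "length (nths vs S) \<le> card {..<length vs}"
        unfolding length_nths by (rule card_mono) auto
      then show ?thesis using a that by (simp add: ext_iff)
    qed
    then show ?thesis by (simp add: wedge_def)
  qed
  then have "part k (wedge c a) = 0" by (auto simp: part_def fun_eq_iff)
  then show ?thesis using pr_part(1)[of k "wedge c a" b] by (simp add: pr_zero)
qed

text \<open>L raises the degree by two, so the sum over degrees is shifted: the terms above the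
  dimension and those in degrees 0 and 1 vanish.\<close>

lemma total_pairing_wedge_w:
  assumes "a \<in> altf" "b \<in> altf"
  shows "total_pairing w (wedge w a) b = total_pairing w a (lam w b)"
proof -
  have "(\<Sum>k\<le>CARD('n). pr w k (wedge w a) b) = (\<Sum>k\<le>CARD('n) + 2. pr w k (wedge w a) b)"
    by (rule sum.mono_neutral_left) (auto intro!: pr_long altf_wedge assms w_altf)
  also have "\<dots> = (\<Sum>k\<le>CARD('n). pr w (Suc (Suc k)) (wedge w a) b)"
    using pr_low_wedge[OF _ w_ext assms(1), of 0] pr_low_wedge[OF _ w_ext assms(1), of 1]
    by (simp del: sum.atMost_Suc add: sum.atMost_Suc_shift)
  finally show ?thesis
    using assms by (simp add: total_pairing_eq altf_wedge w_altf altf_lam pr_wedge_w)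
qed

text \<open>The pairing is symmetric up to \<open>parity\<close>, and w is even, so the adjunction
  for L can be read from the other side.\<close>

lemma total_pairing_lam:
  assumes "a \<in> altf" "b \<in> altf"
  shows "total_pairing w (lam w a) b = total_pairing w a (wedge w b)"
proof -
  have s: "total_pairing w x y = total_pairing w (parity y) x" if "x \<in> altf" "y \<in> altf" for x y
  proof -
    have "pr w k x y = pr w k (parity y) x" for k
    proof -
      have "part k (parity y) = (- 1) ^ k *\<^sub>R part k y" by (auto simp: part_def parity_def fun_eq_iff)
      then show ?thesis
        using pr_skew[of k x y] pr_part(1)[of k "parity y" x] pr_part(1)[of k y x] by (simp add: pr_scale)
    qed
    then show ?thesis using that by (simp add: total_pairing_eq altf_parity)
  qed
  show ?thesis
    using total_pairing_wedge_w[OF altf_parity[OF assms(2)] assms(1)] assms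
    by (simp add: s[of "lam w a"] s[of a] altf_lam altf_wedge w_altf parity_wedge parity_w)
qed

lemma total_pairing_nondegenerate:
  assumes "b \<in> altf" "\<And>a k. a \<in> ext k \<Longrightarrow> total_pairing w a b = 0"
  shows "b = 0"
proof
  fix vs
  show "b vs = 0 vs"
  proof (cases "length vs \<le> CARD('n)")
    case True
    show ?thesis
      unfolding zero_fun_apply
    proof (rule pr_nondegenerate[OF assms(1) _ refl])
      fix a :: "'n ext" assume a: "a \<in> ext (length vs)"
      have z: "part j a = 0" if "j \<noteq> length vs" for j
        using a that by (auto simp: ext_iff part_def fun_eq_iff)
      have "(\<Sum>k\<le>CARD('n). pr w k a b) = (\<Sum>k\<le>CARD('n). if k = length vs then pr w k a b else 0)"
        using z pr_part(1)[of _ a b] by (intro sum.cong refl) (metis pr_zero(1))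
      also have "\<dots> = pr w (length vs) a b" using True by simp
      finally show "pr w (length vs) a b = 0"
        using assms(2)[OF a] total_pairing_eq[OF ext_altf[OF a] assms(1)] by simp
    qed
  qed (use altf_long_zero[OF assms(1), of vs] in auto)
qed

end

section \<open>The symplectic star as a Weyl element\<close>

text \<open>The sign between the star and the Weyl element. Its rule \<open>eps_Suc\<close> supplies
  the sign (-1)^k that the star picks up when a covector is moved through it; the Weyl element picks
  up no sign depending on the degree.\<close>

definition eps :: "nat \<Rightarrow> real"
  where "eps k = (- 1) ^ (k * (k + 1) div 2)"

text \<open>The form \<open>w\<close> only serves to determine the dimension.\<close>

definition nilk :: "('n::finite) ext \<Rightarrow> nat"
  where "nilk w = CARD('n) + 2"

definition weyl_ext :: "('n::finite) ext \<Rightarrow> 'n ext \<Rightarrow> 'n ext"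
  where "weyl_ext w a = opexp (nilk w) (wedge w)
    (opexp (nilk w) (\<lambda>a. - lam w a) (opexp (nilk w) (wedge w) a))"

definition pstar :: "('n::finite) ext \<Rightarrow> 'n ext \<Rightarrow> 'n ext"
  where "pstar w a = weyl_ext w (lenscale eps a)"

lemma eps_Suc: "eps (Suc k) = - eps k * (- 1) ^ k"
proof -
  have "Suc k * (Suc k + 1) div 2 = k * (k + 1) div 2 + (k + 1)"
  proof -
    have "Suc k * (Suc k + 1) = k * (k + 1) + 2 * (k + 1)" by simp
    then show ?thesis by (simp only: div_mult_self2)
  qed
  then show ?thesis by (simp add: eps_def power_add)
qed

lemma linear_wedge_right: "linear (wedge c)"
  by (rule linearI) (simp_all add: wedge_linear)

lemma linear_neg_lam: "linear (\<lambda>a. - lam w a)"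
  by (rule linearI) simp_all

lemma linear_form1_wedge: "linear (\<lambda>a. wedge (form1 u) a)"
  by (rule linear_wedge_right)

lemma linear_ctr: "linear (ctr v)"
  by (rule linearI) simp_all

lemma linear_funpow:
  fixes f :: "'a::real_vector \<Rightarrow> 'a"
  assumes "linear f" shows "linear (f ^^ j)"
proof (induction j)
  case 0 then show ?case by (simp add: linear_ident)
next
  case (Suc j) then show ?case unfolding funpow.simps using assms by (rule linear_compose)
qed

lemma linear_opexp: "linear f \<Longrightarrow> linear (opexp K f)"
proof -
  assume f: "linear f"
  show ?thesis
    by (rule linearI) (simp_all add: opexp_def linear_add[OF linear_funpow[OF f]] linear_scale[OF linear_funpow[OF f]]
      scaleR_add_right sum.distrib scaleR_sum_right mult.commute)
qed

lemma linear_weyl_ext: "linear (weyl_ext w)"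
  unfolding weyl_ext_def
  using linear_compose[OF linear_compose[OF linear_opexp[OF linear_wedge_right] linear_opexp[OF linear_neg_lam]]
    linear_opexp[OF linear_wedge_right]]
  by (simp add: o_def)

lemma linear_pstar: "linear (pstar w)"
  by (rule linearI) (simp_all add: pstar_def linear_add[OF linear_weyl_ext] linear_scale[OF linear_weyl_ext])

lemma altf_opexp: "(\<And>a. a \<in> altf \<Longrightarrow> f a \<in> altf) \<Longrightarrow> a \<in> altf \<Longrightarrow> opexp K f a \<in> altf"
proof -
  assume f: "\<And>a. a \<in> altf \<Longrightarrow> f a \<in> altf" and a: "a \<in> altf"
  have "(f ^^ j) a \<in> altf" for j by (induction j) (auto simp: f a)
  then show ?thesis unfolding opexp_def by (intro altf_sum altf_lin)
qed

lemma altf_weyl_ext: "w \<in> altf \<Longrightarrow> a \<in> altf \<Longrightarrow> weyl_ext w a \<in> altf"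
  unfolding weyl_ext_def by (intro altf_opexp altf_wedge altf_minus altf_lam) 

lemma altf_pstar: "w \<in> altf \<Longrightarrow> a \<in> altf \<Longrightarrow> pstar w a \<in> altf"
  unfolding pstar_def by (intro altf_weyl_ext altf_lenscale)

section \<open>Intertwining relations of the Weyl element and its identification with the
  star\<close>

context symplectic_form
begin

lemma wedge_w_pow_ext: "a \<in> ext k \<Longrightarrow> (wedge w ^^ j) a \<in> ext (k + 2 * j)"
proof (induction j)
  case (Suc j)
  then show ?case using wedge_in_ext[OF w_ext, of "(wedge w ^^ j) a"] by (simp add: add.commute)
qed simp

text \<open>The case split replaces negative degrees, since k - 2 j is a truncated
  difference.\<close>

lemma lam_pow_ext: 
  "a \<in> ext k \<Longrightarrow> (if 2 * j \<le> k then ((\<lambda>a. - lam w a) ^^ j) a \<in> ext (k - 2 * j) else ((\<lambda>a. - lam w a) ^^ j) a = 0)"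
proof (induction j)
  case (Suc j)
  consider "2 * Suc j \<le> k" | "2 * j \<le> k" "k < 2 * Suc j" | "k < 2 * j" by linarith
  then show ?case
  proof cases
    case 1
    then have "k - 2 * j = Suc (Suc (k - 2 * Suc j))" by simp
    then show ?thesis using Suc 1 by (auto intro!: lam_in_ext ext_lin(4))
  next
    case 2
    then show ?thesis using Suc lam_low[of "((\<lambda>a. - lam w a) ^^ j) a" "k - 2 * j" w] by simp
  next
    case 3
    then show ?thesis using Suc by simp
  qed
qed simp

lemma pow_zero_altf:
  fixes f :: "'n ext \<Rightarrow> 'n ext"
  assumes "linear f" "\<And>k a. a \<in> ext k \<Longrightarrow> (f ^^ j) a = 0" "a \<in> altf"
  shows "(f ^^ j) a = (0 :: 'n ext)"
proof -
  have "(f ^^ j) (\<Sum>k\<le>CARD('n). part k a) = 0"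
    unfolding linear_sum[OF linear_funpow[OF assms(1)]] by (simp add: assms(2)[OF part_in_ext[OF assms(3)]])
  then show ?thesis using altf_part_sum[OF assms(3)] by metis
qed

lemma wedge_w_nilpotent: "a \<in> altf \<Longrightarrow> 2 * j > CARD('n) \<Longrightarrow> (wedge w ^^ j) a = 0"
  by (rule pow_zero_altf[OF linear_wedge_right]) (use ext_long_zero[OF wedge_w_pow_ext] in auto)

lemma lam_nilpotent: "a \<in> altf \<Longrightarrow> 2 * j > CARD('n) \<Longrightarrow> ((\<lambda>a. - lam w a) ^^ j) a = 0"
proof (rule pow_zero_altf[OF linear_neg_lam])
  fix k and a :: "'n ext" assume a: "a \<in> ext k" and j: "2 * j > CARD('n)"
  show "((\<lambda>a. - lam w a) ^^ j) a = 0"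
  proof (cases "k > CARD('n)")
    case True
    then show ?thesis using ext_long_zero[OF a] linear_0[OF linear_funpow[OF linear_neg_lam]] by metis
  next
    case False
    then show ?thesis using lam_pow_ext[OF a, of j] j by auto
  qed
qed

lemma nilk_simps [simp]: "0 < nilk w" "n < nilk w" "2 * (nilk w - Suc 0) > CARD('n)" "CARD('n) < 2 * (nilk w - Suc 0)"
  by (simp_all add: nilk_def dim)

abbreviation "eL \<equiv> opexp (nilk w) (wedge w)"
abbreviation "eM \<equiv> opexp (nilk w) (\<lambda>a. - lam w a)"

lemma altf_eL: "a \<in> altf \<Longrightarrow> eL a \<in> altf" by (intro altf_opexp altf_wedge w_altf)
lemma altf_eM: "a \<in> altf \<Longrightarrow> eM a \<in> altf" by (intro altf_opexp altf_minus altf_lam)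

text \<open>Here and in the next three lemmas the commutators stop at first order: [L, contraction]
  is minus the product with a covector, which commutes with L, and [-\<Lambda>, covector] is a
  contraction, which commutes with \<Lambda>. So passing an exponential adds at most one
  term.\<close>

lemma eL_e: "a \<in> altf \<Longrightarrow> eL (wedge (form1 u) a) = wedge (form1 u) (eL a)"
  using opexp_commute[where V = altf and f = "wedge w" and g = "wedge (form1 u)" and h = "\<lambda>_. 0" and a = a and K = "nilk w"]
  by (simp add: altf_wedge w_altf linear_wedge_right linear_zero w_commute_e wedge_w_nilpotent del: funpow.simps)

lemma eL_ctr: "a \<in> altf \<Longrightarrow> eL (ctr (sharp w u) a) = ctr (sharp w u) (eL a) - wedge (form1 u) (eL a)"
  using opexp_commute[where V = altf and f = "wedge w" and g = "ctr (sharp w u)" and h = "\<lambda>a. - wedge (form1 u) a" and a = a and K = "nilk w"]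
  by (simp add: altf_wedge w_altf linear_wedge_right linear_ctr linear_compose_neg linear_form1_wedge w_commute_e
    wedge_w_nilpotent wedge_linear ctr_sharp_wedge_w del: funpow.simps)

lemma eM_e: "a \<in> altf \<Longrightarrow> eM (wedge (form1 u) a) = wedge (form1 u) (eM a) + ctr (sharp w u) (eM a)"
  using opexp_commute[where V = altf and f = "\<lambda>a. - lam w a" and g = "wedge (form1 u)" and h = "ctr (sharp w u)" and a = a and K = "nilk w"]
  by (simp add: altf_lam altf_minus linear_neg_lam linear_ctr linear_form1_wedge lam_e altf_multilin lam_ctr
    lam_nilpotent wedge_linear del: funpow.simps)

lemma eM_ctr: "a \<in> altf \<Longrightarrow> eM (ctr (sharp w u) a) = ctr (sharp w u) (eM a)"
  using opexp_commute[where V = altf and f = "\<lambda>a. - lam w a" and g = "ctr (sharp w u)" and h = "\<lambda>_. 0" and a = a and K = "nilk w"]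
  by (simp add: altf_lam altf_minus linear_neg_lam linear_ctr linear_zero lam_ctr lam_nilpotent del: funpow.simps)

lemma eL_zero: "eL 0 = 0" and eM_zero: "eM 0 = 0"
  by (rule linear_0[OF linear_opexp[OF linear_wedge_right]] linear_0[OF linear_opexp[OF linear_neg_lam]])+

lemmas eL_add = linear_add[OF linear_opexp[OF linear_wedge_right]]
  and eL_diff = linear_diff[OF linear_opexp[OF linear_wedge_right]]
  and eM_diff = linear_diff[OF linear_opexp[OF linear_neg_lam]]
  and weyl_ext_minus = linear_neg[OF linear_weyl_ext]
  and weyl_ext_scale = linear_scale[OF linear_weyl_ext]

text \<open>Moved past the three factors, the contraction i becomes i - u, then i - (u + i) = -u,
  and stays -u, where u is the product with the covector.\<close>

lemma weyl_ext_ctr: "a \<in> altf \<Longrightarrow> weyl_ext w (ctr (sharp w u) a) = - wedge (form1 u) (weyl_ext w a)"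
proof -
  assume a: "a \<in> altf"
  have "eM (eL (ctr (sharp w u) a)) = - wedge (form1 u) (eM (eL a))"
    by (simp add: eL_ctr a eM_diff eM_ctr eM_e altf_eL)
  then show ?thesis
    by (simp add: weyl_ext_def eL_e altf_eL altf_eM a linear_neg[OF linear_opexp[OF linear_wedge_right]])
qed

text \<open>Here the product u stays u, then becomes u + i with the contraction i, and finally u +
  (i - u) = i.\<close>

lemma weyl_ext_e: "a \<in> altf \<Longrightarrow> weyl_ext w (wedge (form1 u) a) = ctr (sharp w u) (weyl_ext w a)"
proof -
  assume a: "a \<in> altf"
  show ?thesis
    by (simp add: weyl_ext_def eL_e eM_e eL_add eL_ctr a altf_eL altf_eM)
qed

lemma lenscale_eps_Suc: "lenscale (\<lambda>k. eps (Suc k)) a = - lenscale eps (parity a)"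
  by (simp add: lenscale_def parity_def fun_eq_iff eps_Suc)

lemma pstar_e: "a \<in> altf \<Longrightarrow> pstar w (wedge (form1 u) a) = - ctr (sharp w u) (pstar w (parity a))"
  by (simp add: pstar_def lenscale_e lenscale_eps_Suc wedge_linear weyl_ext_minus weyl_ext_e altf_lenscale altf_parity)

lemma pstar_ctr: "a \<in> altf \<Longrightarrow> pstar w (ctr (sharp w u) a) = - wedge (form1 u) (pstar w (parity a))"
proof -
  assume a: "a \<in> altf"
  have "lenscale eps (ctr (sharp w u) a) = ctr (sharp w u) (lenscale eps (parity a))"
    by (simp add: ctr_lenscale ctr_parity lenscale_eps_Suc)
  then show ?thesis
    by (simp add: pstar_def weyl_ext_ctr altf_lenscale altf_parity a)
qed

definition vol :: "'n ext" where "vol = (1 / fact n) *\<^sub>R (wedge w ^^ n) unit_ext"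

lemma vol_eq: "volume w = vol"
  by (simp add: volume_def vol_def dim)

lemma vol_ext: "vol \<in> ext CARD('n)"
  using wedge_w_pow_ext[OF unit_in_ext, of n] by (simp add: vol_def dim ext_lin)

lemma part_linear: "part k (a + b) = part k a + part k b" "part k (r *\<^sub>R a) = r *\<^sub>R part k a"
  "part k 0 = 0"
  by (auto simp: part_def fun_eq_iff)

lemma part_sum: "part k (sum f A) = (\<Sum>i\<in>A. part k (f i))"
  by (simp add: part_def fun_eq_iff sum_fun_apply)

lemma part_ext: "a \<in> ext k \<Longrightarrow> part j a = (if j = k then a else 0)"
  by (auto simp: ext_iff part_def fun_eq_iff)

lemma eL_unit: "eL unit_ext = (\<Sum>j<nilk w. (1 / fact j) *\<^sub>R (wedge w ^^ j) unit_ext)"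
  by (simp add: opexp_def)

lemma lam_pow_part:
  assumes "a \<in> altf" "j > 0"
  shows "part CARD('n) (((\<lambda>a. - lam w a) ^^ j) a) = 0"
proof -
  have "part CARD('n) (((\<lambda>a. - lam w a) ^^ j) (part k a)) = 0" if "k \<le> CARD('n)" for k
    using lam_pow_ext[OF part_in_ext[OF assms(1)], of j k] that assms(2)
      part_ext[of "((\<lambda>a. - lam w a) ^^ j) (part k a)" "k - 2 * j" "CARD('n)"]
    by (cases "2 * j \<le> k") (auto simp: part_linear)
  then have "part CARD('n) (((\<lambda>a. - lam w a) ^^ j) (\<Sum>k\<le>CARD('n). part k a)) = 0"
    unfolding linear_sum[OF linear_funpow[OF linear_neg_lam]] part_sum by simp
  then show ?thesis using altf_part_sum[OF assms(1)] by (simp only:)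
qed

lemma top_degree_ext:
  fixes a :: "'n ext"
  assumes "a \<in> altf" "\<And>u. wedge (form1 u) a = 0" shows "a = part CARD('n) a"
  using e_kernel[OF assms(1,2)] by (auto simp: part_def fun_eq_iff)

lemma eL_top: "a \<in> ext CARD('n) \<Longrightarrow> eL a = a"
proof -
  assume a: "a \<in> ext CARD('n)"
  have "(wedge w ^^ j) a = 0" if "j > 0" for j
    by (rule ext_long_zero[OF wedge_w_pow_ext[OF a]]) (use that in simp)
  then have "eL a = (\<Sum>j<nilk w. if j = 0 then a else 0)"
    unfolding opexp_def by (intro sum.cong refl) auto
  then show ?thesis by simp
qed

text \<open>Contraction kills 1, so \<open>eL_ctr\<close> and then \<open>eM_e\<close> show that
  every covector annihilates the left side, which is therefore of top degree. Powers of \<Lambda>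
  lower the degree, so this top part is the term w^n / n! of e^L 1.\<close>

lemma eM_eL_unit: "eM (eL unit_ext) = vol"
proof -
  define y where "y = eM (eL unit_ext)"
  have z: "eL unit_ext \<in> altf" and y: "y \<in> altf" by (simp_all add: y_def altf_eL altf_eM altf_unit)
  have "wedge (form1 u) y = 0" for u
  proof -
    have "ctr (sharp w u) (eL unit_ext) - wedge (form1 u) (eL unit_ext) = 0"
      using eL_ctr[OF altf_unit, of u] by (simp add: eL_zero)
    then have "eM (ctr (sharp w u) (eL unit_ext) - wedge (form1 u) (eL unit_ext)) = 0"
      by (simp add: eM_zero)
    then show ?thesis by (simp add: eM_diff eM_ctr eM_e z y_def)
  qed
  then have "y = part CARD('n) y" by (rule top_degree_ext[OF y])
  also have "\<dots> = (\<Sum>j<nilk w. if j = 0 then part CARD('n) (eL unit_ext) else 0)"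
    unfolding y_def opexp_def[of "nilk w" "\<lambda>a. - lam w a"] part_sum part_linear
    by (intro sum.cong refl) (simp add: lam_pow_part[OF z])
  also have "\<dots> = part CARD('n) (eL unit_ext)" by simp
  also have "\<dots> = (\<Sum>j<nilk w. if j = n then vol else 0)"
    unfolding eL_unit part_sum part_linear
    by (intro sum.cong refl) (use part_ext[OF wedge_w_pow_ext[OF unit_in_ext]] in \<open>auto simp: dim vol_def\<close>)
  also have "\<dots> = vol" by (simp add: dim)
  finally show ?thesis by (simp add: y_def)
qed

lemma pstar_unit: "pstar w unit_ext = vol"
proof -
  have "lenscale eps unit_ext = (unit_ext :: 'n ext)" using lenscale_ext[OF unit_in_ext, of eps] by (simp add: eps_def)
  then show ?thesis by (simp add: pstar_def weyl_ext_def eM_eL_unit eL_top vol_ext)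
qed

lemma pstar_zero: "pstar w 0 = 0" and pstar_minus: "pstar w (- a) = - pstar w a"
  and pstar_add: "pstar w (a + b) = pstar w a + pstar w b"
  and pstar_scale: "pstar w (r *\<^sub>R a) = r *\<^sub>R pstar w a"
  and pstar_sum: "pstar w (sum f A) = (\<Sum>i\<in>A. pstar w (f i))"
  by (rule linear_0[OF linear_pstar] linear_neg[OF linear_pstar] linear_add[OF linear_pstar]
    linear_scale[OF linear_pstar] linear_sum[OF linear_pstar])+

lemma pstar_ext:
  assumes "a \<in> ext k" "k \<le> CARD('n)" shows "pstar w a \<in> ext (CARD('n) - k)"
proof -
  have "k \<le> CARD('n) \<longrightarrow> pstar w a \<in> ext (CARD('n) - k)"
    using assms(1)
proof (induction rule: ext_induct[where P = "\<lambda>k a. k \<le> CARD('n) \<longrightarrow> pstar w a \<in> ext (CARD('n) - k)"])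
  case (wedge k u a)
  show ?case
  proof
  assume "Suc k \<le> CARD('n)"
  then have "CARD('n) - k = Suc (CARD('n) - Suc k)" by simp
  then have "pstar w (parity a) \<in> ext (Suc (CARD('n) - Suc k))"
    using wedge \<open>Suc k \<le> CARD('n)\<close> by (simp add: parity_ext pstar_scale ext_lin)
  then show "pstar w (wedge (form1 u) a) \<in> ext (CARD('n) - Suc k)"
    using wedge.hyps by (simp add: pstar_e ext_altf ext_lin ctr_in_ext)
  qed
qed (auto simp: pstar_add pstar_scale pstar_unit vol_ext intro: ext_lin)
  then show ?thesis using assms(2) by blast
qed

text \<open>The volume form has even degree, which settles the value on 1; in the inductive step a
  covector and the dual contraction are both odd.\<close>

lemma parity_pstar: "a \<in> altf \<Longrightarrow> parity (pstar w a) = pstar w (parity a)"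
proof (induction rule: altf_induct[where P = "\<lambda>a. parity (pstar w a) = pstar w (parity a)"])
  case unit
  show ?case using parity_ext[OF vol_ext] by (simp add: pstar_unit dim)
next
  case (wedge u a)
  then have "parity (pstar w (parity a)) = pstar w a" by (metis parity_parity)
  then show ?case using ctr_parity[of "sharp w u" "pstar w (parity a)"]
    by (simp add: pstar_e wedge.hyps parity_e pstar_minus altf_parity)
qed (simp_all add: pstar_add pstar_scale)

text \<open>The sl2 formula on the string generated by 1: m (n - m + 1) is the sum of the weights n
  - 2 j over j < m.\<close>

lemma lam_wedge_w_pow_unit:
  "lam w ((wedge w ^^ m) unit_ext) = (real m * (real n - real m + 1)) *\<^sub>R (wedge w ^^ (m - 1)) unit_ext"
proof (induction m)
  case 0 then show ?case by (simp add: lam_unit)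
next
  case (Suc m)
  have e: "(wedge w ^^ m) unit_ext \<in> ext (2 * m)" using wedge_w_pow_ext[OF unit_in_ext, of m] by simp
  show ?case
  proof (cases m)
    case 0 then show ?thesis by (simp add: lam_w)
  next
    case (Suc m')
    have "lam w ((wedge w ^^ Suc m) unit_ext)
      = wedge w ((real m * (real n - real m + 1)) *\<^sub>R (wedge w ^^ (m - 1)) unit_ext) + (real n - real (2 * m)) *\<^sub>R (wedge w ^^ m) unit_ext"
      using lam_wedge_w[OF ext_altf[OF e]] Suc.IH by (simp only: funpow.simps o_def lenscale_ext[OF e])
    also have "wedge w ((real m * (real n - real m + 1)) *\<^sub>R (wedge w ^^ (m - 1)) unit_ext)
      = (real m * (real n - real m + 1)) *\<^sub>R (wedge w ^^ m) unit_ext"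
      using Suc by (simp add: wedge_scaleR_right)
    finally show ?thesis by (simp add: algebra_simps flip: scaleR_add_left)
  qed
qed

lemma lam_pow_wedge_w_pow_unit:
  "j \<le> n \<Longrightarrow> ((\<lambda>a. - lam w a) ^^ j) ((wedge w ^^ n) unit_ext)
    = ((- 1) ^ j * fact n * fact j / fact (n - j)) *\<^sub>R (wedge w ^^ (n - j)) unit_ext"
proof (induction j)
  case (Suc j)
  have "fact (n - j) = real (n - j) * fact (n - Suc j)"
    using Suc.prems by (metis Suc_diff_Suc Suc_le_eq fact_Suc of_nat_mult of_nat_fact)
  then have f: "1 / fact (n - j) * real (n - j) = (1 :: real) / fact (n - Suc j)"
    using Suc.prems by (simp add: field_simps)
  have L: "lam w ((wedge w ^^ (n - j)) unit_ext) = (real (n - j) * real (Suc j)) *\<^sub>R (wedge w ^^ (n - Suc j)) unit_ext"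
    using lam_wedge_w_pow_unit[of "n - j"] Suc.prems by (simp add: of_nat_diff algebra_simps)
  have c: "- ((- 1) ^ j * fact n * fact j / fact (n - j) * (real (n - j) * real (Suc j)))
    = ((- 1) ^ Suc j * fact n * fact (Suc j)) * (1 / fact (n - j) * real (n - j))"
    by (simp add: field_simps)
  have "((\<lambda>a. - lam w a) ^^ Suc j) ((wedge w ^^ n) unit_ext)
    = (- ((- 1) ^ j * fact n * fact j / fact (n - j) * (real (n - j) * real (Suc j)))) *\<^sub>R (wedge w ^^ (n - Suc j)) unit_ext"
    using Suc by (simp only: funpow.simps o_def lam_lin L scaleR_scaleR scaleR_minus_left Suc_leD)
  also have "\<dots> = ((- 1) ^ Suc j * fact n * fact (Suc j) / fact (n - Suc j)) *\<^sub>R (wedge w ^^ (n - Suc j)) unit_ext"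
    unfolding c f by simp
  finally show ?case .
qed simp

text \<open>The result has degree 0, so only its value at the empty list is at stake. There only
  \<Lambda>^n applied to w^n / n! contributes, and its sign (-1)^n is cancelled by
  \<open>eps\<close> in degree 2 n.\<close>

lemma pstar_vol: "pstar w vol = unit_ext"
proof -
  have "pstar w vol \<in> ext 0" using pstar_ext[OF vol_ext] by simp
  moreover have "pstar w vol [] = 1"
  proof -
    have L0: "eL a [] = a []" for a :: "'n ext"
    proof -
      have "(wedge w ^^ j) a [] = 0" if "j > 0" for j
        using that w_ext by (cases j) (auto simp: wedge_Nil ext_iff)
      then have "eL a [] = (\<Sum>j<nilk w. if j = 0 then a [] else 0)"
        unfolding opexp_def sum_fun_apply by (intro sum.cong refl) auto
      then show ?thesis by simp
    qed
    have "eM vol [] = (\<Sum>j<nilk w. if j = n then (- 1) ^ n else 0)"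
      unfolding opexp_def sum_fun_apply
    proof (intro sum.cong refl)
      fix j assume "j \<in> {..<nilk w}"
      consider "j < n" | "j = n" | "n < j" by linarith
      then show "((1 / fact j) *\<^sub>R ((\<lambda>a. - lam w a) ^^ j) vol) [] = (if j = n then (- 1) ^ n else 0)"
      proof cases
        case 1
        then have "((\<lambda>a. - lam w a) ^^ j) vol \<in> ext (CARD('n) - 2 * j)" "CARD('n) - 2 * j \<noteq> 0"
          using lam_pow_ext[OF vol_ext, of j] dim by auto
        then show ?thesis using 1 by (simp add: ext_iff)
      next
        case 2
        then show ?thesis
          by (simp add: vol_def linear_scale[OF linear_funpow[OF linear_neg_lam]] lam_pow_wedge_w_pow_unit)
      next
        case 3
        then show ?thesis using lam_pow_ext[OF vol_ext, of j] dim by simp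
      qed
    qed
    then have "eM vol [] = (- 1) ^ n" by (simp add: dim)
    then have "weyl_ext w vol [] = (- 1) ^ n"
      by (simp add: weyl_ext_def L0 eL_top[OF vol_ext])
    moreover have "eps CARD('n) = (- 1) ^ n"
    proof -
      have "2 * n * (2 * n + 1) div 2 = n * (2 * n + 1)" by simp
      then show ?thesis unfolding eps_def dim by (simp add: power_mult power_add)
    qed
    ultimately show ?thesis
      by (simp add: pstar_def lenscale_ext[OF vol_ext] weyl_ext_scale flip: power_mult_distrib)
  qed
  ultimately show ?thesis using ext_0_eq by fastforce
qed

text \<open>Two passages turn a covector into a contraction and back, and the signs and parities
  cancel; on 1 it is \<open>pstar_vol\<close>.\<close>

lemma pstar_pstar: "a \<in> altf \<Longrightarrow> pstar w (pstar w a) = a"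
proof (induction rule: altf_induct[where P = "\<lambda>a. pstar w (pstar w a) = a"])
  case unit then show ?case by (simp add: pstar_unit pstar_vol)
next
  case (wedge u a)
  then show ?case
    by (simp add: pstar_e pstar_minus pstar_ctr altf_pstar w_altf altf_parity parity_pstar)
qed (simp_all add: pstar_add pstar_scale)

lemma vol_nonzero: "vol \<noteq> 0"
proof
  assume "vol = 0"
  then have "unit_ext = (0 :: 'n ext)" using pstar_vol by (simp add: pstar_zero)
  then show False by (metis unit_Nil zero_fun_apply zero_neq_one)
qed

text \<open>The front covector of a is moved next to the star of b, where \<open>pstar_ctr\<close>
  turns it into a contraction of b; \<open>pr_e\<close> makes the same move in the pairing. The
  signs from \<open>wedge_commute\<close> and \<open>parity\<close> cancel.\<close>

lemma wedge_pstar: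
  assumes "a \<in> ext k" "b \<in> ext k"
  shows "wedge a (pstar w b) = pr w k a b *\<^sub>R vol"
proof -
  have "\<forall>b\<in>ext k. wedge a (pstar w b) = pr w k a b *\<^sub>R vol"
    using assms(1)
proof (induction rule: ext_induct[where P = "\<lambda>k a. \<forall>b\<in>ext k. wedge a (pstar w b) = pr w k a b *\<^sub>R vol"])
  case unit
  show ?case
  proof
  fix b :: "'n ext" assume "b \<in> ext 0"
  then have "b = b [] *\<^sub>R unit_ext" by (rule ext_0_eq)
  then have "pstar w b = b [] *\<^sub>R vol" by (metis pstar_scale pstar_unit)
  then show "wedge unit_ext (pstar w b) = pr w 0 unit_ext b *\<^sub>R vol" by simp
  qed
next
  case (wedge k u a)
  show ?case
  proof
  fix b :: "'n ext" assume b: "b \<in> ext (Suc k)"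
  have ba: "b \<in> altf" using b by (rule ext_altf)
  have "wedge (form1 u) a = (- 1) ^ k *\<^sub>R wedge a (form1 u)"
    using wedge_commute[of 1 "form1 u" k a] wedge.hyps by (simp add: form1_def ext_iff)
  then have "wedge (wedge (form1 u) a) (pstar w b) = (- 1) ^ k *\<^sub>R wedge a (wedge (form1 u) (pstar w b))"
    by (simp add: wedge_scaleR_left wedge_assoc)
  also have "wedge (form1 u) (pstar w b) = - pstar w (ctr (sharp w u) (parity b))"
    using pstar_ctr[OF altf_parity[OF ba], of u] by simp
  also have "parity b = - ((- 1) ^ k) *\<^sub>R b" using parity_ext[OF b] by simp
  also have "(- 1) ^ k *\<^sub>R wedge a (- pstar w (ctr (sharp w u) (- ((- 1) ^ k) *\<^sub>R b))) = wedge a (pstar w (ctr (sharp w u) b))"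
    by (simp add: pstar_scale pstar_minus wedge_linear flip: power_mult_distrib)
  also have "\<dots> = pr w k a (ctr (sharp w u) b) *\<^sub>R vol"
    using wedge(2) ctr_in_ext[OF b] by blast
  finally show "wedge (wedge (form1 u) a) (pstar w b) = pr w (Suc k) (wedge (form1 u) a) b *\<^sub>R vol"
    using pr_e[OF ba] by simp
  qed
qed (auto simp: wedge_linear pr_add pr_scale scaleR_add_left)
  then show ?thesis using assms(2) by blast
qed

text \<open>\<open>wedge_pstar\<close> exhibits a solution of the defining property and
  \<open>wedge_nondegenerate\<close> makes it unique.\<close>

lemma star_hom_eq:
  assumes "b \<in> ext k" "k \<le> CARD('n)" shows "star_hom w k b = pstar w b"
  unfolding star_hom_def vol_eq
proof (rule the_equality)
  show "pstar w b \<in> ext (CARD('n) - k) \<and> (\<forall>a\<in>ext k. wedge a (pstar w b) = pairing w k a b *\<^sub>R vol)"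
    using assms by (simp add: pstar_ext wedge_pstar pairing_eq_pr)
next
  fix c assume c: "c \<in> ext (CARD('n) - k) \<and> (\<forall>a\<in>ext k. wedge a c = pairing w k a b *\<^sub>R vol)"
  have "c - pstar w b = 0"
    by (rule wedge_nondegenerate[of _ "CARD('n) - k" k])
      (use assms c in \<open>auto simp: pstar_ext ext_lin wedge_linear wedge_pstar pairing_eq_pr\<close>)
  then show "c = pstar w b" by simp
qed

lemma star_ext_eq: "b \<in> altf \<Longrightarrow> star_ext w b = pstar w b"
proof -
  assume b: "b \<in> altf"
  have "star_ext w b = (\<Sum>k\<le>CARD('n). pstar w (part k b))"
    unfolding star_ext_def by (intro sum.cong refl star_hom_eq part_in_ext b) simp
  also have "\<dots> = pstar w b" unfolding pstar_sum[symmetric] by (simp flip: altf_part_sum[OF b])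
  finally show ?thesis .
qed

text \<open>Coefficients of the volume form are compared: moving c past a costs (-1)^k, and applying
  the involution \<open>pstar\<close> twice to the product of c with the star of b makes it a star
  again. As b has degree k + 3, this sign is opposite to that of \<open>parity b\<close>, whence the
  minus.\<close>

lemma pr_wedge_3:
  assumes c: "c \<in> ext 3" and a: "a \<in> ext k" and b: "b \<in> ext (k + 3)" and k: "k + 3 \<le> CARD('n)"
  shows "pr w (k + 3) (wedge c a) b = pr w k a (- pstar w (wedge c (pstar w (parity b))))"
proof -
  have ca: "wedge c a \<in> ext (k + 3)" using wedge_in_ext[OF c a] by (simp add: add.commute)
  have Tb: "pstar w b \<in> ext (CARD('n) - (k + 3))" by (rule pstar_ext[OF b k])
  have cb: "wedge c (pstar w b) \<in> ext (CARD('n) - k)"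
    using wedge_in_ext[OF c Tb] k by simp
  have T: "pstar w (wedge c (pstar w b)) \<in> ext k"
    using pstar_ext[OF cb] k by simp
  have comm: "wedge c a = (- 1) ^ k *\<^sub>R wedge a c"
    using wedge_commute[of 3 c k a] c a by (simp add: ext_iff power_mult)
  have "pr w (k + 3) (wedge c a) b *\<^sub>R vol = wedge (wedge c a) (pstar w b)"
    by (rule wedge_pstar[OF ca b, symmetric])
  also have "\<dots> = wedge ((- 1) ^ k *\<^sub>R wedge a c) (pstar w b)" by (simp only: comm)
  also have "\<dots> = (- 1) ^ k *\<^sub>R wedge a (pstar w (pstar w (wedge c (pstar w b))))"
    by (simp add: pstar_pstar ext_altf[OF cb] wedge_scaleR_left wedge_assoc)
  also have "\<dots> = ((- 1) ^ k * pr w k a (pstar w (wedge c (pstar w b)))) *\<^sub>R vol"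
    by (simp add: wedge_pstar[OF a T])
  also have "(- 1) ^ k * pr w k a (pstar w (wedge c (pstar w b))) = pr w k a (- pstar w (wedge c (pstar w (parity b))))"
    using parity_ext[OF b] by (simp add: power_add pstar_scale pstar_minus wedge_linear pr_scale pr_minus)
  finally show ?thesis using vol_nonzero scaleR_cancel_right by blast
qed

text \<open>The homogeneous case summed over degrees that differ by 3. The work lies at the ends of
  the range of degrees, where both sides have to vanish.\<close>

lemma total_pairing_wedge_3:
  assumes c: "c \<in> ext 3" and a: "a \<in> altf" and b: "b \<in> altf"
  shows "total_pairing w (wedge c a) b = total_pairing w a (- pstar w (wedge c (pstar w (parity b))))"
proof -
  define psi where "psi x = - pstar w (wedge c (pstar w (parity x)))" for x
  have ca: "c \<in> altf" using c by (rule ext_altf)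
  have psi: "psi x \<in> altf" if "x \<in> altf" for x
    unfolding psi_def by (intro altf_minus altf_pstar altf_wedge altf_parity w_altf ca that)
  have pw: "part (k + 3) (wedge c a) = wedge c (part k a)" for k
    using lenscale_wedge[of 3 c "\<lambda>m. if m = k + 3 then 1 else 0" a] c
    by (simp add: ext_iff lenscale_def part_def if_distrib[of "\<lambda>x. x * _"] add.commute cong: if_cong)
  have e: "psi x \<in> ext (j - 3)" if "x \<in> ext j" "3 \<le> j" "j \<le> CARD('n)" for x j
  proof -
    have "wedge c (pstar w (parity x)) \<in> ext (3 + (CARD('n) - j))"
      using that c by (intro wedge_in_ext) (auto simp: parity_ext pstar_scale ext_lin pstar_ext)
    then have "pstar w (wedge c (pstar w (parity x))) \<in> ext (CARD('n) - (3 + (CARD('n) - j)))"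
      using that by (intro pstar_ext) auto
    then show ?thesis using that by (simp add: ext_lin psi_def)
  qed
  have z: "psi x = 0" if "x \<in> ext j" "j < 3" "j \<le> CARD('n)" for x j
  proof -
    have "parity x \<in> ext j" using that(1) by (simp add: parity_ext ext_lin)
    then have "wedge c (pstar w (parity x)) \<in> ext (3 + (CARD('n) - j))"
      using that(3) by (intro wedge_in_ext c pstar_ext)
    then have "wedge c (pstar w (parity x)) = 0"
      by (rule ext_long_zero) (use that in simp)
    then show ?thesis by (simp add: pstar_zero psi_def)
  qed
  have psi_part: "part k (psi b) = psi (part (k + 3) b)" for k
  proof -
    have "psi b = psi (\<Sum>j\<le>CARD('n). part j b)" by (simp flip: altf_part_sum[OF b])
    also have "\<dots> = (\<Sum>j\<le>CARD('n). psi (part j b))"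
      by (simp add: psi_def parity_lenscale lenscale_sum pstar_sum wedge_sum_right sum_negf)
    finally have "part k (psi b) = (\<Sum>j\<le>CARD('n). part k (psi (part j b)))" by (simp only: part_sum)
    also have "\<dots> = (\<Sum>j\<le>CARD('n). if j = k + 3 then psi (part (k + 3) b) else 0)"
    proof (intro sum.cong refl)
      fix j assume j: "j \<in> {..CARD('n)}"
      show "part k (psi (part j b)) = (if j = k + 3 then psi (part (k + 3) b) else 0)"
      proof (cases "j < 3")
        case True
        then show ?thesis using z[OF part_in_ext[OF b, of j]] j by (simp add: part_linear)
      next
        case False
        then show ?thesis using part_ext[OF e[OF part_in_ext[OF b, of j]], of k] j by auto
      qed
    qed
    also have "\<dots> = psi (part (k + 3) b)"
    proof (cases "k + 3 \<le> CARD('n)")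
      case False
      then have "part (k + 3) b = 0" using ext_long_zero[OF part_in_ext[OF b]] by simp
      then show ?thesis using False by (simp add: pstar_zero psi_def)
    qed simp
    finally show ?thesis .
  qed
  have main: "pr w (k + 3) (wedge c a) b = pr w k a (psi b)" for k
  proof (cases "k + 3 \<le> CARD('n)")
    case True
    have "pr w (k + 3) (wedge c a) b = pr w (k + 3) (wedge c (part k a)) (part (k + 3) b)"
      by (metis pr_part pw)
    also have "\<dots> = pr w k (part k a) (psi (part (k + 3) b))"
      unfolding psi_def by (rule pr_wedge_3[OF c part_in_ext[OF a] part_in_ext[OF b] True])
    also have "\<dots> = pr w k a (psi b)" unfolding psi_part[symmetric] by (simp only: pr_part)
    finally show ?thesis .
  next
    case False
    then have "part (k + 3) b = 0" using ext_long_zero[OF part_in_ext[OF b]] by simp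
    then have "part k (psi b) = 0" unfolding psi_part by (simp add: pstar_zero psi_def)
    then have "pr w k a (psi b) = 0" using pr_part(2)[of k a "psi b"] by (simp add: pr_zero)
    then show ?thesis using False by (simp add: pr_long altf_wedge ca a)
  qed
  have "(\<Sum>k\<le>CARD('n). pr w k (wedge c a) b) = (\<Sum>k\<le>CARD('n) + 3. pr w k (wedge c a) b)"
    by (rule sum.mono_neutral_left) (auto intro!: pr_long altf_wedge a ca)
  also have "\<dots> = (\<Sum>k\<le>CARD('n). pr w (k + 3) (wedge c a) b)"
    using pr_low_wedge[OF _ c a, of 0] pr_low_wedge[OF _ c a, of 1] pr_low_wedge[OF _ c a, of 2]
    by (simp add: numeral_3_eq_3 numeral_2_eq_2 sum.atMost_Suc_shift del: sum.atMost_Suc)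
  finally show ?thesis
    unfolding main psi_def[symmetric] using a b by (simp add: total_pairing_eq altf_wedge ca psi)
qed

end

section \<open>Calculus of smooth functions\<close>

lemma frechet_derivative_eq:
  "(f has_derivative f') (at x) \<Longrightarrow> frechet_derivative f (at x) = f'"
  using frechet_derivative_at by metis

lemma frechet_derivative_cong_open:
  assumes "open S" "x \<in> S" "\<And>y. y \<in> S \<Longrightarrow> f y = g y" "f differentiable (at x)"
  shows "g differentiable (at x)" "frechet_derivative g (at x) = frechet_derivative f (at x)"
proof -
  have "(f has_derivative frechet_derivative f (at x)) (at x)"
    using assms(4) frechet_derivative_works by blast
  then have "(g has_derivative frechet_derivative f (at x)) (at x)"
    by (rule has_derivative_transform_within_open[OF _ assms(1,2)]) (simp add: assms(3))
  then show "g differentiable (at x)" "frechet_derivative g (at x) = frechet_derivative f (at x)"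
    by (auto simp: differentiable_def frechet_derivative_eq)
qed

lemma Ck_on_imp_continuous_on: "Ck_on k S f \<Longrightarrow> continuous_on S f"
  by (cases k) (auto intro!: continuous_at_imp_continuous_on differentiable_imp_continuous_within)

lemma Ck_on_Suc_imp: "Ck_on (Suc k) S f \<Longrightarrow> Ck_on k S f"
proof (induction k arbitrary: f)
  case 0 then show ?case using Ck_on_imp_continuous_on by fastforce
next
  case (Suc k)
  have "Ck_on k S (\<lambda>x. frechet_derivative f (at x) v)" for v
    by (rule Suc.IH) (use Suc.prems in simp)
  then show ?case using Suc.prems by simp
qed

lemma Ck_on_cong:
  assumes "open S" "\<And>x. x \<in> S \<Longrightarrow> f x = g x" "Ck_on k S f"
  shows "Ck_on k S g"
  using assms(2,3)
proof (induction k arbitrary: f g)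
  case 0 then show ?case by (simp cong: continuous_on_cong)
next
  case (Suc k)
  have d: "f differentiable (at x)" if "x \<in> S" for x using Suc.prems that by simp
  have "Ck_on k S (\<lambda>x. frechet_derivative g (at x) v)" for v
    by (rule Suc.IH[of "\<lambda>x. frechet_derivative f (at x) v"])
      (use Suc.prems frechet_derivative_cong_open(2)[OF assms(1) _ Suc.prems(1) d] in auto)
  then show ?case using frechet_derivative_cong_open(1)[OF assms(1) _ Suc.prems(1) d] by simp
qed

lemma Ck_on_subset: "Ck_on k S f \<Longrightarrow> T \<subseteq> S \<Longrightarrow> Ck_on k T f"
  by (induction k arbitrary: f) (auto intro: continuous_on_subset)

text \<open>Derivatives are taken in the whole space, so an open neighbourhood of each point
  decides; this will glue a bump form to zero.\<close>

lemma Ck_on_local: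
  assumes "\<And>x. x \<in> S \<Longrightarrow> \<exists>U. open U \<and> x \<in> U \<and> Ck_on k U f"
  shows "Ck_on k S f"
  using assms
proof (induction k arbitrary: f)
  case 0
  then show ?case
    by (auto intro!: continuous_at_imp_continuous_on) (metis continuous_on_eq_continuous_at)
next
  case (Suc k)
  have "Ck_on k S (\<lambda>x. frechet_derivative f (at x) v)" for v
  proof (rule Suc.IH)
    fix x assume "x \<in> S"
    then obtain U where "open U" "x \<in> U" "Ck_on (Suc k) U f" using Suc.prems by blast
    then show "\<exists>U. open U \<and> x \<in> U \<and> Ck_on k U (\<lambda>x. frechet_derivative f (at x) v)" by auto
  qed
  moreover have "f differentiable (at x)" if "x \<in> S" for x
    using Suc.prems[OF that] by auto
  ultimately show ?case by simp
qed

lemma Ck_on_const: "Ck_on k S (\<lambda>_. c)"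
  by (induction k arbitrary: c) (simp_all add: frechet_derivative_eq[OF has_derivative_const])

lemma Ck_on_SucI:
  assumes S: "open S" and D: "\<And>x. x \<in> S \<Longrightarrow> (f has_derivative D x) (at x)"
    and "\<And>v. Ck_on k S (\<lambda>x. D x v)"
  shows "Ck_on (Suc k) S f"
  using assms(3) D by (auto simp: differentiable_def frechet_derivative_eq[OF D] intro: Ck_on_cong[OF S])

lemma Ck_on_SucD:
  assumes "Ck_on (Suc k) S f"
  shows "x \<in> S \<Longrightarrow> (f has_derivative frechet_derivative f (at x)) (at x)"
    and "Ck_on k S (\<lambda>x. frechet_derivative f (at x) v)"
  using assms by (auto simp: frechet_derivative_works)

lemma Ck_on_linear:
  assumes S: "open S" and h: "bounded_linear h" and "Ck_on k S f"
  shows "Ck_on k S (\<lambda>x. h (f x))"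
  using assms(3)
proof (induction k arbitrary: f)
  case 0 then show ?case using h by (simp add: bounded_linear.continuous_on)
next
  case (Suc k)
  show ?case
    by (rule Ck_on_SucI[OF S bounded_linear.has_derivative[OF h Ck_on_SucD(1)[OF Suc.prems]]])
      (simp_all add: Suc.IH Ck_on_SucD(2)[OF Suc.prems])
qed

lemma Ck_on_add:
  assumes S: "open S" and "Ck_on k S f" "Ck_on k S g"
  shows "Ck_on k S (\<lambda>x. f x + g x)"
  using assms(2,3)
proof (induction k arbitrary: f g)
  case 0 then show ?case by (simp add: continuous_on_add)
next
  case (Suc k)
  show ?case
    by (rule Ck_on_SucI[OF S has_derivative_add[OF Ck_on_SucD(1)[OF Suc.prems(1)] Ck_on_SucD(1)[OF Suc.prems(2)]]])
      (simp_all add: Suc.IH Ck_on_SucD(2)[OF Suc.prems(1)] Ck_on_SucD(2)[OF Suc.prems(2)])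
qed

lemma Ck_on_mult:
  fixes f g :: "'a::real_normed_vector \<Rightarrow> real"
  assumes S: "open S" and "Ck_on k S f" "Ck_on k S g"
  shows "Ck_on k S (\<lambda>x. f x * g x)"
  using assms(2,3)
proof (induction k arbitrary: f g)
  case 0 then show ?case by (simp add: continuous_on_mult)
next
  case (Suc k)
  show ?case
    by (rule Ck_on_SucI[OF S has_derivative_mult[OF Ck_on_SucD(1)[OF Suc.prems(1)] Ck_on_SucD(1)[OF Suc.prems(2)]]])
      (simp_all add: Suc.IH Ck_on_add[OF S] Ck_on_Suc_imp[OF Suc.prems(1)] Ck_on_Suc_imp[OF Suc.prems(2)]
        Ck_on_SucD(2)[OF Suc.prems(1)] Ck_on_SucD(2)[OF Suc.prems(2)])
qed

lemma Ck_on_uminus: "open S \<Longrightarrow> Ck_on k S f \<Longrightarrow> Ck_on k S (\<lambda>x. - f x)"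
  by (rule Ck_on_linear[OF _ bounded_linear_minus[OF bounded_linear_ident]])

lemma Ck_on_sum:
  assumes "open S" "\<And>i. i \<in> I \<Longrightarrow> Ck_on k S (f i)"
  shows "Ck_on k S (\<lambda>x. \<Sum>i\<in>I. f i x)"
  using assms(2) by (induction I rule: infinite_finite_induct) (auto intro!: Ck_on_const Ck_on_add assms(1))

lemma Ck_on_prod:
  fixes f :: "'i \<Rightarrow> 'a::real_normed_vector \<Rightarrow> real"
  assumes "open S" "\<And>i. i \<in> I \<Longrightarrow> Ck_on k S (f i)"
  shows "Ck_on k S (\<lambda>x. \<Prod>i\<in>I. f i x)"
  using assms(2) by (induction I rule: infinite_finite_induct) (auto intro!: Ck_on_const Ck_on_mult assms(1))

lemma Ck_on_inverse:
  fixes f :: "'a::real_normed_vector \<Rightarrow> real"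
  assumes S: "open S" and "Ck_on k S f" and nz: "\<And>x. x \<in> S \<Longrightarrow> f x \<noteq> 0"
  shows "Ck_on k S (\<lambda>x. inverse (f x))"
  using assms(2)
proof (induction k)
  case 0 then show ?case using nz by (simp add: continuous_on_inverse)
next
  case (Suc k)
  have "((\<lambda>x. inverse (f x)) has_derivative (\<lambda>v. - (inverse (f x) * frechet_derivative f (at x) v * inverse (f x)))) (at x)"
    if "x \<in> S" for x
    by (rule Deriv.has_derivative_inverse[OF nz[OF that] Ck_on_SucD(1)[OF Suc.prems that]])
  then show ?case
    by (rule Ck_on_SucI[OF S])
      (simp_all add: Ck_on_uminus[OF S] Ck_on_mult[OF S] Suc.IH[OF Ck_on_Suc_imp[OF Suc.prems]] Ck_on_SucD(2)[OF Suc.prems])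
qed

lemma Ck_on_compose:
  fixes f :: "'a::real_normed_vector \<Rightarrow> 'b::euclidean_space" and g :: "'b \<Rightarrow> real"
  assumes S: "open S" and "Ck_on k S f" "Ck_on k T g" and sub: "f ` S \<subseteq> T"
  shows "Ck_on k S (\<lambda>x. g (f x))"
  using assms(2,3)
proof (induction k arbitrary: g)
  case 0 then show ?case using sub by (auto intro: continuous_on_compose2)
next
  case (Suc k)
  \<comment> \<open>The direction in which g is differentiated varies with x, while
    \<open>Ck_on\<close> speaks of fixed directions; expanding it in \<open>Basis\<close> separates
    the two dependences.\<close>
  define D where "D = (\<lambda>x v. \<Sum>b\<in>Basis. (frechet_derivative f (at x) v \<bullet> b) * frechet_derivative g (at (f x)) b)"
  have 1: "((\<lambda>x. g (f x)) has_derivative D x) (at x)" if "x \<in> S" for x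
  proof -
    have f: "(f has_derivative frechet_derivative f (at x)) (at x)" by (rule Ck_on_SucD(1)[OF Suc.prems(1) that])
    have "f x \<in> T" using that sub by auto
    then have g: "(g has_derivative frechet_derivative g (at (f x))) (at (f x))" by (rule Ck_on_SucD(1)[OF Suc.prems(2)])
    have ex: "frechet_derivative g (at (f x)) y = (\<Sum>b\<in>Basis. (y \<bullet> b) * frechet_derivative g (at (f x)) b)" for y
      using linear_sum[OF has_derivative_linear[OF g], of "\<lambda>b. (y \<bullet> b) *\<^sub>R b" Basis]
        linear_scale[OF has_derivative_linear[OF g]] by (simp add: euclidean_representation)
    have "frechet_derivative g (at (f x)) \<circ> frechet_derivative f (at x) = D x"
      by (rule ext) (simp only: o_def D_def ex[of "frechet_derivative f (at x) _"])
    then show ?thesis using diff_chain_at[OF f g] by (simp only: o_def)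
  qed
  have 2: "Ck_on k S (\<lambda>x. D x v)" for v
    unfolding D_def
  proof (intro Ck_on_sum[OF S] Ck_on_mult[OF S])
    fix b :: 'b
    show "Ck_on k S (\<lambda>x. frechet_derivative f (at x) v \<bullet> b)"
      by (rule Ck_on_linear[OF S bounded_linear_inner_left Ck_on_SucD(2)[OF Suc.prems(1)]])
    show "Ck_on k S (\<lambda>x. frechet_derivative g (at (f x)) b)"
      by (rule Suc.IH[OF Ck_on_Suc_imp[OF Suc.prems(1)] Ck_on_SucD(2)[OF Suc.prems(2)]])
  qed
  show ?case by (rule Ck_on_SucI[OF S 1 2])
qed

lemma smooth_on_cong: "open S \<Longrightarrow> (\<And>x. x \<in> S \<Longrightarrow> f x = g x) \<Longrightarrow> smooth_on S f \<Longrightarrow> smooth_on S g"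
  unfolding smooth_on_def using Ck_on_cong by blast

lemma smooth_on_subset: "smooth_on S f \<Longrightarrow> T \<subseteq> S \<Longrightarrow> smooth_on T f"
  unfolding smooth_on_def using Ck_on_subset by blast

lemma smooth_on_local:
  "(\<And>x. x \<in> S \<Longrightarrow> \<exists>U. open U \<and> x \<in> U \<and> smooth_on U f) \<Longrightarrow> smooth_on S f"
  unfolding smooth_on_def by (intro allI Ck_on_local) blast

lemma smooth_on_const: "smooth_on S (\<lambda>_. c)"
  by (simp add: smooth_on_def Ck_on_const)

lemma smooth_on_linear: "open S \<Longrightarrow> bounded_linear h \<Longrightarrow> smooth_on S f \<Longrightarrow> smooth_on S (\<lambda>x. h (f x))"
  by (simp add: smooth_on_def Ck_on_linear)

lemma smooth_on_add: "open S \<Longrightarrow> smooth_on S f \<Longrightarrow> smooth_on S g \<Longrightarrow> smooth_on S (\<lambda>x. f x + g x)"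
  by (simp add: smooth_on_def Ck_on_add)

lemma smooth_on_mult:
  fixes f g :: "'a::real_normed_vector \<Rightarrow> real"
  shows "open S \<Longrightarrow> smooth_on S f \<Longrightarrow> smooth_on S g \<Longrightarrow> smooth_on S (\<lambda>x. f x * g x)"
  by (simp add: smooth_on_def Ck_on_mult)

lemma smooth_on_sum: "open S \<Longrightarrow> (\<And>i. i \<in> I \<Longrightarrow> smooth_on S (f i)) \<Longrightarrow> smooth_on S (\<lambda>x. \<Sum>i\<in>I. f i x)"
  by (simp add: smooth_on_def Ck_on_sum)

lemma smooth_on_prod:
  fixes f :: "'i \<Rightarrow> 'a::real_normed_vector \<Rightarrow> real"
  shows "open S \<Longrightarrow> (\<And>i. i \<in> I \<Longrightarrow> smooth_on S (f i)) \<Longrightarrow> smooth_on S (\<lambda>x. \<Prod>i\<in>I. f i x)"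
  by (simp add: smooth_on_def Ck_on_prod)

lemma smooth_on_divide:
  fixes f g :: "'a::real_normed_vector \<Rightarrow> real"
  shows "open S \<Longrightarrow> smooth_on S f \<Longrightarrow> smooth_on S g \<Longrightarrow> (\<And>x. x \<in> S \<Longrightarrow> g x \<noteq> 0) \<Longrightarrow> smooth_on S (\<lambda>x. f x / g x)"
  unfolding divide_inverse by (simp add: smooth_on_def Ck_on_mult Ck_on_inverse)

lemma smooth_on_compose:
  fixes f :: "'a::real_normed_vector \<Rightarrow> 'b::euclidean_space" and g :: "'b \<Rightarrow> real"
  shows "open S \<Longrightarrow> smooth_on S f \<Longrightarrow> smooth_on T g \<Longrightarrow> f ` S \<subseteq> T \<Longrightarrow> smooth_on S (\<lambda>x. g (f x))"
  unfolding smooth_on_def using Ck_on_compose by blast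

lemma smooth_on_deriv: "smooth_on S f \<Longrightarrow> smooth_on S (\<lambda>x. frechet_derivative f (at x) v)"
  unfolding smooth_on_def using Ck_on_SucD(2) by blast

lemma smooth_on_has_derivative:
  "smooth_on S f \<Longrightarrow> x \<in> S \<Longrightarrow> (f has_derivative frechet_derivative f (at x)) (at x)"
  unfolding smooth_on_def using Ck_on_SucD(1) by blast

lemma smooth_on_differentiable: "smooth_on S f \<Longrightarrow> x \<in> S \<Longrightarrow> f differentiable (at x)"
  using smooth_on_has_derivative differentiable_def by blast

lemma smooth_on_continuous_on: "smooth_on S f \<Longrightarrow> continuous_on S f"
  unfolding smooth_on_def using Ck_on_imp_continuous_on by blast

section \<open>Symmetry of second derivatives\<close>

text \<open>The mean value theorem twice: along u for the increment in direction v, then along v for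
  the derivative in direction u.\<close>

lemma second_difference:
  fixes f :: "'a::real_normed_vector \<Rightarrow> real"
  assumes s: "s > 0" and sub: "\<And>\<sigma> \<tau>. 0 \<le> \<sigma> \<Longrightarrow> \<sigma> \<le> s \<Longrightarrow> 0 \<le> \<tau> \<Longrightarrow> \<tau> \<le> s \<Longrightarrow> x + \<sigma> *\<^sub>R u + \<tau> *\<^sub>R v \<in> S"
    and f: "smooth_on S f"
  shows "\<exists>\<sigma> \<tau>. 0 \<le> \<sigma> \<and> \<sigma> \<le> s \<and> 0 \<le> \<tau> \<and> \<tau> \<le> s \<and>
    f (x + s *\<^sub>R u + s *\<^sub>R v) - f (x + s *\<^sub>R u) - f (x + s *\<^sub>R v) + f x
      = s * s * frechet_derivative (\<lambda>y. frechet_derivative f (at y) u) (at (x + \<sigma> *\<^sub>R u + \<tau> *\<^sub>R v)) v"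
proof -
  have line: "DERIV (\<lambda>t. h (y + t *\<^sub>R z)) t :> frechet_derivative h (at (y + t *\<^sub>R z)) z"
    if "smooth_on S h" "y + t *\<^sub>R z \<in> S" for h :: "'a \<Rightarrow> real" and y z t
  proof -
    have h: "(h has_derivative frechet_derivative h (at (y + t *\<^sub>R z))) (at (y + t *\<^sub>R z))"
      by (rule smooth_on_has_derivative[OF that])
    have "((\<lambda>t. y + t *\<^sub>R z) has_derivative (\<lambda>t. t *\<^sub>R z)) (at t)"
      by (auto intro!: derivative_eq_intros)
    from diff_chain_at[OF this h]
    have "((\<lambda>t. h (y + t *\<^sub>R z)) has_derivative (\<lambda>t'. frechet_derivative h (at (y + t *\<^sub>R z)) (t' *\<^sub>R z))) (at t)"
      by (simp add: o_def)
    then show ?thesis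
      unfolding has_field_derivative_def
      by (simp add: linear_scale[OF has_derivative_linear[OF h]] mult.commute[of _ "frechet_derivative _ _ _"])
  qed
  define g where "g \<sigma> = f (x + s *\<^sub>R v + \<sigma> *\<^sub>R u) - f (x + \<sigma> *\<^sub>R u)" for \<sigma>
  define g' where "g' \<sigma> = frechet_derivative f (at (x + s *\<^sub>R v + \<sigma> *\<^sub>R u)) u - frechet_derivative f (at (x + \<sigma> *\<^sub>R u)) u" for \<sigma>
  have "DERIV g \<sigma> :> g' \<sigma>" if "0 \<le> \<sigma>" "\<sigma> \<le> s" for \<sigma>
    unfolding g_def g'_def
    by (intro DERIV_diff line f) (use sub[OF that, of s] sub[OF that, of 0] s in \<open>auto simp: algebra_simps\<close>)
  then obtain \<sigma> where \<sigma>: "0 < \<sigma>" "\<sigma> < s" "g s - g 0 = (s - 0) * g' \<sigma>"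
    using MVT2[OF s, of g g'] by auto
  define k where "k \<tau> = frechet_derivative f (at (x + \<sigma> *\<^sub>R u + \<tau> *\<^sub>R v)) u" for \<tau>
  have "DERIV k \<tau> :> frechet_derivative (\<lambda>y. frechet_derivative f (at y) u) (at (x + \<sigma> *\<^sub>R u + \<tau> *\<^sub>R v)) v"
    if "0 \<le> \<tau>" "\<tau> \<le> s" for \<tau>
    unfolding k_def by (rule line[OF smooth_on_deriv[OF f]]) (use sub[of \<sigma> \<tau>] \<sigma> that in auto)
  then obtain \<tau> where \<tau>: "0 < \<tau>" "\<tau> < s"
    "k s - k 0 = (s - 0) * frechet_derivative (\<lambda>y. frechet_derivative f (at y) u) (at (x + \<sigma> *\<^sub>R u + \<tau> *\<^sub>R v)) v"
    using MVT2[OF s, of k "\<lambda>\<tau>. frechet_derivative (\<lambda>y. frechet_derivative f (at y) u) (at (x + \<sigma> *\<^sub>R u + \<tau> *\<^sub>R v)) v"] by auto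
  have "g' \<sigma> = k s - k 0" by (simp add: g'_def k_def algebra_simps)
  then have "g s - g 0 = s * s * frechet_derivative (\<lambda>y. frechet_derivative f (at y) u) (at (x + \<sigma> *\<^sub>R u + \<tau> *\<^sub>R v)) v"
    using \<sigma>(3) \<tau>(3) by simp
  moreover have "g s - g 0 = f (x + s *\<^sub>R u + s *\<^sub>R v) - f (x + s *\<^sub>R u) - f (x + s *\<^sub>R v) + f x"
    by (simp add: g_def algebra_simps)
  ultimately show ?thesis using \<sigma> \<tau> by (metis less_imp_le)
qed

text \<open>The second difference over a parallelogram does not depend on the order of u and v;
  \<open>second_difference\<close> writes it as either mixed derivative at points near x, and
  continuity brings both to x.\<close>

lemma second_derivative_symmetric:
  fixes f :: "'a::real_normed_vector \<Rightarrow> real"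
  assumes S: "open S" "x \<in> S" and f: "smooth_on S f"
  shows "frechet_derivative (\<lambda>y. frechet_derivative f (at y) u) (at x) v
       = frechet_derivative (\<lambda>y. frechet_derivative f (at y) v) (at x) u"
proof -
  define A where "A y = frechet_derivative (\<lambda>y. frechet_derivative f (at y) u) (at y) v" for y
  define B where "B y = frechet_derivative (\<lambda>y. frechet_derivative f (at y) v) (at y) u" for y
  have cA: "isCont A x" and cB: "isCont B x"
    unfolding A_def B_def using smooth_on_continuous_on[OF smooth_on_deriv[OF smooth_on_deriv[OF f]]] S
    by (simp_all add: continuous_on_eq_continuous_at)
  have "\<bar>A x - B x\<bar> \<le> 0 + e" if e: "e > 0" for e
  proof -
    obtain d1 where d1: "d1 > 0" "\<And>y. dist y x < d1 \<Longrightarrow> \<bar>A y - A x\<bar> < e / 2"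
      using cA[unfolded continuous_at_eps_delta, rule_format, of "e / 2"] e
      by (auto simp: dist_real_def)
    obtain d2 where d2: "d2 > 0" "\<And>y. dist y x < d2 \<Longrightarrow> \<bar>B y - B x\<bar> < e / 2"
      using cB[unfolded continuous_at_eps_delta, rule_format, of "e / 2"] e
      by (auto simp: dist_real_def)
    obtain d3 where d3: "d3 > 0" "\<And>y. dist y x < d3 \<Longrightarrow> y \<in> S"
      using S unfolding open_dist by metis
    define d where "d = min d1 (min d2 d3)"
    \<comment> \<open>The summand 1 keeps the quotient meaningful when u and v are both
      zero.\<close>
    define s where "s = d / (norm u + norm v + 1)"
    have d: "d > 0" using d1 d2 d3 by (simp add: d_def)
    have s: "s > 0" unfolding s_def using d by (intro divide_pos_pos) (auto intro: add_nonneg_pos)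
    have near: "dist (x + \<sigma> *\<^sub>R a + \<tau> *\<^sub>R b) x < d"
      if "0 \<le> \<sigma>" "\<sigma> \<le> s" "0 \<le> \<tau>" "\<tau> \<le> s" "norm a + norm b = norm u + norm v" for \<sigma> \<tau> a b
    proof -
      have "dist (x + \<sigma> *\<^sub>R a + \<tau> *\<^sub>R b) x \<le> \<sigma> * norm a + \<tau> * norm b"
        using norm_triangle_ineq[of "\<sigma> *\<^sub>R a" "\<tau> *\<^sub>R b"] that by (simp add: dist_norm add.assoc)
      also have "\<dots> \<le> s * norm a + s * norm b" using that by (intro add_mono mult_right_mono) auto
      also have "\<dots> = s * (norm u + norm v)" using that by (simp add: distrib_left[symmetric])
      also have "\<dots> < s * (norm u + norm v + 1)" using s by simp
      also have "\<dots> = d"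
      proof -
        have "norm u + norm v + 1 > 0" by (intro add_nonneg_pos) auto
        then show ?thesis by (simp add: s_def)
      qed
      finally show ?thesis .
    qed
    obtain \<sigma> \<tau> where 1: "0 \<le> \<sigma>" "\<sigma> \<le> s" "0 \<le> \<tau>" "\<tau> \<le> s"
      "f (x + s *\<^sub>R u + s *\<^sub>R v) - f (x + s *\<^sub>R u) - f (x + s *\<^sub>R v) + f x = s * s * A (x + \<sigma> *\<^sub>R u + \<tau> *\<^sub>R v)"
      using second_difference[OF s _ f, of x u v] near d3(2) unfolding A_def d_def by fastforce
    obtain \<sigma>' \<tau>' where 2: "0 \<le> \<sigma>'" "\<sigma>' \<le> s" "0 \<le> \<tau>'" "\<tau>' \<le> s"
      "f (x + s *\<^sub>R v + s *\<^sub>R u) - f (x + s *\<^sub>R v) - f (x + s *\<^sub>R u) + f x = s * s * B (x + \<sigma>' *\<^sub>R v + \<tau>' *\<^sub>R u)"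
      using second_difference[OF s _ f, of x v u] near d3(2) unfolding B_def d_def by fastforce
    have swap: "x + s *\<^sub>R v + s *\<^sub>R u = x + s *\<^sub>R u + s *\<^sub>R v" by simp
    have "s * s * A (x + \<sigma> *\<^sub>R u + \<tau> *\<^sub>R v) = s * s * B (x + \<sigma>' *\<^sub>R v + \<tau>' *\<^sub>R u)"
      using 1(5) 2(5)[unfolded swap] by linarith
    then have "A (x + \<sigma> *\<^sub>R u + \<tau> *\<^sub>R v) = B (x + \<sigma>' *\<^sub>R v + \<tau>' *\<^sub>R u)" using s by simp
    moreover have "\<bar>A (x + \<sigma> *\<^sub>R u + \<tau> *\<^sub>R v) - A x\<bar> < e / 2" using near[OF 1(1-4)] d1(2) by (simp add: d_def)
    moreover have "\<bar>B (x + \<sigma>' *\<^sub>R v + \<tau>' *\<^sub>R u) - B x\<bar> < e / 2" using near[OF 2(1-4)] d2(2) by (simp add: d_def add.commute)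
    ultimately show ?thesis by linarith
  qed
  then have "\<bar>A x - B x\<bar> \<le> 0" by (rule field_le_epsilon)
  then show ?thesis by (simp add: A_def B_def)
qed

section \<open>A smooth bump function\<close>

text \<open>This family, with a polynomial in 1/t as parameter, is closed under differentiation, so
  smoothness of all its members is a single induction.\<close>

definition flat :: "real poly \<Rightarrow> real \<Rightarrow> real"
  where "flat q t = (if t > 0 then poly q (1 / t) * exp (- 1 / t) else 0)"

text \<open>With y = 1/t this is the decay of y q(y) e^(-y) at infinity; it gives the derivative 0
  at t = 0.\<close>

lemma flat_quotient_tendsto: "((\<lambda>t. flat q t / t) \<longlongrightarrow> 0) (at 0)"
proof -
  have "((\<lambda>y. y * poly q y * exp (- y)) \<longlongrightarrow> 0) at_top" for q :: "real poly"
  proof -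
    have "((\<lambda>y. (\<Sum>i\<le>degree q. coeff q i * (y ^ Suc i / exp y))) \<longlongrightarrow> (\<Sum>i\<le>degree q. coeff q i * 0)) at_top"
      by (intro tendsto_intros tendsto_power_div_exp_0)
    moreover have "(\<lambda>y. (\<Sum>i\<le>degree q. coeff q i * (y ^ Suc i / exp y))) = (\<lambda>y. y * poly q y * exp (- y))"
      by (simp add: poly_altdef fun_eq_iff exp_minus sum_distrib_left sum_distrib_right field_simps)
    ultimately show ?thesis by simp
  qed
  from filterlim_compose[OF this filterlim_inverse_at_top_right]
  have "((\<lambda>t. inverse t * poly q (inverse t) * exp (- inverse t)) \<longlongrightarrow> 0) (at_right 0)" .
  moreover have "eventually (\<lambda>t. inverse t * poly q (inverse t) * exp (- inverse t) = flat q t / t) (at_right 0)"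
    by (rule eventually_mono[OF eventually_at_right_less]) (simp add: flat_def field_simps)
  ultimately have "((\<lambda>t. flat q t / t) \<longlongrightarrow> 0) (at_right 0)"
    by (rule Lim_transform_eventually)
  moreover have "((\<lambda>t. flat q t / t) \<longlongrightarrow> 0) (at_left 0)"
    by (rule tendsto_eventually) (auto simp: eventually_at_left_field flat_def intro!: exI[of _ "-1"])
  ultimately show ?thesis by (rule filterlim_split_at[rotated])
qed

lemma flat_deriv: "\<exists>q'. \<forall>t. (flat q has_real_derivative flat q' t) (at t)"
\<comment> \<open>With y = 1/t, the derivative of q(y) e^(-y) in t is y^2 (q(y) - q'(y)) e^(-y);
  \<open>[:0, 0, 1:]\<close> is y^2.\<close>
proof (intro exI[of _ "[:0, 0, 1:] * (q - pderiv q)"] allI)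
  fix t :: real
  consider "t > 0" | "t = 0" | "t < 0" by linarith
  then show "(flat q has_real_derivative flat ([:0, 0, 1:] * (q - pderiv q)) t) (at t)"
  proof cases
    case 1
    have "((\<lambda>t. poly q (1 / t) * exp (- 1 / t)) has_real_derivative flat ([:0, 0, 1:] * (q - pderiv q)) t) (at t)"
      using 1 by (auto intro!: derivative_eq_intros DERIV_chain'[OF _ poly_DERIV] simp: flat_def field_simps power2_eq_square)
    then show ?thesis
      by (rule has_field_derivative_transform_within_open[of _ _ _ "{0<..}"]) (use 1 in \<open>auto simp: flat_def\<close>)
  next
    case 2
    show ?thesis
      unfolding 2 has_field_derivative_iff using flat_quotient_tendsto[of q] by (simp add: flat_def)
  next
    case 3
    have "((\<lambda>t. 0) has_real_derivative flat ([:0, 0, 1:] * (q - pderiv q)) t) (at t)"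
      using 3 by (auto intro!: derivative_eq_intros simp: flat_def)
    then show ?thesis
      by (rule has_field_derivative_transform_within_open[of _ _ _ "{..<0}"]) (use 3 in \<open>auto simp: flat_def\<close>)
  qed
qed

lemma smooth_on_flat: "smooth_on UNIV (flat q)"
proof -
  have "Ck_on k UNIV (flat q)" for k
  proof (induction k arbitrary: q)
    case 0
    obtain q' where "\<forall>t. (flat q has_real_derivative flat q' t) (at t)" using flat_deriv by blast
    then show ?case by (auto intro!: continuous_at_imp_continuous_on DERIV_isCont)
  next
    case (Suc k)
    obtain q' where q': "\<And>t. (flat q has_real_derivative flat q' t) (at t)" using flat_deriv by blast
    show ?case
      by (rule Ck_on_SucI[OF open_UNIV q'[unfolded has_field_derivative_def]])
        (auto intro!: Ck_on_mult Ck_on_const Suc.IH)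
  qed
  then show ?thesis by (simp add: smooth_on_def)
qed

lemma bump_exists:
  fixes a :: "real ^ 'n::finite"
  assumes "r > 0"
  shows "\<exists>f :: real ^ 'n \<Rightarrow> real. smooth_on UNIV f \<and> f a \<noteq> 0 \<and> (\<forall>x. x \<notin> cball a r \<longrightarrow> f x = 0)"
proof (intro exI conjI allI impI)
  \<comment> \<open>r^2 - |x - a|^2 written out in coordinates: positive at a, negative outside the
    closed ball.\<close>
  let ?g = "\<lambda>x :: real ^ 'n. r * r + (\<Sum>i\<in>UNIV. - ((x $ i + - a $ i) * (x $ i + - a $ i)))"
  let ?f = "\<lambda>x. flat 1 (?g x)"
  have id: "smooth_on UNIV (\<lambda>x :: real ^ 'n. x)"
    unfolding smooth_on_def
  proof
    fix k show "Ck_on k UNIV (\<lambda>x :: real ^ 'n. x)"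
      by (cases k) (auto simp: frechet_derivative_eq[OF has_derivative_ident] Ck_on_const)
  qed
  have nth: "smooth_on UNIV (\<lambda>x :: real ^ 'n. x $ i)" for i
    by (rule smooth_on_linear[OF open_UNIV bounded_linear_vec_nth id])
  have "smooth_on UNIV ?g"
    by (intro smooth_on_add smooth_on_sum smooth_on_const smooth_on_mult nth open_UNIV
      smooth_on_linear[OF open_UNIV bounded_linear_minus[OF bounded_linear_ident]])
  then show "smooth_on UNIV ?f"
    by (rule smooth_on_compose[OF open_UNIV _ smooth_on_flat]) simp
  show "?f a \<noteq> 0" using assms by (simp add: flat_def)
  show "?f x = 0" if "x \<notin> cball a r" for x
  proof -
    have "(dist a x)\<^sup>2 = (\<Sum>i\<in>UNIV. (x $ i + - a $ i) * (x $ i + - a $ i))"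
      by (simp add: dist_norm norm_minus_commute[of a x] power2_norm_eq_inner inner_vec_def)
    moreover have "r * r < (dist a x)\<^sup>2"
      using that assms unfolding power2_eq_square by (intro mult_strict_mono) auto
    ultimately show ?thesis by (simp add: flat_def sum_negf)
  qed
qed

section \<open>Differential forms on open subsets\<close>

definition dird :: "(real ^ 'n \<Rightarrow> ('n::finite) ext) \<Rightarrow> real ^ 'n \<Rightarrow> real ^ 'n \<Rightarrow> 'n ext"
  where "dird F x u = (\<lambda>vs. frechet_derivative (\<lambda>y. F y vs) (at x) u)"

definition dloc :: "(real ^ 'n \<Rightarrow> ('n::finite) ext) \<Rightarrow> real ^ 'n \<Rightarrow> 'n ext"
  where "dloc F x = (\<lambda>vs. \<Sum>i<length vs. (- 1) ^ i *
    frechet_derivative (\<lambda>y. F y (take i vs @ drop (Suc i) vs)) (at x) (vs ! i))"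

definition sform :: "(real ^ 'n) set \<Rightarrow> (real ^ 'n \<Rightarrow> ('n::finite) ext) \<Rightarrow> bool"
  where "sform S F \<longleftrightarrow> (\<forall>x\<in>S. F x \<in> altf) \<and> (\<forall>vs. smooth_on S (\<lambda>x. F x vs))"

lemma sform_altf: "sform S F \<Longrightarrow> x \<in> S \<Longrightarrow> F x \<in> altf"
  by (simp add: sform_def)

lemma sform_smooth: "sform S F \<Longrightarrow> smooth_on S (\<lambda>x. F x vs)"
  by (simp add: sform_def)

lemma sform_deriv: "sform S F \<Longrightarrow> x \<in> S \<Longrightarrow> ((\<lambda>y. F y vs) has_derivative (\<lambda>u. dird F x u vs)) (at x)"
  unfolding dird_def by (rule smooth_on_has_derivative[OF sform_smooth])

lemma dird_eqI:
  assumes "\<And>vs. ((\<lambda>y. F y vs) has_derivative (\<lambda>u. D u vs)) (at x)"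
  shows "dird F x u = D u"
  by (simp add: dird_def fun_eq_iff frechet_derivative_eq[OF assms])

lemma dloc_cong:
  assumes "open S" "x \<in> S" "\<And>y. y \<in> S \<Longrightarrow> F y = G y" "sform S F"
  shows "dloc G x = dloc F x"
proof -
  have "frechet_derivative (\<lambda>y. G y vs) (at x) = frechet_derivative (\<lambda>y. F y vs) (at x)" for vs
    by (rule frechet_derivative_cong_open(2)[OF assms(1,2) _ smooth_on_differentiable[OF sform_smooth[OF assms(4)] assms(2)]])
      (simp add: assms(3))
  then show ?thesis by (simp add: dloc_def)
qed

lemma dird_linear: "sform S F \<Longrightarrow> x \<in> S \<Longrightarrow> linear (\<lambda>u. dird F x u vs)"
  using sform_deriv has_derivative_linear by blast

lemma dird_expand:
  assumes "sform S F" "x \<in> S"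
  shows "dird F x u = (\<Sum>i\<in>UNIV. (u $ i) *\<^sub>R dird F x (axis i 1))"
proof
  fix vs
  have "dird F x (\<Sum>i\<in>UNIV. (u $ i) *\<^sub>R axis i 1) vs = (\<Sum>i\<in>UNIV. (u $ i) *\<^sub>R dird F x (axis i 1)) vs"
    using linear_sum[OF dird_linear[OF assms, of vs], of "\<lambda>i. (u $ i) *\<^sub>R axis i 1" UNIV]
      linear_scale[OF dird_linear[OF assms, of vs]] by (simp add: sum_fun_apply)
  then show "dird F x u vs = (\<Sum>i\<in>UNIV. (u $ i) *\<^sub>R dird F x (axis i 1)) vs"
    by (simp flip: vec_expand)
qed

lemma dloc_Nil: "dloc F x [] = 0"
  by (simp add: dloc_def)

text \<open>Cartan's formula for the constant vector field v; it makes d recursive along the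
  arguments in the same way as the product.\<close>

lemma dloc_Cons: "dloc F x (v # vs) = dird F x v vs - dloc (\<lambda>y. ctr v (F y)) x vs"
  by (simp add: dloc_def dird_def sum.lessThan_Suc_shift sum_negf ctr_def del: sum.lessThan_Suc)

lemma ctr_dird: "ctr v (dird F x u) = dird (\<lambda>y. ctr v (F y)) x u"
  by (simp add: dird_def ctr_def)

text \<open>Both sides obey Cartan's recursion: contracting the right side by v,
  \<open>ctr_e\<close> yields the derivative in direction v minus the same expression for the
  contracted form. The Leibniz rule, d^2 = 0 and naturality start from this formula.\<close>

lemma dloc_eq:
  assumes "\<And>vs. linear (\<lambda>u. dird F x u vs)"
  shows "dloc F x = (\<Sum>i\<in>UNIV. wedge (form1 (axis i 1)) (dird F x (axis i 1)))"
proof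
  fix vs show "dloc F x vs = (\<Sum>i\<in>UNIV. wedge (form1 (axis i 1)) (dird F x (axis i 1))) vs"
    using assms
  proof (induction vs arbitrary: F)
    case Nil then show ?case by (simp add: dloc_Nil sum_fun_apply wedge_Nil form1_def)
  next
    case (Cons v vs)
    have "dird F x v vs = (\<Sum>i\<in>UNIV. v $ i * dird F x (axis i 1) vs)"
      using linear_sum[OF Cons.prems[of vs], of "\<lambda>i. (v $ i) *\<^sub>R axis i 1" UNIV]
      by (simp add: linear_scale[OF Cons.prems[of vs]] flip: vec_expand)
    moreover have "linear (\<lambda>u. dird (\<lambda>y. ctr v (F y)) x u ws)" for ws
      using Cons.prems[of "v # ws"] by (simp add: dird_def ctr_def)
    moreover have "(\<Sum>i\<in>UNIV. wedge (form1 (axis i 1)) (dird F x (axis i 1))) (v # vs)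
      = (\<Sum>i\<in>UNIV. ctr v (wedge (form1 (axis i 1)) (dird F x (axis i 1))) vs)"
      by (simp only: sum_fun_apply ctr_apply)
    ultimately show ?case
      by (simp add: dloc_Cons Cons.IH sum_fun_apply ctr_e inner_axis sum_subtractf ctr_dird)
  qed
qed

lemma dloc_basis:
  "sform S F \<Longrightarrow> x \<in> S \<Longrightarrow> dloc F x = (\<Sum>i\<in>UNIV. wedge (form1 (axis i 1)) (dird F x (axis i 1)))"
  using dloc_eq dird_linear by blast

lemma sform_add: "open S \<Longrightarrow> sform S F \<Longrightarrow> sform S G \<Longrightarrow> sform S (\<lambda>x. F x + G x)"
  by (simp add: sform_def altf_lin smooth_on_add)

lemma sform_scaleR: "open S \<Longrightarrow> smooth_on S f \<Longrightarrow> sform S F \<Longrightarrow> sform S (\<lambda>x. f x *\<^sub>R F x)"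
  by (simp add: sform_def altf_lin smooth_on_mult)

lemma sform_sum: "open S \<Longrightarrow> (\<And>i. i \<in> I \<Longrightarrow> sform S (F i)) \<Longrightarrow> sform S (\<lambda>x. \<Sum>i\<in>I. F i x)"
  by (simp add: sform_def altf_sum sum_fun_apply smooth_on_sum)

lemma sform_const: "a \<in> altf \<Longrightarrow> sform S (\<lambda>_. a)"
  by (simp add: sform_def smooth_on_const)

lemma sform_wedge: "open S \<Longrightarrow> sform S F \<Longrightarrow> sform S G \<Longrightarrow> sform S (\<lambda>x. wedge (F x) (G x))"
  unfolding sform_def wedge_def[abs_def]
  by (auto intro!: altf_wedge[unfolded wedge_def] smooth_on_sum smooth_on_mult smooth_on_const)

lemma sform_lenscale: "open S \<Longrightarrow> sform S F \<Longrightarrow> sform S (\<lambda>x. lenscale g (F x))"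
  by (auto simp: sform_def altf_lenscale) (auto simp: lenscale_def intro!: smooth_on_mult smooth_on_const)

text \<open>The relations that define alternating forms are linear in the form and hold throughout
  S, so they may be differentiated.\<close>

lemma altf_dird:
  assumes S: "open S" "x \<in> S" and F: "sform S F"
  shows "dird F x u \<in> altf"
proof (rule altfI)
  have d: "(\<lambda>y. F y vs) differentiable (at x)" for vs
    by (rule smooth_on_differentiable[OF sform_smooth[OF F] S(2)])
  have ml: "multilin (F y)" if "y \<in> S" for y using sform_altf[OF F that] by (rule altf_multilin)
  show "multilin (dird F x u)"
    unfolding multilin_def
  proof (intro allI linearI)
    fix us vs and v v' :: "real ^ 'a" and r :: real
    have D: "((\<lambda>y. F y ws) has_derivative (\<lambda>u. dird F x u ws)) (at x)" for ws by (rule sform_deriv[OF F S(2)])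
    have "((\<lambda>y. F y (us @ (v + v') # vs)) has_derivative (\<lambda>u. dird F x u (us @ v # vs) + dird F x u (us @ v' # vs))) (at x)"
      by (rule has_derivative_transform_within_open[OF has_derivative_add[OF D D] S])
        (simp add: linear_add[OF multilinD[OF ml]])
    from frechet_derivative_eq[OF this]
    show "dird F x u (us @ (v + v') # vs) = dird F x u (us @ v # vs) + dird F x u (us @ v' # vs)"
      by (simp add: dird_def)
    have "((\<lambda>y. F y (us @ (r *\<^sub>R v) # vs)) has_derivative (\<lambda>u. r *\<^sub>R dird F x u (us @ v # vs))) (at x)"
      by (rule has_derivative_transform_within_open[OF has_derivative_scaleR_right[OF D] S])
        (simp add: linear_scale[OF multilinD[OF ml]])
    from frechet_derivative_eq[OF this]
    show "dird F x u (us @ (r *\<^sub>R v) # vs) = r *\<^sub>R dird F x u (us @ v # vs)"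
      by (simp add: dird_def)
  qed
  show "dird F x u (us @ v # v # vs) = 0" for us v vs
  proof -
    have "((\<lambda>y. F y (us @ v # v # vs)) has_derivative (\<lambda>_. 0)) (at x)"
      by (rule has_derivative_transform_within_open[OF has_derivative_const[of 0] S])
        (simp add: altf_repeat[OF sform_altf[OF F]])
    then show ?thesis by (simp add: dird_def frechet_derivative_eq)
  qed
qed

lemma sform_dird: "open S \<Longrightarrow> sform S F \<Longrightarrow> sform S (\<lambda>x. dird F x u)"
  by (simp add: sform_def[of S "\<lambda>x. dird F x u"] altf_dird) (simp add: dird_def smooth_on_deriv sform_smooth)

lemma sform_dloc: "open S \<Longrightarrow> sform S F \<Longrightarrow> sform S (dloc F)"
proof -
  assume S: "open S" and F: "sform S F"
  have "sform S (\<lambda>x. \<Sum>i\<in>UNIV. wedge (form1 (axis i 1)) (dird F x (axis i 1)))"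
    by (intro sform_sum sform_wedge sform_const altf_form1 sform_dird S F)
  then show ?thesis
    using dloc_basis[OF F] smooth_on_cong[OF S] unfolding sform_def by (metis (no_types, lifting))
qed

lemma dird_wedge:
  assumes F: "sform S F" and G: "sform S G" and x: "x \<in> S"
  shows "dird (\<lambda>y. wedge (F y) (G y)) x u = wedge (dird F x u) (G x) + wedge (F x) (dird G x u)"
proof (rule dird_eqI)
  fix vs
  note [derivative_intros] = sform_deriv[OF F x] sform_deriv[OF G x]
  show "((\<lambda>y. wedge (F y) (G y) vs) has_derivative (\<lambda>u. (wedge (dird F x u) (G x) + wedge (F x) (dird G x u)) vs)) (at x)"
    unfolding wedge_def plus_fun_apply
    by (rule derivative_eq_intros refl | simp)+ (simp add: fun_eq_iff algebra_simps sum.distrib)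
qed

lemma dird_const: "dird (\<lambda>_. a) x u = 0"
  by (auto simp: dird_def fun_eq_iff frechet_derivative_eq[OF has_derivative_const])

lemma e_parity: "wedge (form1 u) a = wedge (parity a) (form1 u)"
proof
  fix vs show "wedge (form1 u) a vs = wedge (parity a) (form1 u) vs"
    by (induction vs arbitrary: a)
      (simp_all add: wedge_Nil wedge_Cons ctr_form1 parity_form1 ctr_parity wedge_linear, simp add: form1_def)
qed

lemma dloc_wedge:
  assumes S: "open S" "x \<in> S" and F: "sform S F" and G: "sform S G"
  shows "dloc (\<lambda>y. wedge (F y) (G y)) x = wedge (dloc F x) (G x) + wedge (parity (F x)) (dloc G x)"
proof -
  have "dloc (\<lambda>y. wedge (F y) (G y)) x
    = (\<Sum>i\<in>UNIV. wedge (form1 (axis i 1)) (wedge (dird F x (axis i 1)) (G x)) + wedge (form1 (axis i 1)) (wedge (F x) (dird G x (axis i 1))))"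
    by (simp only: dloc_basis[OF sform_wedge[OF S(1) F G] S(2)] dird_wedge[OF F G S(2)] wedge_add_right)
  also have "\<dots> = (\<Sum>i\<in>UNIV. wedge (wedge (form1 (axis i 1)) (dird F x (axis i 1))) (G x)
      + wedge (parity (F x)) (wedge (form1 (axis i 1)) (dird G x (axis i 1))))"
    by (simp only: wedge_assoc[symmetric] e_parity[of _ "F x"])
  finally show ?thesis
    by (simp only: dloc_basis[OF F S(2)] dloc_basis[OF G S(2)] sum.distrib wedge_sum_left wedge_sum_right)
qed

text \<open>Two covectors anticommute, so a symmetric array cancels. It is applied to second
  derivatives, both for d^2 = 0 and for naturality.\<close>

lemma e_e_symmetric_sum:
  fixes X :: "'n \<Rightarrow> 'n \<Rightarrow> ('n::finite) ext"
  assumes "\<And>i j. X i j = X j i"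
  shows "(\<Sum>i\<in>UNIV. \<Sum>j\<in>UNIV. wedge (form1 (axis i 1)) (wedge (form1 (axis j 1)) (X i j))) = 0" (is "?A = 0")
proof -
  have "?A = (\<Sum>i\<in>UNIV. \<Sum>j\<in>UNIV. - wedge (form1 (axis i 1)) (wedge (form1 (axis j 1)) (X i j)))"
    by (subst sum.swap, intro sum.cong refl, subst e_e, subst assms, rule refl)
  also have "\<dots> = - ?A" by (simp only: sum_negf)
  finally have "?A = - ?A" .
  then have "2 *\<^sub>R ?A = 0" by (simp add: scaleR_2)
  then show ?thesis by simp
qed

lemma dloc_dloc:
  assumes S: "open S" "x \<in> S" and F: "sform S F"
  shows "dloc (dloc F) x = 0"
proof -
  have e: "sform S (\<lambda>_. form1 (axis j 1))" for j by (rule sform_const[OF altf_form1])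
  have D: "sform S (\<lambda>y. dird F y (axis j 1))" for j by (rule sform_dird[OF S(1) F])
  have G: "sform S (\<lambda>y. \<Sum>j\<in>UNIV. wedge (form1 (axis j 1)) (dird F y (axis j 1)))"
    by (intro sform_sum sform_wedge S e D)
  have inner: "dird (\<lambda>y. \<Sum>j\<in>UNIV. wedge (form1 (axis j 1)) (dird F y (axis j 1))) x u
    = (\<Sum>j\<in>UNIV. wedge (form1 (axis j 1)) (dird (\<lambda>y. dird F y (axis j 1)) x u))" for u
  proof -
    have "dird (\<lambda>y. \<Sum>j\<in>UNIV. wedge (form1 (axis j 1)) (dird F y (axis j 1))) x u
      = (\<Sum>j\<in>UNIV. dird (\<lambda>y. wedge (form1 (axis j 1)) (dird F y (axis j 1))) x u)"
    proof (rule dird_eqI)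
      fix vs
      show "((\<lambda>y. (\<Sum>j\<in>UNIV. wedge (form1 (axis j 1)) (dird F y (axis j 1))) vs) has_derivative
          (\<lambda>u. (\<Sum>j\<in>UNIV. dird (\<lambda>y. wedge (form1 (axis j 1)) (dird F y (axis j 1))) x u) vs)) (at x)"
        unfolding sum_fun_apply by (rule has_derivative_sum) (rule sform_deriv[OF sform_wedge[OF S(1) e D] S(2)])
    qed
    then show ?thesis by (simp only: dird_wedge[OF e D S(2)] dird_const wedge_zero add_0_left)
  qed
  have "dloc (dloc F) x = dloc (\<lambda>y. \<Sum>j\<in>UNIV. wedge (form1 (axis j 1)) (dird F y (axis j 1))) x"
    by (rule dloc_cong[OF S _ G]) (simp add: dloc_basis[OF F])
  also have "\<dots> = (\<Sum>i\<in>UNIV. wedge (form1 (axis i 1)) (dird (\<lambda>y. \<Sum>j\<in>UNIV. wedge (form1 (axis j 1)) (dird F y (axis j 1))) x (axis i 1)))"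
    by (rule dloc_basis[OF G S(2)])
  also have "\<dots> = (\<Sum>i\<in>UNIV. wedge (form1 (axis i 1)) (\<Sum>j\<in>UNIV. wedge (form1 (axis j 1)) (dird (\<lambda>y. dird F y (axis j 1)) x (axis i 1))))"
    by (simp only: inner)
  also have "(\<Sum>i\<in>UNIV. wedge (form1 (axis i 1)) (\<Sum>j\<in>UNIV. wedge (form1 (axis j 1)) (dird (\<lambda>y. dird F y (axis j 1)) x (axis i 1)))) = 0"
    unfolding wedge_sum_right
    by (rule e_e_symmetric_sum) (simp add: dird_def second_derivative_symmetric[OF S sform_smooth[OF F]])
  finally show ?thesis .
qed

section \<open>Naturality of the exterior derivative\<close>

text \<open>The product rule when the form and the linear map both vary. Differentiating the map in
  one argument slot gives the covector with value \<open>D v m u\<close> on v, times the pullback of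
  the form contracted by the m-th basis vector; the induction treats one slot at a time.\<close>

lemma has_derivative_pull:
  fixes F :: "'a::real_normed_vector \<Rightarrow> ('n::finite) ext"
  assumes S: "open S" "x \<in> S"
    and T: "\<And>v m. ((\<lambda>y. T y v $ m) has_derivative D v m) (at x)"
    and F: "\<And>vs. ((\<lambda>y. F y vs) has_derivative (\<lambda>u. F' u vs)) (at x)"
    and alt: "\<And>y. y \<in> S \<Longrightarrow> F y \<in> altf" and F': "\<And>u. multilin (F' u)"
  shows "((\<lambda>y. pull (T y) (F y) vs) has_derivative
    (\<lambda>u. (pull (T x) (F' u) + (\<Sum>m\<in>UNIV. wedge (\<lambda>ws. if length ws = 1 then D (hd ws) m u else 0)
      (pull (T x) (ctr (axis m 1) (F x))))) vs)) (at x)"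
  using F alt F'
proof (induction vs arbitrary: F F')
  case Nil
  then show ?case by (simp add: pull_def sum_fun_apply wedge_Nil)
next
  case (Cons v vs)
  define q where "q m u = (\<lambda>ws :: (real ^ 'n) list. if length ws = 1 then D (hd ws) m u else 0)" for m u
  have IH: "((\<lambda>y. pull (T y) (ctr (axis l 1) (F y)) vs) has_derivative
      (\<lambda>u. (pull (T x) (ctr (axis l 1) (F' u)) + (\<Sum>m\<in>UNIV. wedge (q m u) (pull (T x) (ctr (axis m 1) (ctr (axis l 1) (F x)))))) vs)) (at x)" for l
    unfolding q_def
    by (rule Cons.IH) (use Cons.prems in \<open>auto simp: altf_ctr multilin_ctr\<close>, simp add: ctr_def)
  have "((\<lambda>y. \<Sum>l\<in>UNIV. T y v $ l * pull (T y) (ctr (axis l 1) (F y)) vs) has_derivative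
     (\<lambda>u. \<Sum>l\<in>UNIV. T x v $ l * (pull (T x) (ctr (axis l 1) (F' u)) + (\<Sum>m\<in>UNIV. wedge (q m u) (pull (T x) (ctr (axis m 1) (ctr (axis l 1) (F x)))))) vs
        + D v l u * pull (T x) (ctr (axis l 1) (F x)) vs)) (at x)"
    by (intro has_derivative_sum has_derivative_mult T IH)
  moreover have "(\<Sum>l\<in>UNIV. T y v $ l * pull (T y) (ctr (axis l 1) (F y)) vs) = pull (T y) (F y) (v # vs)" if "y \<in> S" for y
  proof -
    have "ctr (T y v) (F y) (map (T y) vs) = (\<Sum>l\<in>UNIV. T y v $ l * ctr (axis l 1) (F y) (map (T y) vs))"
      by (subst ctr_expand[OF altf_multilin[OF Cons.prems(2)[OF that]]]) (simp add: sum_fun_apply)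
    then show ?thesis by (simp add: pull_def ctr_def)
  qed
  moreover have "(\<Sum>l\<in>UNIV. T x v $ l * (pull (T x) (ctr (axis l 1) (F' u)) + (\<Sum>m\<in>UNIV. wedge (q m u) (pull (T x) (ctr (axis m 1) (ctr (axis l 1) (F x)))))) vs
        + D v l u * pull (T x) (ctr (axis l 1) (F x)) vs)
     = (pull (T x) (F' u) + (\<Sum>m\<in>UNIV. wedge (q m u) (pull (T x) (ctr (axis m 1) (F x))))) (v # vs)" for u
  proof -
    have c: "ctr v (wedge (q m u) a) = D v m u *\<^sub>R a - wedge (q m u) (ctr v a)" for m a
    proof -
      have "ctr v (q m u) = D v m u *\<^sub>R unit_ext" "parity (q m u) = - q m u"
        by (auto simp: q_def ctr_def parity_def unit_ext_def fun_eq_iff)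
      then show ?thesis by (simp add: ctr_wedge wedge_linear)
    qed
    have F2: "pull (T x) (F' u) (v # vs) = (\<Sum>l\<in>UNIV. T x v $ l * pull (T x) (ctr (axis l 1) (F' u)) vs)"
    proof -
      have "pull (T x) (F' u) (v # vs) = ctr (T x v) (F' u) (map (T x) vs)" by (simp add: pull_def ctr_def)
      also have "\<dots> = (\<Sum>l\<in>UNIV. T x v $ l * ctr (axis l 1) (F' u) (map (T x) vs))"
        by (subst ctr_expand[OF Cons.prems(3)]) (simp add: sum_fun_apply)
      finally show ?thesis by (simp add: pull_def)
    qed
    have Fx: "F x \<in> altf" using Cons.prems(2) S by blast
    have "ctr v (pull (T x) (ctr (axis m 1) (F x))) = - (\<Sum>l\<in>UNIV. (T x v $ l) *\<^sub>R pull (T x) (ctr (axis m 1) (ctr (axis l 1) (F x))))" for m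
    proof -
      have "ctr v (pull (T x) (ctr (axis m 1) (F x))) = - pull (T x) (ctr (axis m 1) (ctr (T x v) (F x)))"
        by (simp only: ctr_pull ctr_ctr[OF Fx, of "T x v"] pull_linear)
      also have "ctr (T x v) (F x) = (\<Sum>l\<in>UNIV. (T x v $ l) *\<^sub>R ctr (axis l 1) (F x))"
        by (rule ctr_expand[OF altf_multilin[OF Fx]])
      finally show ?thesis by (simp only: ctr_sum ctr_linear pull_sum pull_linear)
    qed
    moreover have "(\<Sum>m\<in>UNIV. wedge (q m u) (pull (T x) (ctr (axis m 1) (F x)))) (v # vs)
      = (\<Sum>m\<in>UNIV. ctr v (wedge (q m u) (pull (T x) (ctr (axis m 1) (F x)))) vs)"
      by (simp only: sum_fun_apply ctr_apply)
    ultimately have "(\<Sum>m\<in>UNIV. wedge (q m u) (pull (T x) (ctr (axis m 1) (F x)))) (v # vs)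
      = (\<Sum>m\<in>UNIV. D v m u * pull (T x) (ctr (axis m 1) (F x)) vs
         + (\<Sum>l\<in>UNIV. T x v $ l * wedge (q m u) (pull (T x) (ctr (axis m 1) (ctr (axis l 1) (F x)))) vs))"
      by (simp add: sum_fun_apply c wedge_linear wedge_sum_right)
    then show ?thesis
      unfolding plus_fun_apply F2
      by (simp add: sum.distrib algebra_simps sum_fun_apply sum_distrib_left) (rule sum.swap)
  qed
  ultimately show ?case
    unfolding q_def[symmetric] by (simp only:) (rule has_derivative_transform_within_open[OF _ S])
qed

text \<open>Differentiating the Jacobian contributes second derivatives of \<phi>, which are
  symmetric in their two directions and cancel in the product; what remains is the chain rule for
  the first derivatives of F.\<close>

lemma dloc_pull:
  fixes \<phi> :: "real ^ 'n \<Rightarrow> real ^ 'n::finite"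
  assumes S: "open S" "x \<in> S" and S': "open S'" and \<phi>: "smooth_on S \<phi>" "\<phi> ` S \<subseteq> S'"
    and F: "sform S' F" and G: "sform S G"
    and pull: "\<And>y. y \<in> S \<Longrightarrow> G y = pull (frechet_derivative \<phi> (at y)) (F (\<phi> y))"
  shows "dloc G x = pull (frechet_derivative \<phi> (at x)) (dloc F (\<phi> x))"
proof -
  define T where "T y = frechet_derivative \<phi> (at y)" for y
  define D where "D v m u = frechet_derivative (\<lambda>y. T y v $ m) (at x) u" for v m u
  define X where "X m = pull (T x) (ctr (axis m 1) (F (\<phi> x)))" for m
  have Tder: "(\<phi> has_derivative T y) (at y)" if "y \<in> S" for y
    unfolding T_def by (rule smooth_on_has_derivative[OF \<phi>(1) that])
  have lin: "linear (T x)" using Tder[OF S(2)] by (rule has_derivative_linear)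
  have x': "\<phi> x \<in> S'" using \<phi>(2) S(2) by auto
  have comp: "smooth_on S (\<lambda>z. \<phi> z $ m)" for m
    by (rule smooth_on_linear[OF S(1) bounded_linear_vec_nth \<phi>(1)])
  have sT: "smooth_on S (\<lambda>y. T y v $ m)" for v m
    unfolding T_def by (rule smooth_on_linear[OF S(1) bounded_linear_vec_nth smooth_on_deriv[OF \<phi>(1)]])
  have Dder: "((\<lambda>y. T y v $ m) has_derivative D v m) (at x)" for v m
    using smooth_on_has_derivative[OF sT S(2)] unfolding D_def[abs_def] .
  have Tm: "frechet_derivative (\<lambda>z. \<phi> z $ m) (at y) v = T y v $ m" if "y \<in> S" for y v m
    by (rule fun_cong[OF frechet_derivative_eq[OF bounded_linear.has_derivative[OF bounded_linear_vec_nth Tder[OF that]]]])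
  have "D v m u = frechet_derivative (\<lambda>y. frechet_derivative (\<lambda>z. \<phi> z $ m) (at y) v) (at x) u" for v m u
    unfolding D_def
    by (rule fun_cong[OF frechet_derivative_cong_open(2)[OF S _ smooth_on_differentiable[OF smooth_on_deriv[OF comp] S(2)]]])
      (simp add: Tm)
  then have sym: "D v m u = D u m v" for v m u
    by (simp add: second_derivative_symmetric[OF S comp, where u = v and v = u])
  have Dlin: "linear (\<lambda>v. D v m u)" for m u
    using has_derivative_linear[OF Dder[of u m]] by (simp add: sym[of _ m u])
  have q: "(\<lambda>ws. if length ws = 1 then D (hd ws) m u else 0) = (\<Sum>j\<in>UNIV. D (axis j 1) m u *\<^sub>R form1 (axis j 1))" for m u
  proof
    fix ws :: "(real ^ 'n) list"
    have "D (hd ws) m u = (\<Sum>j\<in>UNIV. hd ws $ j * D (axis j 1) m u)"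
      using linear_sum[OF Dlin[of m u], of "\<lambda>j. (hd ws $ j) *\<^sub>R axis j 1" UNIV]
      by (simp add: linear_scale[OF Dlin[of m u]] flip: vec_expand)
    then show "(if length ws = 1 then D (hd ws) m u else 0) = (\<Sum>j\<in>UNIV. D (axis j 1) m u *\<^sub>R form1 (axis j 1)) ws"
      by (simp add: sum_fun_apply form1_def inner_axis mult.commute)
  qed
  have dG: "dird G x u = pull (T x) (dird F (\<phi> x) (T x u)) + (\<Sum>m\<in>UNIV. wedge (\<Sum>j\<in>UNIV. D (axis j 1) m u *\<^sub>R form1 (axis j 1)) (X m))" for u
    unfolding q[symmetric] X_def
  proof (rule dird_eqI)
    fix vs
    have h: "((\<lambda>y. F (\<phi> y) ws) has_derivative (\<lambda>u. dird F (\<phi> x) (T x u) ws)) (at x)" for ws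
      using diff_chain_at[OF Tder[OF S(2)] sform_deriv[OF F x', of ws]] by (simp add: o_def)
    have al: "F (\<phi> y) \<in> altf" if "y \<in> S" for y using \<phi>(2) sform_altf[OF F] that by blast
    have ml: "multilin (dird F (\<phi> x) (T x u))" for u by (rule altf_multilin[OF altf_dird[OF S' x' F]])
    have "((\<lambda>y. pull (T y) (F (\<phi> y)) vs) has_derivative (\<lambda>u. (pull (T x) (dird F (\<phi> x) (T x u)) +
       (\<Sum>m\<in>UNIV. wedge (\<lambda>ws. if length ws = 1 then D (hd ws) m u else 0) (pull (T x) (ctr (axis m 1) (F (\<phi> x)))))) vs)) (at x)"
      by (rule has_derivative_pull[where T = T and D = D and F = "\<lambda>y. F (\<phi> y)" and F' = "\<lambda>u. dird F (\<phi> x) (T x u)", OF S Dder h])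
        (erule al, rule ml)
    then show "((\<lambda>y. G y vs) has_derivative (\<lambda>u. (pull (T x) (dird F (\<phi> x) (T x u)) +
       (\<Sum>m\<in>UNIV. wedge (\<lambda>ws. if length ws = 1 then D (hd ws) m u else 0) (pull (T x) (ctr (axis m 1) (F (\<phi> x)))))) vs)) (at x)"
      by (rule has_derivative_transform_within_open[OF _ S]) (simp add: pull T_def)
  qed
  have z: "(\<Sum>i\<in>UNIV. wedge (form1 (axis i 1)) (\<Sum>m\<in>UNIV. wedge (\<Sum>j\<in>UNIV. D (axis j 1) m (axis i 1) *\<^sub>R form1 (axis j 1)) (X m))) = 0"
  proof -
    have "(\<Sum>i\<in>UNIV. wedge (form1 (axis i 1)) (\<Sum>m\<in>UNIV. wedge (\<Sum>j\<in>UNIV. D (axis j 1) m (axis i 1) *\<^sub>R form1 (axis j 1)) (X m)))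
      = (\<Sum>m\<in>UNIV. \<Sum>i\<in>UNIV. \<Sum>j\<in>UNIV. wedge (form1 (axis i 1)) (wedge (form1 (axis j 1)) (D (axis j 1) m (axis i 1) *\<^sub>R X m)))"
      unfolding wedge_sum_left wedge_sum_right wedge_scaleR_left wedge_scaleR_right by (rule sum.swap)
    also have "\<dots> = (\<Sum>m\<in>(UNIV::'n set). 0)"
      by (intro sum.cong refl e_e_symmetric_sum) (simp add: sym)
    finally show ?thesis by simp
  qed
  have p1: "pull (T x) (form1 (axis j 1)) = (\<Sum>i\<in>UNIV. (T x (axis i 1) $ j) *\<^sub>R form1 (axis i 1))" for j
  proof
    fix ws :: "(real ^ 'n) list"
    show "pull (T x) (form1 (axis j 1)) ws = (\<Sum>i\<in>UNIV. (T x (axis i 1) $ j) *\<^sub>R form1 (axis i 1)) ws"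
    proof (cases "length ws = 1")
      case True
      then obtain v where ws: "ws = [v]" by (auto simp: length_Suc_conv)
      have "T x v = (\<Sum>i\<in>UNIV. v $ i *\<^sub>R T x (axis i 1))"
        using linear_sum[OF lin, of "\<lambda>i. (v $ i) *\<^sub>R axis i 1" UNIV]
        by (simp add: linear_scale[OF lin] flip: vec_expand)
      then show ?thesis
        by (simp add: ws pull_def form1_def sum_fun_apply inner_axis mult.commute)
    next
      case False then show ?thesis by (simp add: pull_def form1_def sum_fun_apply)
    qed
  qed
  have "dloc G x = (\<Sum>i\<in>UNIV. wedge (form1 (axis i 1)) (pull (T x) (dird F (\<phi> x) (T x (axis i 1)))))"
    unfolding dloc_basis[OF G S(2)] dG wedge_add_right sum.distrib z by simp
  also have "\<dots> = (\<Sum>i\<in>UNIV. \<Sum>j\<in>UNIV. (T x (axis i 1) $ j) *\<^sub>R wedge (form1 (axis i 1)) (pull (T x) (dird F (\<phi> x) (axis j 1))))"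
    by (subst dird_expand[OF F x']) (simp add: pull_sum wedge_sum_right wedge_scaleR_right)
  also have "\<dots> = (\<Sum>j\<in>UNIV. wedge (pull (T x) (form1 (axis j 1))) (pull (T x) (dird F (\<phi> x) (axis j 1))))"
    unfolding p1 wedge_sum_left wedge_scaleR_left by (rule sum.swap)
  also have "\<dots> = pull (T x) (dloc F (\<phi> x))"
    by (simp only: dloc_basis[OF F x'] pull_sum wedge_pull)
  finally show ?thesis by (simp add: T_def)
qed

text \<open>A is constant and only the linear map varies; expanding each argument in the basis shows
  the value as a polynomial in components of the map.\<close>

lemma smooth_pull:
  fixes T :: "real ^ 'n \<Rightarrow> real ^ 'n \<Rightarrow> real ^ 'n::finite"
  assumes S: "open S" and T: "\<And>v m. smooth_on S (\<lambda>x. T x v $ m)" and A: "A \<in> altf"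
  shows "smooth_on S (\<lambda>x. pull (T x) A vs)"
  using A
proof (induction vs arbitrary: A)
  case Nil then show ?case by (simp add: pull_def smooth_on_const)
next
  case (Cons v vs)
  have "pull (T x) A (v # vs) = (\<Sum>l\<in>UNIV. T x v $ l * pull (T x) (ctr (axis l 1) A) vs)" for x
  proof -
    have "pull (T x) A (v # vs) = ctr (T x v) A (map (T x) vs)" by (simp add: pull_def ctr_def)
    also have "\<dots> = (\<Sum>l\<in>UNIV. T x v $ l * ctr (axis l 1) A (map (T x) vs))"
      by (subst ctr_expand[OF altf_multilin[OF Cons.prems]]) (simp add: sum_fun_apply)
    finally show ?thesis by (simp add: pull_def)
  qed
  then show ?case
    by (simp add: smooth_on_sum[OF S] smooth_on_mult[OF S] T Cons.IH altf_ctr Cons.prems)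
qed

lemma sform_subset: "sform S F \<Longrightarrow> T \<subseteq> S \<Longrightarrow> sform T F"
  unfolding sform_def using smooth_on_subset by blast

lemma sform_cong:
  assumes "open S" "\<And>x. x \<in> S \<Longrightarrow> F x = G x" "sform S F" shows "sform S G"
  unfolding sform_def
proof (intro conjI ballI allI)
  show "G x \<in> altf" if "x \<in> S" for x using assms that by (metis sform_altf)
  show "smooth_on S (\<lambda>x. G x vs)" for vs
    by (rule smooth_on_cong[OF assms(1) _ sform_smooth[OF assms(3), of vs]]) (simp add: assms(2))
qed

lemma dloc_add: 
  assumes "sform S F" "sform S G" "x \<in> S" shows "dloc (\<lambda>y. F y + G y) x = dloc F x + dloc G x"
proof -
  have "frechet_derivative (\<lambda>y. (F y + G y) vs) (at x) = (\<lambda>u. frechet_derivative (\<lambda>y. F y vs) (at x) u + frechet_derivative (\<lambda>y. G y vs) (at x) u)" for vs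
    unfolding plus_fun_apply
    by (rule frechet_derivative_eq[OF has_derivative_add[OF
      smooth_on_has_derivative[OF sform_smooth[OF assms(1)] assms(3)] smooth_on_has_derivative[OF sform_smooth[OF assms(2)] assms(3)]]])
  then show ?thesis by (simp add: dloc_def fun_eq_iff sum.distrib algebra_simps)
qed

lemma dloc_scaleR: 
  assumes "sform S F" "x \<in> S" shows "dloc (\<lambda>y. r *\<^sub>R F y) x = r *\<^sub>R dloc F x"
proof -
  have "frechet_derivative (\<lambda>y. (r *\<^sub>R F y) vs) (at x) = (\<lambda>u. r *\<^sub>R frechet_derivative (\<lambda>y. F y vs) (at x) u)" for vs
    unfolding scaleR_fun_apply
    by (rule frechet_derivative_eq[OF has_derivative_scaleR_right[OF smooth_on_has_derivative[OF sform_smooth[OF assms(1)] assms(2)]]])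
  then show ?thesis by (simp add: dloc_def fun_eq_iff sum_distrib_left algebra_simps)
qed

lemma dloc_in_ext:
  assumes S: "open S" "x \<in> S" and F: "sform S F" "\<And>y. y \<in> S \<Longrightarrow> F y \<in> ext k"
  shows "dloc F x \<in> ext (Suc k)"
proof -
  have "dird F x u \<in> ext k" for u
    unfolding ext_iff
  proof (intro conjI allI impI)
    show "dird F x u \<in> altf" by (rule altf_dird[OF S F(1)])
    fix vs :: "(real ^ 'a) list" assume l: "length vs \<noteq> k"
    have "((\<lambda>y. F y vs) has_derivative (\<lambda>_. 0)) (at x)"
      by (rule has_derivative_transform_within_open[OF has_derivative_const[of 0] S])
        (use F(2) l in \<open>auto simp: ext_iff\<close>)
    then show "dird F x u vs = 0" by (simp add: dird_def frechet_derivative_eq)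
  qed
  then show ?thesis unfolding dloc_basis[OF F(1) S(2)] by (intro ext_sum e_in_ext)
qed

section \<open>Charts and transition maps\<close>

definition overlap :: "('m, 'n::finite) chart \<Rightarrow> ('m, 'n) chart \<Rightarrow> (real ^ 'n) set"
  where "overlap c c' = snd c ` (chart_dom c \<inter> chart_dom c')"

lemma chart_inj:
  assumes "smooth_manifold M" "c \<in> M" shows "inj_on (snd c) (chart_dom c)"
proof -
  obtain g where "homeomorphism (chart_dom c) (chart_rng c) (snd c) g"
    using assms by (auto simp: smooth_manifold_def)
  then have "g (snd c p) = p" if "p \<in> chart_dom c" for p
    using that by (simp add: homeomorphism_def)
  then show ?thesis by (rule inj_on_inverseI)
qed

lemma open_chart_image:
  assumes M: "smooth_manifold M" "c \<in> M" and U: "open U" "U \<subseteq> chart_dom c"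
  shows "open (snd c ` U)"
proof -
  obtain g where h: "homeomorphism (chart_dom c) (chart_rng c) (snd c) g" and o: "open (chart_rng c)"
    using M by (auto simp: smooth_manifold_def)
  have "openin (top_of_set (chart_dom c)) U" using U by (auto simp: openin_open intro!: exI[of _ U])
  then have "openin (top_of_set (chart_rng c)) (snd c ` U)"
    using homeomorphism_imp_open_map[OF h] by blast
  then show ?thesis using o openin_open_trans by blast
qed

lemma open_chart_dom: "smooth_manifold M \<Longrightarrow> c \<in> M \<Longrightarrow> open (chart_dom c)"
  by (simp add: smooth_manifold_def)

lemma open_chart_rng: "smooth_manifold M \<Longrightarrow> c \<in> M \<Longrightarrow> open (chart_rng c)"
  by (simp add: smooth_manifold_def)

lemma chart_rng_eq: "chart_rng c = snd c ` chart_dom c"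
  by (simp add: chart_rng_def chart_dom_def)

lemma open_overlap: "smooth_manifold M \<Longrightarrow> c \<in> M \<Longrightarrow> c' \<in> M \<Longrightarrow> open (overlap c c')"
  unfolding overlap_def by (intro open_chart_image open_Int open_chart_dom) auto

lemma overlap_subset: "overlap c c' \<subseteq> chart_rng c"
  by (auto simp: overlap_def chart_rng_eq)

lemma transition_eq:
  assumes "smooth_manifold M" "c \<in> M" "p \<in> chart_dom c"
  shows "transition c c' (snd c p) = snd c' p"
  using inv_into_f_f[OF chart_inj[OF assms(1,2)] assms(3)] by (simp add: transition_def)

lemma transition_image:
  assumes "smooth_manifold M" "c \<in> M" shows "transition c c' ` overlap c c' \<subseteq> chart_rng c'"
proof
  fix y assume "y \<in> transition c c' ` overlap c c'"
  then obtain p where "y = transition c c' (snd c p)" "p \<in> chart_dom c" "p \<in> chart_dom c'"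
    by (auto simp: overlap_def)
  then show "y \<in> chart_rng c'" using transition_eq[OF assms, of p c'] by (simp add: chart_rng_eq)
qed

lemma smooth_transition:
  "smooth_manifold M \<Longrightarrow> c \<in> M \<Longrightarrow> c' \<in> M \<Longrightarrow> smooth_on (overlap c c') (transition c c')"
  by (simp add: smooth_manifold_def overlap_def)

abbreviation jac :: "('m, 'n::finite) chart \<Rightarrow> ('m, 'n) chart \<Rightarrow> real ^ 'n \<Rightarrow> real ^ 'n \<Rightarrow> real ^ 'n"
  where "jac c c' x \<equiv> frechet_derivative (transition c c') (at x)"

lemma jac_derivative:
  assumes "smooth_manifold M" "c \<in> M" "c' \<in> M" "x \<in> overlap c c'"
  shows "(transition c c' has_derivative jac c c' x) (at x)"
  by (rule smooth_on_has_derivative[OF smooth_transition[OF assms(1-3)] assms(4)])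

lemma jac_linear:
  assumes "smooth_manifold M" "c \<in> M" "c' \<in> M" "x \<in> overlap c c'"
  shows "linear (jac c c' x)"
  using jac_derivative[OF assms] by (rule has_derivative_linear)

text \<open>The cocycle rule, which makes a form transported out of one chart compatible in all the
  others.\<close>

lemma jac_chain:
  assumes M: "smooth_manifold M" "c \<in> M" "c' \<in> M" "c'' \<in> M"
    and p: "p \<in> chart_dom c" "p \<in> chart_dom c'" "p \<in> chart_dom c''"
  shows "jac c c'' (snd c p) = jac c' c'' (snd c' p) \<circ> jac c c' (snd c p)"
proof -
  have o: "open (snd c ` (chart_dom c \<inter> chart_dom c' \<inter> chart_dom c''))"
    by (intro open_chart_image[OF M(1,2)] open_Int open_chart_dom[OF M(1)] M) auto
  have "(transition c c' has_derivative jac c c' (snd c p)) (at (snd c p))"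
    by (rule jac_derivative[OF M(1-3)]) (use p in \<open>auto simp: overlap_def\<close>)
  moreover have "(transition c' c'' has_derivative jac c' c'' (snd c' p)) (at (transition c c' (snd c p)))"
    unfolding transition_eq[OF M(1,2) p(1)]
    by (rule jac_derivative[OF M(1,3,4)]) (use p in \<open>auto simp: overlap_def\<close>)
  ultimately have "(transition c' c'' \<circ> transition c c' has_derivative jac c' c'' (snd c' p) \<circ> jac c c' (snd c p)) (at (snd c p))"
    by (rule diff_chain_at)
  then have "(transition c c'' has_derivative jac c' c'' (snd c' p) \<circ> jac c c' (snd c p)) (at (snd c p))"
    by (rule has_derivative_transform_within_open[OF _ o])
      (use p in \<open>auto simp: transition_eq[OF M(1,2)] transition_eq[OF M(1,3)]\<close>)
  then show ?thesis by (rule frechet_derivative_eq)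
qed

lemma jac_self:
  assumes M: "smooth_manifold M" "c \<in> M" and p: "p \<in> chart_dom c"
  shows "jac c c (snd c p) = id"
proof -
  have "(transition c c has_derivative id) (at (snd c p))"
    by (rule has_derivative_transform_within_open[OF has_derivative_id open_chart_rng[OF M]])
      (use p in \<open>auto simp: chart_rng_eq transition_eq[OF M]\<close>)
  then show ?thesis by (rule frechet_derivative_eq)
qed

section \<open>The total space of the de Rham algebra\<close>

text \<open>Inhomogeneous differential forms. They turn out to be the total space of the graded
  algebra (\<open>total_space_deRham\<close>), so membership and linearity can be treated without
  degrees.\<close>

definition allforms :: "('m, 'n::finite) chart set \<Rightarrow> ('m, 'n) dform set"
  where "allforms M = {\<alpha>.
    (\<forall>c x. c \<notin> M \<or> x \<notin> chart_rng c \<longrightarrow> \<alpha> c x = 0) \<and>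
    (\<forall>c\<in>M. sform (chart_rng c) (\<alpha> c)) \<and>
    (\<forall>c\<in>M. \<forall>c'\<in>M. \<forall>p\<in>chart_dom c \<inter> chart_dom c'.
       \<alpha> c (snd c p) = pull (jac c c' (snd c p)) (\<alpha> c' (snd c' p)))}"

lemma allformsI:
  assumes "\<And>c x. c \<notin> M \<or> x \<notin> chart_rng c \<Longrightarrow> \<alpha> c x = 0"
    and "\<And>c. c \<in> M \<Longrightarrow> sform (chart_rng c) (\<alpha> c)"
    and "\<And>c c' p. c \<in> M \<Longrightarrow> c' \<in> M \<Longrightarrow> p \<in> chart_dom c \<Longrightarrow> p \<in> chart_dom c' \<Longrightarrow>
       \<alpha> c (snd c p) = pull (jac c c' (snd c p)) (\<alpha> c' (snd c' p))"
  shows "\<alpha> \<in> allforms M"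
  unfolding allforms_def mem_Collect_eq
  by (intro conjI allI ballI impI) (erule assms(1), erule assms(2), erule IntE, rule assms(3))

lemma allforms_off:
  assumes "\<alpha> \<in> allforms M" "c \<notin> M \<or> x \<notin> chart_rng c" shows "\<alpha> c x = 0"
proof -
  have "\<forall>c x. c \<notin> M \<or> x \<notin> chart_rng c \<longrightarrow> \<alpha> c x = 0"
    using assms(1) unfolding allforms_def mem_Collect_eq by (elim conjE)
  then show ?thesis using assms(2) by blast
qed

lemma allforms_sform: "\<alpha> \<in> allforms M \<Longrightarrow> c \<in> M \<Longrightarrow> sform (chart_rng c) (\<alpha> c)"
  unfolding allforms_def mem_Collect_eq by (elim conjE) (rule bspec)

lemma allforms_pull:
  assumes "\<alpha> \<in> allforms M" "c \<in> M" "c' \<in> M" "p \<in> chart_dom c" "p \<in> chart_dom c'"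
  shows "\<alpha> c (snd c p) = pull (jac c c' (snd c p)) (\<alpha> c' (snd c' p))"
proof -
  have "\<forall>c\<in>M. \<forall>c'\<in>M. \<forall>p\<in>chart_dom c \<inter> chart_dom c'.
       \<alpha> c (snd c p) = pull (jac c c' (snd c p)) (\<alpha> c' (snd c' p))"
    using assms(1) unfolding allforms_def mem_Collect_eq by (elim conjE)
  then show ?thesis using assms(2-) by blast
qed

lemma allforms_altf: assumes "\<alpha> \<in> allforms M" shows "\<alpha> c x \<in> altf"
proof (cases "c \<in> M \<and> x \<in> chart_rng c")
  case True then show ?thesis using sform_altf[OF allforms_sform[OF assms]] by blast
next
  case False
  then have "\<alpha> c x = 0" using allforms_off[OF assms] by blast
  then show ?thesis by (simp only: altf_lin)
qed

lemma allforms_eqI: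
  assumes "\<alpha> \<in> allforms M" "\<beta> \<in> allforms M" "\<And>c x. c \<in> M \<Longrightarrow> x \<in> chart_rng c \<Longrightarrow> \<alpha> c x = \<beta> c x"
  shows "\<alpha> = \<beta>"
proof (intro ext)
  fix c x vs
  show "\<alpha> c x vs = \<beta> c x vs"
    using assms allforms_off[OF assms(1), of c x] allforms_off[OF assms(2), of c x] by (cases "c \<in> M \<and> x \<in> chart_rng c") auto
qed

lemma forms_iff: "\<alpha> \<in> forms M k \<longleftrightarrow> \<alpha> \<in> allforms M \<and> (\<forall>c x. \<alpha> c x \<in> ext k)"
proof
  assume a: "\<alpha> \<in> forms M k"
  have off: "\<forall>c x. c \<notin> M \<or> x \<notin> chart_rng c \<longrightarrow> \<alpha> c x = 0"
    using a unfolding forms_def mem_Collect_eq by (elim conjE)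
  have on: "\<forall>c\<in>M. \<forall>x\<in>chart_rng c. \<alpha> c x \<in> ext k"
    using a unfolding forms_def mem_Collect_eq by (elim conjE)
  have "\<alpha> c x \<in> ext k" for c x
  proof (cases "c \<in> M \<and> x \<in> chart_rng c")
    case True then show ?thesis using on by blast
  next
    case False
    then have "\<alpha> c x = 0" using off by blast
    then show ?thesis by (simp only: ext_lin)
  qed
  then show "\<alpha> \<in> allforms M \<and> (\<forall>c x. \<alpha> c x \<in> ext k)"
  proof (intro conjI allI allformsI)
    have sm: "\<forall>c\<in>M. \<forall>vs. smooth_on (chart_rng c) (\<lambda>x. \<alpha> c x vs)"
      using a unfolding forms_def mem_Collect_eq by (elim conjE)
    have pl: "\<forall>c\<in>M. \<forall>c'\<in>M. \<forall>p\<in>chart_dom c \<inter> chart_dom c'. \<forall>vs.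
       \<alpha> c (snd c p) vs = \<alpha> c' (snd c' p) (map (jac c c' (snd c p)) vs)"
      using a unfolding forms_def mem_Collect_eq by (elim conjE)
    show "\<alpha> c x = 0" if "c \<notin> M \<or> x \<notin> chart_rng c" for c x using off that by blast
    show "sform (chart_rng c) (\<alpha> c)" if "c \<in> M" for c
      unfolding sform_def using on sm that ext_altf by blast
    show "\<alpha> c (snd c p) = pull (jac c c' (snd c p)) (\<alpha> c' (snd c' p))"
      if "c \<in> M" "c' \<in> M" "p \<in> chart_dom c" "p \<in> chart_dom c'" for c c' p
      unfolding pull_def using pl that by blast
  qed
next
  assume "\<alpha> \<in> allforms M \<and> (\<forall>c x. \<alpha> c x \<in> ext k)"
  then have a: "\<alpha> \<in> allforms M" and e: "\<And>c x. \<alpha> c x \<in> ext k" by blast+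
  show "\<alpha> \<in> forms M k"
    unfolding forms_def mem_Collect_eq
  proof (intro conjI allI ballI impI)
    show "\<alpha> c x = 0" if "c \<notin> M \<or> x \<notin> chart_rng c" for c x using allforms_off[OF a that] .
    show "smooth_on (chart_rng c) (\<lambda>x. \<alpha> c x vs)" if "c \<in> M" for c vs
      by (rule sform_smooth[OF allforms_sform[OF a that]])
    show "\<alpha> c (snd c p) vs = \<alpha> c' (snd c' p) (map (jac c c' (snd c p)) vs)"
      if "c \<in> M" "c' \<in> M" "p \<in> chart_dom c \<inter> chart_dom c'" for c c' p vs
      using allforms_pull[OF a that(1,2)] that(3) by (simp add: pull_def)
  qed (rule e)
qed

lemma allforms_zero: "0 \<in> allforms M"
  by (rule allformsI) (auto simp: sform_def altf_lin smooth_on_const)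

lemma allforms_add:
  assumes M: "smooth_manifold M" and "\<alpha> \<in> allforms M" "\<beta> \<in> allforms M"
  shows "\<alpha> + \<beta> \<in> allforms M"
proof (rule allformsI)
  show "sform (chart_rng c) ((\<alpha> + \<beta>) c)" if "c \<in> M" for c
    using sform_add[OF open_chart_rng[OF M that] allforms_sform[OF assms(2) that] allforms_sform[OF assms(3) that]]
    by (simp add: plus_fun_def)
  show "(\<alpha> + \<beta>) c x = 0" if "c \<notin> M \<or> x \<notin> chart_rng c" for c x
    using allforms_off[OF assms(2) that] allforms_off[OF assms(3) that] by (simp only: plus_fun_apply add_0_left)
  show "(\<alpha> + \<beta>) c (snd c p) = pull (jac c c' (snd c p)) ((\<alpha> + \<beta>) c' (snd c' p))"
    if "c \<in> M" "c' \<in> M" "p \<in> chart_dom c" "p \<in> chart_dom c'" for c c' p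
    using allforms_pull[OF assms(2) that] allforms_pull[OF assms(3) that] by (simp only: plus_fun_apply pull_linear)
qed

lemma allforms_scaleR:
  assumes M: "smooth_manifold M" and "\<alpha> \<in> allforms M"
  shows "r *\<^sub>R \<alpha> \<in> allforms M"
proof (rule allformsI)
  show "sform (chart_rng c) ((r *\<^sub>R \<alpha>) c)" if "c \<in> M" for c
    using sform_scaleR[OF open_chart_rng[OF M that] smooth_on_const allforms_sform[OF assms(2) that], of r]
    by (simp add: scaleR_fun_def)
  show "(r *\<^sub>R \<alpha>) c x = 0" if "c \<notin> M \<or> x \<notin> chart_rng c" for c x
    using allforms_off[OF assms(2) that] by (simp only: scaleR_fun_apply scaleR_zero_right)
  show "(r *\<^sub>R \<alpha>) c (snd c p) = pull (jac c c' (snd c p)) ((r *\<^sub>R \<alpha>) c' (snd c' p))"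
    if "c \<in> M" "c' \<in> M" "p \<in> chart_dom c" "p \<in> chart_dom c'" for c c' p
    using allforms_pull[OF assms(2) that] by (simp only: scaleR_fun_apply pull_linear)
qed

lemma allforms_subspace: "smooth_manifold M \<Longrightarrow> subspace (allforms M)"
  by (simp add: subspace_def allforms_zero allforms_add allforms_scaleR)

lemma allforms_wedge:
  assumes M: "smooth_manifold M" and a: "\<alpha> \<in> allforms M" and b: "\<beta> \<in> allforms M"
  shows "wedge_form \<alpha> \<beta> \<in> allforms M"
proof (rule allformsI)
  show "sform (chart_rng c) (wedge_form \<alpha> \<beta> c)" if "c \<in> M" for c
    unfolding wedge_form_def by (intro sform_wedge open_chart_rng[OF M that] allforms_sform[OF _ that] a b)
  show "wedge_form \<alpha> \<beta> c (snd c p) = pull (jac c c' (snd c p)) (wedge_form \<alpha> \<beta> c' (snd c' p))"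
    if "c \<in> M" "c' \<in> M" "p \<in> chart_dom c" "p \<in> chart_dom c'" for c c' p
    unfolding wedge_form_def using allforms_pull[OF a that] allforms_pull[OF b that] by (simp only: wedge_pull)
qed (use allforms_off[OF a] in \<open>auto simp: wedge_form_def\<close>)

definition form_map :: "(nat \<Rightarrow> real) \<Rightarrow> ('m, 'n::finite) dform \<Rightarrow> ('m, 'n) dform"
  where "form_map g \<alpha> = (\<lambda>c x. lenscale g (\<alpha> c x))"

lemma allforms_form_map:
  assumes M: "smooth_manifold M" and a: "\<alpha> \<in> allforms M"
  shows "form_map g \<alpha> \<in> allforms M"
proof (rule allformsI)
  show "sform (chart_rng c) (form_map g \<alpha> c)" if "c \<in> M" for c
    unfolding form_map_def by (intro sform_lenscale open_chart_rng[OF M that] allforms_sform[OF a that])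
  show "form_map g \<alpha> c (snd c p) = pull (jac c c' (snd c p)) (form_map g \<alpha> c' (snd c' p))"
    if "c \<in> M" "c' \<in> M" "p \<in> chart_dom c" "p \<in> chart_dom c'" for c c' p
    using allforms_pull[OF a that] by (simp add: form_map_def lenscale_def pull_def fun_eq_iff)
qed (use allforms_off[OF a] in \<open>auto simp: form_map_def\<close>)

lemma one_form_in_forms:
  assumes M: "smooth_manifold M" shows "one_form M \<in> forms M 0"
  unfolding forms_iff
proof (intro conjI allI allformsI)
  show "sform (chart_rng c) (one_form M c)" if "c \<in> M" for c
    by (rule sform_cong[OF open_chart_rng[OF M that] _ sform_const[OF altf_unit]])
      (use that in \<open>auto simp: one_form_def on_charts_def\<close>)
qed (auto simp: one_form_def on_charts_def unit_in_ext ext_lin chart_rng_eq)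

lemma dR_eq: "c \<in> M \<Longrightarrow> x \<in> chart_rng c \<Longrightarrow> dR M \<alpha> c x = dloc (\<alpha> c) x"
  by (simp add: dR_def on_charts_def dloc_def)

text \<open>Compatibility of the chart expressions is naturality of d under the transition map,
  applied on the overlap.\<close>

lemma allforms_dR:
  assumes M: "smooth_manifold M" and a: "\<alpha> \<in> allforms M"
  shows "dR M \<alpha> \<in> allforms M"
proof (rule allformsI)
  show "sform (chart_rng c) (dR M \<alpha> c)" if "c \<in> M" for c
    by (rule sform_cong[OF open_chart_rng[OF M that] _ sform_dloc[OF open_chart_rng[OF M that] allforms_sform[OF a that]]])
      (simp add: dR_eq that)
  show "dR M \<alpha> c (snd c p) = pull (jac c c' (snd c p)) (dR M \<alpha> c' (snd c' p))"
    if c: "c \<in> M" "c' \<in> M" and p: "p \<in> chart_dom c" "p \<in> chart_dom c'" for c c' p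
  proof -
    have "dloc (\<alpha> c) (snd c p) = pull (jac c c' (snd c p)) (dloc (\<alpha> c') (transition c c' (snd c p)))"
    proof (rule dloc_pull[OF open_overlap[OF M c] _ open_chart_rng[OF M c(2)] smooth_transition[OF M c]
          transition_image[OF M c(1)] allforms_sform[OF a c(2)] sform_subset[OF allforms_sform[OF a c(1)] overlap_subset]])
      show "snd c p \<in> overlap c c'" using p by (auto simp: overlap_def)
      fix y assume "y \<in> overlap c c'"
      then obtain q where "y = snd c q" "q \<in> chart_dom c" "q \<in> chart_dom c'" by (auto simp: overlap_def)
      then show "\<alpha> c y = pull (jac c c' y) (\<alpha> c' (transition c c' y))"
        using allforms_pull[OF a c] transition_eq[OF M c(1)] by metis
    qed
    then show ?thesis
      using p by (simp add: dR_eq c chart_rng_eq transition_eq[OF M c(1)])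
  qed
qed (auto simp: dR_def on_charts_def)

lemma dR_add:
  assumes M: "smooth_manifold M" and a: "\<alpha> \<in> allforms M" and b: "\<beta> \<in> allforms M"
  shows "dR M (\<alpha> + \<beta>) = dR M \<alpha> + dR M \<beta>"
proof (rule allforms_eqI[of _ M])
  fix c x assume c: "c \<in> M" "x \<in> chart_rng c"
  have "(\<alpha> + \<beta>) c = (\<lambda>y. \<alpha> c y + \<beta> c y)" by (simp add: fun_eq_iff)
  then show "dR M (\<alpha> + \<beta>) c x = (dR M \<alpha> + dR M \<beta>) c x"
    using dloc_add[OF allforms_sform[OF a c(1)] allforms_sform[OF b c(1)] c(2)] by (simp only: dR_eq c plus_fun_apply)
qed (intro allforms_dR allforms_add M a b)+

lemma dR_scaleR:
  assumes M: "smooth_manifold M" and a: "\<alpha> \<in> allforms M"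
  shows "dR M (r *\<^sub>R \<alpha>) = r *\<^sub>R dR M \<alpha>"
proof (rule allforms_eqI[of _ M])
  fix c x assume c: "c \<in> M" "x \<in> chart_rng c"
  have "(r *\<^sub>R \<alpha>) c = (\<lambda>y. r *\<^sub>R \<alpha> c y)" by (simp add: fun_eq_iff)
  then show "dR M (r *\<^sub>R \<alpha>) c x = (r *\<^sub>R dR M \<alpha>) c x"
    using dloc_scaleR[OF allforms_sform[OF a c(1)] c(2)] by (simp only: dR_eq c scaleR_fun_apply)
qed (intro allforms_dR allforms_scaleR M a)+

lemma dR_dR:
  assumes M: "smooth_manifold M" and a: "\<alpha> \<in> allforms M"
  shows "dR M (dR M \<alpha>) = 0"
proof (rule allforms_eqI[of _ M])
  fix c x assume c: "c \<in> M" "x \<in> chart_rng c"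
  have "dloc (dR M \<alpha> c) x = dloc (dloc (\<alpha> c)) x"
    by (rule dloc_cong[OF open_chart_rng[OF M c(1)] c(2) _ sform_dloc[OF open_chart_rng[OF M c(1)] allforms_sform[OF a c(1)]]])
      (simp add: dR_eq c)
  then show "dR M (dR M \<alpha>) c x = 0 c x"
    by (simp add: dR_eq c dloc_dloc[OF open_chart_rng[OF M c(1)] c(2) allforms_sform[OF a c(1)]])
qed (intro allforms_dR allforms_zero M a)+

lemma dR_wedge:
  assumes M: "smooth_manifold M" and a: "\<alpha> \<in> allforms M" and b: "\<beta> \<in> allforms M"
  shows "dR M (wedge_form \<alpha> \<beta>) = wedge_form (dR M \<alpha>) \<beta> + wedge_form (form_map (\<lambda>k. (- 1) ^ k) \<alpha>) (dR M \<beta>)"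
proof (rule allforms_eqI[of _ M])
  fix c x assume c: "c \<in> M" "x \<in> chart_rng c"
  then show "dR M (wedge_form \<alpha> \<beta>) c x = (wedge_form (dR M \<alpha>) \<beta> + wedge_form (form_map (\<lambda>k. (- 1) ^ k) \<alpha>) (dR M \<beta>)) c x"
    using dloc_wedge[OF open_chart_rng[OF M c(1)] c(2) allforms_sform[OF a c(1)] allforms_sform[OF b c(1)]]
    by (simp add: dR_eq wedge_form_def form_map_def parity_lenscale)
qed (intro allforms_add allforms_dR allforms_wedge allforms_form_map M a b)+

lemma dR_forms:
  assumes M: "smooth_manifold M" and a: "\<alpha> \<in> forms M k"
  shows "dR M \<alpha> \<in> forms M (Suc k)"
proof -
  have a': "\<alpha> \<in> allforms M" "\<And>c x. \<alpha> c x \<in> ext k" using a by (auto simp: forms_iff)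
  have "dR M \<alpha> c x \<in> ext (Suc k)" for c x
  proof (cases "c \<in> M \<and> x \<in> chart_rng c")
    case True
    then show ?thesis
      using dloc_in_ext[OF open_chart_rng[OF M] _ allforms_sform[OF a'(1)] a'(2)] by (simp add: dR_eq)
  next
    case False
    then have "dR M \<alpha> c x = 0" using allforms_off[OF allforms_dR[OF M a'(1)]] by blast
    then show ?thesis by (simp only: ext_lin)
  qed
  then show ?thesis by (simp add: forms_iff allforms_dR[OF M a'(1)])
qed

text \<open>A form has no part above the dimension, so it is a finite sum of its homogeneous
  parts.\<close>

lemma total_space_deRham:
  fixes M :: "('m::{t2_space,second_countable_topology}, 'n::finite) chart set"
  assumes M: "smooth_manifold M"
  shows "total_space (deRham M) = allforms M"
proof
  have "(\<Union>k. deRham M k) \<subseteq> allforms M"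
    by (auto simp: deRham_def forms_iff allforms_zero split: if_splits)
  then show "total_space (deRham M) \<subseteq> allforms M"
    unfolding total_space_def by (intro span_minimal allforms_subspace M)
  show "allforms M \<subseteq> total_space (deRham M)"
  proof
    fix \<alpha> assume a: "\<alpha> \<in> allforms M"
    define P where "P k = (form_map (\<lambda>j. if j = k then 1 else 0) \<alpha> :: ('m, 'n) dform)" for k :: nat
    have Pk: "P k c x = part k (\<alpha> c x)" for k c x
      by (auto simp: P_def form_map_def lenscale_def part_def fun_eq_iff)
    have "P k \<in> allforms M" for k by (simp only: P_def allforms_form_map[OF M a])
    then have "P k \<in> forms M k" for k
      by (simp add: forms_iff Pk part_in_ext[OF allforms_altf[OF a]])
    then have "P k \<in> span (\<Union>k. deRham M k)" for k
      by (intro span_base UN_I[of "int k"]) (auto simp: deRham_def)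
    then have "(\<Sum>k\<le>CARD('n). P k) \<in> span (\<Union>k. deRham M k)" by (intro span_sum)
    moreover have "(\<Sum>k\<le>CARD('n). P k) = \<alpha>"
    proof (intro ext)
      fix c x vs
      show "(\<Sum>k\<le>CARD('n). P k) c x vs = \<alpha> c x vs"
        using fun_cong[OF altf_part_sum[OF allforms_altf[OF a, of c x]], of vs] by (simp add: sum_fun_apply Pk)
    qed
    ultimately show "\<alpha> \<in> total_space (deRham M)" by (simp add: total_space_def)
  qed
qed

section \<open>Forms with small support\<close>

text \<open>The constant form A in the chart c0 is cut off by a bump function and transported to the
  other charts.\<close>

lemma bump_form:
  fixes M :: "('m::{t2_space,second_countable_topology}, 'n::finite) chart set"
  assumes M: "smooth_manifold M" and c0: "c0 \<in> M" "x0 \<in> chart_rng c0" and A: "A \<in> altf"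
  shows "\<exists>\<alpha>\<in>allforms M. \<exists>r. r \<noteq> 0 \<and> \<alpha> c0 x0 = r *\<^sub>R A"
proof -
  obtain r where r: "r > 0" "cball x0 r \<subseteq> chart_rng c0"
    using open_chart_rng[OF M c0(1)] c0(2) open_contains_cball by blast
  obtain f :: "real ^ 'n \<Rightarrow> real" where f: "smooth_on UNIV f" "f x0 \<noteq> 0" "\<And>x. x \<notin> cball x0 r \<Longrightarrow> f x = 0"
    using bump_exists[OF r(1), of x0] by blast
  obtain g where g: "homeomorphism (chart_dom c0) (chart_rng c0) (snd c0) g"
    using M c0 by (auto simp: smooth_manifold_def)
  \<comment> \<open>A set containing the support, seen in the manifold. It is compact, hence closed
    because the space is Hausdorff; this makes the extension by zero smooth outside the domain of
    c0.\<close>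
  define C where "C = g ` cball x0 r"
  have "compact C" unfolding C_def
    using g r(2) by (intro compact_continuous_image) (auto simp: homeomorphism_def intro: continuous_on_subset)
  then have clC: "closed C" by (rule compact_imp_closed)
  have inC: "q \<in> C" if "q \<in> chart_dom c0" "snd c0 q \<in> cball x0 r" for q
  proof -
    have "g (snd c0 q) = q" using g that(1) by (simp add: homeomorphism_def)
    then show ?thesis unfolding C_def using that(2) by (intro image_eqI[of _ _ "snd c0 q"]) simp_all
  qed
  define \<alpha> :: "('m, 'n) dform" where "\<alpha> c x = (if c \<in> M \<and> x \<in> overlap c c0 then f (transition c c0 x) *\<^sub>R pull (jac c c0 x) A else 0)" for c x
  have in_overlap: "snd c q \<in> overlap c c0 \<longleftrightarrow> q \<in> chart_dom c0" if "c \<in> M" "q \<in> chart_dom c" for c q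
    using chart_inj[OF M that(1)] that(2) by (auto simp: overlap_def inj_on_def)
  have \<alpha>: "\<alpha> \<in> allforms M"
  proof (rule allformsI)
    show "\<alpha> c x = 0" if "c \<notin> M \<or> x \<notin> chart_rng c" for c x
      using that overlap_subset[of c c0] by (auto simp: \<alpha>_def)
    show "sform (chart_rng c) (\<alpha> c)" if c: "c \<in> M" for c
      unfolding sform_def
    proof (intro conjI ballI allI)
      show "\<alpha> c x \<in> altf" for x
        using altf_pull[OF jac_linear[OF M c c0(1)] A] by (auto simp: \<alpha>_def altf_lin)
      fix vs
      show "smooth_on (chart_rng c) (\<lambda>x. \<alpha> c x vs)"
      proof (rule smooth_on_local)
        fix x assume "x \<in> chart_rng c"
        then obtain q where q: "x = snd c q" "q \<in> chart_dom c" by (auto simp: chart_rng_eq)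
        show "\<exists>U. open U \<and> x \<in> U \<and> smooth_on U (\<lambda>x. \<alpha> c x vs)"
        proof (cases "x \<in> overlap c c0")
          case True
          have o: "open (overlap c c0)" by (rule open_overlap[OF M c c0(1)])
          have s: "smooth_on (overlap c c0) (transition c c0)" by (rule smooth_transition[OF M c c0(1)])
          have "smooth_on (overlap c c0) (\<lambda>x. f (transition c c0 x) * pull (jac c c0 x) A vs)"
            by (intro smooth_on_mult[OF o] smooth_on_compose[OF o s f(1)] smooth_pull[OF o _ A]
              smooth_on_linear[OF o bounded_linear_vec_nth smooth_on_deriv[OF s]]) auto
          then have "smooth_on (overlap c c0) (\<lambda>x. \<alpha> c x vs)"
            by (rule smooth_on_cong[OF o, rotated]) (simp add: \<alpha>_def c)
          then show ?thesis using o True by blast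
        next
          case False
          \<comment> \<open>A neighbourhood of x, in the chart c, that avoids the support.\<close>
          define U where "U = snd c ` (chart_dom c - C)"
          have o: "open U" unfolding U_def
            by (intro open_chart_image[OF M c] open_Diff open_chart_dom[OF M c] clC) auto
          have "C \<subseteq> chart_dom c0" unfolding C_def using g image_mono[OF r(2), of g] by (simp add: homeomorphism_def)
          then have "x \<in> U" using False q in_overlap[OF c] by (auto simp: U_def)
          have "\<alpha> c y = 0" if y: "y \<in> U" for y
          proof -
            obtain q' where q': "y = snd c q'" "q' \<in> chart_dom c" "q' \<notin> C" using y by (auto simp: U_def)
            have "f (transition c c0 y) = 0" if "q' \<in> chart_dom c0"
              using inC[OF that] q' f(3) transition_eq[OF M c q'(2)] by auto
            then show ?thesis using q' in_overlap[OF c] by (simp add: \<alpha>_def)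
          qed
          then have "smooth_on U (\<lambda>x. \<alpha> c x vs)"
            by (intro smooth_on_cong[OF o _ smooth_on_const[of _ 0]]) auto
          then show ?thesis using o \<open>x \<in> U\<close> by blast
        qed
      qed
    qed
    show "\<alpha> c (snd c p) = pull (jac c c' (snd c p)) (\<alpha> c' (snd c' p))"
      if c: "c \<in> M" "c' \<in> M" and p: "p \<in> chart_dom c" "p \<in> chart_dom c'" for c c' p
    proof (cases "p \<in> chart_dom c0")
      case True
      then show ?thesis
        using c p by (simp add: \<alpha>_def in_overlap transition_eq[OF M] jac_chain[OF M c c0(1) p] pull_pull)
    next
      case False
      then show ?thesis using c p by (simp add: \<alpha>_def in_overlap)
    qed
  qed
  obtain p where p: "x0 = snd c0 p" "p \<in> chart_dom c0" using c0(2) by (auto simp: chart_rng_eq)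
  have "\<alpha> c0 x0 = f x0 *\<^sub>R A"
    using p c0 in_overlap[OF c0(1) p(2)] by (simp add: \<alpha>_def transition_eq[OF M c0(1)] jac_self[OF M c0(1)] pull_def)
  then show ?thesis using \<alpha> f(2) by blast
qed

section \<open>Adjoint actions in an associative algebra\<close>

definition ad :: "'r::real_algebra_1 \<Rightarrow> 'r \<Rightarrow> 'r"
  where "ad x y = x * y - y * x"

lemma ad_linear [simp]:
  "ad x (y + z) = ad x y + ad x z" "ad x (y - z) = ad x y - ad x z" "ad x (r *\<^sub>R y) = r *\<^sub>R ad x y"
  "ad x (- y) = - ad x y" "ad x 0 = 0" "ad (- x) y = - ad x y" "ad (r *\<^sub>R x) y = r *\<^sub>R ad x y"
  by (simp_all add: ad_def algebra_simps)

lemma ad_jacobi: "ad x (ad y z) = ad (ad x y) z + ad y (ad x z)"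
  by (simp add: ad_def algebra_simps)

text \<open>The coefficient of \<xi>^k in e^(x \<xi>) y e^(-x \<xi>) = e^(\<xi> ad x) y. Multiplying
  by k + 1 = i + (k + 1 - i) is formal differentiation in \<xi>: one part yields x times the
  preceding sum, the other minus that sum times x.\<close>

lemma ad_series:
  fixes x y :: "'r::real_algebra_1"
  shows "(\<Sum>i\<le>k. (1 / fact i) *\<^sub>R x ^ i * y * ((1 / fact (k - i)) *\<^sub>R (- x) ^ (k - i))) = (1 / fact k) *\<^sub>R (ad x ^^ k) y"
proof (induction k)
  case (Suc k)
  define a where "a i = (1 / fact i) *\<^sub>R x ^ i" for i
  define b where "b i = (1 / fact i) *\<^sub>R (- x) ^ i" for i
  have a: "real (Suc i) *\<^sub>R a (Suc i) = x * a i" for i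
    by (simp add: a_def field_simps del: of_nat_Suc)
  have b: "real (Suc i) *\<^sub>R b (Suc i) = - (b i * x)" for i
    using power_commutes[of "- x" i] by (simp add: b_def field_simps del: of_nat_Suc)
  have IH: "(\<Sum>i\<le>k. a i * y * b (k - i)) = (1 / fact k) *\<^sub>R (ad x ^^ k) y" using Suc by (simp add: a_def b_def)
  have "real (Suc k) *\<^sub>R (\<Sum>i\<le>Suc k. a i * y * b (Suc k - i))
    = (\<Sum>i\<le>Suc k. (real i *\<^sub>R a i) * y * b (Suc k - i)) + (\<Sum>i\<le>Suc k. a i * y * (real (Suc k - i) *\<^sub>R b (Suc k - i)))"
    unfolding scaleR_sum_right sum.distrib[symmetric]
    by (intro sum.cong refl) (auto simp: of_nat_diff scaleR_add_left[symmetric])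
  also have "(\<Sum>i\<le>Suc k. (real i *\<^sub>R a i) * y * b (Suc k - i)) = x * (\<Sum>i\<le>k. a i * y * b (k - i))"
    unfolding sum.atMost_Suc_shift a by (simp add: sum_distrib_left mult.assoc)
  also have "(\<Sum>i\<le>Suc k. a i * y * (real (Suc k - i) *\<^sub>R b (Suc k - i))) = - ((\<Sum>i\<le>k. a i * y * b (k - i)) * x)"
    unfolding sum.atMost_Suc by (simp add: Suc_diff_le b sum_distrib_right mult.assoc sum_negf del: of_nat_Suc)
  finally have "real (Suc k) *\<^sub>R (\<Sum>i\<le>Suc k. a i * y * b (Suc k - i)) = (1 / fact k) *\<^sub>R (ad x ^^ Suc k) y"
    unfolding IH by (simp add: ad_def scaleR_diff_right)
  then have "(1 / real (Suc k)) *\<^sub>R real (Suc k) *\<^sub>R (\<Sum>i\<le>Suc k. a i * y * b (Suc k - i))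
    = (1 / real (Suc k)) *\<^sub>R (1 / fact k) *\<^sub>R (ad x ^^ Suc k) y" by (rule arg_cong)
  then have "(\<Sum>i\<le>Suc k. a i * y * b (Suc k - i)) = (1 / fact (Suc k)) *\<^sub>R (ad x ^^ Suc k) y"
    by (simp add: field_simps del: of_nat_Suc sum.atMost_Suc funpow.simps)
  then show ?case by (simp only: a_def b_def)
qed simp

text \<open>By \<open>ad_series\<close> only terms x^i y x^(k - i) occur, and one of the two
  exponents is at least N.\<close>

lemma ad_nilpotent:
  fixes x y :: "'r::real_algebra_1"
  assumes "x ^ N = 0" "2 * N \<le> k"
  shows "(ad x ^^ k) y = 0"
proof -
  have xp: "x ^ i = 0" if "N \<le> i" for i
  proof -
    have "x ^ i = x ^ (i - N) * x ^ N" unfolding power_add[symmetric] using that by simp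
    then show ?thesis by (simp only: assms(1) mult_zero_right)
  qed
  have "(1 / fact i) *\<^sub>R x ^ i * y * ((1 / fact (k - i)) *\<^sub>R (- x) ^ (k - i)) = 0" if "i \<le> k" for i
  proof (cases "N \<le> i")
    case False
    then have "N \<le> k - i" using assms(2) by simp
    then have "(- x) ^ (k - i) = 0" using xp power_minus[of x "k - i"] by simp
    then show ?thesis by simp
  qed (simp add: xp)
  then have "(1 / fact k) *\<^sub>R (ad x ^^ k) y = 0"
    unfolding ad_series[symmetric] by (intro sum.neutral) auto
  then show ?thesis by simp
qed

text \<open>Nilpotency of \<Lambda> makes a high power of \<open>ad \<Lambda>\<close> vanish on v;
  the formula for \<open>ad L\<close> pulls the vanishing down step by step, since its coefficient
  (i + 1) (m - i) is nonzero for i > m.\<close>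

lemma sl2_lowest_weight:
  fixes L \<Lambda> H v :: "'r::real_algebra_1"
  assumes LH: "ad \<Lambda> L = H" and HL: "ad H \<Lambda> = 2 *\<^sub>R \<Lambda>" and v: "ad L v = 0" "ad H v = - real m *\<^sub>R v"
    and nil: "\<Lambda> ^ N = 0"
  shows "(ad \<Lambda> ^^ Suc m) v = 0"
    and "ad L ((ad \<Lambda> ^^ Suc i) v) = (real (Suc i) * (real m - real i)) *\<^sub>R (ad \<Lambda> ^^ i) v"
proof -
  have hw: "ad H ((ad \<Lambda> ^^ i) v) = (2 * real i - real m) *\<^sub>R (ad \<Lambda> ^^ i) v" for i
  proof (induction i)
    case (Suc i)
    have "ad H (ad \<Lambda> ((ad \<Lambda> ^^ i) v)) = ad (2 *\<^sub>R \<Lambda>) ((ad \<Lambda> ^^ i) v) + ad \<Lambda> (ad H ((ad \<Lambda> ^^ i) v))"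
      unfolding HL[symmetric] by (rule ad_jacobi)
    also have "\<dots> = 2 *\<^sub>R ad \<Lambda> ((ad \<Lambda> ^^ i) v) + (2 * real i - real m) *\<^sub>R ad \<Lambda> ((ad \<Lambda> ^^ i) v)"
      unfolding Suc by (simp add: ad_def algebra_simps)
    finally show ?case by (simp add: algebra_simps flip: scaleR_add_left)
  qed (simp add: v)
  have low: "ad L ((ad \<Lambda> ^^ Suc i) v) = (real (Suc i) * (real m - real i)) *\<^sub>R (ad \<Lambda> ^^ i) v" for i
  proof (induction i)
    case 0
    have "ad L (ad \<Lambda> v) = ad (ad L \<Lambda>) v + ad \<Lambda> (ad L v)" by (rule ad_jacobi)
    moreover have "ad L \<Lambda> = - H" unfolding LH[symmetric] ad_def by simp
    ultimately show ?case using v by simp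
  next
    case (Suc i)
    have "ad L (ad \<Lambda> ((ad \<Lambda> ^^ Suc i) v)) = ad (ad L \<Lambda>) ((ad \<Lambda> ^^ Suc i) v) + ad \<Lambda> (ad L ((ad \<Lambda> ^^ Suc i) v))"
      by (rule ad_jacobi)
    also have "ad L \<Lambda> = - H" unfolding LH[symmetric] ad_def by simp
    also have "ad (- H) ((ad \<Lambda> ^^ Suc i) v) + ad \<Lambda> (ad L ((ad \<Lambda> ^^ Suc i) v))
      = (real m - 2 * real (Suc i)) *\<^sub>R (ad \<Lambda> ^^ Suc i) v + (real (Suc i) * (real m - real i)) *\<^sub>R (ad \<Lambda> ^^ Suc i) v"
      unfolding Suc ad_linear hw by (simp add: scaleR_minus_left[symmetric] del: scaleR_minus_left)
    finally show ?case by (simp add: algebra_simps flip: scaleR_add_left)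
  qed
  show "ad L ((ad \<Lambda> ^^ Suc i) v) = (real (Suc i) * (real m - real i)) *\<^sub>R (ad \<Lambda> ^^ i) v" by (rule low)
  have down: "(ad \<Lambda> ^^ i) v = 0" if "(ad \<Lambda> ^^ Suc i) v = 0" "m < i" for i
  proof -
    have "(real (Suc i) * (real m - real i)) *\<^sub>R (ad \<Lambda> ^^ i) v = 0"
      using low[of i] that(1) by simp
    moreover have "real (Suc i) * (real m - real i) \<noteq> 0" using that(2) by simp
    ultimately show ?thesis by simp
  qed
  have "(ad \<Lambda> ^^ (Suc m + j)) v = 0 \<Longrightarrow> (ad \<Lambda> ^^ Suc m) v = 0" for j
  proof (induction j)
    case (Suc j)
    then show ?case using down[of "Suc m + j"] by simp
  qed simp
  from this[of "2 * N"] show "(ad \<Lambda> ^^ Suc m) v = 0"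
    using ad_nilpotent[OF nil, of "Suc m + 2 * N" v] by simp
qed

definition nexp :: "nat \<Rightarrow> 'r::real_algebra_1 \<Rightarrow> 'r"
  where "nexp K x = (\<Sum>j<K. (1 / fact j) *\<^sub>R x ^ j)"

text \<open>The truncated form of e^x y = (e^(ad x) y) e^x: each x^m y is rewritten with its powers
  of x on the right of y, and the double sum is rearranged.\<close>

lemma nexp_commute:
  fixes x y :: "'r::real_algebra_1"
  assumes x: "x ^ K = 0" and y: "(ad x ^^ 4) y = 0"
  shows "nexp K x * y = (y + ad x y + (1 / 2) *\<^sub>R ad x (ad x y) + (1 / 6) *\<^sub>R ad x (ad x (ad x y))) * nexp K x"
proof -
  define a where "a i = (1 / fact i) *\<^sub>R x ^ i" for i
  define A where "A i = (1 / fact i) *\<^sub>R (ad x ^^ i) y" for i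
  have a: "real (Suc i) *\<^sub>R a (Suc i) = x * a i" for i
    by (simp add: a_def field_simps del: of_nat_Suc)
  have A: "x * A i = A i * x + real (Suc i) *\<^sub>R A (Suc i)" for i
    by (simp add: A_def ad_def field_simps scaleR_diff_right del: of_nat_Suc)
  have "a m * y = (\<Sum>i\<le>m. A i * a (m - i))" for m
  proof (induction m)
    case (Suc m)
    have "real (Suc m) *\<^sub>R (a (Suc m) * y) = x * (a m * y)"
      unfolding mult_scaleR_left[symmetric] a by (simp add: mult.assoc)
    also have "\<dots> = (\<Sum>i\<le>m. A i * x * a (m - i)) + (\<Sum>i\<le>m. (real (Suc i) *\<^sub>R A (Suc i)) * a (m - i))"
      unfolding Suc sum_distrib_left sum.distrib[symmetric] mult.assoc[symmetric] A by (simp only: distrib_right)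
    also have "(\<Sum>i\<le>m. A i * x * a (m - i)) = (\<Sum>i\<le>Suc m. real (Suc m - i) *\<^sub>R (A i * a (Suc m - i)))"
      unfolding sum.atMost_Suc by (simp add: Suc_diff_le mult.assoc a[symmetric] del: of_nat_Suc)
    also have "(\<Sum>i\<le>m. (real (Suc i) *\<^sub>R A (Suc i)) * a (m - i)) = (\<Sum>i\<le>Suc m. real i *\<^sub>R (A i * a (Suc m - i)))"
      unfolding sum.atMost_Suc_shift by simp
    also have "(\<Sum>i\<le>Suc m. real (Suc m - i) *\<^sub>R (A i * a (Suc m - i))) + (\<Sum>i\<le>Suc m. real i *\<^sub>R (A i * a (Suc m - i)))
      = real (Suc m) *\<^sub>R (\<Sum>i\<le>Suc m. A i * a (Suc m - i))"
      unfolding scaleR_sum_right sum.distrib[symmetric]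
      by (intro sum.cong refl) (auto simp: of_nat_diff scaleR_add_left[symmetric])
    finally show ?case using scaleR_left_imp_eq[of "real (Suc m)"] by simp
  qed (simp add: a_def A_def)
  note conv = this
  have az: "a j = 0" if "K \<le> j" for j
    using x that power_add[of x "j - K" K] by (simp add: a_def)
  have A4: "(ad x ^^ i) y = 0" if "4 \<le> i" for i
  proof -
    have "(ad x ^^ (i - 4 + 4)) y = (ad x ^^ (i - 4)) ((ad x ^^ 4) y)" by (simp only: funpow_add o_def)
    moreover have "(ad x ^^ j) 0 = 0" for j by (induction j) auto
    ultimately show ?thesis using that y by simp
  qed
  have ext: "(\<Sum>j<J. a j) = nexp K x" if "K \<le> J" for J
  proof -
    have "(\<Sum>j<J. a j) = (\<Sum>j<K. a j)" by (rule sum.mono_neutral_right) (use that az in auto)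
    then show ?thesis by (simp add: nexp_def a_def)
  qed
  \<comment> \<open>Four spare powers, so that for each i < 4 the inner sum still reaches K and is
    the full exponential.\<close>
  have "nexp K x * y = (\<Sum>m<K + 4. a m) * y" by (simp only: ext le_add1)
  also have "\<dots> = (\<Sum>m<K + 4. \<Sum>i\<le>m. A i * a (m - i))" by (simp only: sum_distrib_right conv)
  also have "\<dots> = (\<Sum>(m, i)\<in>Sigma {..<K + 4} (\<lambda>m. {..m}). A i * a (m - i))" by (subst sum.Sigma) auto
  also have "\<dots> = (\<Sum>(i, j)\<in>Sigma {..<K + 4} (\<lambda>i. {..<K + 4 - i}). A i * a j)"
    by (rule sum.reindex_bij_witness[of _ "\<lambda>(i, j). (i + j, i)" "\<lambda>(m, i). (i, m - i)"]) auto
  also have "\<dots> = (\<Sum>i<K + 4. A i * (\<Sum>j<K + 4 - i. a j))" by (subst sum.Sigma[symmetric]) (auto simp: sum_distrib_left)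
  also have "\<dots> = (\<Sum>i<4. A i * (\<Sum>j<K + 4 - i. a j))"
    by (rule sum.mono_neutral_right) (use A4 in \<open>auto simp: A_def\<close>)
  also have "\<dots> = (\<Sum>i<4. A i * nexp K x)" by (intro sum.cong refl) (simp add: ext)
  also have "\<dots> = (A 0 + A 1 + A 2 + A 3) * nexp K x"
    by (simp add: eval_nat_numeral algebra_simps)
  finally show ?thesis by (simp add: A_def eval_nat_numeral)
qed

text \<open>
  \<open>d'\<close> and \<open>W\<close> are lowest weight vectors of weights -1 and -3 for the adjoint action of \<open>L\<close>, \<open>\<Lambda>\<close>, and
  conjugation by the Weyl element exchanges lowest and highest weight vectors.
\<close>

locale sl2_pair =
  fixes L \<Lambda> H d :: "'r::real_algebra_1" and W :: 'r and K :: nat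
  assumes LH: "ad \<Lambda> L = H" and HL: "ad H \<Lambda> = 2 *\<^sub>R \<Lambda>" and dL: "ad d L = W" and LW: "ad L W = 0"
    and Hd: "ad H d = - d" and HW: "ad H W = - 3 *\<^sub>R W" and nilL: "L ^ K = 0" and nilLam: "\<Lambda> ^ K = 0"
begin

text \<open>\<open>W1\<close>, \<open>W2\<close>, \<open>W3\<close> are the divided powers (ad
  \<Lambda>)^i W / i!, which span the representation generated by W and keep the coefficients below
  integral. In \<open>d'\<close> the factor 1/3 balances [L, d] = -W against 3 W, the bracket of L
  with \<open>W1\<close>.\<close>

definition W1 where "W1 = ad \<Lambda> W"
definition W2 where "W2 = (1 / 2) *\<^sub>R ad \<Lambda> W1"
definition W3 where "W3 = (1 / 3) *\<^sub>R ad \<Lambda> W2"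
definition d' where "d' = d + (1 / 3) *\<^sub>R W1"

lemma Ld: "ad L d = - W" unfolding dL[symmetric] ad_def by simp

lemma scaleR_3: "3 *\<^sub>R x = x + x + x" for x :: 'r
  using scaleR_add_left[of 2 1 x] by (simp add: scaleR_2)

lemma W_up: "ad \<Lambda> W = W1" "ad \<Lambda> W1 = 2 *\<^sub>R W2" "ad \<Lambda> W2 = 3 *\<^sub>R W3" "ad \<Lambda> W3 = 0"
proof -
  have "(ad \<Lambda> ^^ 4) W = 0"
    using sl2_lowest_weight(1)[OF LH HL LW, of 3 K] HW nilLam by (simp add: numeral_eq_Suc)
  then show "ad \<Lambda> W3 = 0" by (simp add: W1_def W2_def W3_def numeral_eq_Suc)
qed (simp_all add: W1_def W2_def W3_def)

lemma W_down: "ad L W1 = 3 *\<^sub>R W" "ad L W2 = 2 *\<^sub>R W1" "ad L W3 = W2"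
proof -
  have *: "ad L ((ad \<Lambda> ^^ Suc i) W) = (real (Suc i) * (3 - real i)) *\<^sub>R (ad \<Lambda> ^^ i) W" for i
    using sl2_lowest_weight(2)[OF LH HL LW, of 3 K i] HW nilLam by simp
  show "ad L W1 = 3 *\<^sub>R W" using *[of 0] by (simp add: W1_def)
  show "ad L W2 = 2 *\<^sub>R W1" using *[of 1] by (simp add: W1_def W2_def)
  show "ad L W3 = W2" using *[of 2] by (simp add: W1_def W2_def W3_def eval_nat_numeral)
qed

lemma Ld': "ad L d' = 0"
  by (simp add: d'_def Ld W_down)

lemma Hd': "ad H d' = - d'"
proof -
  have "ad H W1 = ad (ad H \<Lambda>) W + ad \<Lambda> (ad H W)" unfolding W1_def by (rule ad_jacobi)
  also have "\<dots> = - W1" unfolding HL HW W1_def ad_linear by (simp add: scaleR_2 scaleR_3)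
  finally show ?thesis by (simp add: d'_def Hd)
qed

lemma Lam_d': "ad \<Lambda> (ad \<Lambda> d') = 0"
  using sl2_lowest_weight(1)[OF LH HL Ld', of 1 K] Hd' nilLam by simp

text \<open>\<open>ad \<Lambda>\<close> kills \<open>d'\<close> after two steps, and two steps take
  its summand \<open>(1 / 3) *\<^sub>R W1\<close> to \<open>2 *\<^sub>R W3\<close>.\<close>

lemma Lam_d: "ad \<Lambda> (ad \<Lambda> d) = - 2 *\<^sub>R W3" "ad \<Lambda> (ad \<Lambda> (ad \<Lambda> d)) = 0"
proof -
  show *: "ad \<Lambda> (ad \<Lambda> d) = - 2 *\<^sub>R W3"
  proof -
    have "ad \<Lambda> (ad \<Lambda> d) + 2 *\<^sub>R W3 = 0"
      using Lam_d' unfolding d'_def ad_linear W_up by simp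
    then show ?thesis unfolding scaleR_minus_left by (rule eq_neg_iff_add_eq_0[THEN iffD2])
  qed
  show "ad \<Lambda> (ad \<Lambda> (ad \<Lambda> d)) = 0" unfolding * by (simp add: W_up)
qed

definition weyl where "weyl = nexp K L * nexp K (- \<Lambda>) * nexp K L"

lemma nil_neg: "(- \<Lambda>) ^ K = 0" using nilLam power_minus[of \<Lambda> K] by simp

lemma nexp_L:
  assumes "ad L y = y1" "ad L y1 = y2" "ad L y2 = y3" "ad L y3 = 0"
  shows "nexp K L * y = (y + y1 + (1 / 2) *\<^sub>R y2 + (1 / 6) *\<^sub>R y3) * nexp K L"
  using nexp_commute[OF nilL, of y] by (simp add: assms numeral_eq_Suc)

lemma nexp_Lam:
  assumes "ad \<Lambda> y = y1" "ad \<Lambda> y1 = y2" "ad \<Lambda> y2 = y3" "ad \<Lambda> y3 = 0"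
  shows "nexp K (- \<Lambda>) * y = (y - y1 + (1 / 2) *\<^sub>R y2 - (1 / 6) *\<^sub>R y3) * nexp K (- \<Lambda>)"
  using nexp_commute[OF nil_neg, of y] by (simp add: assms numeral_eq_Suc)

lemma weyl_step:
  assumes "nexp K L * y1 = y2 * nexp K L" "nexp K (- \<Lambda>) * y2 = y3 * nexp K (- \<Lambda>)" "nexp K L * y3 = y4 * nexp K L"
  shows "weyl * y1 = y4 * weyl"
  unfolding weyl_def by (metis assms mult.assoc)

text \<open>Past the three factors W becomes W, then W - W1 + W2 - W3, then -W3: the lowest weight
  vector goes to a highest one.\<close>

lemma weyl_W: "weyl * W = - W3 * weyl"
proof (rule weyl_step)
  show "nexp K L * W = W * nexp K L"
    using nexp_L[of W 0 0 0] by (simp add: LW)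
  have "nexp K (- \<Lambda>) * W = (W - W1 + (1 / 2) *\<^sub>R (2 *\<^sub>R W2) - (1 / 6) *\<^sub>R (6 *\<^sub>R W3)) * nexp K (- \<Lambda>)"
    by (rule nexp_Lam) (simp_all add: W_up)
  then show "nexp K (- \<Lambda>) * W = (W - W1 + W2 - W3) * nexp K (- \<Lambda>)" by simp
  have "nexp K L * (W - W1 + W2 - W3) = ((W - W1 + W2 - W3) + (2 *\<^sub>R W1 - 3 *\<^sub>R W - W2)
     + (1 / 2) *\<^sub>R (6 *\<^sub>R W - 2 *\<^sub>R W1) + (1 / 6) *\<^sub>R (- 6 *\<^sub>R W)) * nexp K L"
    by (rule nexp_L) (simp_all add: W_down LW)
  also have "(W - W1 + W2 - W3) + (2 *\<^sub>R W1 - 3 *\<^sub>R W - W2)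
     + (1 / 2) *\<^sub>R (6 *\<^sub>R W - 2 *\<^sub>R W1) + (1 / 6) *\<^sub>R (- 6 *\<^sub>R W) = - W3"
    by (simp add: scaleR_diff_right) (simp add: scaleR_2 scaleR_3)
  finally show "nexp K L * (W - W1 + W2 - W3) = - W3 * nexp K L" .
qed

lemma L_Lam_d: "ad L (ad \<Lambda> d) = d - W1"
proof -
  have "ad L \<Lambda> = - H" unfolding LH[symmetric] ad_def by simp
  then show ?thesis using ad_jacobi[of L \<Lambda> d] by (simp add: Ld Hd W_up)
qed

text \<open>Since d = d' - W1 / 3 has a component in each of the two representations, its image has
  the summand \<open>W2\<close> beside [\<Lambda>, d].\<close>

lemma weyl_d: "weyl * d = - (ad \<Lambda> d + W2) * weyl"
proof (rule weyl_step)
  show "nexp K L * d = (d - W) * nexp K L"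
    using nexp_L[of d "- W" 0 0] by (simp add: Ld LW)
  have "nexp K (- \<Lambda>) * (d - W) = ((d - W) - (ad \<Lambda> d - W1) + (1 / 2) *\<^sub>R (- 2 *\<^sub>R W3 - 2 *\<^sub>R W2) - (1 / 6) *\<^sub>R (- 6 *\<^sub>R W3)) * nexp K (- \<Lambda>)"
    by (rule nexp_Lam) (simp_all add: W_up Lam_d)
  also have "(d - W) - (ad \<Lambda> d - W1) + (1 / 2) *\<^sub>R (- 2 *\<^sub>R W3 - 2 *\<^sub>R W2) - (1 / 6) *\<^sub>R (- 6 *\<^sub>R W3) = d - W - ad \<Lambda> d + W1 - W2"
    by (simp add: algebra_simps)
  finally show "nexp K (- \<Lambda>) * (d - W) = (d - W - ad \<Lambda> d + W1 - W2) * nexp K (- \<Lambda>)" .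
  have "nexp K L * (d - W - ad \<Lambda> d + W1 - W2) = ((d - W - ad \<Lambda> d + W1 - W2) + (2 *\<^sub>R W - d - W1)
      + (1 / 2) *\<^sub>R (- 2 *\<^sub>R W) + (1 / 6) *\<^sub>R 0) * nexp K L"
    by (rule nexp_L) (simp_all add: L_Lam_d Ld LW W_down scaleR_2 scaleR_3)
  also have "(d - W - ad \<Lambda> d + W1 - W2) + (2 *\<^sub>R W - d - W1)
      + (1 / 2) *\<^sub>R (- 2 *\<^sub>R W) + (1 / 6) *\<^sub>R 0 = - (ad \<Lambda> d + W2)"
    by simp (simp add: scaleR_2)
  finally show "nexp K L * (d - W - ad \<Lambda> d + W1 - W2) = - (ad \<Lambda> d + W2) * nexp K L" .
qed

text \<open>\<open>ad \<Lambda>\<close> is a derivation; applied repeatedly to d d = 0 it gives, up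
  to nonzero factors, the coefficients of the square of d + [\<Lambda>, d] \<xi> - W3
  \<xi>^2.\<close>

lemma maurer_cartan:
  assumes "d * d = 0"
  shows "d * ad \<Lambda> d + ad \<Lambda> d * d = 0"
    and "d * (- W3) + ad \<Lambda> d * ad \<Lambda> d + (- W3) * d = 0"
    and "ad \<Lambda> d * (- W3) + (- W3) * ad \<Lambda> d = 0"
    and "W3 * W3 = 0"
proof -
  define e where "e = ad \<Lambda> d"
  have der: "ad \<Lambda> (x * y) = ad \<Lambda> x * y + x * ad \<Lambda> y" for x y by (simp add: ad_def algebra_simps)
  have e: "ad \<Lambda> d = e" "ad \<Lambda> e = - 2 *\<^sub>R W3" "ad \<Lambda> W3 = 0" using Lam_d W_up by (simp_all add: e_def)
  have 1: "e * d + d * e = 0"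
    using arg_cong[OF assms, of "ad \<Lambda>"] unfolding der e by simp
  have "- 2 *\<^sub>R (W3 * d) + e * e + (e * e - 2 *\<^sub>R (d * W3)) = 0"
    using arg_cong[OF 1, of "ad \<Lambda>"] unfolding der e ad_linear by (simp add: algebra_simps)
  then have "2 *\<^sub>R (d * (- W3) + e * e + (- W3) * d) = 0"
    by (simp add: algebra_simps scaleR_2)
  then have 2: "d * (- W3) + e * e + (- W3) * d = 0" by simp
  have "- (e * W3) - 2 *\<^sub>R (W3 * e) - 2 *\<^sub>R (e * W3) - W3 * e = 0"
    using arg_cong[OF 2, of "ad \<Lambda>"] unfolding der e ad_linear by (simp add: algebra_simps)
  moreover have "- (e * W3) - 2 *\<^sub>R (W3 * e) - 2 *\<^sub>R (e * W3) - W3 * e = 3 *\<^sub>R (e * (- W3) + (- W3) * e)"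
    by (simp add: scaleR_2 scaleR_3)
  ultimately have 3: "e * (- W3) + (- W3) * e = 0" by simp
  have "4 *\<^sub>R (W3 * W3) = 0"
    using arg_cong[OF 3, of "ad \<Lambda>"] unfolding der e ad_linear
    by (simp add: algebra_simps flip: scaleR_add_left)
  then show "W3 * W3 = 0" by simp
  show "d * ad \<Lambda> d + ad \<Lambda> d * d = 0" using 1 by (simp add: e_def add.commute)
  show "d * (- W3) + ad \<Lambda> d * ad \<Lambda> d + (- W3) * d = 0" using 2 by (simp add: e_def)
  show "ad \<Lambda> d * (- W3) + (- W3) * ad \<Lambda> d = 0" using 3 by (simp add: e_def)
qed

end

section \<open>The algebra of linear maps\<close>

text \<open>In class \<open>real_algebra_1\<close> the unit differs from 0, so linear maps form such
  an algebra only on a nonzero space.\<close>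

class nontrivial_vector = real_vector +
  assumes nontrivial: "\<exists>x. x \<noteq> 0"

instance real :: nontrivial_vector
  by standard (rule exI[of _ 1], simp)

instance "fun" :: (type, nontrivial_vector) nontrivial_vector
proof
  obtain x :: 'b where "x \<noteq> 0" using nontrivial by blast
  then have "(\<lambda>_. x) \<noteq> (0 :: 'a \<Rightarrow> 'b)" by (auto simp: fun_eq_iff)
  then show "\<exists>f :: 'a \<Rightarrow> 'b. f \<noteq> 0" by blast
qed

typedef (overloaded) 'a linmap = "{f :: 'a::real_vector \<Rightarrow> 'a. linear f}"
  morphisms lin_apply Abs_linmap
  using linear_ident by auto

setup_lifting type_definition_linmap

instantiation linmap :: (nontrivial_vector) real_algebra_1
begin

lift_definition zero_linmap :: "'a linmap" is "\<lambda>_. 0" by (rule linear_zero)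
lift_definition one_linmap :: "'a linmap" is "\<lambda>x. x" by (rule linear_ident)
lift_definition plus_linmap :: "'a linmap \<Rightarrow> 'a linmap \<Rightarrow> 'a linmap" is "\<lambda>f g x. f x + g x"
  by (rule linear_compose_add)
lift_definition minus_linmap :: "'a linmap \<Rightarrow> 'a linmap \<Rightarrow> 'a linmap" is "\<lambda>f g x. f x - g x"
  by (rule linear_compose_sub)
lift_definition uminus_linmap :: "'a linmap \<Rightarrow> 'a linmap" is "\<lambda>f x. - f x"
  by (rule linear_compose_neg)
lift_definition times_linmap :: "'a linmap \<Rightarrow> 'a linmap \<Rightarrow> 'a linmap" is "\<lambda>f g x. f (g x)"
  using linear_compose by (auto simp: o_def)
lift_definition scaleR_linmap :: "real \<Rightarrow> 'a linmap \<Rightarrow> 'a linmap" is "\<lambda>r f x. r *\<^sub>R f x"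
  by (rule linear_compose_scale_right)

instance
proof
  obtain x :: 'a where x: "x \<noteq> 0" using nontrivial by blast
  show "(0 :: 'a linmap) \<noteq> 1"
    by transfer (use x in \<open>auto simp: fun_eq_iff\<close>)
qed (transfer; simp add: fun_eq_iff algebra_simps linear_add linear_scale; fail)+

end

lemmas lin_apply_simps [simp] = zero_linmap.rep_eq one_linmap.rep_eq plus_linmap.rep_eq
  minus_linmap.rep_eq uminus_linmap.rep_eq times_linmap.rep_eq scaleR_linmap.rep_eq

lemma linear_lin_apply: "linear (lin_apply f)"
  using lin_apply by auto

lemma lin_apply_eqI: "(\<And>x. lin_apply f x = lin_apply g x) \<Longrightarrow> f = g"
  by (simp add: lin_apply_inject[symmetric] fun_eq_iff)

lemma lin_apply_sum: "lin_apply (sum f I) x = (\<Sum>i\<in>I. lin_apply (f i) x)"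
  by (induction I rule: infinite_finite_induct) simp_all

lemma lin_apply_power: "lin_apply (f ^ k) = lin_apply f ^^ k"
  by (induction k) (auto simp: fun_eq_iff)

lemma lin_apply_nexp: "lin_apply (nexp K f) = opexp K (lin_apply f)"
  by (simp add: nexp_def opexp_def fun_eq_iff lin_apply_sum lin_apply_power)

text \<open>
  The adjoint action needs an associative algebra, but the operators at hand are linear only on the
  subspace \<open>V\<close> of forms; composing with a linear projection onto \<open>V\<close> turns them into linear maps.
\<close>

definition hat :: "'a::real_vector set \<Rightarrow> ('a \<Rightarrow> 'a) \<Rightarrow> 'a linmap"
  where "hat V f = Abs_linmap (f \<circ> (SOME p. linear p \<and> (\<forall>x. p x \<in> V) \<and> (\<forall>x\<in>V. p x = x)))"

definition lin_on :: "'a::real_vector set \<Rightarrow> ('a \<Rightarrow> 'a) \<Rightarrow> bool"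
  where "lin_on V f \<longleftrightarrow> (\<forall>x\<in>V. f x \<in> V) \<and> (\<forall>x\<in>V. \<forall>y\<in>V. f (x + y) = f x + f y) \<and> (\<forall>r. \<forall>x\<in>V. f (r *\<^sub>R x) = r *\<^sub>R f x)"

lemma projection_exists:
  fixes V :: "'a::real_vector set"
  assumes "subspace V" shows "\<exists>p. linear p \<and> (\<forall>x. p x \<in> V) \<and> (\<forall>x\<in>V. p x = x)"
proof -
  obtain g where "range g \<subseteq> V" "linear g" "\<forall>x\<in>V. g (id x) = x"
    using linear_exists_left_inverse_on[OF linear_id assms] by auto
  then show ?thesis by (intro exI[of _ g]) auto
qed

text \<open>The third clause hides the projection: at y all operators are evaluated at one common
  point of V. This is how identities on V become identities of linear maps.\<close>

lemma hat_apply: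
  fixes V :: "'a::real_vector set"
  assumes V: "subspace V" and f: "lin_on V f"
  shows "x \<in> V \<Longrightarrow> lin_apply (hat V f) x = f x" and "lin_apply (hat V f) y \<in> V"
    and "\<exists>p. p y \<in> V \<and> lin_apply (hat V f) y = f (p y) \<and> (\<forall>g. lin_on V g \<longrightarrow> lin_apply (hat V g) y = g (p y))"
proof -
  define p where "p = (SOME p. linear p \<and> (\<forall>x. p x \<in> V) \<and> (\<forall>x\<in>V. p x = x))"
  have p: "linear p" "\<And>x. p x \<in> V" "\<And>x. x \<in> V \<Longrightarrow> p x = x"
    using someI_ex[OF projection_exists[OF V]] by (auto simp: p_def)
  have lin: "linear (g \<circ> p)" if "lin_on V g" for g
    using that p(2) by (intro linearI) (auto simp: lin_on_def linear_add[OF p(1)] linear_scale[OF p(1)])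
  have h: "lin_apply (hat V g) = g \<circ> p" if "lin_on V g" for g
    using lin[OF that] by (simp add: hat_def p_def[symmetric] Abs_linmap_inverse)
  show "x \<in> V \<Longrightarrow> lin_apply (hat V f) x = f x" using p by (simp add: h[OF f])
  show "lin_apply (hat V f) y \<in> V" using p f by (simp add: h[OF f] lin_on_def)
  show "\<exists>p. p y \<in> V \<and> lin_apply (hat V f) y = f (p y) \<and> (\<forall>g. lin_on V g \<longrightarrow> lin_apply (hat V g) y = g (p y))"
    using p h f by (intro exI[of _ p]) auto
qed

lemma lin_on_ops:
  assumes V: "subspace V" and "lin_on V f" "lin_on V g"
  shows "lin_on V (\<lambda>x. f (g x))" "lin_on V (\<lambda>x. f x + g x)" "lin_on V (\<lambda>x. f x - g x)"
    "lin_on V (\<lambda>x. r *\<^sub>R f x)" "lin_on V (\<lambda>x. - f x)" "lin_on V (\<lambda>x. x)" "lin_on V (\<lambda>x. 0)"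
  using assms by (auto simp: lin_on_def algebra_simps subspace_add subspace_diff subspace_scale subspace_neg subspace_0)

lemma hat_eqI:
  assumes V: "subspace V" and f: "lin_on V f" "lin_on V g" and "\<And>x. x \<in> V \<Longrightarrow> f x = g x"
  shows "hat V f = hat V g"
proof (rule lin_apply_eqI)
  fix y show "lin_apply (hat V f) y = lin_apply (hat V g) y"
    using hat_apply(3)[OF V f(1), of y] f(2) assms(4) by auto
qed

text \<open>Products are preserved because g takes values in V, where the projection is the
  identity. The unit is not preserved: the identity of V becomes the projection.\<close>

lemma hat_hom:
  fixes V :: "'a::nontrivial_vector set"
  assumes V: "subspace V" and f: "lin_on V f" and g: "lin_on V g"
  shows "hat V f * hat V g = hat V (\<lambda>x. f (g x))" "hat V f + hat V g = hat V (\<lambda>x. f x + g x)"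
    "hat V f - hat V g = hat V (\<lambda>x. f x - g x)" "r *\<^sub>R hat V f = hat V (\<lambda>x. r *\<^sub>R f x)"
    "- hat V f = hat V (\<lambda>x. - f x)" "0 = hat V (\<lambda>x. 0)"
proof -
  note ops = lin_on_ops[OF V f g]
  have e: "lin_apply (hat V h) y = h (p y)" if "p y \<in> V" "\<forall>g. lin_on V g \<longrightarrow> lin_apply (hat V g) y = g (p y)" "lin_on V h" for h p y
    using that by blast
  show "hat V f * hat V g = hat V (\<lambda>x. f (g x))"
  proof (rule lin_apply_eqI)
    fix y
    obtain p where p: "p y \<in> V" "\<forall>g. lin_on V g \<longrightarrow> lin_apply (hat V g) y = g (p y)" using hat_apply(3)[OF V f, of y] by blast
    have "g (p y) \<in> V" using g p(1) by (simp add: lin_on_def)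
    then show "lin_apply (hat V f * hat V g) y = lin_apply (hat V (\<lambda>x. f (g x))) y"
      using e[of p y, OF p g] e[of p y, OF p ops(1)] hat_apply(1)[OF V f] by simp
  qed
  show "hat V f + hat V g = hat V (\<lambda>x. f x + g x)" "hat V f - hat V g = hat V (\<lambda>x. f x - g x)"
    "r *\<^sub>R hat V f = hat V (\<lambda>x. r *\<^sub>R f x)" "- hat V f = hat V (\<lambda>x. - f x)" "0 = hat V (\<lambda>x. 0)"
  proof (safe intro!: lin_apply_eqI)
    fix y
    obtain p where p: "p y \<in> V" "\<forall>g. lin_on V g \<longrightarrow> lin_apply (hat V g) y = g (p y)" using hat_apply(3)[OF V f, of y] by blast
    note e' = e[of p y, OF p]
    show "lin_apply (hat V f + hat V g) y = lin_apply (hat V (\<lambda>x. f x + g x)) y" by (simp add: e' f g ops)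
    show "lin_apply (hat V f - hat V g) y = lin_apply (hat V (\<lambda>x. f x - g x)) y" by (simp add: e' f g ops)
    show "lin_apply (r *\<^sub>R hat V f) y = lin_apply (hat V (\<lambda>x. r *\<^sub>R f x)) y" by (simp add: e' f ops)
    show "lin_apply (- hat V f) y = lin_apply (hat V (\<lambda>x. - f x)) y" by (simp add: e' f ops)
    show "lin_apply 0 y = lin_apply (hat V (\<lambda>x. 0)) y" by (simp add: e' ops)
  qed
qed

section \<open>The order of a graded commutator\<close>

lemma total_space_lin:
  "x \<in> total_space A \<Longrightarrow> y \<in> total_space A \<Longrightarrow> x + y \<in> total_space A"
  "x \<in> total_space A \<Longrightarrow> y \<in> total_space A \<Longrightarrow> x - y \<in> total_space A"
  "x \<in> total_space A \<Longrightarrow> r *\<^sub>R x \<in> total_space A" "0 \<in> total_space A"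
  "x \<in> total_space A \<Longrightarrow> - x \<in> total_space A"
  by (simp_all add: total_space_def span_add span_diff span_scale span_zero span_neg)

lemma component_total_space: "x \<in> A k \<Longrightarrow> x \<in> total_space A"
  by (auto simp: total_space_def intro: span_base)

lemma endo_iff_lin_on: "endo A f \<longleftrightarrow> lin_on (total_space A) f"
  by (simp add: endo_def lin_on_def)

lemma ksign_add: "ksign (i + j) = ksign i * ksign j"
  by (auto simp: ksign_def)

lemma ksign_sq [simp]: "ksign i * ksign i = 1" "ksign i * (ksign i * x) = x"
  by (auto simp: ksign_def)

lemma endoD:
  assumes "endo A f" "x \<in> total_space A" "y \<in> total_space A"
  shows "f x \<in> total_space A" "f (x + y) = f x + f y" "f (x - y) = f x - f y" "f (r *\<^sub>R x) = r *\<^sub>R f x"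
    "f (- x) = - f x"
proof -
  show 1: "f x \<in> total_space A" "f (x + y) = f x + f y" and s: "f (r *\<^sub>R x) = r *\<^sub>R f x" for r
    using assms by (auto simp: endo_def)
  show "f (- x) = - f x" using s[of "-1"] by simp
  have "f (- y) = - f y" using assms(1,3) by (auto simp: endo_def) (metis scaleR_minus1_left)
  moreover have "f (x + - y) = f x + f (- y)"
    using assms(1,2) total_space_lin(5)[OF assms(3)] unfolding endo_def by blast
  ultimately show "f (x - y) = f x - f y" by simp
qed

locale graded_algebra =
  fixes A :: "int \<Rightarrow> 'a::real_vector set" and m :: "'a \<Rightarrow> 'a \<Rightarrow> 'a" and e :: 'a
  assumes alg: "graded_comm_algebra A m e"
begin

abbreviation "T \<equiv> total_space A"

lemmas inT = component_total_space[of _ A]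

lemma sub: "subspace (A k)" using alg by (simp add: graded_comm_algebra_def)

lemma endo_m: "a \<in> T \<Longrightarrow> endo A (m a)" "a \<in> T \<Longrightarrow> endo A (\<lambda>b. m b a)"
  using alg by (simp_all add: graded_comm_algebra_def)

lemma m_assoc: "a \<in> T \<Longrightarrow> b \<in> T \<Longrightarrow> c \<in> T \<Longrightarrow> m (m a b) c = m a (m b c)"
  using alg by (simp add: graded_comm_algebra_def)

lemma m_comm: "a \<in> A i \<Longrightarrow> b \<in> A j \<Longrightarrow> m a b \<in> A (i + j)" "a \<in> A i \<Longrightarrow> b \<in> A j \<Longrightarrow> m a b = ksign (i * j) *\<^sub>R m b a"
  using alg unfolding graded_comm_algebra_def by blast+

lemma has_degree_m: "a \<in> A j \<Longrightarrow> has_degree A j (m a)"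
  unfolding has_degree_def using endo_m(1)[OF component_total_space[of a A j]] m_comm(1)[of a j] by (simp add: add.commute)

lemma has_degree_endo: "has_degree A k f \<Longrightarrow> endo A f" by (simp add: has_degree_def)

lemma has_degree_cong:
  assumes "has_degree A k f" "\<And>x. x \<in> T \<Longrightarrow> f x = g x" shows "has_degree A k g"
proof -
  have "endo A g" using assms by (auto simp: has_degree_def endo_def total_space_lin)
  moreover have "g x \<in> A (j + k)" if "x \<in> A j" for j x
    using assms that component_total_space[of x A j] by (metis has_degree_def)
  ultimately show ?thesis by (simp add: has_degree_def)
qed

lemma has_degree_comp:
  assumes "has_degree A i f" "has_degree A j g" shows "has_degree A (i + j) (\<lambda>x. f (g x))"
  unfolding has_degree_def
proof (intro conjI allI ballI)
  show "endo A (\<lambda>x. f (g x))"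
    using assms by (simp add: has_degree_def endo_def)
  fix k x assume "x \<in> A k"
  then have "f (g x) \<in> A (k + j + i)" using assms by (simp add: has_degree_def)
  then show "f (g x) \<in> A (k + (i + j))" by (simp add: algebra_simps)
qed

lemma has_degree_lin:
  assumes "has_degree A k f" "has_degree A k g"
  shows "has_degree A k (\<lambda>x. f x + g x)" "has_degree A k (\<lambda>x. f x - g x)" "has_degree A k (\<lambda>x. r *\<^sub>R f x)" "has_degree A k (\<lambda>x. 0)"
  using assms subspace_add[OF sub] subspace_diff[OF sub] subspace_scale[OF sub] subspace_0[OF sub]
  by (auto simp: has_degree_def endo_def total_space_lin algebra_simps)

lemma has_degree_gcomm:
  assumes "has_degree A i f" "has_degree A j g" shows "has_degree A (i + j) (gcomm i j f g)"
  unfolding gcomm_def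
  using has_degree_lin(2)[OF has_degree_comp[OF assms] has_degree_lin(3)[OF has_degree_comp[OF assms(2,1), unfolded add.commute[of j i]] has_degree_comp[OF assms]]]
  by blast

lemma order_le_has_degree: "order_le A m r k f \<Longrightarrow> has_degree A k f"
  by (cases r) auto

lemma order_le_cong:
  "order_le A m r k f \<Longrightarrow> (\<And>x. x \<in> T \<Longrightarrow> f x = g x) \<Longrightarrow> order_le A m r k g"
proof (induction r arbitrary: k f g)
  case 0
  then show ?case using has_degree_cong[of k f g] by (auto intro: has_degree_cong)
next
  case (Suc r)
  have "order_le A m r (j + k) (gcomm j k (m a) g)" if "a \<in> A j" for j a
  proof (rule Suc.IH)
    show "order_le A m r (j + k) (gcomm j k (m a) f)" using Suc.prems(1) that by simp
    fix x assume "x \<in> T"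
    then show "gcomm j k (m a) f x = gcomm j k (m a) g x"
      using Suc.prems(2) endoD(1)[OF endo_m(1)[OF inT[OF that]]] by (simp add: gcomm_def)
  qed
  then show ?case using Suc.prems has_degree_cong by auto
qed

lemma order_le_zero: "order_le A m r k (\<lambda>_. 0)"
proof (induction r arbitrary: k)
  case 0
  have hd: "has_degree A k (\<lambda>_. 0)"
    using subspace_0[OF sub] by (simp add: has_degree_def endo_def total_space_lin)
  have "m 0 x = 0" if "x \<in> T" for x
    using endoD(4)[OF endo_m(2)[OF that] total_space_lin(4) total_space_lin(4), of 0] by simp
  then show ?case using hd subspace_0[OF sub] by auto
next
  case (Suc r)
  have hd: "has_degree A k (\<lambda>_. 0)"
    using subspace_0[OF sub] by (simp add: has_degree_def endo_def total_space_lin)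
  have "order_le A m r (j + k) (gcomm j k (m a) (\<lambda>_. 0))" if "a \<in> A j" for j a
    using endoD(4)[OF endo_m(1)[OF inT[OF that]] total_space_lin(4) total_space_lin(4), of 0]
    by (intro order_le_cong[OF Suc]) (simp add: gcomm_def)
  then show ?case using hd by simp
qed

lemma order_le_add:
  "order_le A m r k f \<Longrightarrow> order_le A m r k g \<Longrightarrow> order_le A m r k (\<lambda>x. f x + g x)"
proof (induction r arbitrary: k f g)
  case 0
  then obtain a b where ab: "a \<in> A k" "b \<in> A k" "\<And>x. x \<in> T \<Longrightarrow> f x = m a x" "\<And>x. x \<in> T \<Longrightarrow> g x = m b x" by auto
  have "f x + g x = m (a + b) x" if "x \<in> T" for x
    using ab that endoD(2)[OF endo_m(2)[OF that] inT[OF ab(1)] inT[OF ab(2)]] by simp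
  then show ?case using 0 ab subspace_add[OF sub] has_degree_lin(1) by auto
next
  case (Suc r)
  have d: "has_degree A k f" "has_degree A k g" using Suc.prems by auto
  have "order_le A m r (j + k) (gcomm j k (m a) (\<lambda>x. f x + g x))" if a: "a \<in> A j" for j a
  proof (rule order_le_cong[OF Suc.IH])
    show "order_le A m r (j + k) (gcomm j k (m a) f)" "order_le A m r (j + k) (gcomm j k (m a) g)" using Suc.prems a by auto
    fix x assume x: "x \<in> T"
    have "f x \<in> T" "g x \<in> T" using endoD(1)[OF has_degree_endo] d x by blast+
    then show "gcomm j k (m a) f x + gcomm j k (m a) g x = gcomm j k (m a) (\<lambda>x. f x + g x) x"
      using endoD(2)[OF endo_m(1)[OF inT[OF a]]] by (simp add: gcomm_def algebra_simps)
  qed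
  then show ?case using d has_degree_lin(1) by auto
qed

lemma order_le_scale: "order_le A m r k f \<Longrightarrow> order_le A m r k (\<lambda>x. s *\<^sub>R f x)"
proof (induction r arbitrary: k f)
  case 0
  then obtain a where ab: "a \<in> A k" "\<And>x. x \<in> T \<Longrightarrow> f x = m a x" by auto
  have "s *\<^sub>R f x = m (s *\<^sub>R a) x" if "x \<in> T" for x
    using ab that endoD(4)[OF endo_m(2)[OF that] inT[OF ab(1)] inT[OF ab(1)]] by simp
  then show ?case using 0 ab subspace_scale[OF sub] has_degree_lin(3) by auto
next
  case (Suc r)
  have d: "has_degree A k f" using Suc.prems by auto
  have "order_le A m r (j + k) (gcomm j k (m a) (\<lambda>x. s *\<^sub>R f x))" if a: "a \<in> A j" for j a
  proof (rule order_le_cong[OF Suc.IH])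
    show "order_le A m r (j + k) (gcomm j k (m a) f)" using Suc.prems a by auto
    fix x assume x: "x \<in> T"
    have "f x \<in> T" using endoD(1)[OF has_degree_endo] d x by blast
    then show "s *\<^sub>R gcomm j k (m a) f x = gcomm j k (m a) (\<lambda>x. s *\<^sub>R f x) x"
      using endoD(4)[OF endo_m(1)[OF inT[OF a]]] by (simp add: gcomm_def algebra_simps)
  qed
  then show ?case using d has_degree_lin(3) by auto
qed

lemma gcomm_swap: "gcomm i j f g x = - ksign (i * j) *\<^sub>R gcomm j i g f x"
  by (simp add: gcomm_def algebra_simps)

lemma gcomm_jacobi:
  assumes a: "endo A p" and f: "endo A f" and g: "endo A g" and x: "x \<in> T"
  shows "gcomm j (i + l) p (gcomm i l f g) x
    = gcomm (j + i) l (gcomm j i p f) g x + ksign (j * i) *\<^sub>R gcomm i (j + l) f (gcomm j l p g) x"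
proof -
  note t = endoD(1)[OF a] endoD(1)[OF f] endoD(1)[OF g] total_space_lin
  note l = endoD(2-5)[OF a] endoD(2-5)[OF f] endoD(2-5)[OF g]
  show ?thesis
    using x by (simp add: gcomm_def l t scaleR_diff_right ring_distribs ksign_add mult.commute mult.left_commute)
qed

text \<open>Order shifted by one, so that operators vanishing on the total space get an order below
  that of multiplications; the commutator estimate then has a uniform induction.\<close>

definition ordz :: "nat \<Rightarrow> int \<Rightarrow> ('a \<Rightarrow> 'a) \<Rightarrow> bool"
  where "ordz r k f \<longleftrightarrow> has_degree A k f \<and> (case r of 0 \<Rightarrow> \<forall>x\<in>T. f x = 0 | Suc r' \<Rightarrow> order_le A m r' k f)"

lemma ordz_zero: "has_degree A k f \<Longrightarrow> (\<And>x. x \<in> T \<Longrightarrow> f x = 0) \<Longrightarrow> ordz r k f"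
  using order_le_cong[OF order_le_zero, of f] by (auto simp: ordz_def split: nat.splits)

lemma ordz_add: "ordz r k f \<Longrightarrow> ordz r k g \<Longrightarrow> ordz r k (\<lambda>x. f x + g x)"
  by (auto simp: ordz_def has_degree_lin order_le_add split: nat.splits)

lemma ordz_scale: "ordz r k f \<Longrightarrow> ordz r k (\<lambda>x. s *\<^sub>R f x)"
  by (auto simp: ordz_def has_degree_lin order_le_scale split: nat.splits)

lemma ordz_cong: "ordz r k f \<Longrightarrow> (\<And>x. x \<in> T \<Longrightarrow> f x = g x) \<Longrightarrow> ordz r k g"
  using has_degree_cong[of k f g] order_le_cong[of _ k f g] by (auto simp: ordz_def split: nat.splits)

text \<open>For shifted order 1 this is the graded commutativity of two multiplications; above that
  it is the definition of order.\<close>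

lemma ordz_gcomm_m:
  assumes f: "ordz r k f" and a: "a \<in> A j"
  shows "ordz (r - 1) (j + k) (gcomm j k (m a) f)"
proof -
  have d: "has_degree A (j + k) (gcomm j k (m a) f)"
    using f has_degree_gcomm[OF has_degree_m[OF a]] by (simp add: ordz_def)
  consider "r = 0" | "r = 1" | r' where "r = Suc (Suc r')" by (metis One_nat_def not0_implies_Suc)
  then show ?thesis
  proof cases
    case 1
    have "m a 0 = 0" using endoD(4)[OF endo_m(1)[OF inT[OF a]] total_space_lin(4) total_space_lin(4), of 0] by simp
    then show ?thesis using 1 f d endoD(1)[OF endo_m(1)[OF inT[OF a]]]
      by (intro ordz_zero) (auto simp: ordz_def gcomm_def)
  next
    case 2
    then obtain b where b: "b \<in> A k" "\<And>x. x \<in> T \<Longrightarrow> f x = m b x" using f by (auto simp: ordz_def)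
    note t = inT[OF a] inT[OF b(1)]
    have "gcomm j k (m a) f x = 0" if x: "x \<in> T" for x
    proof -
      have "m a (m b x) = m (m a b) x" using m_assoc t x by simp
      also have "\<dots> = m (ksign (j * k) *\<^sub>R m b a) x" using m_comm(2)[OF a b(1)] by simp
      also have "\<dots> = ksign (j * k) *\<^sub>R m b (m a x)"
        using endoD(4)[OF endo_m(2)[OF x] endoD(1)[OF endo_m(1)[OF t(2)] t(1) t(1)] t(1)] m_assoc t x by simp
      finally show ?thesis using b x endoD(1)[OF endo_m(1)[OF t(1)] x x] by (simp add: gcomm_def)
    qed
    then show ?thesis using d by (intro ordz_zero)
  next
    case 3
    then show ?thesis using f a d by (simp add: ordz_def)
  qed
qed

text \<open>Induction on the sum of the orders. The graded Jacobi identity writes the commutator of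
  a multiplication with [f, g] as two commutators in each of which one entry has lost one
  order.\<close>

lemma ordz_gcomm:
  "ordz p i f \<Longrightarrow> ordz q l g \<Longrightarrow> ordz (p + q - 2) (i + l) (gcomm i l f g)"
proof (induction "p + q" arbitrary: p q i l f g rule: less_induct)
  case less
  have d: "has_degree A i f" "has_degree A l g" using less.prems by (auto simp: ordz_def)
  have dc: "has_degree A (i + l) (gcomm i l f g)" by (rule has_degree_gcomm[OF d])
  have f0: "f 0 = 0" "g 0 = 0"
    using endoD(4)[OF has_degree_endo[OF d(1)] total_space_lin(4) total_space_lin(4), of 0]
      endoD(4)[OF has_degree_endo[OF d(2)] total_space_lin(4) total_space_lin(4), of 0] by simp_all
  consider "p = 0" | "q = 0" | "p = 1" "q > 0" | "q = 1" "p > 0" | "p \<ge> 2" "q \<ge> 2" by linarith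
  then show ?case
  proof cases
    case 1
    then show ?thesis using less.prems f0 endoD(1)[OF has_degree_endo[OF d(2)]]
      by (intro ordz_zero[OF dc]) (auto simp: ordz_def gcomm_def)
  next
    case 2
    then show ?thesis using less.prems f0 endoD(1)[OF has_degree_endo[OF d(1)]]
      by (intro ordz_zero[OF dc]) (auto simp: ordz_def gcomm_def)
  next
    case 3
    then obtain a where a: "a \<in> A i" "\<And>x. x \<in> T \<Longrightarrow> m a x = f x" using less.prems(1) by (auto simp: ordz_def)
    have "ordz (q - 1) (i + l) (gcomm i l (m a) g)" by (rule ordz_gcomm_m[OF less.prems(2) a(1)])
    moreover have "p + q - 2 = q - 1" using 3 by simp
    ultimately show ?thesis
      using a endoD(1)[OF has_degree_endo[OF d(2)]] by (auto simp: gcomm_def intro: ordz_cong)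
  next
    case 4
    then obtain a where a: "a \<in> A l" "\<And>x. x \<in> T \<Longrightarrow> m a x = g x" using less.prems(2) by (auto simp: ordz_def)
    have "ordz (p - 1) (i + l) (gcomm l i (m a) f)" using ordz_gcomm_m[OF less.prems(1) a(1)] by (simp add: add.commute)
    then have "ordz (p - 1) (i + l) (\<lambda>x. - ksign (i * l) *\<^sub>R gcomm l i (m a) f x)" by (rule ordz_scale)
    moreover have "p + q - 2 = p - 1" using 4 by simp
    moreover have "- ksign (i * l) *\<^sub>R gcomm l i (m a) f x = gcomm i l f g x" if "x \<in> T" for x
      unfolding gcomm_swap[of i l f g x] using a that endoD(1)[OF has_degree_endo[OF d(1)] that that]
      by (simp add: gcomm_def)
    ultimately show ?thesis using ordz_cong by simp
  next
    case 5
    \<comment> \<open>Both shifted orders are at least 2 here, so the truncated subtractions are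
      exact.\<close>
    define t where "t = p + q - 4"
    have t: "p + q - 2 = Suc (Suc t)" using 5 by (simp add: t_def)
    have "order_le A m t (j + (i + l)) (gcomm j (i + l) (m a) (gcomm i l f g))" if a: "a \<in> A j" for j a
    proof -
      have "ordz (p - 1 + q - 2) (j + i + l) (gcomm (j + i) l (gcomm j i (m a) f) g)"
        using 5 by (intro less.hyps ordz_gcomm_m less.prems a) auto
      moreover have "ordz (p + (q - 1) - 2) (i + (j + l)) (gcomm i (j + l) f (gcomm j l (m a) g))"
        using 5 by (intro less.hyps ordz_gcomm_m less.prems a) auto
      moreover have "p - 1 + q - 2 = Suc t" "p + (q - 1) - 2 = Suc t" "i + (j + l) = j + i + l" using t 5 by auto
      ultimately have "ordz (Suc t) (j + i + l) (\<lambda>x. gcomm (j + i) l (gcomm j i (m a) f) g x + ksign (j * i) *\<^sub>R gcomm i (j + l) f (gcomm j l (m a) g) x)"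
        using ordz_add ordz_scale by metis
      then have "ordz (Suc t) (j + i + l) (gcomm j (i + l) (m a) (gcomm i l f g))"
        using gcomm_jacobi[OF endo_m(1)[OF inT[OF a]] has_degree_endo[OF d(1)] has_degree_endo[OF d(2)]]
        by (auto intro: ordz_cong)
      then show ?thesis by (simp add: ordz_def add.assoc)
    qed
    then show ?thesis using dc t by (simp add: ordz_def)
  qed
qed

lemma order_le_gcomm:
  assumes "order_le A m (Suc r) i f" "order_le A m s l g"
  shows "order_le A m (r + s) (i + l) (gcomm i l f g)"
  using ordz_gcomm[of "Suc (Suc r)" i f "Suc s" l g] assms order_le_has_degree by (simp add: ordz_def del: order_le.simps)

end

section \<open>The contraction with the inverse bivector on forms\<close>

declare split_paired_All [simp del] split_paired_Ex [simp del]

text \<open>Cramer's rule shows the entries of the inverse as quotients of polynomials in the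
  entries of the form; this is why \<Lambda> preserves smoothness.\<close>

lemma (in symplectic_form) pinv_cramer:
  "pinv w i j = Determinants.det (\<chi> r l. if l = i then axis j 1 $ r else gram w $ r $ l) / Determinants.det (gram w)"
    "Determinants.det (gram w) \<noteq> 0"
proof -
  show nz: "Determinants.det (gram w) \<noteq> 0" using invertible_gram by (simp add: invertible_det_nz)
  have "gram w *v (matrix_inv (gram w) *v axis j 1) = axis j 1"
    by (simp add: matrix_vector_mul_assoc gram_inverse)
  then have "matrix_inv (gram w) *v axis j 1 = (\<chi> k. Determinants.det (\<chi> r l. if l = k then axis j 1 $ r else gram w $ r $ l) / Determinants.det (gram w))"
    using cramer[OF nz] by blast
  moreover have "(matrix_inv (gram w) *v axis j 1) $ i = pinv w i j"
    by (simp add: matrix_vector_mult_def axis_nth pinv_def if_distrib[of "\<lambda>x. _ * x"] cong: if_cong)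
  ultimately show "pinv w i j = Determinants.det (\<chi> r l. if l = i then axis j 1 $ r else gram w $ r $ l) / Determinants.det (gram w)"
    by simp
qed

lemma smooth_on_det:
  fixes B :: "'a::real_normed_vector \<Rightarrow> real ^ 'n ^ 'n"
  assumes S: "open S" and "\<And>i j. smooth_on S (\<lambda>x. B x $ i $ j)"
  shows "smooth_on S (\<lambda>x. Determinants.det (B x))"
  unfolding Determinants.det_def
  by (intro smooth_on_sum smooth_on_mult smooth_on_prod smooth_on_const assms)

lemma smooth_on_pinv:
  assumes S: "open S" and F: "sform S F" and sy: "\<And>x. x \<in> S \<Longrightarrow> symplectic_form (F x) n"
  shows "smooth_on S (\<lambda>x. pinv (F x) i j)"
proof -
  have g: "smooth_on S (\<lambda>x. gram (F x) $ r $ l)" for r l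
    using sform_smooth[OF F] by (simp add: gram_def)
  have "smooth_on S (\<lambda>x. (\<chi> r l. if l = i then axis j 1 $ r else gram (F x) $ r $ l) $ r $ l)" for r l
    by (cases "l = i") (simp_all add: smooth_on_const g)
  then have "smooth_on S (\<lambda>x. Determinants.det (\<chi> r l. if l = i then axis j 1 $ r else gram (F x) $ r $ l) / Determinants.det (gram (F x)))"
    by (intro smooth_on_divide smooth_on_det S g symplectic_form.pinv_cramer(2)[OF sy])
  then show ?thesis
    by (rule smooth_on_cong[OF S, rotated]) (simp add: symplectic_form.pinv_cramer(1)[OF sy])
qed

text \<open>T is injective because the pulled back form w is nondegenerate, hence bijective; it
  carries the dual vector of a pulled back covector to the dual vector of the covector itself, and
  the claim follows along generators.\<close>

lemma lam_pull:
  fixes w w' :: "('n::finite) ext"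
  assumes w: "symplectic_form w n" and w': "symplectic_form w' n" and T: "linear T" and eq: "w = pull T w'"
    and b: "b \<in> altf"
  shows "lam w (pull T b) = pull T (lam w' b)"
proof -
  interpret w: symplectic_form w n by (rule w)
  interpret w': symplectic_form w' n by (rule w')
  have inj: "inj T"
  proof (rule linear_injective_0[OF T, THEN iffD2], intro allI impI)
    fix v assume "T v = 0"
    then have "w [v, u] = 0" for u
      using linear_0[OF multilinD[OF altf_multilin[OF w'.w_altf], of "[]" "[T u]"]] by (simp add: eq pull_def)
    then show "v = 0" using w.nondeg by (simp add: nondegenerate_def)
  qed
  then have surj: "surj T" using linear_injective_imp_surjective[OF T] by blast
  have form: "\<exists>u'. pull T (form1 u) = form1 u'" for u
  proof -
    have "pull T (form1 u) \<in> ext 1"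
      using altf_pull[OF T altf_form1] by (simp add: ext_iff) (simp add: pull_def form1_def)
    then show ?thesis using ext_1_eq by blast
  qed
  show ?thesis
    using b
  proof (induction rule: altf_induct[where P = "\<lambda>b. lam w (pull T b) = pull T (lam w' b)"])
    case unit
    show ?case by (simp add: w.lam_unit w'.lam_unit)
  next
    case (wedge u b)
    obtain u' where u': "pull T (form1 u) = form1 u'" using form by blast
    have "T (sharp w u') = sharp w' u"
    proof (rule w'.sharp_flat[symmetric])
      have "pull T (ctr (T (sharp w u')) w') = pull T (form1 u)"
        using w.ctr_sharp_w[of u'] by (simp add: eq ctr_pull[symmetric] u')
      then have "ctr (T (sharp w u')) w' (map T vs) = form1 u (map T vs)" for vs
        by (simp add: pull_def fun_eq_iff)
      moreover have "\<exists>vs. ws = map T vs" for ws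
        using surj by (metis ex_map_conv surjD)
      ultimately show "ctr (T (sharp w u')) w' = form1 u" by (metis ext)
    qed
    moreover have "multilin b" "multilin (pull T b)" using wedge.hyps altf_pull[OF T] altf_multilin by blast+
    ultimately show ?case
      using wedge.IH by (simp add: wedge_pull[symmetric] u' w.lam_e w'.lam_e ctr_pull)
  qed simp_all
qed

definition lam_form :: "('m, 'n::finite) dform \<Rightarrow> ('m, 'n) dform \<Rightarrow> ('m, 'n) dform"
  where "lam_form \<omega> \<alpha> = (\<lambda>c x. lam (\<omega> c x) (\<alpha> c x))"

text \<open>The defect of \<Lambda> from being a derivation of the product: a bracket that contracts
  each factor once.\<close>

definition lam_cross :: "('n::finite) ext \<Rightarrow> 'n ext \<Rightarrow> 'n ext \<Rightarrow> 'n ext"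
  where "lam_cross w a b = (\<Sum>i\<in>UNIV. \<Sum>m\<in>UNIV. pinv w i m *\<^sub>R wedge (ctr (axis i 1) (parity a)) (ctr (axis m 1) b))"

context symplectic_form
begin

lemma lam_wedge: "lam w (wedge a b) = wedge (lam w a) b + wedge a (lam w b) + lam_cross w a b"
proof -
  have c: "ctr (axis i 1) (ctr (axis m 1) (wedge a b)) = wedge (ctr (axis i 1) (ctr (axis m 1) a)) b
     + wedge a (ctr (axis i 1) (ctr (axis m 1) b))
     + (wedge (ctr (axis i 1) (parity a)) (ctr (axis m 1) b) - wedge (ctr (axis m 1) (parity a)) (ctr (axis i 1) b))" for i m
    by (simp add: ctr_wedge ctr_parity wedge_linear)
  have "(\<Sum>i\<in>UNIV. \<Sum>m\<in>UNIV. (pinv w i m / 2) *\<^sub>R wedge (ctr (axis m 1) (parity a)) (ctr (axis i 1) b))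
    = (\<Sum>i\<in>UNIV. \<Sum>m\<in>UNIV. (pinv w m i / 2) *\<^sub>R wedge (ctr (axis i 1) (parity a)) (ctr (axis m 1) b))"
    by (rule sum.swap)
  also have "\<dots> = - (\<Sum>i\<in>UNIV. \<Sum>m\<in>UNIV. (pinv w i m / 2) *\<^sub>R wedge (ctr (axis i 1) (parity a)) (ctr (axis m 1) b))"
    unfolding sum_negf[symmetric] by (intro sum.cong refl) (subst pinv_skew, simp)
  finally have sk: "(\<Sum>i\<in>UNIV. \<Sum>m\<in>UNIV. (pinv w i m / 2) *\<^sub>R (wedge (ctr (axis i 1) (parity a)) (ctr (axis m 1) b) - wedge (ctr (axis m 1) (parity a)) (ctr (axis i 1) b)))
     = lam_cross w a b"
    by (simp add: scaleR_diff_right sum_subtractf lam_cross_def sum.distrib[symmetric] scaleR_add_left[symmetric])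
  show ?thesis
    unfolding lam_ctr_eq c scaleR_add_right sum.distrib sk
    by (simp add: wedge_sum_left wedge_sum_right wedge_linear)
qed

text \<open>The commutator of a with \<Lambda> is, up to a multiplication, minus
  \<open>lam_cross w a\<close>, a graded derivation in its second argument. Commuting with b
  therefore leaves a multiplication: \<Lambda> has order 2.\<close>

lemma lam_second_commutator:
  assumes a: "a \<in> ext p" and b: "b \<in> ext q"
  shows "wedge b (wedge a (lam w x) - lam w (wedge a x)) - (- 1) ^ (p * q) *\<^sub>R (wedge a (lam w (wedge b x)) - lam w (wedge a (wedge b x)))
    = (- 1) ^ (p * q) *\<^sub>R wedge (lam w (wedge a b) - wedge (lam w a) b - wedge a (lam w b)) x"
proof -
  have D: "wedge a (lam w y) - lam w (wedge a y) = - wedge (lam w a) y - lam_cross w a y" for y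
    by (simp add: lam_wedge)
  have sg: "(- 1) ^ k * ((- 1) ^ k * r) = r" for k and r :: real
    by (simp add: mult.assoc[symmetric] flip: power_mult_distrib)
  have la: "wedge b (lam w a) = (- 1) ^ (p * q) *\<^sub>R wedge (lam w a) b"
  proof (cases "p < 2")
    case True then show ?thesis by (simp add: lam_low[OF a])
  next
    case False
    then obtain p' where p': "p = Suc (Suc p')" by (metis add_2_eq_Suc le_Suc_ex not_less)
    then have "lam w a \<in> ext p'" using a lam_in_ext by blast
    then show ?thesis using b by (subst wedge_commute[of q _ p']) (auto simp: ext_iff p' power_add mult.commute)
  qed
  have c: "wedge (ctr v (parity a)) (parity b) = (- 1) ^ (p * q) *\<^sub>R wedge b (ctr v (parity a))" for v
  proof (cases p)
    case 0
    then have "ctr v (parity a) = 0"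
      using a by (auto simp: ext_iff ctr_def parity_def fun_eq_iff)
    then show ?thesis by simp
  next
    case (Suc p')
    have "ctr v (parity a) \<in> ext p'" using a Suc by (simp add: ctr_in_ext parity_ext ext_lin)
    then have "wedge (ctr v (parity a)) b = (- 1) ^ (p' * q) *\<^sub>R wedge b (ctr v (parity a))"
      using b by (intro wedge_commute) (auto simp: ext_iff)
    then show ?thesis using parity_ext[OF b] Suc by (simp add: wedge_scaleR_right power_add)
  qed
  have "lam_cross w a (wedge b x) = wedge (lam_cross w a b) x + (- 1) ^ (p * q) *\<^sub>R wedge b (lam_cross w a x)"
  proof -
    have "wedge (ctr v (parity a)) (ctr u (wedge b x)) = wedge (wedge (ctr v (parity a)) (ctr u b)) x
       + (- 1) ^ (p * q) *\<^sub>R wedge b (wedge (ctr v (parity a)) (ctr u x))" for u v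
      unfolding ctr_wedge wedge_add_right
      by (simp only: wedge_assoc[symmetric] c wedge_scaleR_left)
    then show ?thesis
      unfolding lam_cross_def
      by (simp add: wedge_sum_left wedge_sum_right scaleR_add_right sum.distrib wedge_linear scaleR_sum_right mult.commute)
  qed
  moreover have "wedge b (wedge (lam w a) x) = (- 1) ^ (p * q) *\<^sub>R wedge (lam w a) (wedge b x)"
    unfolding wedge_assoc[symmetric] la wedge_scaleR_left ..
  moreover have "lam w (wedge a b) - wedge (lam w a) b - wedge a (lam w b) = lam_cross w a b"
    by (simp add: lam_wedge)
  ultimately show ?thesis
    unfolding D by (simp add: wedge_linear scaleR_add_right scaleR_diff_right)
qed

end

text \<open>The truncated difference k - 1 does no harm in degree 0, since \<open>dloc\<close>
  vanishes at the empty list.\<close>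

lemma dloc_lenscale:
  assumes "sform S F" "x \<in> S"
  shows "dloc (\<lambda>y. lenscale g (F y)) x = lenscale (\<lambda>k. g (k - 1)) (dloc F x)"
proof -
  have "frechet_derivative (\<lambda>y. lenscale g (F y) vs) (at x) = (\<lambda>u. g (length vs) * frechet_derivative (\<lambda>y. F y vs) (at x) u)" for vs
    unfolding lenscale_def
    by (rule frechet_derivative_eq[OF has_derivative_mult_right[OF smooth_on_has_derivative[OF sform_smooth[OF assms(1)] assms(2)]]])
  note fd = this
  show ?thesis
  proof
    fix vs
    have "dloc (\<lambda>y. lenscale g (F y)) x vs
      = (\<Sum>i<length vs. (- 1) ^ i * (g (length vs - 1) * frechet_derivative (\<lambda>y. F y (take i vs @ drop (Suc i) vs)) (at x) (vs ! i)))"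
      unfolding dloc_def fd by (intro sum.cong refl) (simp add: min_def)
    then show "dloc (\<lambda>y. lenscale g (F y)) x vs = lenscale (\<lambda>k. g (k - 1)) (dloc F x) vs"
      by (simp add: dloc_def lenscale_def sum_distrib_left mult.left_commute)
  qed
qed

section \<open>The de Rham algebra of an almost symplectic manifold\<close>

locale almost_symplectic_manifold =
  fixes M :: "('m::{t2_space,second_countable_topology}, 'n::finite) chart set" and \<omega> :: "('m, 'n) dform" and n :: nat
  assumes dim: "CARD('n) = 2 * n" and as: "almost_symplectic M \<omega>"
begin

lemma M: "smooth_manifold M" using as by (simp add: almost_symplectic_def)

lemma omega: "\<omega> \<in> forms M 2" using as by (simp add: almost_symplectic_def)

lemma omega_all: "\<omega> \<in> allforms M" and omega_ext: "\<omega> c x \<in> ext 2"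
  using omega by (auto simp: forms_iff)

lemma sympl: "c \<in> M \<Longrightarrow> x \<in> chart_rng c \<Longrightarrow> symplectic_form (\<omega> c x) n"
  using as dim omega_ext by (simp add: symplectic_form_def almost_symplectic_def)

abbreviation "V \<equiv> allforms M"

lemma V: "subspace V" by (rule allforms_subspace[OF M])

lemma total: "total_space (deRham M) = V" by (rule total_space_deRham[OF M])

lemma V_lin: "\<alpha> \<in> V \<Longrightarrow> \<beta> \<in> V \<Longrightarrow> \<alpha> + \<beta> \<in> V" "\<alpha> \<in> V \<Longrightarrow> \<beta> \<in> V \<Longrightarrow> \<alpha> - \<beta> \<in> V" "\<alpha> \<in> V \<Longrightarrow> r *\<^sub>R \<alpha> \<in> V" "\<alpha> \<in> V \<Longrightarrow> - \<alpha> \<in> V" "0 \<in> V"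
  using V by (auto simp: subspace_add subspace_diff subspace_scale subspace_neg subspace_0)

lemma V_lam: assumes a: "\<alpha> \<in> V" shows "lam_form \<omega> \<alpha> \<in> V"
proof (rule allformsI)
  show "lam_form \<omega> \<alpha> c x = 0" if "c \<notin> M \<or> x \<notin> chart_rng c" for c x
    using allforms_off[OF a that] by (simp add: lam_form_def)
  show "sform (chart_rng c) (lam_form \<omega> \<alpha> c)" if c: "c \<in> M" for c
    unfolding sform_def
  proof (intro conjI ballI allI)
    show "lam_form \<omega> \<alpha> c x \<in> altf" for x
      unfolding lam_form_def by (intro altf_lam allforms_altf[OF a])
    fix vs
    have "smooth_on (chart_rng c) (\<lambda>x. \<Sum>i\<in>UNIV. \<Sum>m\<in>UNIV. pinv (\<omega> c x) i m * (1 / 2) * \<alpha> c x (axis m 1 # axis i 1 # vs))"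
      by (intro smooth_on_sum smooth_on_mult smooth_on_const open_chart_rng[OF M c] sform_smooth[OF allforms_sform[OF a c]]
        smooth_on_pinv[OF open_chart_rng[OF M c] allforms_sform[OF omega_all c] sympl[OF c]])
    then show "smooth_on (chart_rng c) (\<lambda>x. lam_form \<omega> \<alpha> c x vs)"
      by (simp add: lam_form_def lam_def)
  qed
  show "lam_form \<omega> \<alpha> c (snd c p) = pull (jac c c' (snd c p)) (lam_form \<omega> \<alpha> c' (snd c' p))"
    if c: "c \<in> M" "c' \<in> M" and p: "p \<in> chart_dom c" "p \<in> chart_dom c'" for c c' p
  proof -
    have "snd c p \<in> chart_rng c" "snd c' p \<in> chart_rng c'" "snd c p \<in> overlap c c'"
      using p by (auto simp: chart_rng_eq overlap_def)
    then show ?thesis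
      unfolding lam_form_def
      using lam_pull[OF sympl[OF c(1)] sympl[OF c(2)] jac_linear[OF M c] allforms_pull[OF omega_all c p] allforms_altf[OF a]]
        allforms_pull[OF a c p] by simp
  qed
qed

lemma deRham_cases:
  assumes "a \<in> deRham M k"
  obtains p where "k = int p" "a \<in> forms M p" | "k < 0" "a = 0"
  using assms by (cases "k < 0") (auto simp: deRham_def intro: that(1)[of "nat k"])

lemma forms_deRham: "a \<in> forms M p \<Longrightarrow> a \<in> deRham M (int p)"
  by (simp add: deRham_def)

lemma subspace_forms: "subspace (forms M p)"
  unfolding subspace_def by (auto simp: forms_iff V_lin ext_lin)

lemma subspace_deRham: "subspace (deRham M k)"
  by (simp add: deRham_def subspace_forms)

lemma zero_deRham: "0 \<in> deRham M k" using subspace_deRham by (rule subspace_0)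

lemma deRham_V: "a \<in> deRham M k \<Longrightarrow> a \<in> V"
  using component_total_space[of a "deRham M" k] total by simp

lemma lin_on_wedge: "\<alpha> \<in> V \<Longrightarrow> lin_on V (wedge_form \<alpha>)" "\<alpha> \<in> V \<Longrightarrow> lin_on V (\<lambda>\<beta>. wedge_form \<beta> \<alpha>)"
  by (auto simp: lin_on_def allforms_wedge[OF M], auto simp: wedge_form_def fun_eq_iff wedge_linear)

lemma lin_on_dR: "lin_on V (dR M)"
  by (simp add: lin_on_def allforms_dR[OF M] dR_add[OF M] dR_scaleR[OF M])

lemma lin_on_lam: "lin_on V (lam_form \<omega>)"
  by (simp add: lin_on_def V_lam) (simp add: lam_form_def fun_eq_iff)

lemma lin_on_form_map: "lin_on V (form_map g)"
  by (simp add: lin_on_def allforms_form_map[OF M]) (simp add: form_map_def fun_eq_iff)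

lemma has_degreeI:
  assumes f: "lin_on V f" and "\<And>p a. a \<in> forms M p \<Longrightarrow> f a \<in> deRham M (int p + k)"
  shows "has_degree (deRham M) k f"
  unfolding has_degree_def endo_iff_lin_on total
proof (intro conjI allI ballI f)
  fix j a assume "a \<in> deRham M j"
  then show "f a \<in> deRham M (j + k)"
  proof (cases rule: deRham_cases)
    case (1 p) then show ?thesis using assms(2) by simp
  next
    case 2
    have "f (0 *\<^sub>R 0) = 0 *\<^sub>R f 0" using f V_lin(5) unfolding lin_on_def by blast
    then show ?thesis using 2 zero_deRham by simp
  qed
qed

lemma wedge_forms: "a \<in> forms M p \<Longrightarrow> b \<in> forms M q \<Longrightarrow> wedge_form a b \<in> forms M (p + q)"
  by (simp add: forms_iff allforms_wedge[OF M]) (simp add: wedge_form_def wedge_in_ext)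

lemma ksign_int: "ksign (int p) = (- 1) ^ p"
  by (simp add: ksign_def)

lemma form_map_sign: "a \<in> deRham M i \<Longrightarrow> form_map (\<lambda>k. (- 1) ^ k) a = ksign i *\<^sub>R a"
proof (erule deRham_cases)
  fix p assume "i = int p" "a \<in> forms M p"
  then have "lenscale (\<lambda>k. (- 1) ^ k) (a c x) = (ksign i *\<^sub>R a) c x" for c x
    by (simp add: forms_iff lenscale_ext ksign_int)
  then show ?thesis by (intro ext) (simp add: form_map_def)
next
  assume "a = 0" then show ?thesis by (simp add: form_map_def lenscale_def fun_eq_iff)
qed

lemma graded_comm_algebra_deRham: "graded_comm_algebra (deRham M) wedge_form (one_form M)"
  unfolding graded_comm_algebra_def endo_iff_lin_on total
proof (intro conjI allI ballI impI)
  show "subspace (deRham M k)" for k by (rule subspace_deRham)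
  fix K :: "int set" and x k
  assume K: "finite K" "\<forall>k\<in>K. x k \<in> deRham M k" "(\<Sum>k\<in>K. x k) = 0" "k \<in> K"
  \<comment> \<open>Components of different degree live on lists of different length, which makes
    the sum direct.\<close>
  have supp: "x j c y vs = 0" if "j \<in> K" "int (length vs) \<noteq> j" for j c y vs
    using K(2) that by (auto simp: forms_iff ext_iff elim!: deRham_cases dest!: bspec)
  show "x k = 0"
  proof (intro ext)
    fix c y vs
    show "x k c y vs = 0 c y vs"
    proof (cases "int (length vs) = k")
      case True
      have "(\<Sum>j\<in>K. x j c y vs) = (\<Sum>j\<in>K. if j = k then x k c y vs else 0)"
        by (intro sum.cong refl) (use supp True in auto)
      also have "\<dots> = x k c y vs" using K by simp
      moreover have "(\<Sum>j\<in>K. x j c y vs) = (\<Sum>j\<in>K. x j) c y vs" by (simp add: sum_fun_apply)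
      ultimately show ?thesis using K(3) by simp
    qed (use supp K in auto)
  qed
next
  fix a b c assume "a \<in> V" "b \<in> V" "c \<in> V"
  show "wedge_form (wedge_form a b) c = wedge_form a (wedge_form b c)" by (simp add: wedge_form_def wedge_assoc)
next
  show "one_form M \<in> deRham M 0" using forms_deRham[OF one_form_in_forms[OF M]] by simp
  fix a assume a: "a \<in> V"
  show "lin_on V (wedge_form a)" "lin_on V (\<lambda>b. wedge_form b a)" by (rule lin_on_wedge[OF a])+
  have "one_form M c x = unit_ext \<or> a c x = 0" for c x
    using allforms_off[OF a, of c x] unfolding one_form_def on_charts_def by auto
  then have "wedge (one_form M c x) (a c x) = a c x \<and> wedge (a c x) (one_form M c x) = a c x" for c x
    by (metis wedge_unit_left wedge_unit_right wedge_zero)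
  then show "wedge_form (one_form M) a = a" "wedge_form a (one_form M) = a" by (simp_all add: wedge_form_def)
next
  fix i j a b assume a: "a \<in> deRham M i" and b: "b \<in> deRham M j"
  have z: "wedge_form 0 b = 0" "wedge_form b 0 = 0" for b :: "('m, 'n) dform"
    by (simp_all add: wedge_form_def fun_eq_iff)
  show "wedge_form a b \<in> deRham M (i + j)"
    using a b by (elim deRham_cases) (use forms_deRham[OF wedge_forms] zero_deRham in \<open>auto simp: z\<close>)
  show "wedge_form a b = ksign (i * j) *\<^sub>R wedge_form b a"
    using a
  proof (cases rule: deRham_cases)
    case (1 p)
    note p = this
    show ?thesis using b
    proof (cases rule: deRham_cases)
      case (1 q)
      have "wedge (a c x) (b c x) = (- 1) ^ (p * q) *\<^sub>R wedge (b c x) (a c x)" for c x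
        using p(2) 1(2) by (intro wedge_commute) (auto simp: forms_iff ext_iff)
      then show ?thesis using p(1) 1(1) ksign_int[of "p * q"] by (simp add: wedge_form_def fun_eq_iff)
    qed (simp add: z)
  qed (simp add: z)
qed

sublocale GA: graded_algebra "deRham M" wedge_form "one_form M"
  by unfold_locales (rule graded_comm_algebra_deRham)

lemma degree_dR: "has_degree (deRham M) 1 (dR M)"
  by (rule has_degreeI[OF lin_on_dR]) (use forms_deRham[OF dR_forms[OF M]] in \<open>simp add: add.commute\<close>)

lemma degree_lam: "has_degree (deRham M) (- 2) (lam_form \<omega>)"
proof (rule has_degreeI[OF lin_on_lam])
  fix p a assume a: "a \<in> forms M p"
  then have a': "a \<in> V" "\<And>c x. a c x \<in> ext p" by (auto simp: forms_iff)
  show "lam_form \<omega> a \<in> deRham M (int p + - 2)"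
  proof (cases "p < 2")
    case True
    then have "lam_form \<omega> a = 0" using lam_low[OF a'(2)] by (simp add: lam_form_def fun_eq_iff)
    then show ?thesis using zero_deRham by simp
  next
    case False
    then obtain q where q: "p = Suc (Suc q)" by (metis add_2_eq_Suc le_Suc_ex not_less)
    then have "lam_form \<omega> a \<in> forms M q"
      using V_lam[OF a'(1)] a'(2) lam_in_ext by (simp add: forms_iff) (simp add: lam_form_def lam_in_ext)
    then show ?thesis using forms_deRham q by simp
  qed
qed

lemma dga: "commutative_dg_algebra (deRham M) wedge_form (one_form M) (dR M)"
  unfolding commutative_dg_algebra_def total
  using graded_comm_algebra_deRham degree_dR dR_dR[OF M] dR_wedge[OF M deRham_V] form_map_sign
  by (auto simp: wedge_form_def[of "_ *\<^sub>R _"] wedge_linear) (simp add: fun_eq_iff wedge_form_def wedge_linear)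

text \<open>By the Leibniz rule the commutator of a with d is multiplication by plus or minus
  da.\<close>

lemma order_dR: "order_le (deRham M) wedge_form 1 1 (dR M)"
proof -
  have "order_le (deRham M) wedge_form 0 (j + 1) (gcomm j 1 (wedge_form a) (dR M))" if a: "a \<in> deRham M j" for j a
  proof -
    have d: "has_degree (deRham M) (j + 1) (gcomm j 1 (wedge_form a) (dR M))"
      by (rule GA.has_degree_gcomm[OF GA.has_degree_m[OF a] degree_dR])
    have da: "dR M a \<in> deRham M (j + 1)" using degree_dR a by (simp add: has_degree_def)
    have "gcomm j 1 (wedge_form a) (dR M) x = wedge_form (- ksign j *\<^sub>R dR M a) x" if "x \<in> V" for x
      unfolding gcomm_def dR_wedge[OF M deRham_V[OF a] that] form_map_sign[OF a]
      by (simp add: wedge_form_def fun_eq_iff wedge_linear algebra_simps)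
    moreover have "- ksign j *\<^sub>R dR M a \<in> deRham M (j + 1)"
      using subspace_scale[OF subspace_deRham da] by blast
    ultimately show ?thesis using d unfolding order_le.simps total by blast
  qed
  then show ?thesis using degree_dR by simp
qed

text \<open>\<open>lam_second_commutator\<close> at every point, with the form that the iterated
  commutator multiplies by exhibited globally.\<close>

lemma order_lam: "order_le (deRham M) wedge_form 2 (- 2) (lam_form \<omega>)"
proof -
  have "order_le (deRham M) wedge_form 0 (j + (i + - 2)) (gcomm j (i + - 2) (wedge_form b) (gcomm i (- 2) (wedge_form a) (lam_form \<omega>)))"
    if a: "a \<in> deRham M i" and b: "b \<in> deRham M j" for i j a b
  proof -
    define c where "c = ksign (i * j) *\<^sub>R (lam_form \<omega> (wedge_form a b) - wedge_form (lam_form \<omega> a) b - wedge_form a (lam_form \<omega> b))"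
    have l: "lam_form \<omega> a \<in> deRham M (i + - 2)" "lam_form \<omega> b \<in> deRham M (j + - 2)"
      using degree_lam a b unfolding has_degree_def by blast+
    have "lam_form \<omega> (wedge_form a b) \<in> deRham M ((i + j) + - 2)"
      using degree_lam GA.m_comm(1)[OF a b] unfolding has_degree_def by blast
    moreover have "wedge_form (lam_form \<omega> a) b \<in> deRham M ((i + - 2) + j)" "wedge_form a (lam_form \<omega> b) \<in> deRham M (i + (j + - 2))"
      by (rule GA.m_comm(1)[OF l(1) b] GA.m_comm(1)[OF a l(2)])+
    moreover have "(i + j) + - 2 = j + (i + - 2)" "(i + - 2) + j = j + (i + - 2)" "i + (j + - 2) = j + (i + - 2)" by simp_all
    ultimately have cA: "c \<in> deRham M (j + (i + - 2))"
      unfolding c_def using subspace_scale[OF subspace_deRham] subspace_diff[OF subspace_deRham] by metis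
    have "gcomm j (i + - 2) (wedge_form b) (gcomm i (- 2) (wedge_form a) (lam_form \<omega>)) x = wedge_form c x" if x: "x \<in> V" for x
    proof (rule allforms_eqI[of _ M])
      have aV: "a \<in> V" "b \<in> V" using a b deRham_V by blast+
      show "gcomm j (i + - 2) (wedge_form b) (gcomm i (- 2) (wedge_form a) (lam_form \<omega>)) x \<in> V"
        unfolding gcomm_def by (intro V_lin allforms_wedge M V_lam aV x)
      show "wedge_form c x \<in> V" by (intro allforms_wedge M x deRham_V[OF cA])
      fix ch y assume ch: "ch \<in> M" "y \<in> chart_rng ch"
      interpret symplectic_form "\<omega> ch y" n by (rule sympl[OF ch])
      have s: "ksign (- (i * 2)) = 1" "ksign (j * (i - 2)) = ksign (i * j)" for i j
        by (auto simp: ksign_def)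
      show "gcomm j (i + - 2) (wedge_form b) (gcomm i (- 2) (wedge_form a) (lam_form \<omega>)) x ch y = wedge_form c x ch y"
        using a
      proof (cases rule: deRham_cases)
        case (1 p)
        note p = this
        show ?thesis using b
        proof (cases rule: deRham_cases)
          case (1 q)
          have "a ch y \<in> ext p" "b ch y \<in> ext q" using p(2) 1(2) by (auto simp: forms_iff)
          from lam_second_commutator[OF this, of "x ch y"] show ?thesis
            using p(1) 1(1) ksign_int[of "p * q"]
            by (simp add: gcomm_def s c_def wedge_form_def lam_form_def wedge_scaleR_left)
        next
          case 2
          then show ?thesis by (simp add: gcomm_def c_def wedge_form_def lam_form_def)
        qed
      next
        case 2
        then show ?thesis by (simp add: gcomm_def c_def wedge_form_def lam_form_def)
      qed
    qed
    moreover have "has_degree (deRham M) (j + (i + - 2)) (gcomm j (i + - 2) (wedge_form b) (gcomm i (- 2) (wedge_form a) (lam_form \<omega>)))"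
      by (intro GA.has_degree_gcomm GA.has_degree_m degree_lam a b)
    ultimately show ?thesis using cA unfolding order_le.simps total by blast
  qed
  then show ?thesis
    using degree_lam GA.has_degree_gcomm[OF GA.has_degree_m degree_lam] by (simp add: numeral_2_eq_2)
qed

section \<open>Symplectic adjoints\<close>

text \<open>Two candidates have the same pairing with all forms at a given point; bump forms take
  every value there up to a nonzero factor, and the pairing on the fibre is nondegenerate.\<close>

lemma adjoint_op_eq:
  assumes b: "\<beta> \<in> V" and g: "\<gamma> \<in> V"
    and adj: "\<And>\<alpha> c x. \<alpha> \<in> V \<Longrightarrow> c \<in> M \<Longrightarrow> x \<in> chart_rng c \<Longrightarrow>
      total_pairing (\<omega> c x) (\<phi> \<alpha> c x) (\<beta> c x) = total_pairing (\<omega> c x) (\<alpha> c x) (\<gamma> c x)"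
  shows "adjoint_op M \<omega> \<phi> \<beta> = \<gamma>"
  unfolding adjoint_op_def total
proof (rule the_equality)
  show "\<gamma> \<in> V \<and> (\<forall>\<alpha>\<in>V. \<forall>c\<in>M. \<forall>x\<in>chart_rng c.
       total_pairing (\<omega> c x) (\<phi> \<alpha> c x) (\<beta> c x) = total_pairing (\<omega> c x) (\<alpha> c x) (\<gamma> c x))"
    using g adj by blast
  fix \<delta>
  assume d: "\<delta> \<in> V \<and> (\<forall>\<alpha>\<in>V. \<forall>c\<in>M. \<forall>x\<in>chart_rng c.
       total_pairing (\<omega> c x) (\<phi> \<alpha> c x) (\<beta> c x) = total_pairing (\<omega> c x) (\<alpha> c x) (\<delta> c x))"
  show "\<delta> = \<gamma>"
  proof (rule allforms_eqI[of _ M])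
    show "\<delta> \<in> V" "\<gamma> \<in> V" using d g by auto
    fix c x assume c: "c \<in> M" "x \<in> chart_rng c"
    interpret symplectic_form "\<omega> c x" n by (rule sympl[OF c])
    have dx: "\<delta> c x \<in> altf" and gx: "\<gamma> c x \<in> altf" using d g allforms_altf by blast+
    have "\<delta> c x - \<gamma> c x = 0"
    proof (rule total_pairing_nondegenerate)
      show "\<delta> c x - \<gamma> c x \<in> altf" by (rule altf_diff[OF dx gx])
      fix a :: "'n ext" and k assume a: "a \<in> ext k"
      obtain \<alpha> r where al: "\<alpha> \<in> V" "r \<noteq> 0" "\<alpha> c x = r *\<^sub>R a"
        using bump_form[OF M c ext_altf[OF a]] by blast
      have "total_pairing (\<omega> c x) (\<alpha> c x) (\<delta> c x) = total_pairing (\<omega> c x) (\<alpha> c x) (\<gamma> c x)"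
        using d adj[OF al(1) c] al(1) c by metis
      then have "r * total_pairing (\<omega> c x) a (\<delta> c x - \<gamma> c x) = 0"
        unfolding al(3) total_pairing_eq[OF altf_lin(2)[OF ext_altf[OF a]] dx] total_pairing_eq[OF altf_lin(2)[OF ext_altf[OF a]] gx]
          total_pairing_eq[OF ext_altf[OF a] altf_diff[OF dx gx]]
        by (simp add: pr_scale pr_diff sum_subtractf sum_distrib_left[symmetric] right_diff_distrib)
      then show "total_pairing (\<omega> c x) a (\<delta> c x - \<gamma> c x) = 0" using al(2) by simp
    qed
    then show "\<delta> c x = \<gamma> c x" by simp
  qed
qed

lemma dual_lefschetz_eq: "\<beta> \<in> V \<Longrightarrow> dual_lefschetz M \<omega> \<beta> = lam_form \<omega> \<beta>"
  unfolding dual_lefschetz_def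
proof (rule adjoint_op_eq)
  fix \<alpha> c x assume "\<beta> \<in> V" "\<alpha> \<in> V" and c: "c \<in> M" "x \<in> chart_rng c"
  interpret symplectic_form "\<omega> c x" n by (rule sympl[OF c])
  show "total_pairing (\<omega> c x) (lefschetz \<omega> \<alpha> c x) (\<beta> c x) = total_pairing (\<omega> c x) (\<alpha> c x) (lam_form \<omega> \<beta> c x)"
    unfolding lefschetz_def wedge_form_def lam_form_def
    by (rule total_pairing_wedge_w) (rule allforms_altf, fact)+
qed (auto intro: V_lam)

end

section \<open>The total differential\<close>

text \<open>One power more than on V, because the first application is what brings an arbitrary y
  into V.\<close>

lemma hat_pow_zero:
  fixes f :: "'a::nontrivial_vector \<Rightarrow> 'a"
  assumes V: "subspace V" and f: "lin_on V f" and z: "\<And>x. x \<in> V \<Longrightarrow> (f ^^ K) x = 0"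
  shows "hat V f ^ Suc K = 0"
proof (rule lin_apply_eqI)
  fix y
  have p: "(lin_apply (hat V f) ^^ k) x = (f ^^ k) x \<and> (f ^^ k) x \<in> V" if "x \<in> V" for k x
    using that f hat_apply(1)[OF V f] by (induction k) (auto simp: lin_on_def)
  have "lin_apply (hat V f ^ Suc K) y = (lin_apply (hat V f) ^^ K) (lin_apply (hat V f) y)"
    by (simp add: power_commutes[symmetric] lin_apply_power)
  also have "\<dots> = 0" using p z hat_apply(2)[OF V f] by simp
  finally show "lin_apply (hat V f ^ Suc K) y = lin_apply 0 y" by simp
qed

lemma opexp_hat:
  assumes V: "subspace V" and f: "lin_on V f" and x: "x \<in> V"
  shows "opexp K (lin_apply (hat V f)) x = opexp K f x"
proof -
  have "(lin_apply (hat V f) ^^ k) x = (f ^^ k) x \<and> (f ^^ k) x \<in> V" for k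
    using x f hat_apply(1)[OF V f] by (induction k) (auto simp: lin_on_def)
  then show ?thesis by (simp add: opexp_def)
qed

context almost_symplectic_manifold
begin

abbreviation "d \<equiv> dR M"
abbreviation "Lop \<equiv> wedge_form \<omega>"
abbreviation "Lam \<equiv> lam_form \<omega>"
abbreviation "Wop \<equiv> wedge_form (dR M \<omega>)"
abbreviation "Eop \<equiv> form_map eps"
abbreviation "Pop \<equiv> form_map (\<lambda>k. (- 1) ^ k)"
abbreviation "KK \<equiv> nilk (\<omega> undefined undefined)"

definition weyl_op :: "('m, 'n) dform \<Rightarrow> ('m, 'n) dform"
  where "weyl_op \<alpha> = opexp KK Lop (opexp KK (\<lambda>\<alpha>. - Lam \<alpha>) (opexp KK Lop \<alpha>))"

lemma KK_eq: "KK = nilk (\<omega> c x)" "KK = CARD('n) + 2" by (simp_all add: nilk_def)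

lemma opexp_pointwise:
  assumes "\<And>\<alpha>. f \<alpha> c x = g (\<alpha> c x)" shows "opexp K f \<alpha> c x = opexp K g (\<alpha> c x)"
proof -
  have "(f ^^ j) \<alpha> c x = (g ^^ j) (\<alpha> c x)" for j by (induction j) (simp_all add: assms)
  then show ?thesis by (simp add: opexp_def sum_fun_apply)
qed

lemma weyl_op_pointwise: "weyl_op \<alpha> c x = weyl_ext (\<omega> c x) (\<alpha> c x)"
proof -
  have L: "opexp KK Lop \<alpha> c x = opexp (nilk (\<omega> c x)) (wedge (\<omega> c x)) (\<alpha> c x)" for \<alpha>
    unfolding KK_eq(1)[of c x] by (rule opexp_pointwise) (simp add: wedge_form_def)
  have M: "opexp KK (\<lambda>\<alpha>. - Lam \<alpha>) \<alpha> c x = opexp (nilk (\<omega> c x)) (\<lambda>a. - lam (\<omega> c x) a) (\<alpha> c x)" for \<alpha>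
    unfolding KK_eq(1)[of c x] by (rule opexp_pointwise) (simp add: lam_form_def)
  show ?thesis by (simp only: weyl_op_def weyl_ext_def L M)
qed

lemma lin_on_pow: "lin_on V f \<Longrightarrow> lin_on V (f ^^ k)"
  by (induction k) (auto simp: lin_on_def)

lemma lin_on_opexp: assumes "lin_on V f" shows "lin_on V (opexp K f)"
  using lin_on_pow[OF assms] unfolding lin_on_def opexp_def
  by (auto simp: scaleR_add_right sum.distrib scaleR_sum_right mult.commute intro!: subspace_sum[OF V] subspace_scale[OF V])

lemma lin_on_Lop: "lin_on V Lop" by (rule lin_on_wedge(1)[OF omega_all])
lemma lin_on_Wop: "lin_on V Wop" by (rule lin_on_wedge(1)[OF allforms_dR[OF M omega_all]])
lemma lin_on_neg_lam: "lin_on V (\<lambda>\<alpha>. - Lam \<alpha>)" by (rule lin_on_ops(5)[OF V lin_on_lam lin_on_lam])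

lemma lin_on_weyl_op: "lin_on V weyl_op"
  unfolding weyl_op_def[abs_def]
  by (rule lin_on_ops(1)[OF V lin_on_opexp[OF lin_on_Lop] lin_on_ops(1)[OF V lin_on_opexp[OF lin_on_neg_lam] lin_on_opexp[OF lin_on_Lop]]])

lemma V_weyl_op: "\<alpha> \<in> V \<Longrightarrow> weyl_op \<alpha> \<in> V" using lin_on_weyl_op by (simp add: lin_on_def)

lemma V_form_map: "\<alpha> \<in> V \<Longrightarrow> form_map g \<alpha> \<in> V" by (rule allforms_form_map[OF M])

text \<open>Fibrewise this is \<open>star_ext_eq\<close>. The right side is built from global
  operators, so the star inherits smoothness and compatibility between charts.\<close>

lemma star_eq: "\<alpha> \<in> V \<Longrightarrow> star M \<omega> \<alpha> = weyl_op (Eop \<alpha>)"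
proof (intro ext)
  fix c x vs assume a: "\<alpha> \<in> V"
  show "star M \<omega> \<alpha> c x vs = weyl_op (Eop \<alpha>) c x vs"
  proof (cases "c \<in> M \<and> x \<in> chart_rng c")
    case True
    then have c: "c \<in> M" "x \<in> chart_rng c" by auto
    interpret symplectic_form "\<omega> c x" n by (rule sympl[OF c])
    show ?thesis
      using c star_ext_eq[OF allforms_altf[OF a, of c x]]
      by (simp add: star_def on_charts_def weyl_op_pointwise pstar_def form_map_def)
  next
    case False
    then have "star M \<omega> \<alpha> c x = 0" by (auto simp: star_def on_charts_def)
    moreover have "weyl_op (Eop \<alpha>) c x = 0"
      by (rule allforms_off[OF V_weyl_op[OF V_form_map[OF a]]]) (use False in auto)
    ultimately show ?thesis by simp
  qed
qed

lemma V_star: "\<alpha> \<in> V \<Longrightarrow> star M \<omega> \<alpha> \<in> V"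
  by (simp add: star_eq V_weyl_op V_form_map)

lemma star_pointwise:
  assumes "\<alpha> \<in> V" "c \<in> M" "x \<in> chart_rng c" shows "star M \<omega> \<alpha> c x = pstar (\<omega> c x) (\<alpha> c x)"
  by (simp add: star_eq[OF assms(1)] weyl_op_pointwise pstar_def form_map_def)

lemma star_star: "\<alpha> \<in> V \<Longrightarrow> star M \<omega> (star M \<omega> \<alpha>) = \<alpha>"
proof (rule allforms_eqI[of _ M])
  fix c x assume a: "\<alpha> \<in> V" and c: "c \<in> M" "x \<in> chart_rng c"
  interpret symplectic_form "\<omega> c x" n by (rule sympl[OF c])
  show "star M \<omega> (star M \<omega> \<alpha>) c x = \<alpha> c x"
    by (simp add: star_pointwise V_star a c pstar_pstar[OF allforms_altf[OF a]])
qed (simp_all add: V_star)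

lemma Pop_apply: "Pop \<alpha> c x = parity (\<alpha> c x)"
  by (simp add: form_map_def parity_lenscale)

lemma star_Pop: "\<alpha> \<in> V \<Longrightarrow> star M \<omega> (Pop \<alpha>) = Pop (star M \<omega> \<alpha>)"
proof (rule allforms_eqI[of _ M])
  fix c x assume a: "\<alpha> \<in> V" and c: "c \<in> M" "x \<in> chart_rng c"
  interpret symplectic_form "\<omega> c x" n by (rule sympl[OF c])
  show "star M \<omega> (Pop \<alpha>) c x = Pop (star M \<omega> \<alpha>) c x"
    by (simp only: star_pointwise[OF V_form_map[OF a] c] star_pointwise[OF a c] Pop_apply
      parity_pstar[OF allforms_altf[OF a]])
qed (simp_all add: V_star V_form_map)

lemma form_map_form_map: "form_map g (form_map h \<alpha>) = form_map (\<lambda>k. g k * h k) \<alpha>"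
  by (simp add: form_map_def lenscale_lenscale)

lemma eps_eps: "eps k * eps k = 1" "(- 1) ^ k * (- 1) ^ k = (1 :: real)"
  by (simp_all add: eps_def flip: power_mult_distrib)

lemma form_map_one: "form_map (\<lambda>k. 1) \<alpha> = \<alpha>"
  by (simp add: form_map_def lenscale_def)

lemma weyl_op_surj: assumes "\<alpha> \<in> V" obtains y where "y \<in> V" "\<alpha> = weyl_op y"
  using star_star[OF assms] star_eq[OF V_star[OF assms]] V_form_map[OF V_star[OF assms]] by metis

text \<open>The star is an involution and equals the Weyl element up to \<open>eps\<close>, so here
  it undoes the Weyl element up to signs. As every form is a Weyl image, conjugation by the star
  becomes conjugation by the Weyl element.\<close>

lemma star_sign_weyl_op:
  assumes y: "y \<in> V" shows "star M \<omega> (Pop (weyl_op y)) = form_map (\<lambda>k. (- 1) ^ k * eps k) y"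
proof -
  have "weyl_op y = star M \<omega> (Eop y)"
    by (simp add: star_eq V_form_map y form_map_form_map eps_eps form_map_one)
  then have "star M \<omega> (Pop (weyl_op y)) = Pop (Eop y)"
    by (simp add: star_Pop star_star V_star V_form_map y)
  then show ?thesis by (simp add: form_map_form_map)
qed

lemma dR_form_map: "\<alpha> \<in> V \<Longrightarrow> d (form_map g \<alpha>) = form_map (\<lambda>k. g (k - 1)) (d \<alpha>)"
proof (rule allforms_eqI[of _ M])
  fix c x assume a: "\<alpha> \<in> V" and c: "c \<in> M" "x \<in> chart_rng c"
  have "form_map g \<alpha> c = (\<lambda>y. lenscale g (\<alpha> c y))" by (simp add: form_map_def)
  then show "d (form_map g \<alpha>) c x = form_map (\<lambda>k. g (k - 1)) (d \<alpha>) c x"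
    using dloc_lenscale[OF allforms_sform[OF a c(1)] c(2)] by (simp add: dR_eq c form_map_def)
qed (simp_all add: V_form_map allforms_dR[OF M])

text \<open>The image of d has no part of degree 0.\<close>

lemma form_map_dR_cong:
  assumes "\<alpha> \<in> V" "\<And>k. g (Suc k) = h (Suc k)" shows "form_map g (d \<alpha>) = form_map h (d \<alpha>)"
proof (intro ext)
  fix c x vs
  have "d \<alpha> c x [] = 0"
    by (cases "c \<in> M \<and> x \<in> chart_rng c") (auto simp: dR_eq dloc_Nil allforms_off[OF allforms_dR[OF M assms(1)]])
  then show "form_map g (d \<alpha>) c x vs = form_map h (d \<alpha>) c x vs"
    using assms(2) by (cases vs) (simp_all add: form_map_def lenscale_def)
qed

text \<open>The degree signs collapse to -1 in every degree k, by
  \<open>eps (Suc k) * ((- 1) ^ k * eps k) = - 1\<close>.\<close>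

lemma d_adjoint_weyl_op: assumes y: "y \<in> V" shows "d_adjoint M \<omega> (weyl_op y) = - weyl_op (d y)"
proof -
  have P: "degree_sign \<alpha> = Pop \<alpha>" for \<alpha> :: "('m, 'n) dform"
    by (simp add: degree_sign_def form_map_def lenscale_def)
  have dy: "d y \<in> V" by (rule allforms_dR[OF M y])
  have s: "eps (Suc k) * ((- 1) ^ k * eps k) = - 1" for k
    using eps_eps[of k] by (simp add: eps_Suc algebra_simps)
  have "d_adjoint M \<omega> (weyl_op y) = weyl_op (Eop (d (form_map (\<lambda>k. (- 1) ^ k * eps k) y)))"
    unfolding d_adjoint_def P star_sign_weyl_op[OF y] by (rule star_eq) (intro allforms_dR M V_form_map y)
  also have "Eop (d (form_map (\<lambda>k. (- 1) ^ k * eps k) y)) = form_map (\<lambda>k. - 1) (d y)"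
    unfolding dR_form_map[OF y] form_map_form_map by (rule form_map_dR_cong[OF y]) (simp add: s)
  also have "form_map (\<lambda>k. - 1) (d y) = (- 1) *\<^sub>R d y" by (simp add: form_map_def lenscale_def fun_eq_iff)
  also have "weyl_op ((- 1) *\<^sub>R d y) = (- 1) *\<^sub>R weyl_op (d y)" using lin_on_weyl_op dy unfolding lin_on_def by blast
  finally show ?thesis by simp
qed

lemma domega_ext: "d \<omega> c x \<in> ext 3"
  using dR_forms[OF M omega] by (simp add: forms_iff numeral_3_eq_3)

text \<open>W raises the degree by 3, not 1, and the collected sign
  \<open>eps (3 + k) * ((- 1) ^ k * eps k)\<close> is +1.\<close>

lemma star_Wop_weyl_op:
  assumes y: "y \<in> V" shows "star M \<omega> (Wop (star M \<omega> (Pop (weyl_op y)))) = weyl_op (Wop y)"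
proof -
  have W: "Wop (form_map g y) \<in> V" for g using lin_on_Wop V_form_map[OF y] by (simp add: lin_on_def)
  have s: "eps (3 + k) * ((- 1) ^ k * eps k) = 1" for k
    using eps_eps[of k] by (simp add: eps_Suc numeral_3_eq_3 algebra_simps)
  have "star M \<omega> (Wop (star M \<omega> (Pop (weyl_op y)))) = weyl_op (Eop (Wop (form_map (\<lambda>k. (- 1) ^ k * eps k) y)))"
    unfolding star_sign_weyl_op[OF y] by (rule star_eq[OF W])
  also have "Eop (Wop (form_map (\<lambda>k. (- 1) ^ k * eps k) y)) = Wop y"
  proof (intro ext)
    fix c x vs
    have "lenscale eps (wedge (d \<omega> c x) (lenscale (\<lambda>k. (- 1) ^ k * eps k) (y c x)))
      = wedge (d \<omega> c x) (lenscale (\<lambda>k. eps (3 + k) * ((- 1) ^ k * eps k)) (y c x))"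
      using domega_ext[of c x] by (subst lenscale_wedge[of 3]) (simp_all add: ext_iff lenscale_lenscale)
    then show "Eop (Wop (form_map (\<lambda>k. (- 1) ^ k * eps k) y)) c x vs = Wop y c x vs"
      unfolding s by (simp add: form_map_def wedge_form_def lenscale_def)
  qed
  finally show ?thesis .
qed

section \<open>The sl2 action on forms and the adjoints of d, [d, L] and [\<Lambda>, [d, L]]\<close>

abbreviation "rL \<equiv> hat V Lop"
abbreviation "rLam \<equiv> hat V Lam"
abbreviation "rd \<equiv> hat V d"
abbreviation "rW \<equiv> hat V Wop"
abbreviation "rH \<equiv> hat V (form_map (\<lambda>k. real n - real k))"

lemma ad_hat:
  assumes "lin_on V f" "lin_on V g" "lin_on V h" "\<And>x. x \<in> V \<Longrightarrow> f (g x) - g (f x) = h x"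
  shows "ad (hat V f) (hat V g) = hat V h"
  unfolding ad_def hat_hom(1)[OF V assms(1,2)] hat_hom(1)[OF V assms(2,1)]
    hat_hom(3)[OF V lin_on_ops(1)[OF V assms(1,2)] lin_on_ops(1)[OF V assms(2,1)]]
  by (rule hat_eqI[OF V lin_on_ops(3)[OF V lin_on_ops(1)[OF V assms(1,2)] lin_on_ops(1)[OF V assms(2,1)]] assms(3,4)])

lemma V_Lop: "\<alpha> \<in> V \<Longrightarrow> Lop \<alpha> \<in> V" using lin_on_Lop by (simp add: lin_on_def)
lemma V_Wop: "\<alpha> \<in> V \<Longrightarrow> Wop \<alpha> \<in> V" using lin_on_Wop by (simp add: lin_on_def)

lemma comm_d_L_eq: "\<alpha> \<in> V \<Longrightarrow> d (Lop \<alpha>) - Lop (d \<alpha>) = Wop \<alpha>"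
  using dR_wedge[OF M omega_all, of \<alpha>] form_map_sign[OF forms_deRham[OF omega]] by (simp add: ksign_def)

text \<open>H multiplies k-forms by n - k, so its bracket with an operator of degree r is -r times
  that operator; r = -2, 1, 3 give the weights of \<Lambda>, d and W.\<close>

lemma sl2: "sl2_pair rL rLam rH rd rW KK"
proof
  show "ad rLam rL = rH"
  proof (rule ad_hat[OF lin_on_lam lin_on_Lop lin_on_form_map])
    fix x assume x: "x \<in> V"
    show "Lam (Lop x) - Lop (Lam x) = form_map (\<lambda>k. real n - real k) x"
    proof (rule allforms_eqI[of _ M])
      fix c y assume c: "c \<in> M" "y \<in> chart_rng c"
      interpret symplectic_form "\<omega> c y" n by (rule sympl[OF c])
      show "(Lam (Lop x) - Lop (Lam x)) c y = form_map (\<lambda>k. real n - real k) x c y"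
        using lam_wedge_w[OF allforms_altf[OF x, of c y]] by (simp add: lam_form_def wedge_form_def form_map_def)
    qed (simp_all add: V_lin V_lam V_Lop V_form_map x)
  qed
  show "ad rH rLam = 2 *\<^sub>R rLam"
    unfolding hat_hom(4)[OF V lin_on_lam lin_on_lam]
  proof (rule ad_hat[OF lin_on_form_map lin_on_lam lin_on_ops(4)[OF V lin_on_lam lin_on_lam]], intro ext)
    fix x c y vs
    show "(form_map (\<lambda>k. real n - real k) (Lam x) - Lam (form_map (\<lambda>k. real n - real k) x)) c y vs = (2 *\<^sub>R Lam x) c y vs"
    proof -
      have "lam w (lenscale g a) vs = g (length vs + 2) * lam w a vs" for w g and a :: "'n ext"
        by (simp add: lam_def lenscale_def sum_distrib_left mult.left_commute)
      then show ?thesis by (simp add: form_map_def lam_form_def lenscale_def[of _ "lam _ _"] algebra_simps)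
    qed
  qed
  show "ad rd rL = rW"
    by (rule ad_hat[OF lin_on_dR lin_on_Lop lin_on_Wop comm_d_L_eq])
  show "ad rL rW = 0"
    unfolding hat_hom(6)[OF V lin_on_lam lin_on_lam]
  proof (rule ad_hat[OF lin_on_Lop lin_on_Wop lin_on_ops(7)[OF V lin_on_lam lin_on_lam]])
    fix x
    have "wedge (\<omega> c y) (d \<omega> c y) = wedge (d \<omega> c y) (\<omega> c y)" for c y
      using wedge_commute[of 2 "\<omega> c y" 3 "d \<omega> c y"] omega_ext[of c y] domega_ext[of c y] by (simp add: ext_iff)
    then have "wedge (\<omega> c y) (wedge (d \<omega> c y) a) = wedge (d \<omega> c y) (wedge (\<omega> c y) a)" for c y a
      by (metis wedge_assoc)
    then show "Lop (Wop x) - Wop (Lop x) = 0" by (simp add: wedge_form_def)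
  qed
  show "ad rH rd = - rd"
    unfolding hat_hom(5)[OF V lin_on_dR lin_on_dR]
  proof (rule ad_hat[OF lin_on_form_map lin_on_dR lin_on_ops(5)[OF V lin_on_dR lin_on_dR]])
    fix x assume x: "x \<in> V"
    have "form_map (\<lambda>k. real n - real (k - 1)) (d x) = form_map (\<lambda>k. real n - real k + 1) (d x)"
      by (rule form_map_dR_cong[OF x]) simp
    then show "form_map (\<lambda>k. real n - real k) (d x) - d (form_map (\<lambda>k. real n - real k) x) = - d x"
      unfolding dR_form_map[OF x] by (simp add: form_map_def lenscale_def fun_eq_iff algebra_simps)
  qed
  show "ad rH rW = - 3 *\<^sub>R rW"
    unfolding hat_hom(4)[OF V lin_on_Wop lin_on_Wop]
  proof (rule ad_hat[OF lin_on_form_map lin_on_Wop lin_on_ops(4)[OF V lin_on_Wop lin_on_Wop]], intro ext)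
    fix x c y vs
    have "lenscale (\<lambda>k. real n - real k) (wedge (d \<omega> c y) (x c y)) = wedge (d \<omega> c y) (lenscale (\<lambda>k. real n - real (3 + k)) (x c y))"
      using domega_ext[of c y] by (intro lenscale_wedge) (simp add: ext_iff)
    moreover have "lenscale (\<lambda>k. real n - real (3 + k)) (x c y) = lenscale (\<lambda>k. real n - real k) (x c y) - 3 *\<^sub>R x c y"
      by (simp add: lenscale_def fun_eq_iff algebra_simps)
    ultimately show "(form_map (\<lambda>k. real n - real k) (Wop x) - Wop (form_map (\<lambda>k. real n - real k) x)) c y vs = (- 3 *\<^sub>R Wop x) c y vs"
      by (simp add: form_map_def wedge_form_def wedge_linear)
  qed
  \<comment> \<open>On forms the power \<open>CARD('n) + 1\<close> is already zero; passing to
    \<open>hat\<close> costs one more.\<close>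
  have KS: "KK = Suc (CARD('n) + 1)" by (simp add: nilk_def)
  have Lz: "(Lop ^^ (CARD('n) + 1)) x = 0" and Mz: "(Lam ^^ (CARD('n) + 1)) x = 0" if x: "x \<in> V" for x
  proof -
    have p: "(Lop ^^ j) x c y = (wedge (\<omega> c y) ^^ j) (x c y)" for j c y
      by (induction j) (simp_all add: wedge_form_def)
    define nf where "nf c y = (\<lambda>a. - lam (\<omega> c y) a)" for c y
    have q: "(Lam ^^ j) x c y = (-1) ^ j *\<^sub>R (nf c y ^^ j) (x c y)" for j c y
    proof (induction j)
      case (Suc j)
      have "(Lam ^^ Suc j) x c y = lam (\<omega> c y) ((Lam ^^ j) x c y)" by (simp add: lam_form_def)
      also have "\<dots> = (-1) ^ j *\<^sub>R lam (\<omega> c y) ((nf c y ^^ j) (x c y))"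
        unfolding Suc by (rule linear_scale[OF lam_linear])
      also have "lam (\<omega> c y) ((nf c y ^^ j) (x c y)) = - nf c y ((nf c y ^^ j) (x c y))"
        unfolding nf_def by (rule minus_minus[symmetric])
      finally show ?case
        by (simp only: funpow.simps o_apply power_Suc mult_minus_left mult_1_left scaleR_minus_left scaleR_minus_right)
    qed simp
    have Lj: "(Lop ^^ j) x \<in> V" and Mj: "(Lam ^^ j) x \<in> V" for j
      using lin_on_pow[OF lin_on_Lop, of j] lin_on_pow[OF lin_on_lam, of j] x by (simp_all add: lin_on_def)
    show "(Lop ^^ (CARD('n) + 1)) x = 0"
    proof (rule allforms_eqI[OF Lj V_lin(5)])
      fix c y assume c: "c \<in> M" "y \<in> chart_rng c"
      interpret symplectic_form "\<omega> c y" n by (rule sympl[OF c])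
      show "(Lop ^^ (CARD('n) + 1)) x c y = 0 c y"
        unfolding p using wedge_w_nilpotent[OF allforms_altf[OF x], of "CARD('n) + 1"] by (simp del: funpow.simps)
    qed
    show "(Lam ^^ (CARD('n) + 1)) x = 0"
    proof (rule allforms_eqI[OF Mj V_lin(5)])
      fix c y assume c: "c \<in> M" "y \<in> chart_rng c"
      interpret symplectic_form "\<omega> c y" n by (rule sympl[OF c])
      show "(Lam ^^ (CARD('n) + 1)) x c y = 0 c y"
        unfolding q nf_def using lam_nilpotent[OF allforms_altf[OF x], of "CARD('n) + 1"] by (simp del: funpow.simps)
    qed
  qed
  show "rL ^ KK = 0" unfolding KS by (rule hat_pow_zero[OF V lin_on_Lop Lz])
  show "rLam ^ KK = 0" unfolding KS by (rule hat_pow_zero[OF V lin_on_lam Mz])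
qed

sublocale R: sl2_pair rL rLam rH rd rW KK by (rule sl2)

lemma lin_hat: "lin_on V f \<Longrightarrow> x \<in> V \<Longrightarrow> lin_apply (hat V f) x = f x"
  by (rule hat_apply(1)[OF V])

lemma weyl_apply: assumes x: "x \<in> V" shows "lin_apply R.weyl x = weyl_op x"
proof -
  have L: "lin_apply (nexp KK rL) x = opexp KK Lop x" if "x \<in> V" for x
    by (simp add: lin_apply_nexp opexp_hat[OF V lin_on_Lop that])
  have N: "lin_apply (nexp KK (- rLam)) x = opexp KK (\<lambda>\<alpha>. - Lam \<alpha>) x" if "x \<in> V" for x
    unfolding hat_hom(5)[OF V lin_on_lam lin_on_lam] by (simp add: lin_apply_nexp opexp_hat[OF V lin_on_neg_lam that])
  have 1: "opexp KK Lop x \<in> V" using lin_on_opexp[OF lin_on_Lop] x by (simp add: lin_on_def)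
  have 2: "opexp KK (\<lambda>\<alpha>. - Lam \<alpha>) (opexp KK Lop x) \<in> V" using lin_on_opexp[OF lin_on_neg_lam] 1 by (simp add: lin_on_def)
  show ?thesis by (simp add: R.weyl_def weyl_op_def L N x 1 2)
qed

text \<open>The algebra of linear maps contains elements, such as its unit, that need not map into
  V; this predicate singles out those whose values are always forms.\<close>

definition V_elem :: "('m, 'n) dform linmap \<Rightarrow> bool"
  where "V_elem r \<longleftrightarrow> (\<forall>y. lin_apply r y \<in> V)"

lemma V_elem_ops: "V_elem r \<Longrightarrow> V_elem s \<Longrightarrow> V_elem (r * s)" "V_elem r \<Longrightarrow> V_elem s \<Longrightarrow> V_elem (r - s)"
  "V_elem r \<Longrightarrow> V_elem s \<Longrightarrow> V_elem (ad r s)" "V_elem r \<Longrightarrow> V_elem (t *\<^sub>R r)" "V_elem r \<Longrightarrow> V_elem (- r)"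
  by (auto simp: V_elem_def ad_def V_lin)

lemma V_elem_hat: "lin_on V f \<Longrightarrow> V_elem (hat V f)"
  by (simp add: V_elem_def hat_apply(2)[OF V])

lemma V_elem_W: "V_elem R.W2" "V_elem R.W3"
  unfolding R.W3_def R.W2_def R.W1_def by (intro V_elem_ops V_elem_hat lin_on_lam lin_on_Wop)+

lemma V_W3: "lin_apply R.W3 x \<in> V" and V_W2: "lin_apply R.W2 x \<in> V"
  using V_elem_W by (simp_all add: V_elem_def)

lemma ad_apply: "x \<in> V \<Longrightarrow> lin_apply (ad rLam rd) x = Lam (d x) - d (Lam x)"
  by (simp add: ad_def lin_hat lin_on_lam lin_on_dR V_lam allforms_dR[OF M])

text \<open>With x written as the Weyl image of y, \<open>R.weyl_d\<close> at y and
  \<open>d_adjoint_weyl_op\<close> compute the same form.\<close>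

lemma d_adjoint_eq: assumes x: "x \<in> V" shows "d_adjoint M \<omega> x = Lam (d x) - d (Lam x) + lin_apply R.W2 x"
proof -
  obtain y where y: "y \<in> V" "x = weyl_op y" by (rule weyl_op_surj[OF x])
  have "lin_apply (R.weyl * rd) y = lin_apply (- (ad rLam rd + R.W2) * R.weyl) y" by (simp only: R.weyl_d)
  then have "weyl_op (d y) = - (lin_apply (ad rLam rd) x + lin_apply R.W2 x)"
    using y by (simp add: weyl_apply lin_hat lin_on_dR allforms_dR[OF M])
  then show ?thesis using d_adjoint_weyl_op[OF y(1)] ad_apply[OF x] by (simp flip: y(2))
qed

lemma star_Wop_eq: assumes x: "x \<in> V" shows "- star M \<omega> (Wop (star M \<omega> (Pop x))) = lin_apply R.W3 x"
proof -
  obtain y where y: "y \<in> V" "x = weyl_op y" by (rule weyl_op_surj[OF x])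
  have "lin_apply (R.weyl * rW) y = lin_apply (- R.W3 * R.weyl) y" by (simp only: R.weyl_W)
  then have "weyl_op (Wop y) = - lin_apply R.W3 x"
    using y by (simp add: weyl_apply lin_hat lin_on_Wop V_Wop)
  then show ?thesis using star_Wop_weyl_op[OF y(1)] by (simp flip: y(2))
qed

text \<open>\<open>total_pairing_wedge_3\<close> gives the adjoint of W as a star conjugate, which
  \<open>star_Wop_eq\<close> identifies with \<open>R.W3\<close>.\<close>

lemma pairing_Wop:
  assumes "\<alpha> \<in> V" "\<beta> \<in> V" "c \<in> M" "x \<in> chart_rng c"
  shows "total_pairing (\<omega> c x) (Wop \<alpha> c x) (\<beta> c x) = total_pairing (\<omega> c x) (\<alpha> c x) (lin_apply R.W3 \<beta> c x)"
proof -
  interpret symplectic_form "\<omega> c x" n by (rule sympl[OF assms(3,4)])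
  define \<gamma> where "\<gamma> = star M \<omega> (Pop \<beta>)"
  have g: "\<gamma> \<in> V" unfolding \<gamma>_def by (intro V_star V_form_map assms(2))
  have "\<gamma> c x = pstar (\<omega> c x) (parity (\<beta> c x))"
    unfolding \<gamma>_def by (simp only: star_pointwise[OF V_form_map[OF assms(2)] assms(3,4)] Pop_apply)
  moreover have "star M \<omega> (Wop \<gamma>) c x = pstar (\<omega> c x) (wedge (d \<omega> c x) (\<gamma> c x))"
    unfolding star_pointwise[OF V_Wop[OF g] assms(3,4)] by (simp only: wedge_form_def)
  moreover have "lin_apply R.W3 \<beta> c x = - star M \<omega> (Wop \<gamma>) c x"
    unfolding star_Wop_eq[OF assms(2), symmetric] \<gamma>_def by simp
  ultimately have "lin_apply R.W3 \<beta> c x = - pstar (\<omega> c x) (wedge (d \<omega> c x) (pstar (\<omega> c x) (parity (\<beta> c x))))"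
    by simp
  then show ?thesis
    using total_pairing_wedge_3[OF domega_ext[of c x] allforms_altf[OF assms(1), of c x] allforms_altf[OF assms(2), of c x]]
    by (simp only: wedge_form_def)
qed

lemma comm_d_L_V: "\<alpha> \<in> V \<Longrightarrow> comm_d_L M \<omega> \<alpha> = Wop \<alpha>"
  using comm_d_L_eq[of \<alpha>] by (simp add: comm_d_L_def gcomm_def lefschetz_def ksign_def)

lemma adjoint_comm_d_L: "\<beta> \<in> V \<Longrightarrow> adjoint_op M \<omega> (comm_d_L M \<omega>) \<beta> = lin_apply R.W3 \<beta>"
  by (rule adjoint_op_eq) (simp_all add: V_W3 comm_d_L_V pairing_Wop)

lemma comm_Lambda_d_L_V: "\<alpha> \<in> V \<Longrightarrow> comm_Lambda_d_L M \<omega> \<alpha> = Lam (Wop \<alpha>) - Wop (Lam \<alpha>)"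
  by (simp add: comm_Lambda_d_L_def gcomm_def comm_d_L_V dual_lefschetz_eq V_Wop V_lam ksign_def)

text \<open>Adjoints reverse commutators: the adjoint of [\<Lambda>, W] is [W3, L] = -[L, W3] = -W2.
  Added to the adjoint of d, which is [\<Lambda>, d] + W2, it leaves [\<Lambda>, d].\<close>

lemma adjoint_comm_Lambda_d_L:
  assumes b: "\<beta> \<in> V" shows "adjoint_op M \<omega> (comm_Lambda_d_L M \<omega>) \<beta> = - lin_apply R.W2 \<beta>"
proof (rule adjoint_op_eq[OF b])
  show "- lin_apply R.W2 \<beta> \<in> V" by (intro V_lin V_W2)
  fix \<alpha> c x assume a: "\<alpha> \<in> V" and c: "c \<in> M" "x \<in> chart_rng c"
  interpret symplectic_form "\<omega> c x" n by (rule sympl[OF c])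
  have "R.W2 = ad rL R.W3" by (simp add: R.W_down)
  then have W2: "- lin_apply R.W2 \<beta> = lin_apply R.W3 (Lop \<beta>) - Lop (lin_apply R.W3 \<beta>)"
    by (simp add: ad_def lin_hat lin_on_Lop V_W3 b)
  have sub: "total_pairing (\<omega> c x) (p - q) r = total_pairing (\<omega> c x) p r - total_pairing (\<omega> c x) q r"
    "total_pairing (\<omega> c x) r (p - q) = total_pairing (\<omega> c x) r p - total_pairing (\<omega> c x) r q"
    if "p \<in> altf" "q \<in> altf" "r \<in> altf" for p q r
    using that by (simp_all add: total_pairing_eq altf_diff pr_diff sum_subtractf)
  have "total_pairing (\<omega> c x) (Lam (Wop \<alpha>) c x) (\<beta> c x) = total_pairing (\<omega> c x) (\<alpha> c x) (lin_apply R.W3 (Lop \<beta>) c x)"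
    using total_pairing_lam[OF allforms_altf[OF V_Wop[OF a], of c x] allforms_altf[OF b, of c x]] pairing_Wop[OF a V_Lop[OF b] c]
    by (simp add: lam_form_def wedge_form_def[of \<omega>])
  moreover have "total_pairing (\<omega> c x) (Wop (Lam \<alpha>) c x) (\<beta> c x) = total_pairing (\<omega> c x) (\<alpha> c x) (Lop (lin_apply R.W3 \<beta>) c x)"
    using pairing_Wop[OF V_lam[OF a] b c] total_pairing_lam[OF allforms_altf[OF a, of c x] allforms_altf[OF V_W3[of \<beta>], of c x]]
    by (simp add: lam_form_def wedge_form_def[of \<omega>])
  moreover have e1: "(Lam (Wop \<alpha>) - Wop (Lam \<alpha>)) c x = Lam (Wop \<alpha>) c x - Wop (Lam \<alpha>) c x" by simp
  moreover have e2: "(lin_apply R.W3 (Lop \<beta>) - Lop (lin_apply R.W3 \<beta>)) c x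
    = lin_apply R.W3 (Lop \<beta>) c x - Lop (lin_apply R.W3 \<beta>) c x" by simp
  ultimately show "total_pairing (\<omega> c x) (comm_Lambda_d_L M \<omega> \<alpha> c x) (\<beta> c x) = total_pairing (\<omega> c x) (\<alpha> c x) ((- lin_apply R.W2 \<beta>) c x)"
    unfolding W2 comm_Lambda_d_L_V[OF a]
    by (simp only: e1 e2 sub allforms_altf[OF V_lam[OF V_Wop[OF a]]] allforms_altf[OF V_Wop[OF V_lam[OF a]]]
      allforms_altf[OF V_W3] allforms_altf[OF V_Lop[OF V_W3]] allforms_altf[OF a] allforms_altf[OF b])
qed

section \<open>The coefficients of the total differential\<close>

definition D1 where "D1 = d_adjoint M \<omega> + adjoint_op M \<omega> (comm_Lambda_d_L M \<omega>)"
definition D2 where "D2 = - adjoint_op M \<omega> (comm_d_L M \<omega>)"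
definition DD where "DD = nth_default 0 [d, D1, D2]"

lemma DD_simps: "DD 0 = d" "DD (Suc 0) = D1" "DD (Suc (Suc 0)) = D2" "DD (Suc (Suc (Suc k))) = 0"
  by (simp_all add: DD_def nth_default_def)

lemma D1_eq: "x \<in> V \<Longrightarrow> D1 x = lin_apply (ad rLam rd) x"
  by (simp add: D1_def d_adjoint_eq adjoint_comm_Lambda_d_L ad_apply)

lemma D2_eq: "x \<in> V \<Longrightarrow> D2 x = lin_apply (- R.W3) x"
  by (simp add: D2_def adjoint_comm_d_L)

text \<open>The coefficients (ad \<Lambda>)^k d / k! of the conjugated differential, already
  evaluated (\<open>rD_series\<close>).\<close>

definition rD :: "nat \<Rightarrow> ('m, 'n) dform linmap"
  where "rD k = (if k = 0 then rd else if k = 1 then ad rLam rd else if k = 2 then - R.W3 else 0)"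

lemma DD_eq: "x \<in> V \<Longrightarrow> DD k x = lin_apply (rD k) x"
proof -
  assume x: "x \<in> V"
  consider "k = 0" | "k = Suc 0" | "k = Suc (Suc 0)" | j where "k = Suc (Suc (Suc j))"
    by (metis not0_implies_Suc)
  then show ?thesis
    using x by cases (simp_all add: DD_simps rD_def lin_hat lin_on_dR D1_eq D2_eq)
qed

lemma V_rD: "lin_apply (rD k) x \<in> V"
proof -
  have "V_elem rd" "V_elem (ad rLam rd)" "V_elem (- R.W3)"
    by (intro V_elem_ops V_elem_hat lin_on_dR lin_on_lam V_elem_W)+
  then show ?thesis by (auto simp: rD_def V_elem_def V_lin)
qed

lemma lin_on_DD: "lin_on V (DD k)"
  unfolding lin_on_def
  by (auto simp: DD_eq V_rD V_lin linear_add[OF linear_lin_apply] linear_scale[OF linear_lin_apply])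

lemma rD_series: "(1 / fact k) *\<^sub>R (ad rLam ^^ k) rd = rD k"
proof -
  consider "k = 0" | "k = Suc 0" | "k = Suc (Suc 0)" | j where "k = j + 3"
  proof -
    have "k = 0 \<or> k = Suc 0 \<or> k = Suc (Suc 0) \<or> k = (k - 3) + 3" by linarith
    then show ?thesis using that by blast
  qed
  then show ?thesis
  proof cases
    case 4
    have "(ad rLam ^^ (j + 3)) rd = (ad rLam ^^ j) (ad rLam (ad rLam (ad rLam rd)))"
      by (simp only: funpow_add o_apply numeral_3_eq_3 funpow.simps id_apply)
    also have "\<dots> = (ad rLam ^^ j) 0" by (simp only: R.Lam_d(2))
    also have "\<dots> = 0" by (induction j) auto
    finally show ?thesis using 4 by (simp add: rD_def)
  qed (simp_all add: rD_def R.Lam_d)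
qed

lemma rD_square: "(\<Sum>i\<le>k. rD i * rD (k - i)) = 0"
proof -
  have dd: "rd * rd = 0"
    unfolding hat_hom(1)[OF V lin_on_dR lin_on_dR] hat_hom(6)[OF V lin_on_dR lin_on_dR]
    by (rule hat_eqI[OF V lin_on_ops(1)[OF V lin_on_dR lin_on_dR] lin_on_ops(7)[OF V lin_on_dR lin_on_dR] dR_dR[OF M]])
  note mc = R.maurer_cartan[OF dd]
  consider "k = 0" | "k = 1" | "k = 2" | "k = 3" | "k = 4" | "k \<ge> 5" by linarith
  then show ?thesis
  proof cases
    \<comment> \<open>One of i and k - i is at least 3.\<close>
    case 6
    then have "rD i * rD (k - i) = 0" for i by (cases "i \<ge> 3") (auto simp: rD_def)
    then show ?thesis by simp
  qed (use dd mc in \<open>simp_all add: rD_def eval_nat_numeral algebra_simps\<close>)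
qed

text \<open>Each commutator with \<Lambda>, which has order 2, raises the order by at most one,
  starting from d of order 1.\<close>

lemma degree_order_DD:
  "order_le (deRham M) wedge_form (k + 1) (1 - 2 * int k) (DD k)"
proof -
  have o1: "order_le (deRham M) wedge_form 2 (- 1) (gcomm (- 2) 1 Lam d)"
    using GA.order_le_gcomm[of 1 "- 2" Lam 1 1 d] order_lam order_dR by (simp add: numeral_2_eq_2 del: order_le.simps)
  have o2: "order_le (deRham M) wedge_form 3 (- 3) (gcomm (- 2) (- 1) Lam (gcomm (- 2) 1 Lam d))"
    using GA.order_le_gcomm[of 1 "- 2" Lam 2 "- 1" "gcomm (- 2) 1 Lam d"] order_lam o1
    by (simp add: numeral_2_eq_2 numeral_3_eq_3 del: order_le.simps)
  \<comment> \<open>\<Lambda> has even degree, so these graded commutators are ordinary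
    ones.\<close>
  have g1: "gcomm (- 2) 1 Lam d x = lin_apply (ad rLam rd) x" if "x \<in> V" for x
    using that by (simp add: gcomm_def ad_apply ksign_def)
  have g2: "(1 / 2) *\<^sub>R gcomm (- 2) (- 1) Lam (gcomm (- 2) 1 Lam d) x = lin_apply (- R.W3) x" if x: "x \<in> V" for x
  proof -
    have Vad: "lin_apply (ad rLam rd) y \<in> V" for y
      using V_elem_ops(3)[OF V_elem_hat[OF lin_on_lam] V_elem_hat[OF lin_on_dR]] by (simp add: V_elem_def)
    have "gcomm (- 2) (- 1) Lam (gcomm (- 2) 1 Lam d) x = Lam (lin_apply (ad rLam rd) x) - lin_apply (ad rLam rd) (Lam x)"
      unfolding gcomm_def[of "- 2" "- 1"] g1[OF x] g1[OF V_lam[OF x]] by (simp add: ksign_def)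
    also have "\<dots> = lin_apply (ad rLam (ad rLam rd)) x"
      unfolding ad_def[of rLam "ad rLam rd"] by (simp add: lin_hat lin_on_lam Vad x)
    finally show ?thesis by (simp add: R.Lam_d)
  qed
  consider "k = 0" | "k = Suc 0" | "k = Suc (Suc 0)" | j where "k = Suc (Suc (Suc j))"
    by (metis not0_implies_Suc)
  then show ?thesis
  proof cases
    case 1 then show ?thesis using order_dR by (simp add: DD_simps del: order_le.simps)
  next
    case 2
    have "order_le (deRham M) wedge_form 2 (- 1) D1"
      by (rule GA.order_le_cong[OF o1]) (simp add: total g1 D1_eq)
    then show ?thesis using 2 by (simp add: DD_simps numeral_2_eq_2 del: order_le.simps)
  next
    case 3
    have "order_le (deRham M) wedge_form 3 (- 3) D2"
      by (rule GA.order_le_cong[OF GA.order_le_scale[OF o2, of "1 / 2"]]) (simp add: total g2 D2_eq del: lin_apply_simps)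
    then show ?thesis using 3 by (simp add: DD_simps numeral_3_eq_3 del: order_le.simps)
  next
    case 4
    have "order_le (deRham M) wedge_form (k + 1) (1 - 2 * int k) (\<lambda>_. 0)" by (rule GA.order_le_zero)
    then show ?thesis using 4 by (simp add: DD_simps zero_fun_def del: order_le.simps)
  qed
qed

lemma BV_infinity: "commutative_BV_infinity_algebra (deRham M) wedge_form (one_form M) DD"
  unfolding commutative_BV_infinity_algebra_def total
proof (intro conjI allI ballI)
  show "commutative_dg_algebra (deRham M) wedge_form (one_form M) (DD 0)" using dga by (simp add: DD_simps)
  show "order_le (deRham M) wedge_form (k + 1) (1 - 2 * int k) (DD k)" for k by (rule degree_order_DD)
  then show "has_degree (deRham M) (1 - 2 * int k) (DD k)" for k by (rule GA.order_le_has_degree)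
  fix k x assume x: "x \<in> V"
  have "(\<Sum>i\<le>k. DD i (DD (k - i) x)) = lin_apply (\<Sum>i\<le>k. rD i * rD (k - i)) x"
    unfolding lin_apply_sum by (intro sum.cong refl) (simp add: DD_eq x V_rD)
  then show "(\<Sum>i\<le>k. DD i (DD (k - i) x)) = 0" by (simp add: rD_square)
qed

text \<open>Coefficientwise this is \<open>ad_series\<close> for the linear maps.
  \<open>dual_lefschetz\<close> is known only on forms, so its powers are compared with those of
  \<open>rLam\<close> on V.\<close>

lemma DD_conjugation:
  "series_eq (deRham M) DD
    (series_mult (series_exp (dual_lefschetz M \<omega>)) (series_mult (series_const d) (series_exp (- dual_lefschetz M \<omega>))))"
  unfolding series_eq_def total
proof (intro allI ballI)
  fix k x assume x: "x \<in> V"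
  have pos: "(dual_lefschetz M \<omega> ^^ j) y = lin_apply (rLam ^ j) y \<and> lin_apply (rLam ^ j) y \<in> V" if "y \<in> V" for j y
    using that by (induction j) (simp_all add: dual_lefschetz_eq lin_hat lin_on_lam V_lam)
  have neg: "((- dual_lefschetz M \<omega>) ^^ j) y = lin_apply ((- rLam) ^ j) y \<and> lin_apply ((- rLam) ^ j) y \<in> V" if "y \<in> V" for j y
    using that by (induction j) (simp_all add: dual_lefschetz_eq lin_hat lin_on_lam V_lam V_lin)
  \<comment> \<open>A constant series contributes only through its coefficient of index 0.\<close>
  have inner: "series_mult (series_const d) (series_exp (- dual_lefschetz M \<omega>)) j x = d ((1 / fact j) *\<^sub>R lin_apply ((- rLam) ^ j) x)" for j
  proof -
    have "series_mult (series_const d) (series_exp (- dual_lefschetz M \<omega>)) j x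
      = (\<Sum>i\<le>j. if i = 0 then d ((1 / fact j) *\<^sub>R lin_apply ((- rLam) ^ j) x) else 0)"
      unfolding series_mult_def by (intro sum.cong refl) (use neg[OF x] in \<open>auto simp: series_const_def series_exp_def\<close>)
    then show ?thesis by simp
  qed
  have "series_mult (series_exp (dual_lefschetz M \<omega>)) (series_mult (series_const d) (series_exp (- dual_lefschetz M \<omega>))) k x
    = (\<Sum>i\<le>k. (1 / fact i) *\<^sub>R (dual_lefschetz M \<omega> ^^ i) (d ((1 / fact (k - i)) *\<^sub>R lin_apply ((- rLam) ^ (k - i)) x)))"
    unfolding series_mult_def[of "series_exp (dual_lefschetz M \<omega>)"] inner by (simp add: series_exp_def)
  also have "\<dots> = (\<Sum>i\<le>k. lin_apply ((1 / fact i) *\<^sub>R rLam ^ i * rd * ((1 / fact (k - i)) *\<^sub>R (- rLam) ^ (k - i))) x)"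
  proof (intro sum.cong refl)
    fix i
    have z: "(1 / fact (k - i)) *\<^sub>R lin_apply ((- rLam) ^ (k - i)) x \<in> V" using neg[OF x] V_lin(3) by blast
    show "(1 / fact i) *\<^sub>R (dual_lefschetz M \<omega> ^^ i) (d ((1 / fact (k - i)) *\<^sub>R lin_apply ((- rLam) ^ (k - i)) x))
      = lin_apply ((1 / fact i) *\<^sub>R rLam ^ i * rd * ((1 / fact (k - i)) *\<^sub>R (- rLam) ^ (k - i))) x"
      by (simp only: times_linmap.rep_eq scaleR_linmap.rep_eq lin_hat[OF lin_on_dR z]
        pos[OF allforms_dR[OF M z], THEN conjunct1])
  qed
  also have "\<dots> = lin_apply (rD k) x"
    unfolding lin_apply_sum[symmetric] ad_series rD_series ..
  finally show "DD k x = series_mult (series_exp (dual_lefschetz M \<omega>)) (series_mult (series_const d) (series_exp (- dual_lefschetz M \<omega>))) k x"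
    by (simp add: DD_eq x)
qed

end

theorem theorem4p3:
  fixes M :: "('m::{t2_space,second_countable_topology}, 'n::finite) chart set"
    and \<omega> :: "('m, 'n) dform" and n :: nat
  assumes "CARD('n) = 2 * n"
    and "almost_symplectic M \<omega>"
  shows "let \<A> = deRham M; d = dR M; \<Lambda> = dual_lefschetz M \<omega>;
             \<Delta>\<^sub>1 = d_adjoint M \<omega> + adjoint_op M \<omega> (comm_Lambda_d_L M \<omega>);
             \<Delta>\<^sub>2 = - adjoint_op M \<omega> (comm_d_L M \<omega>);
             \<D> = nth_default 0 [d, \<Delta>\<^sub>1, \<Delta>\<^sub>2]
         in commutative_BV_infinity_algebra \<A> wedge_form (one_form M)
              (nth_default 0 [d, \<Delta>\<^sub>1, \<Delta>\<^sub>2]) \<and>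
            \<D> \<in> End_series \<A> \<and>
            endo \<A> \<Lambda> \<and>
            series_eq \<A> \<D>
              (series_mult (series_exp \<Lambda>) (series_mult (series_const d) (series_exp (- \<Lambda>))))"
proof -
  interpret almost_symplectic_manifold M \<omega> n
    using assms by unfold_locales
  have "lin_on V (dual_lefschetz M \<omega>)"
    using lin_on_lam by (simp add: lin_on_def dual_lefschetz_eq V_lin V_lam)
  then show ?thesis
    using BV_infinity DD_conjugation lin_on_DD
    unfolding Let_def DD_def D1_def D2_def End_series_def endo_iff_lin_on total by blast
qed

end
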